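(* Let $0<\varepsilon<1/2$. Consider the streaming $(1+\varepsilon)$-approximate Hamming distance problem in which both the pattern $P$ (of length $n$) and the text stream $T$ are binary strings: the text arrives one symbol at a time, and as soon as each new symbol arrives the algorithm must output a $(1+\varepsilon)$-approximation of the Hamming distance between $P$ and the latest $n$-length suffix of the stream. There is a randomised algorithm for this problem which uses $\mathcal{O}(\varepsilon^{-3}\sqrt{n}\log^2 n)$ bits of space and runs in $\mathcal{O}(\varepsilon^{-2}\log n)$ time per arriving symbol.
   Context: The Hamming distance between two strings of equal length is the number of positions at which they differ. A $(1+\varepsilon)$-approximation of a nonnegative quantity $h$ is a value $h'$ with $h\le h'\le(1+\varepsilon)h$. In the streaming model all stored information (including any copy of the pattern or of parts of the stream) counts towards the space bound; the algorithm is randomised and its outputs are required to be correct with constant probability. Throughout the paper it is assumed that $\varepsilon<1/2$. *)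

theory Defs
  imports "HOL-Probability.Probability_Mass_Function"
begin

section \<open>The approximation problem\<close>

definition hamming_distance :: "'a list \<Rightarrow> 'a list \<Rightarrow> nat" where
  "hamming_distance xs ys = card {i. i < length xs \<and> xs ! i \<noteq> ys ! i}"

definition is_approximation :: "real \<Rightarrow> real \<Rightarrow> real \<Rightarrow> bool" where
  "is_approximation \<epsilon> h h' \<longleftrightarrow> h \<le> h' \<and> h' \<le> (1 + \<epsilon>) * h"

definition latest :: "nat \<Rightarrow> 'a list \<Rightarrow> 'a list" where
  "latest n xs = drop (length xs - n) xs"


section \<open>A randomised unit-cost word RAM\<close>

text \<open>
  All data of the machine live in a memory of finitely many words, which is a list of natural
  numbers below \<open>2 ^ w\<close>; there are no further registers. The number of bits of space is therefore
  the length of that list times the word size \<open>w\<close>. The operands of an instruction are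
  addresses of memory words; \<open>Load\<close> and \<open>Store\<close> provide indirect addressing.
\<close>

datatype binop = Add | Sub | Mul | Div | Mod | And | Or | Xor | Shl | Shr | Less | Eq

datatype instr =
    Set nat nat
  | Bin binop nat nat nat
  | Load nat nat
  | Store nat nat
  | Rand nat
  | ReadPattern nat nat
  | JumpIfZero nat nat
  | Halt

datatype config = Running nat "nat list" | Halted "nat list" | Crashed

fun eval_binop :: "nat \<Rightarrow> binop \<Rightarrow> nat \<Rightarrow> nat \<Rightarrow> nat" where
  "eval_binop w Add x y = x + y"
| "eval_binop w Sub x y = x + 2 ^ w - y"
| "eval_binop w Mul x y = x * y"
| "eval_binop w Div x y = x div y"
| "eval_binop w Mod x y = x mod y"
| "eval_binop w And x y = and x y"
| "eval_binop w Or x y = or x y"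
| "eval_binop w Xor x y = xor x y"
| "eval_binop w Shl x y = push_bit y x"
| "eval_binop w Shr x y = drop_bit y x"
| "eval_binop w Less x y = of_bool (x < y)"
| "eval_binop w Eq x y = of_bool (x = y)"

text \<open>
  Results are reduced modulo \<open>2 ^ w\<close> when they are written. Any access outside the memory crashes
  the machine.
\<close>

definition put :: "nat \<Rightarrow> nat \<Rightarrow> nat list \<Rightarrow> nat \<Rightarrow> nat \<Rightarrow> config" where
  "put w pc m d v = (if d < length m then Running (Suc pc) (m[d := v mod 2 ^ w]) else Crashed)"

text \<open>
  \<open>Rand\<close> draws a fresh uniformly random word. Random words that are to be used again have to be
  kept in memory. \<open>ReadPattern\<close> reads one symbol of a read-only string \<open>P\<close>, which is the pattern
  during preprocessing and the empty string afterwards.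
\<close>

fun exec :: "nat \<Rightarrow> bool list \<Rightarrow> nat \<Rightarrow> nat list \<Rightarrow> instr \<Rightarrow> config pmf" where
  "exec w P pc m (Set d k) = return_pmf (put w pc m d k)"
| "exec w P pc m (Bin f d a b) = return_pmf
     (if a < length m \<and> b < length m then put w pc m d (eval_binop w f (m ! a) (m ! b))
      else Crashed)"
| "exec w P pc m (Load d a) = return_pmf
     (if a < length m \<and> m ! a < length m then put w pc m d (m ! (m ! a)) else Crashed)"
| "exec w P pc m (Store a b) = return_pmf
     (if a < length m \<and> b < length m then put w pc m (m ! a) (m ! b) else Crashed)"
| "exec w P pc m (Rand d) = map_pmf (put w pc m d) (pmf_of_set {..<2 ^ w})"
| "exec w P pc m (ReadPattern d a) = return_pmf
     (if a < length m \<and> m ! a < length P then put w pc m d (of_bool (P ! (m ! a))) else Crashed)"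
| "exec w P pc m (JumpIfZero a l) = return_pmf
     (if a < length m then Running (if m ! a = 0 then l else Suc pc) m else Crashed)"
| "exec w P pc m Halt = return_pmf (Halted m)"

fun step :: "nat \<Rightarrow> bool list \<Rightarrow> instr list \<Rightarrow> config \<Rightarrow> config pmf" where
  "step w P code (Running pc m) =
     (if pc < length code then exec w P pc m (code ! pc) else return_pmf Crashed)"
| "step w P code (Halted m) = return_pmf (Halted m)"
| "step w P code Crashed = return_pmf Crashed"

text \<open>The distribution of configurations after \<open>t\<close> steps.\<close>

primrec run :: "nat \<Rightarrow> bool list \<Rightarrow> instr list \<Rightarrow> nat \<Rightarrow> config \<Rightarrow> config pmf" where
  "run w P code 0 c = return_pmf c"
| "run w P code (Suc t) c = bind_pmf (step w P code c) (run w P code t)"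


section \<open>Streaming algorithms\<close>

text \<open>
  An algorithm consists of a preprocessing program and a program executed once for
  every arriving text symbol. Only the memory contents survive from one execution to the next.
\<close>

record stream_alg =
  preprocess :: "instr list"
  on_arrival :: "instr list"

text \<open>
  The parameters handed to the preprocessing program are \<open>n\<close> in word 0 and \<open>\<lceil>1/\<epsilon>\<rceil>\<close> in word 1; the
  latter is capped at the largest number that fits into a word. All other words are 0.
\<close>

definition initial_memory :: "nat \<Rightarrow> nat \<Rightarrow> nat \<Rightarrow> real \<Rightarrow> nat list" where
  "initial_memory w S n \<epsilon> =
     (replicate S 0)[0 := n mod 2 ^ w, 1 := min (nat \<lceil>1 / \<epsilon>\<rceil>) (2 ^ w - 1)]"

text \<open>
  The arriving symbol is placed in word 0, and the output is what word 0 holds on halting. If the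
  program does not halt within \<open>T\<close> steps, the configuration is not of the form \<open>Halted m\<close> and
  remains so forever.
\<close>

definition arrive :: "stream_alg \<Rightarrow> nat \<Rightarrow> nat \<Rightarrow> bool \<Rightarrow> config \<Rightarrow> config pmf" where
  "arrive A w T x c =
     (case c of
        Halted m \<Rightarrow> run w [] (on_arrival A) T (Running 0 (m[0 := of_bool x]))
      | _ \<Rightarrow> return_pmf c)"

definition after_stream ::
  "stream_alg \<Rightarrow> nat \<Rightarrow> nat \<Rightarrow> nat \<Rightarrow> nat \<Rightarrow> real \<Rightarrow> bool list \<Rightarrow> bool list \<Rightarrow> config pmf" where
  "after_stream A w S T\<^sub>0 T \<epsilon> P xs =
     foldl (\<lambda>p x. bind_pmf p (arrive A w T x))
       (run w P (preprocess A) T\<^sub>0 (Running 0 (initial_memory w S (length P) \<epsilon>))) xs"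

text \<open>
  With \<open>S\<close> words of \<open>w\<close> bits, the algorithm surely terminates its preprocessing, surely processes
  every symbol in at most \<open>T\<close> steps, and each output made when at least \<open>length P\<close> symbols
  have arrived is correct with probability at least 2/3. The list \<open>xs\<close> is the part of the stream
  that has arrived so far.
\<close>

definition solves_approx_hamming ::
  "stream_alg \<Rightarrow> nat \<Rightarrow> nat \<Rightarrow> nat \<Rightarrow> real \<Rightarrow> bool list \<Rightarrow> bool" where
  "solves_approx_hamming A w S T \<epsilon> P \<longleftrightarrow>
     (\<exists>T\<^sub>0. \<forall>xs.
        (\<forall>c \<in> set_pmf (after_stream A w S T\<^sub>0 T \<epsilon> P xs). \<exists>m. c = Halted m) \<and>
        (length P \<le> length xs \<longrightarrow>
           measure_pmf.prob (after_stream A w S T\<^sub>0 T \<epsilon> P xs)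
             {Halted m | m. is_approximation \<epsilon>
                (real (hamming_distance P (latest (length P) xs))) (real (m ! 0))} \<ge> 2 / 3))"

definition word_size :: "nat \<Rightarrow> nat \<Rightarrow> nat" where
  "word_size c n = c * nat \<lceil>log 2 (real n)\<rceil>"


section \<open>Adequacy of the space measure\<close>

text \<open>Every reachable memory consists of exactly \<open>S\<close> words of \<open>w\<close> bits.\<close>

fun fits :: "nat \<Rightarrow> nat \<Rightarrow> config \<Rightarrow> bool" where
  "fits w S (Running pc m) \<longleftrightarrow> length m = S \<and> set m \<subseteq> {..<2 ^ w}"
| "fits w S (Halted m) \<longleftrightarrow> length m = S \<and> set m \<subseteq> {..<2 ^ w}"
| "fits w S Crashed \<longleftrightarrow> True"

lemma set_list_update_subset: "set m \<subseteq> A \<Longrightarrow> v \<in> A \<Longrightarrow> set (m[d := v]) \<subseteq> A"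
  using set_update_subset_insert by fastforce

lemma fits_put: "length m = S \<Longrightarrow> set m \<subseteq> {..<2 ^ w} \<Longrightarrow> fits w S (put w pc m d v)"
  by (simp add: put_def set_list_update_subset)

lemma fits_step:
  assumes "fits w S c" "c' \<in> set_pmf (step w P code c)"
  shows "fits w S c'"
proof (cases c)
  case (Running pc m)
  show ?thesis
  proof (cases "pc < length code")
    case True
    then show ?thesis using assms Running
      by (cases "code ! pc") (auto simp: fits_put simp del: set_pmf_of_set split: if_splits)
  qed (use assms Running in auto)
qed (use assms in auto)

lemma fits_run:
  "fits w S c \<Longrightarrow> c' \<in> set_pmf (run w P code t c) \<Longrightarrow> fits w S c'"
  by (induction t arbitrary: c) (auto dest: fits_step)

lemma fits_initial: "fits w S (Running pc (initial_memory w S n \<epsilon>))"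
proof -
  have "min (nat \<lceil>1 / \<epsilon>\<rceil>) (2 ^ w - 1) < 2 ^ w"
    by (rule le_less_trans[OF min.cobounded2]) simp
  moreover have "set (replicate S 0) \<subseteq> {..<2 ^ w :: nat}" by auto
  ultimately have "set (initial_memory w S n \<epsilon>) \<subseteq> {..<2 ^ w}"
    unfolding initial_memory_def by (intro set_list_update_subset) simp_all
  then show ?thesis by (simp add: initial_memory_def)
qed

lemma fits_after_stream:
  assumes "0 < w" "c \<in> set_pmf (after_stream A w S T\<^sub>0 T \<epsilon> P xs)"
  shows "fits w S c"
  using assms(2)
proof (induction xs arbitrary: c rule: rev_induct)
  case Nil
  then show ?case unfolding after_stream_def by (auto intro: fits_run fits_initial)
next
  case (snoc x xs)
  then obtain b where b: "b \<in> set_pmf (after_stream A w S T\<^sub>0 T \<epsilon> P xs)"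
    and c: "c \<in> set_pmf (arrive A w T x b)"
    by (auto simp: after_stream_def)
  have "fits w S b" using snoc.IH b .
  show ?case
  proof (cases b)
    case (Halted m)
    have "of_bool x < (2 :: nat) ^ w"
      using one_less_power[of "2 :: nat" w] \<open>0 < w\<close> by (cases x) simp_all
    then have "set (m[0 := of_bool x]) \<subseteq> {..<2 ^ w}"
      using \<open>fits w S b\<close> Halted by (intro set_list_update_subset) auto
    then have "fits w S (Running 0 (m[0 := of_bool x]))"
      using \<open>fits w S b\<close> Halted by simp
    moreover have "c \<in> set_pmf (run w [] (on_arrival A) T (Running 0 (m[0 := of_bool x])))"
      using c Halted by (simp add: arrive_def)
    ultimately show ?thesis by (rule fits_run)
  qed (use \<open>fits w S b\<close> c in \<open>auto simp: arrive_def\<close>)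
qed

end

theory Submission
  imports Defs "HOL-Probability.Product_PMF"
begin

text \<open>
  The text is cut into blocks of length \<open>B\<close>, about \<open>sqrt n\<close>, and a window of \<open>n\<close> symbols is
  compared with the pattern through \<open>O(k^2)\<close> rows of signs, where \<open>k = \<lceil>1/\<epsilon>\<rceil>\<close>. The sign of a position is
  the product of a sign of its block and a sign of its column, so the sketch of a window is a signed
  sum of block sketches, and the mean square of the rows of the difference vector \<open>u\<close> estimates its
  squared norm, which is the Hamming distance \<open>h\<close>.

  The partial block at the left end of the window is the obstacle: the sketches of all its suffixes
  would need too much space. While a block is scanned, \<open>O(log n)\<close> further rows give constant factor estimates
  of the distance between every suffix of the block and the pattern prefix aligned with it. The scan
  remembers the alignment with the smallest estimate so far and stores the sketch of the suffix, a
  checkpoint, whenever a much better alignment appears or the block has accumulated too many mismatches with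
  the remembered alignment. There are \<open>O(k log n)\<close> checkpoints. Between two checkpoints the
  block is replaced by the shifted pattern; this changes the squared norm of \<open>u\<close> only by a small
  fraction of \<open>h/k\<close>. Chebyshev's inequality controls the \<open>O(k^2)\<close> rows, an exponential moment bound and
  a union bound over the positions of the block control the \<open>O(log n)\<close> rows.

  All sums are exact integers modulo \<open>2 ^ w\<close>. The programs are written in a small while language over
  variables and arrays and compiled to the word RAM with an exact count of steps.
\<close>

section \<open>A while language for the word RAM\<close>

text \<open>The obstacle is dependence: the checkpoints, and with them \<open>u\<close>, are random.
  They are computed from the \<open>R2\<close> rows only, so conditioning on these rows freezes
  \<open>u\<close> while the \<open>R1\<close> rows are still fresh signs for it. At every position
  only one side of the \<open>R2\<close> estimates must hold (no suffix is badly underestimated),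
  which needs an exponential tail; the other side matters only at the start of the current window,
  where Markov's inequality suffices. The failure probabilities 1/16, 1/10 and 1/8 add up to 23/80 <
  1/3. The sketch of a suffix needs the whole block, so a block is scanned while its successor
  arrives. Summing the sketches of all full blocks at once would exceed the time bound; the sum for
  the next block grows by one block per arrival, which works because \<open>q\<close> is at most
  \<open>B + 1\<close>. The factor \<open>(2k+1) / (2k)\<close> in the output turns a two-sided
  error into a one-sided one. The cap \<open>k \<le> 2n\<close> keeps all numbers polynomial in
  \<open>n\<close>, so that words of \<open>O(log n)\<close> bits suffice; at the cap the answer is
  exact.\<close>

definition nV :: nat where "nV = 48"
definition nT :: nat where "nT = 16"
definition nA :: nat where "nA = 16"

record st =
  vr :: "nat \<Rightarrow> int"
  ar :: "nat \<Rightarrow> nat \<Rightarrow> int"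

datatype ex = Cst nat | Var nat | Arr nat ex | Op binop ex ex

datatype cmd =
    Skip
  | Asg nat ex
  | Sto nat ex ex
  | Rp nat ex
  | Rnd nat
  | Seq cmd cmd
  | If ex cmd cmd
  | While ex cmd

text \<open>Addition, subtraction and multiplication stay exact over the integers because they
  commute with reduction modulo \<open>2 ^ w\<close>; every other operation sees canonical residues.
  Signed sums may thus become negative and wrap around in memory without side conditions.\<close>

fun iop :: "nat \<Rightarrow> binop \<Rightarrow> int \<Rightarrow> int \<Rightarrow> int" where
  "iop w Add x y = x + y"
| "iop w Sub x y = x - y"
| "iop w Mul x y = x * y"
| "iop w f x y = int (eval_binop w f (nat (x mod 2 ^ w)) (nat (y mod 2 ^ w)))"

fun ev :: "nat \<Rightarrow> st \<Rightarrow> ex \<Rightarrow> int" where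
  "ev w s (Cst k) = int k"
| "ev w s (Var x) = vr s x"
| "ev w s (Arr a e) = ar s a (nat (ev w s e))"
| "ev w s (Op f e1 e2) = iop w f (ev w s e1) (ev w s e2)"

fun okx :: "nat \<Rightarrow> nat \<Rightarrow> st \<Rightarrow> ex \<Rightarrow> bool" where
  "okx w M s (Cst k) = True"
| "okx w M s (Var x) = True"
| "okx w M s (Arr a e) = (okx w M s e \<and> 0 \<le> ev w s e \<and> ev w s e < int M)"
| "okx w M s (Op f e1 e2) = (okx w M s e1 \<and> okx w M s e2)"

text \<open>\<open>d\<close> is the temporary that receives the value. An \<open>Op\<close> keeps
  its left operand in \<open>d\<close> while the right one is evaluated from \<open>Suc d\<close>
  on, so mainly right nesting consumes temporaries.\<close>

fun wfx :: "nat \<Rightarrow> ex \<Rightarrow> bool" where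
  "wfx d (Cst k) = (d < nT)"
| "wfx d (Var x) = (d < nT \<and> x < nV)"
| "wfx d (Arr a e) = (Suc d < nT \<and> a < nA \<and> wfx d e)"
| "wfx d (Op f e1 e2) = (Suc d < nT \<and> wfx d e1 \<and> wfx (Suc d) e2)"

fun wfc :: "cmd \<Rightarrow> bool" where
  "wfc Skip = True"
| "wfc (Asg x e) = (x < nV \<and> wfx 0 e)"
| "wfc (Sto a e1 e2) = (a < nA \<and> wfx 0 e1 \<and> wfx 1 e2)"
| "wfc (Rp x e) = (x < nV \<and> wfx 0 e)"
| "wfc (Rnd x) = (x < nV)"
| "wfc (Seq c1 c2) = (wfc c1 \<and> wfc c2)"
| "wfc (If e c1 c2) = (wfx 0 e \<and> wfc c1 \<and> wfc c2)"
| "wfc (While e c) = (wfx 0 e \<and> wfc c)"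

text \<open>Arrays are interleaved: entry \<open>j\<close> of array \<open>a\<close> has address
  \<open>nV + nT + nA * j + a\<close>. No address computation involves the array length
  \<open>M\<close>, which depends on the input and is unknown to a fixed program.\<close>

definition caddr :: "nat \<Rightarrow> nat \<Rightarrow> instr list" where
  "caddr d a = [Set (nV + Suc d) nA, Bin Mul (nV + d) (nV + d) (nV + Suc d),
     Set (nV + Suc d) (nV + nT + a), Bin Add (nV + d) (nV + d) (nV + Suc d)]"

text \<open>The RAM has no move instruction; \<open>Or\<close> of a word with itself copies
  it.\<close>

fun cx :: "nat \<Rightarrow> ex \<Rightarrow> instr list" where
  "cx d (Cst k) = [Set (nV + d) k]"
| "cx d (Var x) = [Bin Or (nV + d) x x]"
| "cx d (Arr a e) = cx d e @ caddr d a @ [Load (nV + d) (nV + d)]"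
| "cx d (Op f e1 e2) = cx d e1 @ cx (Suc d) e2 @ [Bin f (nV + d) (nV + d) (nV + Suc d)]"

fun clen :: "cmd \<Rightarrow> nat" where
  "clen Skip = 0"
| "clen (Asg x e) = length (cx 0 e) + 1"
| "clen (Sto a e1 e2) = length (cx 0 e1) + length (cx 1 e2) + 5"
| "clen (Rp x e) = length (cx 0 e) + 1"
| "clen (Rnd x) = 1"
| "clen (Seq c1 c2) = clen c1 + clen c2"
| "clen (If e c1 c2) = length (cx 0 e) + clen c1 + clen c2 + 3"
| "clen (While e c) = length (cx 0 e) + clen c + 3"

text \<open>Jump targets are absolute, hence the start address \<open>l\<close>.
  \<open>Set nV 0\<close> followed by \<open>JumpIfZero nV\<close> is an unconditional jump.\<close>

fun cc :: "nat \<Rightarrow> cmd \<Rightarrow> instr list" where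
  "cc l Skip = []"
| "cc l (Asg x e) = cx 0 e @ [Bin Or x nV nV]"
| "cc l (Sto a e1 e2) = cx 0 e1 @ caddr 0 a @ cx 1 e2 @ [Store nV (Suc nV)]"
| "cc l (Rp x e) = cx 0 e @ [ReadPattern x nV]"
| "cc l (Rnd x) = [Rand x]"
| "cc l (Seq c1 c2) = cc l c1 @ cc (l + clen c1) c2"
| "cc l (If e c1 c2) =
     (let l1 = l + length (cx 0 e) + 1; k1 = cc l1 c1; l2 = l1 + clen c1 + 2; k2 = cc l2 c2
      in cx 0 e @ [JumpIfZero nV l2] @ k1 @ [Set nV 0, JumpIfZero nV (l2 + clen c2)] @ k2)"
| "cc l (While e c) =
     (let l1 = l + length (cx 0 e) + 1; k = cc l1 c
      in cx 0 e @ [JumpIfZero nV (l1 + clen c + 2)] @ k @ [Set nV 0, JumpIfZero nV l])"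

section \<open>Placement of code and composition of runs\<close>

definition code_at :: "instr list \<Rightarrow> nat \<Rightarrow> instr list \<Rightarrow> bool" where
  "code_at code l xs \<longleftrightarrow> (\<forall>j < length xs. l + j < length code \<and> code ! (l + j) = xs ! j)"

lemma code_at_append:
  "code_at code l (xs @ ys) \<longleftrightarrow> code_at code l xs \<and> code_at code (l + length xs) ys"
proof
  assume a: "code_at code l (xs @ ys)"
  show "code_at code l xs \<and> code_at code (l + length xs) ys"
    unfolding code_at_def
  proof (intro conjI allI impI)
    fix j assume "j < length xs"
    then show "l + j < length code" "code ! (l + j) = xs ! j"
      using a[unfolded code_at_def, rule_format, of j] by (auto simp: nth_append)
  next
    fix j assume "j < length ys"
    then show "l + length xs + j < length code" "code ! (l + length xs + j) = ys ! j"
      using a[unfolded code_at_def, rule_format, of "length xs + j"]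
      by (auto simp: nth_append add.assoc)
  qed
next
  assume a: "code_at code l xs \<and> code_at code (l + length xs) ys"
  show "code_at code l (xs @ ys)"
    unfolding code_at_def
  proof (intro allI impI)
    fix j assume j: "j < length (xs @ ys)"
    show "l + j < length code \<and> code ! (l + j) = (xs @ ys) ! j"
    proof (cases "j < length xs")
      case True
      then show ?thesis using a by (auto simp: code_at_def nth_append)
    next
      case False
      then have "j - length xs < length ys" using j by auto
      then show ?thesis
        using a[unfolded code_at_def, THEN conjunct2, rule_format, of "j - length xs"] False
        by (auto simp: nth_append)
    qed
  qed
qed

lemma code_at_Cons:
  "code_at code l (x # xs) \<longleftrightarrow> l < length code \<and> code ! l = x \<and> code_at code (Suc l) xs"
proof -
  have "code_at code l [x] \<longleftrightarrow> l < length code \<and> code ! l = x" by (simp add: code_at_def)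
  then show ?thesis using code_at_append[of code l "[x]" xs] by simp
qed

lemma code_at_Nil [simp]: "code_at code l []"
  by (simp add: code_at_def)

lemma code_at_whole: "code_at code 0 code"
  by (simp add: code_at_def)

lemma length_cc [simp]: "length (cc l c) = clen c"
  by (induction c arbitrary: l) (simp_all add: Let_def caddr_def)

lemma run_add: "run w P code (a + b) c = bind_pmf (run w P code a c) (run w P code b)"
proof (induction a arbitrary: c)
  case (Suc a)
  have "run w P code (a + b) = (\<lambda>c. bind_pmf (run w P code a c) (run w P code b))"
    using Suc.IH by (rule ext)
  then show ?case by (simp add: bind_assoc_pmf)
qed (simp add: bind_return_pmf)

lemma run_0_eq: "run w P code 0 = return_pmf"
  by (rule ext) simp

lemma run_trans:
  assumes "run w P code a c = return_pmf c'" "run w P code b c' = d"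
  shows "run w P code (a + b) c = d"
  using assms by (simp add: run_add bind_return_pmf)

lemma run_Halted: "run w P code t (Halted m) = return_pmf (Halted m)"
  by (induction t) (auto simp: bind_return_pmf)

text \<open>States hold integers, the memory their residues. Temporaries are left unconstrained, so
  that evaluating an expression does not change the represented state. Variables 0 and 1 are the
  words 0 and 1 of the input and output convention.\<close>

definition rel :: "nat \<Rightarrow> nat \<Rightarrow> st \<Rightarrow> nat list \<Rightarrow> bool" where
  "rel w M s m \<longleftrightarrow> length m = nV + nT + nA * M \<and>
     (\<forall>x < nV. int (m ! x) = vr s x mod 2 ^ w) \<and>
     (\<forall>a < nA. \<forall>j < M. int (m ! (nV + nT + nA * j + a)) = ar s a j mod 2 ^ w)"

lemma rel_temp: "rel w M s m \<Longrightarrow> d < nT \<Longrightarrow> rel w M s (m[nV + d := v])"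
  unfolding rel_def by (auto simp: nth_list_update)

lemma rel_var:
  "rel w M s m \<Longrightarrow> x < nV \<Longrightarrow> int v = z mod 2 ^ w \<Longrightarrow>
   rel w M (s\<lparr>vr := (vr s)(x := z)\<rparr>) (m[x := v])"
  unfolding rel_def by (auto simp: nth_list_update)

lemma addr_inj:
  assumes "a < nA" "a' < nA" "nA * j + a = nA * j' + a'"
  shows "a = a' \<and> j = j'"
proof -
  have "(nA * j + a) div nA = j" "(nA * j' + a') div nA = j'" using assms(1,2) by simp_all
  then have "j = j'" using assms(3) by metis
  then show ?thesis using assms(3) by simp
qed

lemma addr_less: "a < nA \<Longrightarrow> j < M \<Longrightarrow> nA * j + a < nA * M"
proof -
  assume "a < nA" "j < M"
  then have "nA * j + a < nA * Suc j" by simp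
  also have "\<dots> \<le> nA * M" using \<open>j < M\<close> by (intro mult_le_mono2) simp
  finally show ?thesis .
qed

lemma rel_arr:
  assumes "rel w M s m" "a < nA" "j < M" "int v = z mod 2 ^ w"
  shows "rel w M (s\<lparr>ar := (ar s)(a := (ar s a)(j := z))\<rparr>) (m[nV + nT + nA * j + a := v])"
proof -
  have len: "length m = nV + nT + nA * M" using assms by (simp add: rel_def)
  have lt: "nV + nT + nA * j + a < length m" using addr_less[OF assms(2,3)] len by simp
  show ?thesis
    unfolding rel_def
  proof (intro conjI allI impI)
    fix x assume "x < nV"
    then show "int (m[nV + nT + nA * j + a := v] ! x)
        = vr (s\<lparr>ar := (ar s)(a := (ar s a)(j := z))\<rparr>) x mod 2 ^ w"
      using assms(1) by (simp add: rel_def)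
  next
    fix a' j' assume a': "a' < nA" "j' < M"
    show "int (m[nV + nT + nA * j + a := v] ! (nV + nT + nA * j' + a'))
        = ar (s\<lparr>ar := (ar s)(a := (ar s a)(j := z))\<rparr>) a' j' mod 2 ^ w"
    proof (cases "a = a' \<and> j = j'")
      case True
      then show ?thesis using lt assms(4) by simp
    next
      case False
      then have "nV + nT + nA * j + a \<noteq> nV + nT + nA * j' + a'"
        using addr_inj[OF assms(2) a'(1), of j j'] by auto
      then show ?thesis using False assms(1) a' by (auto simp: rel_def)
    qed
  qed (simp add: len)
qed

lemma iop_mod:
  assumes "int x = X mod 2 ^ w" "int y = Y mod 2 ^ w"
  shows "int (eval_binop w f x y mod 2 ^ w) = iop w f X Y mod 2 ^ w"
proof -
  have p: "(0::int) < 2 ^ w" by simp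
  have y: "y < 2 ^ w"
  proof -
    have "int y < 2 ^ w" using assms(2) p by (metis pos_mod_bound)
    then show ?thesis by (metis of_nat_less_iff of_nat_numeral of_nat_power)
  qed
  have sub: "int ((x + 2 ^ w - y) mod 2 ^ w) = (X - Y) mod 2 ^ w"
  proof -
    have "int (x + 2 ^ w - y) = int x + 2 ^ w - int y" using y by (simp add: of_nat_diff)
    then have "int ((x + 2 ^ w - y) mod 2 ^ w) = (int x + 2 ^ w - int y) mod 2 ^ w"
      by (simp add: zmod_int)
    also have "\<dots> = (int x - int y) mod 2 ^ w"
      by (metis add_diff_eq diff_add_eq mod_add_self2)
    also have "\<dots> = (X - Y) mod 2 ^ w" using assms by (simp add: mod_simps)
    finally show ?thesis .
  qed
  have "(int x + int y) mod 2 ^ w = (X + Y) mod 2 ^ w" "int x * int y mod 2 ^ w = X * Y mod 2 ^ w"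
    unfolding assms by (simp_all add: mod_simps)
  then show ?thesis
    using sub assms(1)[symmetric] assms(2)[symmetric]
    by (cases f) (simp_all add: zmod_int)
qed

fun loopfree :: "cmd \<Rightarrow> bool" where
  "loopfree (Seq c1 c2) = (loopfree c1 \<and> loopfree c2)"
| "loopfree (If e c1 c2) = (loopfree c1 \<and> loopfree c2)"
| "loopfree (While e c) = False"
| "loopfree (Rnd x) = False"
| "loopfree _ = True"

text \<open>Without branches the number of steps is exactly \<open>clen\<close>, whatever the data.
  The random loop needs this: after a fixed number of steps all its outcomes must stand at the same
  program point.\<close>

fun straight :: "cmd \<Rightarrow> bool" where
  "straight (Seq c1 c2) = (straight c1 \<and> straight c2)"
| "straight (If e c1 c2) = False"
| "straight (While e c) = False"
| "straight (Rnd x) = False"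
| "straight _ = True"

definition For :: "nat \<Rightarrow> ex \<Rightarrow> nat \<Rightarrow> cmd \<Rightarrow> cmd" where
  "For x e y c = Seq (Asg x e)
     (While (Op Less (Var x) (Var y)) (Seq c (Asg x (Op Add (Var x) (Cst 1)))))"

text \<open>Random words are drawn in this loop only, so all other commands of the algorithm can be
  treated as deterministic runs.\<close>

definition Fill :: "nat \<Rightarrow> nat \<Rightarrow> nat \<Rightarrow> cmd \<Rightarrow> cmd" where
  "Fill x y z c = While (Op Less (Var x) (Var y)) (Seq (Rnd z) c)"

section \<open>Compiler correctness with step counts\<close>

locale machine =
  fixes w M :: nat
  assumes fit: "nV + nT + nA * M \<le> 2 ^ w"
begin

lemma one_mod_pw: "(1::int) mod 2 ^ w = 1"
proof -
  have "1 < (2::nat) ^ w" using fit by (simp add: nV_def)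
  then have "w \<noteq> 0" by (metis less_irrefl power_0)
  then show ?thesis by simp
qed

lemma caddr_correct:
  assumes "code_at code l (caddr d a)" "rel w M s m" "Suc d < nT" "a < nA"
    "int (m ! (nV + d)) = int j" "j < M"
  obtains m' where "run w P code (length (caddr d a)) (Running l m)
      = return_pmf (Running (l + length (caddr d a)) m')"
    "rel w M s m'" "m' ! (nV + d) = nV + nT + nA * j + a" "\<forall>i<d. m' ! (nV + i) = m ! (nV + i)"
proof -
  have len: "length m = nV + nT + nA * M" using assms by (simp add: rel_def)
  have j: "nV + nT + nA * j + a < 2 ^ w"
    using addr_less[OF assms(4,6)] fit by linarith
  have M1: "M \<ge> 1" using assms(6) by simp
  have "nA \<le> nA * M" using M1 by simp
  then have na: "nA < 2 ^ w" using fit unfolding nV_def by linarith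
  define m' where "m' = m[nV + Suc d := nA, nV + d := j * nA,
     nV + Suc d := nV + nT + a, nV + d := nV + nT + nA * j + a]"
  have ja: "j * nA < 2 ^ w" using j by (simp add: mult.commute)
  have "run w P code (length (caddr d a)) (Running l m)
      = return_pmf (Running (l + length (caddr d a)) m')"
    using assms(1,3,5) len na j ja unfolding caddr_def m'_def
    by (simp add: code_at_Cons bind_return_pmf put_def eval_nat_numeral nth_list_update algebra_simps)
  moreover have "rel w M s m'" unfolding m'_def
    using assms by (intro rel_temp) auto
  moreover have "m' ! (nV + d) = nV + nT + nA * j + a"
    unfolding m'_def using len assms by (simp add: nth_list_update)
  moreover have "\<forall>i<d. m' ! (nV + i) = m ! (nV + i)"
    unfolding m'_def by (simp add: nth_list_update)
  ultimately show ?thesis using that by blast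
qed

text \<open>That the temporaries below \<open>d\<close> survive is what the induction needs for
  \<open>Op\<close>: the left operand must outlive the evaluation of the right one.\<close>

lemma cx_correct:
  assumes "code_at code l (cx d e)" "rel w M s m" "okx w M s e" "wfx d e"
  shows "\<exists>m'. run w P code (length (cx d e)) (Running l m)
      = return_pmf (Running (l + length (cx d e)) m') \<and> rel w M s m' \<and>
      int (m' ! (nV + d)) = ev w s e mod 2 ^ w \<and> (\<forall>i<d. m' ! (nV + i) = m ! (nV + i))"
  using assms
proof (induction e arbitrary: d l m)
  case (Cst k)
  have "length m = nV + nT + nA * M" using Cst by (simp add: rel_def)
  then show ?case using Cst
    by (intro exI[of _ "m[nV + d := k mod 2 ^ w]"])
      (auto simp: code_at_Cons bind_return_pmf put_def nth_list_update rel_temp zmod_int)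
next
  case (Var x)
  have "length m = nV + nT + nA * M" using Var by (simp add: rel_def)
  moreover have x: "int (m ! x) = vr s x mod 2 ^ w" using Var by (simp add: rel_def)
  moreover have "int (m ! x mod 2 ^ w) = vr s x mod 2 ^ w" using x by (simp add: zmod_int)
  ultimately show ?case using Var
    by (intro exI[of _ "m[nV + d := m ! x mod 2 ^ w]"])
      (auto simp: code_at_Cons bind_return_pmf put_def nth_list_update rel_temp)
next
  case (Arr a e)
  have c: "code_at code l (cx d e)" "code_at code (l + length (cx d e)) (caddr d a)"
    "code_at code (l + length (cx d e) + length (caddr d a)) [Load (nV + d) (nV + d)]"
    using Arr.prems by (simp_all add: code_at_append)
  obtain m1 where m1: "run w P code (length (cx d e)) (Running l m)
      = return_pmf (Running (l + length (cx d e)) m1)" "rel w M s m1"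
      "int (m1 ! (nV + d)) = ev w s e mod 2 ^ w" "\<forall>i<d. m1 ! (nV + i) = m ! (nV + i)"
    using Arr.IH[OF c(1)] Arr.prems by auto
  define j where "j = nat (ev w s e)"
  have j: "j < M" "ev w s e = int j" using Arr.prems by (auto simp: j_def)
  have "j < 2 ^ w"
  proof -
    have "M \<le> nA * M" by (simp add: nA_def)
    then show ?thesis using j fit by linarith
  qed
  then have "int j mod 2 ^ w = int j" by (metis mod_less of_nat_numeral of_nat_power zmod_int)
  then have m1j: "int (m1 ! (nV + d)) = int j" using m1(3) j by simp
  have wf: "Suc d < nT" "a < nA" using Arr.prems by auto
  obtain m2 where m2: "run w P code (length (caddr d a)) (Running (l + length (cx d e)) m1)
      = return_pmf (Running (l + length (cx d e) + length (caddr d a)) m2)"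
    "rel w M s m2" "m2 ! (nV + d) = nV + nT + nA * j + a" "\<forall>i<d. m2 ! (nV + i) = m1 ! (nV + i)"
    using caddr_correct[OF c(2) m1(2) wf m1j j(1)] by blast
  have len: "length m2 = nV + nT + nA * M" using m2 by (simp add: rel_def)
  define v where "v = m2 ! (nV + nT + nA * j + a)"
  have v: "int v = ar s a j mod 2 ^ w" using m2(2) wf j by (simp add: rel_def v_def)
  have v': "int (v mod 2 ^ w) = ar s a j mod 2 ^ w" using v by (simp add: zmod_int)
  define m3 where "m3 = m2[nV + d := v mod 2 ^ w]"
  have al: "nV + nT + nA * j + a < length m2" using addr_less[OF wf(2) j(1)] len by simp
  have "run w P code 1 (Running (l + length (cx d e) + length (caddr d a)) m2)
    = return_pmf (Running (Suc (l + length (cx d e) + length (caddr d a))) m3)"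
    using c(3) m2(3) al len wf
    by (simp add: code_at_Cons bind_return_pmf put_def m3_def v_def)
  from run_trans[OF m1(1) run_trans[OF m2(1) this]]
  have "run w P code (length (cx d (Arr a e))) (Running l m)
      = return_pmf (Running (l + length (cx d (Arr a e))) m3)"
    by (simp add: add.assoc)
  moreover have "rel w M s m3" using m2 wf by (auto simp: m3_def intro: rel_temp)
  moreover have "int (m3 ! (nV + d)) = ev w s (Arr a e) mod 2 ^ w"
    using v' len wf by (simp add: m3_def j)
  moreover have "\<forall>i<d. m3 ! (nV + i) = m ! (nV + i)"
    using m1(4) m2(4) by (simp add: m3_def nth_list_update)
  ultimately show ?case by blast
next
  case (Op f e1 e2)
  have c: "code_at code l (cx d e1)" "code_at code (l + length (cx d e1)) (cx (Suc d) e2)"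
    "code_at code (l + length (cx d e1) + length (cx (Suc d) e2)) [Bin f (nV + d) (nV + d) (nV + Suc d)]"
    using Op.prems by (simp_all add: code_at_append)
  have wf: "Suc d < nT" using Op.prems by simp
  obtain m1 where m1: "run w P code (length (cx d e1)) (Running l m)
      = return_pmf (Running (l + length (cx d e1)) m1)" "rel w M s m1"
      "int (m1 ! (nV + d)) = ev w s e1 mod 2 ^ w" "\<forall>i<d. m1 ! (nV + i) = m ! (nV + i)"
    using Op.IH(1)[OF c(1)] Op.prems by auto
  obtain m2 where m2: "run w P code (length (cx (Suc d) e2)) (Running (l + length (cx d e1)) m1)
      = return_pmf (Running (l + length (cx d e1) + length (cx (Suc d) e2)) m2)" "rel w M s m2"
      "int (m2 ! (nV + Suc d)) = ev w s e2 mod 2 ^ w" "\<forall>i<Suc d. m2 ! (nV + i) = m1 ! (nV + i)"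
    using Op.IH(2)[OF c(2) m1(2)] Op.prems by auto
  have len: "length m2 = nV + nT + nA * M" using m2 by (simp add: rel_def)
  define v where "v = eval_binop w f (m2 ! (nV + d)) (m2 ! (nV + Suc d)) mod 2 ^ w"
  have v: "int v = iop w f (ev w s e1) (ev w s e2) mod 2 ^ w"
    unfolding v_def by (rule iop_mod) (use m1(3) m2(3,4) in auto)
  define m3 where "m3 = m2[nV + d := v]"
  have "run w P code 1 (Running (l + length (cx d e1) + length (cx (Suc d) e2)) m2)
    = return_pmf (Running (Suc (l + length (cx d e1) + length (cx (Suc d) e2))) m3)"
    using c(3) len wf
    by (simp add: code_at_Cons bind_return_pmf put_def m3_def v_def)
  from run_trans[OF m1(1) run_trans[OF m2(1) this]]
  have "run w P code (length (cx d (Op f e1 e2))) (Running l m)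
      = return_pmf (Running (l + length (cx d (Op f e1 e2))) m3)"
    by (simp add: add.assoc)
  moreover have "rel w M s m3" using m2 wf by (auto simp: m3_def intro: rel_temp)
  moreover have "int (m3 ! (nV + d)) = ev w s (Op f e1 e2) mod 2 ^ w"
    using v len wf by (simp add: m3_def)
  moreover have "\<forall>i<d. m3 ! (nV + i) = m ! (nV + i)"
    using m1(4) m2(4) by (simp add: m3_def nth_list_update)
  ultimately show ?case by blast
qed

text \<open>Well-formedness is a premise inside the definition, so that the rules for composite
  commands need not carry it; it is checked once for each complete program.\<close>

definition goes :: "bool list \<Rightarrow> cmd \<Rightarrow> st \<Rightarrow> nat \<Rightarrow> st \<Rightarrow> bool" where
  "goes P c s t s' \<longleftrightarrow> (wfc c \<longrightarrow> (\<forall>code l m. code_at code l (cc l c) \<and> rel w M s m \<longrightarrow>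
     (\<exists>m'. run w P code t (Running l m) = return_pmf (Running (l + clen c) m') \<and>
           rel w M s' m')))"

lemma goesI:
  assumes "\<And>code l m. wfc c \<Longrightarrow> code_at code l (cc l c) \<Longrightarrow> rel w M s m \<Longrightarrow>
     \<exists>m'. run w P code t (Running l m) = return_pmf (Running (l + clen c) m') \<and> rel w M s' m'"
  shows "goes P c s t s'"
  using assms unfolding goes_def by blast

lemma goes_Skip: "goes P Skip s 0 s"
  by (rule goesI) auto

lemma goes_Asg:
  assumes "okx w M s e"
  shows "goes P (Asg x e) s (Suc (length (cx 0 e))) (s\<lparr>vr := (vr s)(x := ev w s e)\<rparr>)"
proof (rule goesI)
  fix code l m assume a: "wfc (Asg x e)" "code_at code l (cc l (Asg x e))" "rel w M s m"
  have c: "code_at code l (cx 0 e)" "code_at code (l + length (cx 0 e)) [Bin Or x nV nV]"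
    using a by (simp_all add: code_at_append)
  obtain m1 where m1: "run w P code (length (cx 0 e)) (Running l m)
      = return_pmf (Running (l + length (cx 0 e)) m1)" "rel w M s m1"
      "int (m1 ! nV) = ev w s e mod 2 ^ w"
    using cx_correct[OF c(1) a(3) assms, of P] a(1) by auto
  have len: "length m1 = nV + nT + nA * M" using m1 by (simp add: rel_def)
  define m2 where "m2 = m1[x := m1 ! nV mod 2 ^ w]"
  have "run w P code 1 (Running (l + length (cx 0 e)) m1)
      = return_pmf (Running (Suc (l + length (cx 0 e))) m2)"
    using c(2) len a(1) by (simp add: code_at_Cons bind_return_pmf put_def m2_def nT_def)
  from run_trans[OF m1(1) this]
  have "run w P code (Suc (length (cx 0 e))) (Running l m)
     = return_pmf (Running (l + clen (Asg x e)) m2)" by simp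
  moreover have "rel w M (s\<lparr>vr := (vr s)(x := ev w s e)\<rparr>) m2"
    unfolding m2_def using m1 a(1) by (intro rel_var) (auto simp: zmod_int)
  ultimately show "\<exists>m'. run w P code (Suc (length (cx 0 e))) (Running l m)
      = return_pmf (Running (l + clen (Asg x e)) m') \<and>
       rel w M (s\<lparr>vr := (vr s)(x := ev w s e)\<rparr>) m'" by blast
qed

lemma goes_Rp:
  assumes "okx w M s e" "ev w s e = int j" "j < length P" "j < 2 ^ w"
  shows "goes P (Rp x e) s (Suc (length (cx 0 e))) (s\<lparr>vr := (vr s)(x := of_bool (P ! j))\<rparr>)"
proof (rule goesI)
  fix code l m assume a: "wfc (Rp x e)" "code_at code l (cc l (Rp x e))" "rel w M s m"
  have c: "code_at code l (cx 0 e)" "code_at code (l + length (cx 0 e)) [ReadPattern x nV]"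
    using a by (simp_all add: code_at_append)
  obtain m1 where m1: "run w P code (length (cx 0 e)) (Running l m)
      = return_pmf (Running (l + length (cx 0 e)) m1)" "rel w M s m1"
      "int (m1 ! nV) = ev w s e mod 2 ^ w"
    using cx_correct[OF c(1) a(3) assms(1), of P] a(1) by auto
  have len: "length m1 = nV + nT + nA * M" using m1 by (simp add: rel_def)
  have "int j mod 2 ^ w = int j" using assms(4) by (metis mod_less of_nat_numeral of_nat_power zmod_int)
  then have j: "m1 ! nV = j" using m1(3) assms(2) by simp
  define m2 where "m2 = m1[x := of_bool (P ! j) mod 2 ^ w]"
  have "run w P code 1 (Running (l + length (cx 0 e)) m1)
      = return_pmf (Running (Suc (l + length (cx 0 e))) m2)"
    using c(2) len a(1) assms(3) j
    by (simp add: code_at_Cons bind_return_pmf put_def m2_def nT_def)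
  from run_trans[OF m1(1) this]
  have "run w P code (Suc (length (cx 0 e))) (Running l m)
     = return_pmf (Running (l + clen (Rp x e)) m2)" by simp
  moreover have "rel w M (s\<lparr>vr := (vr s)(x := of_bool (P ! j))\<rparr>) m2"
    unfolding m2_def using m1 a(1) by (intro rel_var) (auto simp: zmod_int)
  ultimately show "\<exists>m'. run w P code (Suc (length (cx 0 e))) (Running l m)
      = return_pmf (Running (l + clen (Rp x e)) m') \<and>
       rel w M (s\<lparr>vr := (vr s)(x := of_bool (P ! j))\<rparr>) m'" by blast
qed

lemma goes_Sto:
  assumes "okx w M s e1" "okx w M s e2" "0 \<le> ev w s e1" "ev w s e1 < int M"
  shows "goes P (Sto a e1 e2) s (clen (Sto a e1 e2))
    (s\<lparr>ar := (ar s)(a := (ar s a)(nat (ev w s e1) := ev w s e2))\<rparr>)"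
proof (rule goesI)
  fix code l m assume h: "wfc (Sto a e1 e2)" "code_at code l (cc l (Sto a e1 e2))" "rel w M s m"
  let ?l1 = "l + length (cx 0 e1)"
  let ?l2 = "?l1 + length (caddr 0 a)"
  let ?l3 = "?l2 + length (cx 1 e2)"
  have c: "code_at code l (cx 0 e1)" "code_at code ?l1 (caddr 0 a)" "code_at code ?l2 (cx 1 e2)"
     "code_at code ?l3 [Store nV (Suc nV)]"
    using h by (simp_all add: code_at_append)
  obtain m1 where m1: "run w P code (length (cx 0 e1)) (Running l m) = return_pmf (Running ?l1 m1)"
      "rel w M s m1" "int (m1 ! (nV + 0)) = ev w s e1 mod 2 ^ w"
    using cx_correct[OF c(1) h(3) assms(1), of P] h(1) by auto
  define j where "j = nat (ev w s e1)"
  have j: "j < M" "ev w s e1 = int j" using assms by (auto simp: j_def)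
  have "j < 2 ^ w"
  proof -
    have "M \<le> nA * M" by (simp add: nA_def)
    then show ?thesis using j fit by linarith
  qed
  then have "int j mod 2 ^ w = int j" by (metis mod_less of_nat_numeral of_nat_power zmod_int)
  then have m1j: "int (m1 ! (nV + 0)) = int j" using m1(3) j by simp
  have nt: "Suc 0 < nT" by (simp add: nT_def)
  have aA: "a < nA" using h(1) by simp
  obtain m2 where m2: "run w P code (length (caddr 0 a)) (Running ?l1 m1) = return_pmf (Running ?l2 m2)"
    "rel w M s m2" "m2 ! (nV + 0) = nV + nT + nA * j + a"
    using caddr_correct[OF c(2) m1(2) nt aA m1j j(1)] by blast
  obtain m3 where m3: "run w P code (length (cx 1 e2)) (Running ?l2 m2) = return_pmf (Running ?l3 m3)"
      "rel w M s m3" "int (m3 ! (nV + 1)) = ev w s e2 mod 2 ^ w" "\<forall>i<1. m3 ! (nV + i) = m2 ! (nV + i)"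
    using cx_correct[OF c(3) m2(2) assms(2), of P] h(1) by auto
  have len: "length m3 = nV + nT + nA * M" using m3 by (simp add: rel_def)
  have al: "nV + nT + nA * j + a < length m3" using addr_less[OF aA j(1)] len by simp
  define m4 where "m4 = m3[nV + nT + nA * j + a := m3 ! (Suc nV) mod 2 ^ w]"
  have "run w P code 1 (Running ?l3 m3) = return_pmf (Running (Suc ?l3) m4)"
    using c(4) len al m3(4) m2(3) nt
    by (simp add: code_at_Cons bind_return_pmf put_def m4_def)
  from run_trans[OF m1(1) run_trans[OF m2(1) run_trans[OF m3(1) this]]]
  have "run w P code (clen (Sto a e1 e2)) (Running l m)
     = return_pmf (Running (l + clen (Sto a e1 e2)) m4)"
    by (simp add: add_ac caddr_def numeral_eq_Suc del: run.simps)
  moreover have "rel w M (s\<lparr>ar := (ar s)(a := (ar s a)(j := ev w s e2))\<rparr>) m4"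
    unfolding m4_def using m3 h(1) aA j by (intro rel_arr) (auto simp: zmod_int)
  ultimately show "\<exists>m'. run w P code (clen (Sto a e1 e2)) (Running l m)
      = return_pmf (Running (l + clen (Sto a e1 e2)) m') \<and>
       rel w M (s\<lparr>ar := (ar s)(a := (ar s a)(nat (ev w s e1) := ev w s e2))\<rparr>) m'"
    unfolding j_def by blast
qed

lemma goes_Seq:
  assumes "goes P c1 s t1 s1" "goes P c2 s1 t2 s2"
  shows "goes P (Seq c1 c2) s (t1 + t2) s2"
proof (rule goesI)
  fix code l m assume h: "wfc (Seq c1 c2)" "code_at code l (cc l (Seq c1 c2))" "rel w M s m"
  let ?l = "l + clen c1"
  have c: "code_at code l (cc l c1)" "code_at code ?l (cc ?l c2)"
    using h by (simp_all add: code_at_append)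
  obtain m1 where m1: "run w P code t1 (Running l m) = return_pmf (Running ?l m1)" "rel w M s1 m1"
    using assms(1) h(1,3) c(1) unfolding goes_def wfc.simps by blast
  obtain m2 where m2: "run w P code t2 (Running ?l m1) = return_pmf (Running (?l + clen c2) m2)"
     "rel w M s2 m2"
    using assms(2) h(1) c(2) m1(2) unfolding goes_def wfc.simps by blast
  show "\<exists>m'. run w P code (t1 + t2) (Running l m)
     = return_pmf (Running (l + clen (Seq c1 c2)) m') \<and> rel w M s2 m'"
    using run_trans[OF m1(1) m2(1)] m2(2) by (auto simp: add.assoc simp del: run.simps)
qed

lemma eval_cond:
  assumes "code_at code l (cx 0 e @ [JumpIfZero nV l2])" "rel w M s m" "okx w M s e" "wfx 0 e"
  obtains m' where "run w P code (Suc (length (cx 0 e))) (Running l m) = return_pmf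
      (Running (if ev w s e mod 2 ^ w = 0 then l2 else l + length (cx 0 e) + 1) m')" "rel w M s m'"
proof -
  have c: "code_at code l (cx 0 e)" "code_at code (l + length (cx 0 e)) [JumpIfZero nV l2]"
    using assms by (simp_all add: code_at_append)
  obtain m1 where m1: "run w P code (length (cx 0 e)) (Running l m)
      = return_pmf (Running (l + length (cx 0 e)) m1)" "rel w M s m1"
      "int (m1 ! nV) = ev w s e mod 2 ^ w"
    using cx_correct[OF c(1) assms(2,3), of P] assms(4) by auto
  have len: "nV < length m1" using m1 by (simp add: rel_def nT_def)
  have "m1 ! nV = 0 \<longleftrightarrow> ev w s e mod 2 ^ w = 0" using m1(3) by auto
  then have "run w P code 1 (Running (l + length (cx 0 e)) m1) = return_pmf
      (Running (if ev w s e mod 2 ^ w = 0 then l2 else l + length (cx 0 e) + 1) m1)"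
    using c(2) len by (simp add: code_at_Cons bind_return_pmf)
  from run_trans[OF m1(1) this] m1(2) that show ?thesis by simp
qed

lemma goto:
  assumes "code_at code l [Set nV 0, JumpIfZero nV l2]" "rel w M s m"
  obtains m' where "run w P code 2 (Running l m) = return_pmf (Running l2 m')" "rel w M s m'"
proof -
  have len: "nV < length m" using assms by (simp add: rel_def nT_def)
  have "run w P code 2 (Running l m) = return_pmf (Running l2 (m[nV := 0]))"
    using assms(1) len by (simp add: code_at_Cons bind_return_pmf put_def numeral_2_eq_2)
  moreover have "rel w M s (m[nV := 0])" using rel_temp[OF assms(2), of 0 0] by (simp add: nT_def)
  ultimately show ?thesis using that by blast
qed

lemma goes_If_True:
  assumes "okx w M s e" "ev w s e mod 2 ^ w \<noteq> 0" "goes P c1 s t s'"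
  shows "goes P (If e c1 c2) s (length (cx 0 e) + t + 3) s'"
proof (rule goesI)
  fix code l m assume h: "wfc (If e c1 c2)" "code_at code l (cc l (If e c1 c2))" "rel w M s m"
  define l1 where "l1 = l + length (cx 0 e) + 1"
  define l2 where "l2 = l1 + clen c1 + 2"
  define l3 where "l3 = l2 + clen c2"
  have c: "code_at code l (cx 0 e @ [JumpIfZero nV l2])" "code_at code l1 (cc l1 c1)"
     "code_at code (l1 + clen c1) [Set nV 0, JumpIfZero nV l3]"
    using h(2) by (simp_all add: Let_def l1_def[symmetric] l2_def[symmetric] l3_def[symmetric]
       code_at_append code_at_Cons l1_def l2_def l3_def add.assoc)
  obtain m1 where m1: "run w P code (Suc (length (cx 0 e))) (Running l m) = return_pmf (Running l1 m1)"
    "rel w M s m1"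
    using eval_cond[OF c(1) h(3) assms(1), of P] h(1) assms(2) unfolding l1_def by auto
  obtain m2 where m2: "run w P code t (Running l1 m1)
     = return_pmf (Running (l1 + clen c1) m2)" "rel w M s' m2"
    using assms(3) h(1) c(2) m1(2) unfolding goes_def wfc.simps by blast
  obtain m3 where m3: "run w P code 2 (Running (l1 + clen c1) m2)
     = return_pmf (Running l3 m3)" "rel w M s' m3"
    using goto[OF c(3) m2(2)] by blast
  have "l3 = l + clen (If e c1 c2)"
    by (simp add: Let_def l3_def l2_def l1_def)
  moreover have "Suc (length (cx 0 e)) + (t + 2) = length (cx 0 e) + t + 3" by simp
  ultimately show "\<exists>m'. run w P code (length (cx 0 e) + t + 3) (Running l m) =
     return_pmf (Running (l + clen (If e c1 c2)) m') \<and> rel w M s' m'"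
    using run_trans[OF m1(1) run_trans[OF m2(1) m3(1)]] m3(2) by metis
qed

lemma goes_If_False:
  assumes "okx w M s e" "ev w s e mod 2 ^ w = 0" "goes P c2 s t s'"
  shows "goes P (If e c1 c2) s (length (cx 0 e) + t + 1) s'"
proof (rule goesI)
  fix code l m assume h: "wfc (If e c1 c2)" "code_at code l (cc l (If e c1 c2))" "rel w M s m"
  define l1 where "l1 = l + length (cx 0 e) + 1"
  define l2 where "l2 = l1 + clen c1 + 2"
  have c: "code_at code l (cx 0 e @ [JumpIfZero nV l2])" "code_at code l2 (cc l2 c2)"
    using h(2) by (simp_all add: Let_def l1_def[symmetric] l2_def[symmetric]
       code_at_append code_at_Cons l1_def l2_def add.assoc)
  obtain m1 where m1: "run w P code (Suc (length (cx 0 e))) (Running l m) = return_pmf (Running l2 m1)"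
    "rel w M s m1"
    using eval_cond[OF c(1) h(3) assms(1), of P] h(1) assms(2) unfolding l1_def by auto
  obtain m2 where m2: "run w P code t (Running l2 m1)
     = return_pmf (Running (l2 + clen c2) m2)" "rel w M s' m2"
    using assms(3) h(1) c(2) m1(2) unfolding goes_def wfc.simps by blast
  have "l2 + clen c2 = l + clen (If e c1 c2)"
    by (simp add: Let_def l2_def l1_def)
  moreover have "Suc (length (cx 0 e)) + t = length (cx 0 e) + t + 1" by simp
  ultimately show "\<exists>m'. run w P code (length (cx 0 e) + t + 1) (Running l m) =
     return_pmf (Running (l + clen (If e c1 c2)) m') \<and> rel w M s' m'"
    using run_trans[OF m1(1) m2(1)] m2(2) by metis
qed

lemma goes_While_end:
  assumes "okx w M s e" "ev w s e mod 2 ^ w = 0"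
  shows "goes P (While e c) s (length (cx 0 e) + 1) s"
proof (rule goesI)
  fix code l m assume h: "wfc (While e c)" "code_at code l (cc l (While e c))" "rel w M s m"
  define l1 where "l1 = l + length (cx 0 e) + 1"
  define l2 where "l2 = l1 + clen c + 2"
  have c: "code_at code l (cx 0 e @ [JumpIfZero nV l2])"
    using h(2) by (simp_all add: Let_def l1_def[symmetric] l2_def[symmetric]
       code_at_append code_at_Cons l1_def l2_def add.assoc)
  obtain m1 where m1: "run w P code (Suc (length (cx 0 e))) (Running l m) = return_pmf (Running l2 m1)"
    "rel w M s m1"
    using eval_cond[OF c(1) h(3) assms(1), of P] h(1) assms(2) unfolding l1_def by auto
  have "l2 = l + clen (While e c)"
    by (simp add: Let_def l2_def l1_def)
  with m1
  show "\<exists>m'. run w P code (length (cx 0 e) + 1) (Running l m) =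
     return_pmf (Running (l + clen (While e c)) m') \<and> rel w M s m'"
    by (auto simp del: cc.simps run.simps)
qed

lemma goes_While_step:
  assumes "okx w M s e" "ev w s e mod 2 ^ w \<noteq> 0" "goes P c s t s1" "goes P (While e c) s1 t2 s2"
  shows "goes P (While e c) s (length (cx 0 e) + t + 3 + t2) s2"
proof (rule goesI)
  fix code l m assume h: "wfc (While e c)" "code_at code l (cc l (While e c))" "rel w M s m"
  define l1 where "l1 = l + length (cx 0 e) + 1"
  define l2 where "l2 = l1 + clen c + 2"
  have c: "code_at code l (cx 0 e @ [JumpIfZero nV l2])" "code_at code l1 (cc l1 c)"
    "code_at code (l1 + clen c) [Set nV 0, JumpIfZero nV l]"
    using h(2) by (simp_all add: Let_def l1_def[symmetric] l2_def[symmetric]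
       code_at_append code_at_Cons l1_def l2_def add.assoc)
  obtain m1 where m1: "run w P code (Suc (length (cx 0 e))) (Running l m) = return_pmf (Running l1 m1)"
    "rel w M s m1"
    using eval_cond[OF c(1) h(3) assms(1), of P] h(1) assms(2) unfolding l1_def by auto
  obtain m2 where m2: "run w P code t (Running l1 m1)
     = return_pmf (Running (l1 + clen c) m2)" "rel w M s1 m2"
    using assms(3) h(1) c(2) m1(2) unfolding goes_def wfc.simps by blast
  obtain m3 where m3: "run w P code 2 (Running (l1 + clen c) m2)
     = return_pmf (Running l m3)" "rel w M s1 m3"
    using goto[OF c(3) m2(2)] by blast
  obtain m4 where m4: "run w P code t2 (Running l m3)
     = return_pmf (Running (l + clen (While e c)) m4)" "rel w M s2 m4"
    using assms(4) h m3 unfolding goes_def by blast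
  have t: "Suc (length (cx 0 e)) + (t + (2 + t2)) = length (cx 0 e) + t + 3 + t2" by simp
  from run_trans[OF m1(1) run_trans[OF m2(1) run_trans[OF m3(1) m4(1)]]] m4(2)
  show "\<exists>m'. run w P code (length (cx 0 e) + t + 3 + t2) (Running l m) =
     return_pmf (Running (l + clen (While e c)) m') \<and> rel w M s2 m'"
    unfolding t by blast
qed

text \<open>Total correctness with a time bound. The postcondition may itself be a
  \<open>tri\<close>, which is how sequential composition is handled.\<close>

definition tri :: "bool list \<Rightarrow> cmd \<Rightarrow> st \<Rightarrow> nat \<Rightarrow> (st \<Rightarrow> bool) \<Rightarrow> bool" where
  "tri P c s t Q \<longleftrightarrow> (\<exists>t' \<le> t. \<exists>s'. goes P c s t' s' \<and> Q s')"

lemma triI: "goes P c s t' s' \<Longrightarrow> t' \<le> t \<Longrightarrow> Q s' \<Longrightarrow> tri P c s t Q"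
  unfolding tri_def by blast

lemma tri_mono: "tri P c s t Q \<Longrightarrow> (\<And>s'. Q s' \<Longrightarrow> Q' s') \<Longrightarrow> t \<le> t' \<Longrightarrow> tri P c s t' Q'"
  unfolding tri_def by (meson order_trans)

lemma tri_Seq:
  "tri P c1 s t1 (\<lambda>s'. tri P c2 s' t2 Q) \<Longrightarrow> tri P (Seq c1 c2) s (t1 + t2) Q"
  unfolding tri_def by (meson add_mono goes_Seq)

lemma tri_If:
  assumes "okx w M s e"
    "ev w s e mod 2 ^ w \<noteq> 0 \<Longrightarrow> tri P c1 s t Q"
    "ev w s e mod 2 ^ w = 0 \<Longrightarrow> tri P c2 s t Q"
  shows "tri P (If e c1 c2) s (length (cx 0 e) + t + 3) Q"
proof (cases "ev w s e mod 2 ^ w = 0")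
  case True
  then obtain t' s' where t': "t' \<le> t" "goes P c2 s t' s'" "Q s'" using assms(3) by (auto simp: tri_def)
  show ?thesis by (rule triI[OF goes_If_False[OF assms(1) True t'(2)]]) (use t' in auto)
next
  case False
  then obtain t' s' where t': "t' \<le> t" "goes P c1 s t' s'" "Q s'" using assms(2) by (auto simp: tri_def)
  show ?thesis by (rule triI[OF goes_If_True[OF assms(1) False t'(2)]]) (use t' in auto)
qed

text \<open>Symbolic execution of loop-free commands: \<open>den\<close> computes the final state
  and \<open>okc\<close> the absence of crashes, so that such a piece of program is verified by
  simplification.\<close>

fun den :: "bool list \<Rightarrow> cmd \<Rightarrow> st \<Rightarrow> st" where
  "den P (Asg x e) s = s\<lparr>vr := (vr s)(x := ev w s e)\<rparr>"
| "den P (Sto a e1 e2) s = s\<lparr>ar := (ar s)(a := (ar s a)(nat (ev w s e1) := ev w s e2))\<rparr>"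
| "den P (Rp x e) s = s\<lparr>vr := (vr s)(x := of_bool (P ! nat (ev w s e)))\<rparr>"
| "den P (Seq c1 c2) s = den P c2 (den P c1 s)"
| "den P (If e c1 c2) s = (if ev w s e mod 2 ^ w \<noteq> 0 then den P c1 s else den P c2 s)"
| "den P _ s = s"

fun okc :: "bool list \<Rightarrow> cmd \<Rightarrow> st \<Rightarrow> bool" where
  "okc P (Asg x e) s = okx w M s e"
| "okc P (Sto a e1 e2) s = (okx w M s e1 \<and> okx w M s e2 \<and> 0 \<le> ev w s e1 \<and> ev w s e1 < int M)"
| "okc P (Rp x e) s = (okx w M s e \<and> 0 \<le> ev w s e \<and> ev w s e < int (length P) \<and> ev w s e < 2 ^ w)"
| "okc P (Seq c1 c2) s = (okc P c1 s \<and> okc P c2 (den P c1 s))"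
| "okc P (If e c1 c2) s = (okx w M s e \<and> (if ev w s e mod 2 ^ w \<noteq> 0 then okc P c1 s else okc P c2 s))"
| "okc P _ s = True"

lemma den_correct:
  assumes "loopfree c" "okc P c s"
  shows "\<exists>t \<le> clen c. (straight c \<longrightarrow> t = clen c) \<and> goes P c s t (den P c s)"
  using assms
proof (induction c arbitrary: s)
  case (Asg x e)
  then show ?case using goes_Asg[of s e P x] by (auto simp del: run.simps)
next
  case (Sto a e1 e2)
  then show ?case using goes_Sto[of s e1 e2 P a] by auto
next
  case (Rp x e)
  have "nat (ev w s e) < 2 ^ w"
  proof -
    have "int (nat (ev w s e)) < int (2 ^ w)" using Rp by simp
    then show ?thesis by (simp only: of_nat_less_iff)
  qed
  then show ?case using Rp goes_Rp[of s e "nat (ev w s e)" P x] by (auto simp: nat_less_iff)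
next
  case (Seq c1 c2)
  have ok: "loopfree c1" "loopfree c2" "okc P c1 s" "okc P c2 (den P c1 s)" using Seq.prems by auto
  obtain t1 where t1: "t1 \<le> clen c1" "straight c1 \<longrightarrow> t1 = clen c1" "goes P c1 s t1 (den P c1 s)"
    using Seq.IH(1)[OF ok(1,3)] by blast
  obtain t2 where t2: "t2 \<le> clen c2" "straight c2 \<longrightarrow> t2 = clen c2"
     "goes P c2 (den P c1 s) t2 (den P c2 (den P c1 s))"
    using Seq.IH(2)[OF ok(2,4)] by blast
  show ?case using goes_Seq[OF t1(3) t2(3)] t1 t2
    by (intro exI[of _ "t1 + t2"]) auto
next
  case (If e c1 c2)
  show ?case
  proof (cases "ev w s e mod 2 ^ w = 0")
    case True
    then obtain t where "t \<le> clen c2" "goes P c2 s t (den P c2 s)"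
      using If.IH(2)[of s] If.prems by auto
    then show ?thesis using goes_If_False[of s e P c2 t "den P c2 s" c1] If.prems True
      by (intro exI[of _ "length (cx 0 e) + t + 1"]) auto
  next
    case False
    then obtain t where "t \<le> clen c1" "goes P c1 s t (den P c1 s)"
      using If.IH(1)[of s] If.prems by auto
    then show ?thesis using goes_If_True[of s e P c1 t "den P c1 s" c2] If.prems False
      by (intro exI[of _ "length (cx 0 e) + t + 3"]) auto
  qed
qed (use goes_Skip in auto)

lemma tri_den:
  assumes "loopfree c" "okc P c s" "Q (den P c s)" "clen c \<le> t"
  shows "tri P c s t Q"
  using den_correct[OF assms(1,2)] assms(3,4) unfolding tri_def by (meson order_trans)

lemma int_mod_pw [simp]: "0 \<le> x \<Longrightarrow> x < 2 ^ w \<Longrightarrow> x mod 2 ^ w = (x::int)"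
  by simp

lemma nat_mod_pw [simp]: "j < 2 ^ w \<Longrightarrow> int j mod 2 ^ w = int j"
  by (metis mod_less of_nat_numeral of_nat_power zmod_int)

text \<open>A round costs 10 steps besides the body: 4 for the test, 4 for the increment of
  \<open>x\<close>, 2 for the jump back. The failing test at the end costs 4.\<close>

lemma tri_For_aux:
  assumes "hi < 2 ^ w" "j \<le> hi" "I j s" "vr s x = int j" "vr s y = int hi"
    "\<And>j s. j < hi \<Longrightarrow> lo \<le> j \<Longrightarrow> I j s \<Longrightarrow> vr s x = int j \<Longrightarrow> vr s y = int hi \<Longrightarrow>
       tri P c s t (\<lambda>s'. vr s' x = int j \<and> vr s' y = int hi \<and> I (Suc j) (s'\<lparr>vr := (vr s')(x := 1 + int j)\<rparr>))"
    "\<And>s. I hi s \<Longrightarrow> vr s x = int hi \<Longrightarrow> Q s" "x \<noteq> y" "lo \<le> j"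
  shows "tri P (While (Op Less (Var x) (Var y)) (Seq c (Asg x (Op Add (Var x) (Cst 1))))) s
    ((hi - j) * (t + 10) + 4) Q"
  using assms(2-5,9)
proof (induction "hi - j" arbitrary: j s)
  case 0
  then have "j = hi" by simp
  then have "ev w s (Op Less (Var x) (Var y)) mod 2 ^ w = 0" using 0 by simp
  then have "goes P (While (Op Less (Var x) (Var y)) (Seq c (Asg x (Op Add (Var x) (Cst 1))))) s
     (length (cx 0 (Op Less (Var x) (Var y))) + 1) s"
    by (intro goes_While_end) simp_all
  then show ?case using 0 assms(7) \<open>j = hi\<close> by (intro triI) auto
next
  case (Suc d)
  then have j: "j < hi" by simp
  then have jw: "j < 2 ^ w" using assms(1) by simp
  obtain t1 s1 where s1: "t1 \<le> t" "goes P c s t1 s1" "vr s1 x = int j" "vr s1 y = int hi"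
     "I (Suc j) (s1\<lparr>vr := (vr s1)(x := 1 + int j)\<rparr>)"
    using assms(6)[OF j Suc.prems(5) Suc.prems(2,3,4)] by (auto simp: tri_def)
  define s2 where "s2 = s1\<lparr>vr := (vr s1)(x := 1 + int j)\<rparr>"
  have "goes P (Asg x (Op Add (Var x) (Cst 1))) s1
      (Suc (length (cx 0 (Op Add (Var x) (Cst 1))))) s2"
    using goes_Asg[of s1 "Op Add (Var x) (Cst 1)" P x] s1(3) by (simp add: s2_def add.commute)
  from goes_Seq[OF s1(2) this]
  have body: "goes P (Seq c (Asg x (Op Add (Var x) (Cst 1)))) s (t1 + 4) s2"
    by (simp add: numeral_eq_Suc)
  have "tri P (While (Op Less (Var x) (Var y)) (Seq c (Asg x (Op Add (Var x) (Cst 1))))) s2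
    ((hi - Suc j) * (t + 10) + 4) Q"
    using Suc.hyps(2) j s1 assms(8) Suc.prems(5) by (intro Suc.hyps(1)) (auto simp: s2_def)
  then obtain t2 s3 where s3: "t2 \<le> (hi - Suc j) * (t + 10) + 4" "Q s3"
    "goes P (While (Op Less (Var x) (Var y)) (Seq c (Asg x (Op Add (Var x) (Cst 1))))) s2 t2 s3"
    by (auto simp: tri_def)
  have "ev w s (Op Less (Var x) (Var y)) = 1"
    using j jw assms(1) Suc.prems(3,4) by simp
  moreover have "(1::int) mod 2 ^ w \<noteq> 0" unfolding one_mod_pw by simp
  ultimately have g: "goes P (While (Op Less (Var x) (Var y)) (Seq c (Asg x (Op Add (Var x) (Cst 1))))) s
    (length (cx 0 (Op Less (Var x) (Var y))) + (t1 + 4) + 3 + t2) s3"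
    by (intro goes_While_step[OF _ _ body s3(3)]) auto
  have e: "(hi - j) * (t + 10) = (t + 10) + (hi - Suc j) * (t + 10)"
    using j by (metis Suc_diff_Suc mult_Suc)
  have "length (cx 0 (Op Less (Var x) (Var y))) + (t1 + 4) + 3 + t2 \<le> (hi - j) * (t + 10) + 4"
    unfolding e using s1(1) s3(1) by simp
  then show ?case by (rule triI[OF g]) (rule s3(2))
qed

lemma tri_For:
  assumes "okx w M s e" "ev w s e = int lo" "vr s y = int hi" "lo \<le> hi" "hi < 2 ^ w" "x \<noteq> y"
    "I lo (s\<lparr>vr := (vr s)(x := int lo)\<rparr>)"
    "\<And>j s. lo \<le> j \<Longrightarrow> j < hi \<Longrightarrow> I j s \<Longrightarrow> vr s x = int j \<Longrightarrow> vr s y = int hi \<Longrightarrow>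
       tri P c s t (\<lambda>s'. vr s' x = int j \<and> vr s' y = int hi \<and> I (Suc j) (s'\<lparr>vr := (vr s')(x := 1 + int j)\<rparr>))"
    "\<And>s. I hi s \<Longrightarrow> vr s x = int hi \<Longrightarrow> Q s"
    "length (cx 0 e) + 5 + hi * (t + 10) \<le> T"
  shows "tri P (For x e y c) s T Q"
proof -
  define s1 where "s1 = s\<lparr>vr := (vr s)(x := int lo)\<rparr>"
  have g: "goes P (Asg x e) s (Suc (length (cx 0 e))) s1"
    using goes_Asg[OF assms(1), of P x] assms(2) by (simp add: s1_def)
  have "tri P (While (Op Less (Var x) (Var y)) (Seq c (Asg x (Op Add (Var x) (Cst 1))))) s1
    ((hi - lo) * (t + 10) + 4) Q"
    using assms by (intro tri_For_aux[where I = I and lo = lo]) (auto simp: s1_def)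
  then have "tri P (For x e y c) s (Suc (length (cx 0 e)) + ((hi - lo) * (t + 10) + 4)) Q"
    unfolding For_def by (intro tri_Seq triI[OF g]) auto
  moreover have "Suc (length (cx 0 e)) + ((hi - lo) * (t + 10) + 4) \<le> T"
  proof -
    have "(hi - lo) * (t + 10) \<le> hi * (t + 10)" by (intro mult_le_mono1) simp
    then show ?thesis using assms(10) by linarith
  qed
  ultimately show ?thesis using tri_mono by blast
qed

text \<open>The invariant is a closed form \<open>F j\<close> of the state before round
  \<open>j\<close>. One round then becomes an equation between states that simplification with
  \<open>den\<close> can check.\<close>

lemma tri_For_fun:
  assumes "okx w M s e" "ev w s e = int lo" "vr s y = int hi" "lo \<le> hi" "hi < 2 ^ w" "x \<noteq> y"
    "F lo = s\<lparr>vr := (vr s)(x := int lo)\<rparr>" "loopfree c"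
    "\<And>j. lo \<le> j \<Longrightarrow> j < hi \<Longrightarrow> vr (F j) x = int j \<Longrightarrow> vr (F j) y = int hi \<Longrightarrow>
       okc P c (F j) \<and> vr (den P c (F j)) x = int j \<and> vr (den P c (F j)) y = int hi \<and>
       (den P c (F j))\<lparr>vr := (vr (den P c (F j)))(x := 1 + int j)\<rparr> = F (Suc j)"
    "Q (F hi)" "length (cx 0 e) + 5 + hi * (clen c + 10) \<le> T"
  shows "tri P (For x e y c) s T Q"
proof (rule tri_For[OF assms(1-6), where I = "\<lambda>j s. s = F j" and t = "clen c"])
  fix j s' assume j: "lo \<le> j" "j < hi" and s': "s' = F j" and v: "vr s' x = int j" "vr s' y = int hi"
  from assms(9)[OF j] v have *: "okc P c (F j)" "vr (den P c (F j)) x = int j"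
    "vr (den P c (F j)) y = int hi" 
    "(den P c (F j))\<lparr>vr := (vr (den P c (F j)))(x := 1 + int j)\<rparr> = F (Suc j)"
    by (auto simp: s')
  show "tri P c s' (clen c) (\<lambda>s'. vr s' x = int j \<and> vr s' y = int hi \<and>
      s'\<lparr>vr := (vr s')(x := 1 + int j)\<rparr> = F (Suc j))"
    unfolding s' by (rule tri_den) (use assms(8) * in auto)
qed (use assms in auto)

lemma tri_halts:
  assumes "tri P c s t Q" "rel w M s m" "wfc c"
  shows "\<exists>m' s'. run w P (cc 0 c @ [Halt]) (Suc t) (Running 0 m) = return_pmf (Halted m') \<and>
    rel w M s' m' \<and> Q s'"
proof -
  let ?code = "cc 0 c @ [Halt]"
  obtain t' s' where t': "t' \<le> t" "goes P c s t' s'" "Q s'" using assms(1) by (auto simp: tri_def)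
  have "code_at ?code 0 (cc 0 c @ [Halt])" by (rule code_at_whole)
  then have c: "code_at ?code 0 (cc 0 c)" "code_at ?code (0 + clen c) [Halt]"
    by (simp_all add: code_at_append)
  obtain m' where m': "run w P ?code t' (Running 0 m) = return_pmf (Running (0 + clen c) m')"
     "rel w M s' m'"
    using t'(2) assms(2,3) c(1) unfolding goes_def by blast
  have "run w P ?code 1 (Running (0 + clen c) m') = return_pmf (Halted m')"
    using c(2) by (simp add: code_at_Cons bind_return_pmf)
  from run_trans[OF this run_Halted, of "t - t'"]
  have "run w P ?code (1 + (t - t')) (Running (0 + clen c) m') = return_pmf (Halted m')" .
  from run_trans[OF m'(1) this] have "run w P ?code (Suc t) (Running 0 m) = return_pmf (Halted m')"
    using t'(1) by (simp del: run.simps)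
  then show ?thesis using m'(2) t'(3) by blast
qed

section \<open>Runs that draw random words\<close>

definition uni :: "nat pmf" where "uni = pmf_of_set {..<2 ^ w}"

lemma set_uni [simp]: "set_pmf uni = {..<2 ^ w}"
  unfolding uni_def by (subst set_pmf_of_set) (auto simp: lessThan_empty_iff)

lemma Rand_step:
  assumes "code_at code l [Rand z]" "z < nV" "rel w M s m"
  shows "run w P code 1 (Running l m) = map_pmf (\<lambda>v. Running (Suc l) (m[z := v])) uni"
    "v < 2 ^ w \<Longrightarrow> rel w M (s\<lparr>vr := (vr s)(z := int v)\<rparr>) (m[z := v])"
proof -
  have len: "z < length m" using assms by (simp add: rel_def)
  have "run w P code 1 (Running l m) = map_pmf (put w l m z) (pmf_of_set {..<2 ^ w})"
    using assms(1) by (simp add: code_at_Cons bind_return_pmf'[unfolded id_def] run_0_eq)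
  also have "\<dots> = map_pmf (\<lambda>v. Running (Suc l) (m[z := v])) uni"
    unfolding uni_def[symmetric] by (rule map_pmf_cong) (auto simp: put_def len)
  finally show "run w P code 1 (Running l m) = map_pmf (\<lambda>v. Running (Suc l) (m[z := v])) uni" .
  show "v < 2 ^ w \<Longrightarrow> rel w M (s\<lparr>vr := (vr s)(z := int v)\<rparr>) (m[z := v])"
    by (rule rel_var[OF assms(3,2)]) simp
qed

text \<open>Seven steps besides the body: 4 for the test, 1 for the draw, 2 for the jump
  back.\<close>

lemma Fill_iter:
  assumes code: "code_at code l (cc l (Fill x y z c))" and wf: "wfc (Fill x y z c)"
    and st: "straight c" "loopfree c"
    and N: "j < N" "N < 2 ^ w" "vr s x = int j" "vr s y = int N"
    and body: "\<And>v. v < 2 ^ w \<Longrightarrow> okc P c (s\<lparr>vr := (vr s)(z := int v)\<rparr>)"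
    and r: "rel w M s m"
  shows "\<exists>h. run w P code (clen c + 7) (Running l m) = map_pmf (\<lambda>v. Running l (h v)) uni \<and>
    (\<forall>v < 2 ^ w. rel w M (den P c (s\<lparr>vr := (vr s)(z := int v)\<rparr>)) (h v))"
proof -
  let ?e = "Op Less (Var x) (Var y)"
  define l1 where "l1 = l + length (cx 0 ?e) + 1"
  define l2 where "l2 = Suc l1 + clen c"
  have cs: "code_at code l (cx 0 ?e @ [JumpIfZero nV (l2 + 2)])" "code_at code l1 [Rand z]"
    "code_at code (Suc l1) (cc (Suc l1) c)" "code_at code l2 [Set nV 0, JumpIfZero nV l]"
    using code by (simp_all add: Fill_def Let_def code_at_append code_at_Cons l1_def l2_def add_ac)
  have "(1::int) mod 2 ^ w \<noteq> 0" unfolding one_mod_pw by simp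
  moreover have "ev w s ?e = 1" using N by simp
  ultimately have "ev w s ?e mod 2 ^ w \<noteq> 0" by simp
  then obtain m1 where m1: "run w P code (Suc (length (cx 0 ?e))) (Running l m)
      = return_pmf (Running l1 m1)" "rel w M s m1"
    using eval_cond[OF cs(1) r, of P] wf unfolding l1_def Fill_def by auto
  have zV: "z < nV" using wf by (simp add: Fill_def)
  note rs = Rand_step[OF cs(2) zV m1(2)]
  have "\<exists>m'. run w P code (clen c + 2) (Running (Suc l1) (m1[z := v])) = return_pmf (Running l m')
     \<and> rel w M (den P c (s\<lparr>vr := (vr s)(z := int v)\<rparr>)) m'" if v: "v < 2 ^ w" for v
  proof -
    let ?s = "s\<lparr>vr := (vr s)(z := int v)\<rparr>"
    have g: "goes P c ?s (clen c) (den P c ?s)"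
      using den_correct[OF st(2) body[OF v]] st(1) by auto
    have wfc: "wfc c" using wf by (simp add: Fill_def)
    obtain m2 where m2: "run w P code (clen c) (Running (Suc l1) (m1[z := v]))
        = return_pmf (Running l2 m2)" "rel w M (den P c ?s) m2"
      using g cs(3) rs(2)[OF v] wfc unfolding goes_def l2_def by blast
    obtain m3 where m3: "run w P code 2 (Running l2 m2) = return_pmf (Running l m3)"
       "rel w M (den P c ?s) m3"
      using goto[OF cs(4) m2(2)] by blast
    show ?thesis using run_trans[OF m2(1) m3(1)] m3(2) by blast
  qed
  then obtain h where h: "\<And>v. v < 2 ^ w \<Longrightarrow>
     run w P code (clen c + 2) (Running (Suc l1) (m1[z := v])) = return_pmf (Running l (h v))"
     "\<And>v. v < 2 ^ w \<Longrightarrow> rel w M (den P c (s\<lparr>vr := (vr s)(z := int v)\<rparr>)) (h v)"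
    by metis
  have "run w P code (1 + (clen c + 2)) (Running l1 m1)
     = bind_pmf uni (\<lambda>v. run w P code (clen c + 2) (Running (Suc l1) (m1[z := v])))"
    unfolding run_add[of _ _ _ 1] rs(1) by (simp add: bind_map_pmf)
  also have "\<dots> = bind_pmf uni (\<lambda>v. return_pmf (Running l (h v)))"
    by (rule bind_pmf_cong[OF refl h(1)]) simp
  also have "\<dots> = map_pmf (\<lambda>v. Running l (h v)) uni" by (simp add: map_pmf_def)
  finally have "run w P code (1 + (clen c + 2)) (Running l1 m1) = map_pmf (\<lambda>v. Running l (h v)) uni" .
  from run_trans[OF m1(1) this]
  have "run w P code (clen c + 7) (Running l m) = map_pmf (\<lambda>v. Running l (h v)) uni"
    by (simp add: numeral_eq_Suc del: run.simps)
  then show ?thesis using h(2) by blast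
qed

text \<open>\<open>D\<close> is a joint law of the memory and the recorded values
  \<open>\<tau>\<close>. A function from \<open>\<tau>\<close> to memories would not do: temporaries
  may still hold traces of the random words, of which \<open>\<tau>\<close> keeps only
  \<open>g v\<close>.\<close>

lemma Fill_loop:
  assumes code: "code_at code l (cc l (Fill x y z c))" and wf: "wfc (Fill x y z c)"
    and st: "straight c" "loopfree c"
    and N: "N < 2 ^ w" and v: "\<And>j \<tau>. vr (F j \<tau>) x = int j" "\<And>j \<tau>. vr (F j \<tau>) y = int N"
    and body: "\<And>j \<tau> v. j < N \<Longrightarrow> v < 2 ^ w \<Longrightarrow> okc P c ((F j \<tau>)\<lparr>vr := (vr (F j \<tau>))(z := int v)\<rparr>) \<and>
      den P c ((F j \<tau>)\<lparr>vr := (vr (F j \<tau>))(z := int v)\<rparr>) = F (Suc j) (\<tau>(j := g v))"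
    and r: "rel w M (F 0 (\<lambda>_. 0)) m"
    and j: "j \<le> N"
  shows "\<exists>D :: (nat list \<times> (nat \<Rightarrow> int)) pmf.
    run w P code (j * (clen c + 7)) (Running l m) = map_pmf (\<lambda>d. Running l (fst d)) D \<and>
    map_pmf snd D = Pi_pmf {..<j} 0 (\<lambda>_. map_pmf g uni) \<and>
    (\<forall>d \<in> set_pmf D. rel w M (F j (snd d)) (fst d))"
  using j
proof (induction j)
  case 0
  show ?case
    by (rule exI[of _ "return_pmf (m, \<lambda>_. 0)"]) (use r in auto)
next
  case (Suc j)
  then obtain D where D: "run w P code (j * (clen c + 7)) (Running l m) = map_pmf (\<lambda>d. Running l (fst d)) D"
    "map_pmf snd D = Pi_pmf {..<j} 0 (\<lambda>_. map_pmf g uni)"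
    "\<And>d. d \<in> set_pmf D \<Longrightarrow> rel w M (F j (snd d)) (fst d)"
    by auto
  have jN: "j < N" using Suc by simp
  have "\<exists>h. run w P code (clen c + 7) (Running l (fst d)) = map_pmf (\<lambda>v. Running l (h v)) uni \<and>
      (\<forall>v < 2 ^ w. rel w M (F (Suc j) ((snd d)(j := g v))) (h v))" if d: "d \<in> set_pmf D" for d
    using Fill_iter[OF code wf st jN N v(1) v(2) _ D(3)[OF d], of P] body[OF jN] by simp
  then obtain h where h: "\<And>d. d \<in> set_pmf D \<Longrightarrow>
      run w P code (clen c + 7) (Running l (fst d)) = map_pmf (\<lambda>v. Running l (h d v)) uni"
    "\<And>d v. d \<in> set_pmf D \<Longrightarrow> v < 2 ^ w \<Longrightarrow> rel w M (F (Suc j) ((snd d)(j := g v))) (h d v)"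
    by metis
  define D' where "D' = bind_pmf D (\<lambda>d. map_pmf (\<lambda>v. (h d v, (snd d)(j := g v))) uni)"
  have "run w P code (Suc j * (clen c + 7)) (Running l m)
      = bind_pmf D (\<lambda>d. run w P code (clen c + 7) (Running l (fst d)))"
    unfolding mult_Suc add.commute[of "clen c + 7"] run_add[of _ _ _ "j * (clen c + 7)"] D(1)
    by (simp add: bind_map_pmf)
  also have "\<dots> = bind_pmf D (\<lambda>d. map_pmf (\<lambda>v. Running l (h d v)) uni)"
    by (rule bind_pmf_cong[OF refl h(1)])
  also have "\<dots> = map_pmf (\<lambda>d. Running l (fst d)) D'"
    unfolding D'_def map_bind_pmf by (simp add: map_pmf_comp)
  finally have 1: "run w P code (Suc j * (clen c + 7)) (Running l m) = map_pmf (\<lambda>d. Running l (fst d)) D'" .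
  have "map_pmf snd D' = bind_pmf (map_pmf snd D) (\<lambda>\<tau>. map_pmf (\<lambda>v. \<tau>(j := g v)) uni)"
    unfolding D'_def map_bind_pmf bind_map_pmf by (simp add: map_pmf_comp)
  \<comment> \<open>The program draws coordinate \<open>j\<close> after the others, the product rule
    draws it first; the two independent draws are exchanged.\<close>
  also have "\<dots> = Pi_pmf (insert j {..<j}) 0 (\<lambda>_. map_pmf g uni)"
    unfolding D(2) by (subst Pi_pmf_insert', simp, simp, subst bind_commute_pmf)
      (simp add: map_pmf_def bind_assoc_pmf bind_return_pmf)
  finally have 2: "map_pmf snd D' = Pi_pmf {..<Suc j} 0 (\<lambda>_. map_pmf g uni)"
    by (simp add: lessThan_Suc)
  have 3: "\<forall>d \<in> set_pmf D'. rel w M (F (Suc j) (snd d)) (fst d)"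
    using h(2) by (auto simp: D'_def)
  show ?case using 1 2 3 by blast
qed

text \<open>\<open>c2\<close> may take a different time for each \<open>\<tau>\<close>. Since a
  halted machine stays put, all runs are padded to one common \<open>T\<^sub>0\<close>.\<close>

lemma Fill_program:
  assumes "tri P c1 s t1 (\<lambda>s'. s' = F 0 (\<lambda>_. 0))" "rel w M s m"
    and wf: "wfc c1" "wfc (Fill x y z c)" "wfc c2"
    and st: "straight c" "loopfree c"
    and N: "N < 2 ^ w" and v: "\<And>j \<tau>. vr (F j \<tau>) x = int j" "\<And>j \<tau>. vr (F j \<tau>) y = int N"
    and body: "\<And>j \<tau> v. j < N \<Longrightarrow> v < 2 ^ w \<Longrightarrow> okc P c ((F j \<tau>)\<lparr>vr := (vr (F j \<tau>))(z := int v)\<rparr>) \<and>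
      den P c ((F j \<tau>)\<lparr>vr := (vr (F j \<tau>))(z := int v)\<rparr>) = F (Suc j) (\<tau>(j := g v))"
    and c2: "\<And>\<tau>. \<tau> \<in> set_pmf (Pi_pmf {..<N} 0 (\<lambda>_. map_pmf g uni)) \<Longrightarrow> tri P c2 (F N \<tau>) t2 (Q \<tau>)"
  shows "\<exists>T\<^sub>0 (D :: (nat list \<times> (nat \<Rightarrow> int)) pmf).
    run w P (cc 0 (Seq (Seq c1 (Fill x y z c)) c2) @ [Halt]) T\<^sub>0 (Running 0 m)
      = map_pmf (\<lambda>d. Halted (fst d)) D \<and>
    map_pmf snd D = Pi_pmf {..<N} 0 (\<lambda>_. map_pmf g uni) \<and>
    (\<forall>d \<in> set_pmf D. \<exists>s'. rel w M s' (fst d) \<and> Q (snd d) s')"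
proof -
  let ?f = "Fill x y z c" and ?e = "Op Less (Var x) (Var y)"
  let ?code = "cc 0 (Seq (Seq c1 ?f) c2) @ [Halt]"
  let ?l2 = "clen c1 + clen ?f"
  let ?l3 = "?l2 + clen c2"
  have "code_at ?code 0 ?code" by (rule code_at_whole)
  then have cs: "code_at ?code 0 (cc 0 c1)" "code_at ?code (clen c1) (cc (clen c1) ?f)"
    "code_at ?code ?l2 (cc ?l2 c2)" "code_at ?code ?l3 [Halt]"
    by (simp_all add: code_at_append)
  obtain t1' where t1': "goes P c1 s t1' (F 0 (\<lambda>_. 0))" using assms(1) by (auto simp: tri_def)
  obtain m1 where m1: "run w P ?code t1' (Running 0 m) = return_pmf (Running (clen c1) m1)"
     "rel w M (F 0 (\<lambda>_. 0)) m1"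
    using t1' wf(1) cs(1) assms(2) unfolding goes_def by (metis add_0)
  obtain D where D: "run w P ?code (N * (clen c + 7)) (Running (clen c1) m1)
      = map_pmf (\<lambda>d. Running (clen c1) (fst d)) D"
    "map_pmf snd D = Pi_pmf {..<N} 0 (\<lambda>_. map_pmf g uni)"
    "\<forall>d \<in> set_pmf D. rel w M (F N (snd d)) (fst d)"
    using Fill_loop[OF cs(2) wf(2) st N v body m1(2), of N] by blast
  have "\<exists>m' s'. run w P ?code (4 + (t2 + 1)) (Running (clen c1) (fst d)) = return_pmf (Halted m') \<and>
     rel w M s' m' \<and> Q (snd d) s'" if d: "d \<in> set_pmf D" for d
  proof -
    have "snd d \<in> set_pmf (Pi_pmf {..<N} 0 (\<lambda>_. map_pmf g uni))"
      using d D(2) by (metis imageI set_map_pmf)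
    then obtain t2' s' where t2': "t2' \<le> t2" "goes P c2 (F N (snd d)) t2' s'" "Q (snd d) s'"
      using c2 unfolding tri_def by blast
    have "ev w (F N (snd d)) ?e mod 2 ^ w = 0" using v by simp
    then have "goes P ?f (F N (snd d)) (length (cx 0 ?e) + 1) (F N (snd d))"
      unfolding Fill_def by (intro goes_While_end) simp_all
    from goes_Seq[OF this t2'(2)] have g: "goes P (Seq ?f c2) (F N (snd d)) (4 + t2') s'"
      by (simp add: numeral_eq_Suc)
    have "code_at ?code (clen c1) (cc (clen c1) (Seq ?f c2))" using cs by (simp add: code_at_append)
    then obtain m' where m': "run w P ?code (4 + t2') (Running (clen c1) (fst d))
       = return_pmf (Running (clen c1 + clen (Seq ?f c2)) m')" "rel w M s' m'"
      using g wf D(3) d unfolding goes_def wfc.simps by blast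
    have "run w P ?code 1 (Running (clen c1 + clen (Seq ?f c2)) m') = return_pmf (Halted m')"
      using cs(4) by (simp add: code_at_Cons bind_return_pmf add.assoc)
    from run_trans[OF m'(1) run_trans[OF this run_Halted, of "t2 - t2'"]]
    have "run w P ?code (4 + t2' + (1 + (t2 - t2'))) (Running (clen c1) (fst d)) = return_pmf (Halted m')" .
    moreover have "4 + t2' + (1 + (t2 - t2')) = 4 + (t2 + 1)" using t2'(1) by simp
    ultimately show ?thesis using m'(2) t2'(3) by metis
  qed
  then obtain h where h: "\<And>d. d \<in> set_pmf D \<Longrightarrow>
      run w P ?code (4 + (t2 + 1)) (Running (clen c1) (fst d)) = return_pmf (Halted (h d))"
     "\<And>d. d \<in> set_pmf D \<Longrightarrow> \<exists>s'. rel w M s' (h d) \<and> Q (snd d) s'"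
    by metis
  define D' where "D' = map_pmf (\<lambda>d. (h d, snd d)) D"
  have "run w P ?code (N * (clen c + 7) + (4 + (t2 + 1))) (Running (clen c1) m1)
     = bind_pmf D (\<lambda>d. run w P ?code (4 + (t2 + 1)) (Running (clen c1) (fst d)))"
    unfolding run_add[of _ _ _ "N * (clen c + 7)"] D(1) by (simp only: bind_map_pmf)
  also have "\<dots> = bind_pmf D (\<lambda>d. return_pmf (Halted (h d)))"
    by (rule bind_pmf_cong[OF refl h(1)])
  also have "\<dots> = map_pmf (\<lambda>d. Halted (fst d)) D'"
    unfolding D'_def by (simp add: map_pmf_comp map_pmf_def[symmetric])
  finally have "run w P ?code (t1' + (N * (clen c + 7) + (4 + (t2 + 1)))) (Running 0 m)
     = map_pmf (\<lambda>d. Halted (fst d)) D'"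
    by (rule run_trans[OF m1(1)])
  moreover have "map_pmf snd D' = Pi_pmf {..<N} 0 (\<lambda>_. map_pmf g uni)"
    unfolding D'_def by (simp add: map_pmf_comp D(2))
  moreover have "\<forall>d \<in> set_pmf D'. \<exists>s'. rel w M s' (fst d) \<and> Q (snd d) s'"
    using h(2) by (auto simp: D'_def)
  ultimately show ?thesis by blast
qed

end

section \<open>Expectations over distributions with finite support\<close>

abbreviation E :: "'a pmf \<Rightarrow> ('a \<Rightarrow> real) \<Rightarrow> real" where
  "E p f \<equiv> measure_pmf.expectation p f"

definition sg :: "int pmf" where "sg = pmf_of_set {1, -1}"

lemma set_sg [simp]: "set_pmf sg = {1, -1}"
  by (simp add: sg_def)

lemma E_sg: "E sg f = (f 1 + f (-1)) / 2"
  unfolding sg_def by (subst integral_pmf_of_set) auto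

lemma E_add:
  "finite (set_pmf p) \<Longrightarrow> E p (\<lambda>x. f x + g x) = E p f + E p g"
  by (intro Bochner_Integration.integral_add integrable_measure_pmf_finite)

lemma E_diff:
  "finite (set_pmf p) \<Longrightarrow> E p (\<lambda>x. f x - g x) = E p f - E p g"
  by (intro Bochner_Integration.integral_diff integrable_measure_pmf_finite)

lemma E_mono:
  "finite (set_pmf p) \<Longrightarrow> (\<And>x. x \<in> set_pmf p \<Longrightarrow> f x \<le> g x) \<Longrightarrow> E p f \<le> E p g"
  by (intro integral_mono_AE integrable_measure_pmf_finite AE_pmfI)

lemma E_sum:
  "finite (set_pmf p) \<Longrightarrow> E p (\<lambda>x. \<Sum>i\<in>I. f i x) = (\<Sum>i\<in>I. E p (f i))"
  by (intro Bochner_Integration.integral_sum integrable_measure_pmf_finite)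

lemma E_cong: "(\<And>x. x \<in> set_pmf p \<Longrightarrow> f x = g x) \<Longrightarrow> E p f = E p g"
  by (intro integral_cong_AE AE_pmfI) auto

lemma E_pair:
  assumes "finite (set_pmf p)" "finite (set_pmf q)"
  shows "E (pair_pmf p q) f = E p (\<lambda>x. E q (\<lambda>y. f (x, y)))"
proof -
  have "pair_pmf p q = bind_pmf p (\<lambda>x. map_pmf (Pair x) q)"
    by (simp add: pair_pmf_def map_pmf_def)
  also have "E \<dots> f = (\<Sum>a\<in>set_pmf p. pmf p a *\<^sub>R E (map_pmf (Pair a) q) f)"
    using assms by (intro pmf_expectation_bind) auto
  also have "\<dots> = E p (\<lambda>x. E q (\<lambda>y. f (x, y)))"
    by (subst integral_measure_pmf[of "set_pmf p"]) (use assms in auto)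
  finally show ?thesis .
qed

lemma finite_set_Pi_pmf:
  "finite A \<Longrightarrow> (\<And>x. x \<in> A \<Longrightarrow> finite (set_pmf (p x))) \<Longrightarrow> finite (set_pmf (Pi_pmf A d p))"
  by (simp add: set_Pi_pmf finite_PiE_dflt)

lemma E_Pi_insert:
  assumes "finite A" "x \<notin> A" "\<And>x. finite (set_pmf (p x))"
  shows "E (Pi_pmf (insert x A) d p) f = E (p x) (\<lambda>y. E (Pi_pmf A d p) (\<lambda>g. f (g(x := y))))"
  unfolding Pi_pmf_insert[OF assms(1,2)]
  by (simp add: E_pair assms finite_set_Pi_pmf case_prod_beta)

lemma markov_pmf:
  assumes "finite (set_pmf p)" "\<And>x. x \<in> set_pmf p \<Longrightarrow> 0 \<le> f x" "0 < a"
    "\<And>x. x \<in> set_pmf p \<Longrightarrow> x \<in> S \<Longrightarrow> a \<le> f x"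
  shows "measure_pmf.prob p S \<le> E p f / a"
proof -
  have "measure_pmf.prob p S = E p (indicator S)" by simp
  also have "\<dots> \<le> E p (\<lambda>x. f x / a)"
    using assms by (intro E_mono) (auto simp: indicator_def field_simps)
  finally show ?thesis by simp
qed

section \<open>Moments of Rademacher sums\<close>

abbreviation rad :: "nat set \<Rightarrow> (nat \<Rightarrow> int) pmf" where
  "rad A \<equiv> Pi_pmf A 0 (\<lambda>_. sg)"

lemma finite_rad [simp]: "finite A \<Longrightarrow> finite (set_pmf (rad A))"
  by (intro finite_set_Pi_pmf) auto

lemma rad_insert:
  assumes "finite A" "i \<notin> A"
  shows "E (rad (insert i A)) f =
    E (rad A) (\<lambda>r. (f (r(i := 1)) + f (r(i := -1))) / 2)"
  using assms by (subst E_Pi_insert) (auto simp: E_sg E_add)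

lemma sum_upd_rad:
  assumes "finite A" "i \<notin> A"
  shows "(\<Sum>j\<in>insert i A. real_of_int ((r(i := v)) j) * x j) = real_of_int v * x i + (\<Sum>j\<in>A. real_of_int (r j) * x j)"
proof -
  have "(\<Sum>j\<in>A. real_of_int ((r(i := v)) j) * x j) = (\<Sum>j\<in>A. real_of_int (r j) * x j)"
    using assms by (intro sum.cong) auto
  then show ?thesis using assms by simp
qed

text \<open>The index \<open>b\<close> numbers the coordinates of a vector, so this and the next
  bound concern the norm of a randomly signed sum of vectors. The scalar case is
  \<open>J = {()}\<close>.\<close>

lemma rad_second_moment:
  fixes x :: "'b \<Rightarrow> nat \<Rightarrow> real"
  assumes "finite A"
  shows "E (rad A) (\<lambda>r. \<Sum>b\<in>J. (\<Sum>i\<in>A. real_of_int (r i) * x b i)\<^sup>2) = (\<Sum>b\<in>J. \<Sum>i\<in>A. (x b i)\<^sup>2)"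
  using assms
proof (induction A rule: finite_induct)
  case (insert i A)
  let ?V = "\<lambda>r b. \<Sum>j\<in>A. real_of_int (r j) * x b j"
  have "E (rad (insert i A)) (\<lambda>r. \<Sum>b\<in>J. (\<Sum>j\<in>insert i A. real_of_int (r j) * x b j)\<^sup>2)
     = E (rad A) (\<lambda>r. ((\<Sum>b\<in>J. (x b i + ?V r b)\<^sup>2) + (\<Sum>b\<in>J. (- x b i + ?V r b)\<^sup>2)) / 2)"
    unfolding rad_insert[OF insert(1,2)] sum_upd_rad[OF insert(1,2)] by simp
  also have "\<dots> = E (rad A) (\<lambda>r. (\<Sum>b\<in>J. (?V r b)\<^sup>2) + (\<Sum>b\<in>J. (x b i)\<^sup>2))"
    unfolding sum.distrib[symmetric] sum_divide_distrib
    by (intro E_cong sum.cong refl) (simp add: power2_eq_square field_simps)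
  also have "\<dots> = (\<Sum>b\<in>J. \<Sum>j\<in>A. (x b j)\<^sup>2) + (\<Sum>b\<in>J. (x b i)\<^sup>2)"
    using insert by (subst E_add) auto
  finally show ?case using insert by (simp add: sum.distrib add.commute)
qed simp

text \<open>Khintchine's inequality for exponent 4, in vector form. Averaging over one sign turns
  \<open>U^2\<close> into \<open>(U + d)^2 + 4 c^2\<close>, and Cauchy-Schwarz bounds
  \<open>c^2\<close> by \<open>U d\<close>. The resulting coefficient 6 of the mixed term is exactly
  that of \<open>3 (d + N)^2\<close>.\<close>

lemma rad_fourth_moment:
  fixes x :: "'b \<Rightarrow> nat \<Rightarrow> real"
  assumes "finite A"
  shows "E (rad A) (\<lambda>r. (\<Sum>b\<in>J. (\<Sum>i\<in>A. real_of_int (r i) * x b i)\<^sup>2)\<^sup>2)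
    \<le> 3 * (\<Sum>b\<in>J. \<Sum>i\<in>A. (x b i)\<^sup>2)\<^sup>2"
  using assms
proof (induction A rule: finite_induct)
  case (insert i A)
  let ?V = "\<lambda>r b. \<Sum>j\<in>A. real_of_int (r j) * x b j"
  let ?U = "\<lambda>r. \<Sum>b\<in>J. (?V r b)\<^sup>2"
  let ?d = "\<Sum>b\<in>J. (x b i)\<^sup>2"
  let ?N = "\<Sum>b\<in>J. \<Sum>j\<in>A. (x b j)\<^sup>2"
  have "E (rad (insert i A)) (\<lambda>r. (\<Sum>b\<in>J. (\<Sum>j\<in>insert i A. real_of_int (r j) * x b j)\<^sup>2)\<^sup>2)
     = E (rad A) (\<lambda>r. ((\<Sum>b\<in>J. (x b i + ?V r b)\<^sup>2)\<^sup>2 + (\<Sum>b\<in>J. (- x b i + ?V r b)\<^sup>2)\<^sup>2) / 2)"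
    unfolding rad_insert[OF insert(1,2)] sum_upd_rad[OF insert(1,2)] by simp
  also have "\<dots> \<le> E (rad A) (\<lambda>r. (?U r)\<^sup>2 + (6 * ?d * ?U r + ?d\<^sup>2))"
  proof (intro E_mono)
    fix r
    let ?c = "\<Sum>b\<in>J. ?V r b * x b i"
    have cs: "?c\<^sup>2 \<le> ?U r * ?d" by (rule Cauchy_Schwarz_ineq_sum)
    have 1: "(\<Sum>b\<in>J. (x b i + ?V r b)\<^sup>2) = ?U r + 2 * ?c + ?d"
      "(\<Sum>b\<in>J. (- x b i + ?V r b)\<^sup>2) = ?U r - 2 * ?c + ?d"
      unfolding sum_distrib_left sum.distrib[symmetric] sum_subtractf[symmetric]
      by (intro sum.cong refl; simp add: power2_eq_square algebra_simps)+
    have "((?U r + 2 * ?c + ?d)\<^sup>2 + (?U r - 2 * ?c + ?d)\<^sup>2) / 2 = (?U r + ?d)\<^sup>2 + 4 * ?c\<^sup>2"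
      by (simp add: power2_eq_square field_simps)
    also have "\<dots> \<le> (?U r + ?d)\<^sup>2 + 4 * (?U r * ?d)" using cs by simp
    also have "\<dots> = (?U r)\<^sup>2 + (6 * ?d * ?U r + ?d\<^sup>2)" by (simp add: power2_eq_square algebra_simps)
    finally show "((\<Sum>b\<in>J. (x b i + ?V r b)\<^sup>2)\<^sup>2 + (\<Sum>b\<in>J. (- x b i + ?V r b)\<^sup>2)\<^sup>2) / 2
      \<le> (?U r)\<^sup>2 + (6 * ?d * ?U r + ?d\<^sup>2)" unfolding 1 .
  qed (use insert in auto)
  also have "\<dots> = E (rad A) (\<lambda>r. (?U r)\<^sup>2) + (6 * ?d * E (rad A) ?U + ?d\<^sup>2)"
    using insert by (subst E_add, simp, subst E_add) auto
  also have "E (rad A) ?U = ?N" by (rule rad_second_moment) fact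
  also have "E (rad A) (\<lambda>r. (?U r)\<^sup>2) + (6 * ?d * ?N + ?d\<^sup>2) \<le> 3 * ?N\<^sup>2 + (6 * ?d * ?N + ?d\<^sup>2)"
    using insert.IH by simp
  also have "\<dots> \<le> 3 * (?d + ?N)\<^sup>2" by (simp add: power2_eq_square algebra_simps)
  also have "?d + ?N = (\<Sum>b\<in>J. \<Sum>j\<in>insert i A. (x b j)\<^sup>2)"
    using insert by (simp add: sum.distrib)
  finally show ?case .
qed simp

lemma E_rad_split:
  "E (rad {..<a + b}) f = E (rad {..<a}) (\<lambda>r. E (rad {a..<a + b}) (\<lambda>s. f (\<lambda>j. if j < a then r j else s j)))"
proof -
  have u: "{..<a + b} = {..<a} \<union> {a..<a + b}" by auto
  have "rad {..<a + b} = map_pmf (\<lambda>(f, g) x. if x \<in> {..<a} then f x else g x)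
      (pair_pmf (rad {..<a}) (rad {a..<a + b}))"
    unfolding u by (rule Pi_pmf_union) auto
  then show ?thesis by (simp add: E_pair case_prod_beta cong: if_cong)
qed

text \<open>Signs of the grid position \<open>g = \<beta> B + o\<close> are products of a block sign and a column sign.\<close>

definition grid :: "nat \<Rightarrow> nat \<Rightarrow> (nat \<Rightarrow> int) \<Rightarrow> (nat \<Rightarrow> nat \<Rightarrow> real) \<Rightarrow> real" where
  "grid B K r x = (\<Sum>b<K. real_of_int (r (B + b)) * (\<Sum>j<B. real_of_int (r j) * x b j))"

lemma grid_split:
  "grid B K (\<lambda>j. if j < B then r j else s j) x =
    (\<Sum>i\<in>{B..<B + K}. real_of_int (s i) * (\<Sum>j<B. real_of_int (r j) * x (i - B) j))"
proof -
  have "(\<Sum>i\<in>{B..<B + K}. real_of_int (s i) * (\<Sum>j<B. real_of_int (r j) * x (i - B) j))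
      = (\<Sum>b<K. real_of_int (s (B + b)) * (\<Sum>j<B. real_of_int (r j) * x b j))"
    by (rule sum.reindex_bij_witness[of _ "\<lambda>b. B + b" "\<lambda>i. i - B"]) auto
  then show ?thesis by (simp add: grid_def)
qed

lemma sum_shift_grid: "(\<Sum>i\<in>{B..<B + K}. f (i - B)) = (\<Sum>b<K. f b)" for f :: "nat \<Rightarrow> real"
  by (rule sum.reindex_bij_witness[of _ "\<lambda>b. B + b" "\<lambda>i. i - B"]) auto

lemma grid_second_moment:
  "E (rad {..<B + K}) (\<lambda>r. (grid B K r x)\<^sup>2) = (\<Sum>b<K. \<Sum>j<B. (x b j)\<^sup>2)"
proof -
  have "E (rad {B..<B + K}) (\<lambda>s. (grid B K (\<lambda>j. if j < B then r j else s j) x)\<^sup>2)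
     = (\<Sum>b<K. (\<Sum>j<B. real_of_int (r j) * x b j)\<^sup>2)" for r
    unfolding grid_split
    using rad_second_moment[of "{B..<B + K}" "\<lambda>_ i. \<Sum>j<B. real_of_int (r j) * x (i - B) j" "{()}"]
    by (simp add: sum_shift_grid[where f = "\<lambda>b. (\<Sum>j<B. real_of_int (r j) * x b j)\<^sup>2"])
  then show ?thesis
    unfolding E_rad_split using rad_second_moment[of "{..<B}" x "{..<K}"] by simp
qed

text \<open>9 is 3 twice: the scalar inequality for the block signs with the column signs fixed,
  then the vector inequality for the column signs, with one coordinate per block.\<close>

lemma grid_fourth_moment:
  "E (rad {..<B + K}) (\<lambda>r. (grid B K r x) ^ 4) \<le> 9 * (\<Sum>b<K. \<Sum>j<B. (x b j)\<^sup>2)\<^sup>2"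
proof -
  have "E (rad {B..<B + K}) (\<lambda>s. (grid B K (\<lambda>j. if j < B then r j else s j) x) ^ 4)
     \<le> 3 * (\<Sum>b<K. (\<Sum>j<B. real_of_int (r j) * x b j)\<^sup>2)\<^sup>2" for r
    unfolding grid_split
    using rad_fourth_moment[of "{B..<B + K}" "\<lambda>_ i. \<Sum>j<B. real_of_int (r j) * x (i - B) j" "{()}"]
    by (simp add: sum_shift_grid[where f = "\<lambda>b. (\<Sum>j<B. real_of_int (r j) * x b j)\<^sup>2"])
  then have "E (rad {..<B + K}) (\<lambda>r. (grid B K r x) ^ 4)
     \<le> E (rad {..<B}) (\<lambda>r. 3 * (\<Sum>b<K. (\<Sum>j<B. real_of_int (r j) * x b j)\<^sup>2)\<^sup>2)"
    unfolding E_rad_split by (intro E_mono) auto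
  also have "\<dots> \<le> 3 * (3 * (\<Sum>b<K. \<Sum>j<B. (x b j)\<^sup>2)\<^sup>2)"
    using rad_fourth_moment[of "{..<B}" x "{..<K}"] by simp
  finally show ?thesis by simp
qed

lemma E_rad_prefix:
  "E (rad {..<B + K}) (\<lambda>r. f (\<lambda>j. if j < B then r j else 0))
    = E (rad {..<B}) (\<lambda>r. f (\<lambda>j. if j < B then r j else 0))"
proof -
  have "(\<lambda>j. if j < B then if j < B then r j else s j else 0) = (\<lambda>j. if j < B then r j else 0)"
    for r s :: "nat \<Rightarrow> int" by auto
  then show ?thesis unfolding E_rad_split by simp
qed

section \<open>Independent rows\<close>

text \<open>The program keeps one flat table of signs, the analysis wants \<open>R\<close>
  independent rows of width \<open>W\<close>.\<close>

lemma Pi_pmf_rows: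
  fixes p :: "int pmf" and R W :: nat
  shows "Pi_pmf {..<R * W} 0 (\<lambda>_. p) =
    map_pmf (\<lambda>F j. if j < R * W then F (j div W) (j mod W) else 0)
      (Pi_pmf {..<R} (\<lambda>_. 0) (\<lambda>_. Pi_pmf {..<W} 0 (\<lambda>_. p)))"
proof (induction R)
  case (Suc R)
  let ?q = "Pi_pmf {..<W} 0 (\<lambda>_. p)"
  let ?Q = "Pi_pmf {..<R} (\<lambda>_. 0) (\<lambda>_. ?q)"
  have u: "{..<Suc R * W} = {..<R * W} \<union> {R * W..<Suc R * W}" by auto
  have sh: "Pi_pmf {R * W..<Suc R * W} 0 (\<lambda>_. p)
    = map_pmf (\<lambda>g. g \<circ> (\<lambda>j. if R * W \<le> j then j - R * W else W + j)) ?q"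
  proof (rule Pi_pmf_bij_betw)
    show "bij_betw (\<lambda>j. if R * W \<le> j then j - R * W else W + j) {R * W..<Suc R * W} {..<W}"
      by (rule bij_betw_byWitness[where f' = "\<lambda>j. j + R * W"]) auto
  qed auto
  have "Pi_pmf {..<Suc R * W} 0 (\<lambda>_. p) =
     map_pmf (\<lambda>(f, g) x. if x \<in> {..<R * W} then f x else g x)
       (pair_pmf (Pi_pmf {..<R * W} 0 (\<lambda>_. p)) (Pi_pmf {R * W..<Suc R * W} 0 (\<lambda>_. p)))"
    unfolding u by (rule Pi_pmf_union) auto
  also have "\<dots> = map_pmf (\<lambda>(F, g) x. if x < R * W then F (x div W) (x mod W)
        else g (if R * W \<le> x then x - R * W else W + x)) (pair_pmf ?Q ?q)"
    unfolding Suc sh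
    by (simp add: map_pair[symmetric] pmf.map_comp o_def case_prod_unfold cong: if_cong)
  also have "\<dots> = map_pmf (\<lambda>(g, F) x. if x < R * W then F (x div W) (x mod W)
        else g (if R * W \<le> x then x - R * W else W + x)) (pair_pmf ?q ?Q)"
    by (subst pair_commute_pmf) (simp add: pmf.map_comp o_def case_prod_unfold cong: if_cong)
  also have "\<dots> = map_pmf (\<lambda>z j. if j < Suc R * W then ((snd z)(R := fst z)) (j div W) (j mod W) else 0)
      (pair_pmf ?q ?Q)"
  proof (rule map_pmf_cong[OF refl])
    fix z assume z: "z \<in> set_pmf (pair_pmf ?q ?Q)"
    obtain g F where gF: "z = (g, F)" by (cases z)
    then have g: "g \<in> set_pmf ?q" using z by simp
    have g0: "g j = 0" if "\<not> j < W" for j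
      using set_Pi_pmf_subset[of "{..<W}" 0 "\<lambda>_. p"] g that by auto
    have "(if j < R * W then F (j div W) (j mod W) else g (if R * W \<le> j then j - R * W else W + j)) =
        (if j < Suc R * W then (F(R := g)) (j div W) (j mod W) else 0)" for j
    proof (cases "j < R * W")
      case True
      then have "j div W < R" by (simp add: less_mult_imp_div_less)
      then show ?thesis using True by simp
    next
      case F: False
      show ?thesis
      proof (cases "j < Suc R * W")
        case True
        have "j div W = R"
          by (rule div_nat_eqI) (use F True in \<open>auto simp: mult.commute\<close>)
        moreover from this have "j mod W = j - R * W"
          by (metis minus_div_mult_eq_mod)
        ultimately have "j div W = R \<and> j mod W = j - R * W" by blast
        then show ?thesis using F True by simp
      next
        case False
        then show ?thesis using F g0 by simp
      qed
    qed
    then show "(case z of (g, F) \<Rightarrow> \<lambda>x. if x < R * W then F (x div W) (x mod W)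
        else g (if R * W \<le> x then x - R * W else W + x)) =
      (\<lambda>j. if j < Suc R * W then ((snd z)(R := fst z)) (j div W) (j mod W) else 0)"
      unfolding gF fst_conv snd_conv prod.case by (rule ext)
  qed
  also have "\<dots> = map_pmf (\<lambda>F j. if j < Suc R * W then F (j div W) (j mod W) else 0)
      (map_pmf (\<lambda>(y, f). f(R := y)) (pair_pmf ?q ?Q))"
    by (simp add: pmf.map_comp o_def case_prod_unfold)
  also have "map_pmf (\<lambda>(y, f). f(R := y)) (pair_pmf ?q ?Q) = Pi_pmf (insert R {..<R}) (\<lambda>_. 0) (\<lambda>_. ?q)"
    by (subst Pi_pmf_insert) auto
  finally show ?case by (simp add: lessThan_Suc)
qed (simp add: map_pmf_const)

lemma rows_mean:
  assumes "finite A" "finite (set_pmf p)"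
  shows "E (Pi_pmf A d (\<lambda>_. p)) (\<lambda>F. \<Sum>i\<in>A. f (F i)) = real (card A) * E p f"
proof -
  have "E (Pi_pmf A d (\<lambda>_. p)) (\<lambda>F. f (F i)) = E p f" if "i \<in> A" for i
  proof -
    have "E (Pi_pmf A d (\<lambda>_. p)) (\<lambda>F. f (F i)) = E (map_pmf (\<lambda>F. F i) (Pi_pmf A d (\<lambda>_. p))) f"
      by simp
    also have "map_pmf (\<lambda>F. F i) (Pi_pmf A d (\<lambda>_. p)) = p"
      using assms that by (subst Pi_pmf_component) auto
    finally show ?thesis .
  qed
  then show ?thesis using assms by (subst E_sum) (auto intro!: finite_set_Pi_pmf)
qed

lemma rows_variance:
  assumes "finite A" "finite (set_pmf p)" "E p f = 0"
  shows "E (Pi_pmf A d (\<lambda>_. p)) (\<lambda>F. (\<Sum>i\<in>A. f (F i))\<^sup>2) = real (card A) * E p (\<lambda>x. (f x)\<^sup>2)"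
  using assms(1)
proof (induction A rule: finite_induct)
  case (insert a A)
  let ?P = "Pi_pmf A d (\<lambda>_. p)"
  have fP: "finite (set_pmf ?P)" using insert assms by (intro finite_set_Pi_pmf) auto
  let ?S = "\<lambda>F. \<Sum>i\<in>A. f (F i)"
  have "(\<Sum>i\<in>insert a A. f ((F(a := y)) i)) = f y + ?S F" for F y
  proof -
    have "(\<Sum>i\<in>A. f ((F(a := y)) i)) = ?S F" using insert by (intro sum.cong) auto
    then show ?thesis using insert by simp
  qed
  then have "E (Pi_pmf (insert a A) d (\<lambda>_. p)) (\<lambda>F. (\<Sum>i\<in>insert a A. f (F i))\<^sup>2)
      = E p (\<lambda>y. E ?P (\<lambda>F. (f y + ?S F)\<^sup>2))"
    using insert assms by (subst E_Pi_insert) auto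
  also have "\<dots> = E p (\<lambda>y. (f y)\<^sup>2 + (2 * f y * E ?P ?S + E ?P (\<lambda>F. (?S F)\<^sup>2)))"
    using fP by (intro E_cong) (simp add: power2_sum E_add add.assoc)
  also have "\<dots> = E p (\<lambda>y. (f y)\<^sup>2) + E ?P (\<lambda>F. (?S F)\<^sup>2)"
    using assms by (simp add: E_add)
  finally show ?case using insert by (simp add: algebra_simps)
qed simp

text \<open>Chebyshev's inequality for \<open>R\<close> independent rows. Subtracting the squared
  mean from the fourth moment leaves a variance of at most \<open>(9 - 1) N^2\<close> per
  row.\<close>

lemma grid_concentration:
  assumes "0 < \<delta>" "0 < R"
  shows "measure_pmf.prob (Pi_pmf {..<R} d (\<lambda>_. rad {..<B + K}))
     {F. \<bar>(\<Sum>i<R. (grid B K (F i) x)\<^sup>2) - real R * (\<Sum>b<K. \<Sum>j<B. (x b j)\<^sup>2)\<bar>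
        > \<delta> * real R * (\<Sum>b<K. \<Sum>j<B. (x b j)\<^sup>2)} \<le> 8 / (real R * \<delta>\<^sup>2)"
proof -
  let ?p = "rad {..<B + K}" and ?N = "\<Sum>b<K. \<Sum>j<B. (x b j)\<^sup>2"
  let ?P = "Pi_pmf {..<R} d (\<lambda>_. ?p)"
  let ?f = "\<lambda>r. (grid B K r x)\<^sup>2 - ?N"
  have fp: "finite (set_pmf ?p)" by simp
  have fP: "finite (set_pmf ?P)" by (intro finite_set_Pi_pmf) auto
  have N0: "0 \<le> ?N" by (intro sum_nonneg) auto
  have m: "E ?p ?f = 0" using E_diff[OF fp] grid_second_moment by simp
  have "E ?p (\<lambda>r. (?f r)\<^sup>2) = E ?p (\<lambda>r. (grid B K r x) ^ 4 - (2 * ?N * (grid B K r x)\<^sup>2 - ?N\<^sup>2))"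
    by (intro E_cong) (simp add: power2_diff power4_eq_xxxx power2_eq_square algebra_simps)
  also have "\<dots> = E ?p (\<lambda>r. (grid B K r x) ^ 4) - (2 * ?N * ?N - ?N\<^sup>2)"
    using fp by (simp add: E_diff grid_second_moment)
  also have "\<dots> \<le> 8 * ?N\<^sup>2"
    using grid_fourth_moment[of B K x] by (simp add: power2_eq_square)
  finally have v: "E ?p (\<lambda>r. (?f r)\<^sup>2) \<le> 8 * ?N\<^sup>2" .
  have eq: "(\<Sum>i<R. (grid B K (F i) x)\<^sup>2) - real R * ?N = (\<Sum>i<R. ?f (F i))" for F
    by (simp add: sum_subtractf)
  show ?thesis
  \<comment> \<open>Markov's inequality would divide by zero. For a zero vector all rows vanish, and
    the strict inequality makes the event empty.\<close>
  proof (cases "?N = 0")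
    case True
    have "E ?P (\<lambda>F. (\<Sum>i<R. ?f (F i))\<^sup>2) \<le> 0"
      using rows_variance[of "{..<R}" ?p ?f d] v m True
      by (simp add: mult_nonneg_nonpos)
    moreover have "0 \<le> E ?P (\<lambda>F. (\<Sum>i<R. ?f (F i))\<^sup>2)" by simp
    ultimately have "E ?P (\<lambda>F. (\<Sum>i<R. ?f (F i))\<^sup>2) = 0" by linarith
    have z: "x b j = 0" if "b < K" "j < B" for b j
    proof -
      have "(\<Sum>j<B. (x b j)\<^sup>2) = 0"
        using True that by (subst (asm) sum_nonneg_eq_0_iff) (auto intro: sum_nonneg)
      then show ?thesis using that by (subst (asm) sum_nonneg_eq_0_iff) auto
    qed
    have "grid B K r x = 0" for r unfolding grid_def by (intro sum.neutral) (simp add: z)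
    then show ?thesis using True assms by simp
  next
    case False
    then have N: "0 < ?N" using N0 by simp
    have "measure_pmf.prob ?P {F. \<bar>(\<Sum>i<R. (grid B K (F i) x)\<^sup>2) - real R * ?N\<bar> > \<delta> * real R * ?N}
       \<le> E ?P (\<lambda>F. (\<Sum>i<R. ?f (F i))\<^sup>2) / (\<delta> * real R * ?N)\<^sup>2"
    proof (rule markov_pmf[OF fP])
      fix F assume "F \<in> {F. \<bar>(\<Sum>i<R. (grid B K (F i) x)\<^sup>2) - real R * ?N\<bar> > \<delta> * real R * ?N}"
      then have "\<delta> * real R * ?N \<le> \<bar>\<Sum>i<R. ?f (F i)\<bar>" unfolding eq by simp
      moreover have "0 \<le> \<delta> * real R * ?N" using assms N by simp
      ultimately have "(\<delta> * real R * ?N)\<^sup>2 \<le> \<bar>\<Sum>i<R. ?f (F i)\<bar>\<^sup>2" by (intro power_mono)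
      then show "(\<delta> * real R * ?N)\<^sup>2 \<le> (\<Sum>i<R. ?f (F i))\<^sup>2" by simp
    qed (use assms N in auto)
    also have "\<dots> \<le> (real R * (8 * ?N\<^sup>2)) / (\<delta> * real R * ?N)\<^sup>2"
      using rows_variance[of "{..<R}" ?p ?f d] v m
      by (intro divide_right_mono) (auto intro: mult_left_mono)
    also have "\<dots> = 8 / (real R * \<delta>\<^sup>2)"
      using N assms by (simp add: power2_eq_square field_simps)
    finally show ?thesis .
  qed
qed

section \<open>Tails of the estimates for a single block\<close>

definition lin :: "nat \<Rightarrow> (nat \<Rightarrow> int) \<Rightarrow> (nat \<Rightarrow> real) \<Rightarrow> real" where
  "lin B r x = (\<Sum>j<B. real_of_int (r j) * x j)"

lemma lin_prefix: "lin B (\<lambda>j. if j < B then r j else 0) x = lin B r x"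
  unfolding lin_def by (intro sum.cong) auto

lemma lin_moments:
  "E (rad {..<B + K}) (\<lambda>r. (lin B r x)\<^sup>2) = (\<Sum>j<B. (x j)\<^sup>2)"
  "E (rad {..<B + K}) (\<lambda>r. (lin B r x) ^ 4) \<le> 3 * (\<Sum>j<B. (x j)\<^sup>2)\<^sup>2"
proof -
  have e: "E (rad {..<B + K}) (\<lambda>r. f (lin B r x)) = E (rad {..<B}) (\<lambda>r. f (lin B r x))" for f
    using E_rad_prefix[of B K "\<lambda>r. f (lin B r x)"] unfolding lin_prefix .
  show "E (rad {..<B + K}) (\<lambda>r. (lin B r x)\<^sup>2) = (\<Sum>j<B. (x j)\<^sup>2)"
    unfolding e[of "\<lambda>z. z\<^sup>2"] using rad_second_moment[of "{..<B}" "\<lambda>_. x" "{()}"] by (simp add: lin_def)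
  show "E (rad {..<B + K}) (\<lambda>r. (lin B r x) ^ 4) \<le> 3 * (\<Sum>j<B. (x j)\<^sup>2)\<^sup>2"
    unfolding e[of "\<lambda>z. z ^ 4"] using rad_fourth_moment[of "{..<B}" "\<lambda>_. x" "{()}"] by (simp add: lin_def)
qed

lemma exp_minus_le: "0 \<le> z \<Longrightarrow> exp (- z) \<le> 1 - z + z\<^sup>2 / 2" for z :: real
proof -
  assume z: "0 \<le> z"
  let ?f = "\<lambda>z::real. 1 - z + z\<^sup>2 / 2 - exp (- z)"
  have "?f 0 \<le> ?f z"
  proof (rule DERIV_nonneg_imp_nondecreasing[OF z])
    fix y :: real assume "0 \<le> y"
    have "(?f has_real_derivative (y - 1 + exp (- y))) (at y)"
      by (auto intro!: derivative_eq_intros)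
    moreover have "0 \<le> y - 1 + exp (- y)" using exp_ge_add_one_self[of "- y"] by simp
    ultimately show "\<exists>d. (?f has_real_derivative d) (at y) \<and> 0 \<le> d" by blast
  qed
  then show ?thesis by simp
qed

lemma power_div_exp: "e ^ k / exp (- (real k / 12)) = (e * exp (1 / 12)) ^ k" for e :: real
proof -
  have k: "exp (real k / 12) = exp (1 / 12 :: real) ^ k"
    using exp_of_nat_mult[of k "1 / 12 :: real"] by simp
  show ?thesis
    unfolding exp_minus k power_mult_distrib by (simp only: divide_inverse inverse_inverse_eq)
qed

text \<open>A Chernoff bound. For \<open>z = X^2 / (3 N)\<close> the second and fourth moments give
  \<open>E exp(-z) \<le> 1 - 1/3 + 1/6 = 5/6\<close>; the divisor 3 is the one that minimises this
  bound. The threshold \<open>N / 4\<close> costs a factor \<open>exp (1/12) \<le> 12/11\<close> per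
  row, and \<open>5/6 * 12/11 = 10/11\<close>.\<close>

lemma lin_lower_tail:
  assumes "finite A"
  shows "measure_pmf.prob (Pi_pmf A d (\<lambda>_. rad {..<B + K}))
     {F. (\<Sum>i\<in>A. (lin B (F i) x)\<^sup>2) < real (card A) * (\<Sum>j<B. (x j)\<^sup>2) / 4} \<le> (10 / 11) ^ card A"
proof -
  let ?p = "rad {..<B + K}"
  define N where "N = (\<Sum>j<B. (x j)\<^sup>2)"
  let ?P = "Pi_pmf A d (\<lambda>_. ?p)"
  have fp: "finite (set_pmf ?p)" by simp
  have fP: "finite (set_pmf ?P)" using assms by (intro finite_set_Pi_pmf) auto
  have N0: "0 \<le> N" unfolding N_def by (intro sum_nonneg) auto
  note mom = lin_moments[of B K x, folded N_def]
  have "measure_pmf.prob ?P {F. (\<Sum>i\<in>A. (lin B (F i) x)\<^sup>2) < real (card A) * N / 4} \<le> (10 / 11) ^ card A"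
  proof (cases "N = 0")
    case True
    have "\<not> (\<Sum>i\<in>A. (lin B (F i) x)\<^sup>2) < 0" for F by (simp add: not_less sum_nonneg)
    then show ?thesis unfolding True by simp
  next
    case False
    then have N: "0 < N" using N0 by simp
    let ?g = "\<lambda>r. exp (- ((lin B r x)\<^sup>2 / (3 * N)))"
    have "E ?p ?g \<le> E ?p (\<lambda>r. 1 - ((lin B r x)\<^sup>2 / (3 * N) - ((lin B r x) ^ 4) / (18 * N\<^sup>2)))"
    proof (intro E_mono fp)
      fix r
      have "?g r \<le> 1 - (lin B r x)\<^sup>2 / (3 * N) + ((lin B r x)\<^sup>2 / (3 * N))\<^sup>2 / 2"
        using N by (intro exp_minus_le) auto
      also have "((lin B r x)\<^sup>2 / (3 * N))\<^sup>2 / 2 = ((lin B r x) ^ 4) / (18 * N\<^sup>2)"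
        using N by (simp add: power2_eq_square power4_eq_xxxx field_simps)
      finally show "?g r \<le> 1 - ((lin B r x)\<^sup>2 / (3 * N) - ((lin B r x) ^ 4) / (18 * N\<^sup>2))" by simp
    qed
    also have "\<dots> = 1 - (N / (3 * N) - E ?p (\<lambda>r. (lin B r x) ^ 4) / (18 * N\<^sup>2))"
      using fp by (simp add: E_diff mom)
    also have "\<dots> \<le> 1 - (N / (3 * N) - (3 * N\<^sup>2) / (18 * N\<^sup>2))"
    proof -
      have "E ?p (\<lambda>r. (lin B r x) ^ 4) / (18 * N\<^sup>2) \<le> (3 * N\<^sup>2) / (18 * N\<^sup>2)"
        by (rule divide_right_mono[OF mom(2)]) simp
      then show ?thesis by linarith
    qed
    also have "\<dots> = 5 / 6"
    proof -
      have "N / (3 * N) = 1 / 3" "(3 * N\<^sup>2) / (18 * N\<^sup>2) = 1 / 6"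
        using N by (auto simp: power2_eq_square)
      then show ?thesis by simp
    qed
    finally have mgf: "E ?p ?g \<le> 5 / 6" .
    have "measure_pmf.prob ?P {F. (\<Sum>i\<in>A. (lin B (F i) x)\<^sup>2) < real (card A) * N / 4}
      \<le> E ?P (\<lambda>F. \<Prod>i\<in>A. ?g (F i)) / exp (- (real (card A) / 12))"
    proof (rule markov_pmf[OF fP])
      fix F assume "F \<in> {F. (\<Sum>i\<in>A. (lin B (F i) x)\<^sup>2) < real (card A) * N / 4}"
      then have "(\<Sum>i\<in>A. (lin B (F i) x)\<^sup>2) / (3 * N) \<le> (real (card A) * N / 4) / (3 * N)"
        using N by (intro divide_right_mono) auto
      also have "\<dots> = real (card A) / 12" using N by simp
      finally have "exp (- (real (card A) / 12)) \<le> exp (- ((\<Sum>i\<in>A. (lin B (F i) x)\<^sup>2) / (3 * N)))"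
        by simp
      also have "\<dots> = (\<Prod>i\<in>A. ?g (F i))"
        unfolding exp_sum[OF assms, symmetric] sum_negf sum_divide_distrib ..
      finally show "exp (- (real (card A) / 12)) \<le> (\<Prod>i\<in>A. ?g (F i))" .
    qed (auto intro: prod_nonneg)
    also have "E ?P (\<lambda>F. \<Prod>i\<in>A. ?g (F i)) = (E ?p ?g) ^ card A"
      using assms by (subst expectation_prod_Pi_pmf) (auto intro: integrable_measure_pmf_finite)
    also have "(E ?p ?g) ^ card A / exp (- (real (card A) / 12)) = (E ?p ?g * exp (1 / 12)) ^ card A"
      by (rule power_div_exp)
    also have "\<dots> \<le> (10 / 11) ^ card A"
    proof (rule power_mono)
      have "1 - 1 / 12 \<le> exp (- (1 / 12 :: real))" using exp_ge_add_one_self[of "- (1 / 12) :: real"] by simp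
      then have "11 / 12 * exp (1 / 12) \<le> exp (- (1 / 12)) * exp (1 / 12 :: real)"
        by (intro mult_right_mono) auto
      then have "exp (1 / 12 :: real) \<le> 12 / 11" by (simp add: exp_minus)
      then have "E ?p ?g * exp (1 / 12) \<le> 5 / 6 * (12 / 11)"
        using mgf by (intro mult_mono) auto
      then show "E ?p ?g * exp (1 / 12) \<le> 10 / 11" by simp
      show "0 \<le> E ?p ?g * exp (1 / 12)" by simp
    qed
    finally show ?thesis .
  qed
  then show ?thesis unfolding N_def .
qed

text \<open>Markov's inequality is enough: this side is needed at one position only, so there is no
  union bound to pay for.\<close>

lemma lin_upper_tail:
  assumes "finite A"
  shows "measure_pmf.prob (Pi_pmf A d (\<lambda>_. rad {..<B + K}))
     {F. (\<Sum>i\<in>A. (lin B (F i) x)\<^sup>2) > 10 * real (card A) * (\<Sum>j<B. (x j)\<^sup>2)} \<le> 1 / 10"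
proof -
  let ?p = "rad {..<B + K}" and ?N = "\<Sum>j<B. (x j)\<^sup>2"
  let ?P = "Pi_pmf A d (\<lambda>_. ?p)"
  have fP: "finite (set_pmf ?P)" using assms by (intro finite_set_Pi_pmf) auto
  have N0: "0 \<le> ?N" by (intro sum_nonneg) auto
  show ?thesis
  proof (cases "real (card A) * ?N = 0")
    case True
    have z: "(\<Sum>i\<in>A. (lin B (F i) x)\<^sup>2) = 0" for F
    proof (cases "?N = 0")
      case True
      have x0: "x j = 0" if "j < B" for j
        using sum_nonneg_0[of "{..<B}" "\<lambda>j. (x j)\<^sup>2" j] True that by simp
      have "lin B r x = 0" for r unfolding lin_def by (rule sum.neutral) (simp add: x0)
      then show ?thesis by simp
    next
      case False
      then have "card A = 0" using \<open>real (card A) * ?N = 0\<close> by (metis mult_eq_0_iff of_nat_eq_0_iff)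
      then show ?thesis using assms by simp
    qed
    have t: "10 * real (card A) * ?N = 0" using True by simp
    have e: "{F. (\<Sum>i\<in>A. (lin B (F i) x)\<^sup>2) > 10 * real (card A) * ?N} = {}"
    proof -
      have "\<not> 10 * real (card A) * ?N < (\<Sum>i\<in>A. (lin B (F i) x)\<^sup>2)" for F
        unfolding z t by (rule less_irrefl)
      then show ?thesis by blast
    qed
    show ?thesis unfolding e measure_empty by simp
  next
    case False
    define c where "c = real (card A) * ?N"
    have c: "0 < c"
      using False mult_nonneg_nonneg[OF of_nat_0_le_iff[of "card A"] N0] unfolding c_def by linarith
    have "measure_pmf.prob ?P {F. (\<Sum>i\<in>A. (lin B (F i) x)\<^sup>2) > 10 * real (card A) * ?N}
       \<le> E ?P (\<lambda>F. \<Sum>i\<in>A. (lin B (F i) x)\<^sup>2) / (10 * c)"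
    proof (rule markov_pmf[OF fP])
      fix F :: "'a \<Rightarrow> nat \<Rightarrow> int"
      show "0 \<le> (\<Sum>i\<in>A. (lin B (F i) x)\<^sup>2)" by (intro sum_nonneg) simp
      assume "F \<in> {F. (\<Sum>i\<in>A. (lin B (F i) x)\<^sup>2) > 10 * real (card A) * ?N}"
      then show "10 * c \<le> (\<Sum>i\<in>A. (lin B (F i) x)\<^sup>2)" unfolding c_def by simp
    qed (use c in simp)
    also have "E ?P (\<lambda>F. \<Sum>i\<in>A. (lin B (F i) x)\<^sup>2) = c"
    proof -
      have "E ?P (\<lambda>F. \<Sum>i\<in>A. (lin B (F i) x)\<^sup>2) = real (card A) * E ?p (\<lambda>r. (lin B r x)\<^sup>2)"
        by (rule rows_mean[OF assms]) simp
      then show ?thesis unfolding c_def by (simp only: lin_moments(1))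
    qed
    also have "c / (10 * c) = 1 / 10" using c by simp
    finally show ?thesis .
  qed
qed

section \<open>Block sketches and checkpoints\<close>

text \<open>The inequalities characterise \<open>B\<close> as the integer square root and
  \<open>Lg\<close> as the rounded-up binary logarithm of \<open>n\<close>.\<close>

locale params =
  fixes n k B Lg :: nat and P :: "bool list"
  assumes n2: "2 \<le> n" and k1: "1 \<le> k" and k2: "k \<le> 2 * n" and lenP: "length P = n"
    and B1: "1 \<le> B" and BB: "B * B \<le> n" and nB: "n < (B + 1) * (B + 1)"
    and Lg1: "1 \<le> Lg" and nLg: "n \<le> 2 ^ Lg" and Lgn: "2 ^ Lg < 2 * n"
begin

text \<open>Dividing \<open>n - 1\<close> instead of \<open>n\<close> splits off the last symbol of
  a window: a window that ends in some block starts \<open>q\<close> or \<open>q + 1\<close> blocks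
  earlier. Hence checkpoints are kept for \<open>G = q + 1\<close> blocks, and \<open>q + 2\<close>
  block signs suffice.\<close>

definition q :: nat where "q = (n - 1) div B"
definition m0 :: nat where "m0 = (n - 1) mod B"
definition G :: nat where "G = q + 1"
definition Wd :: nat where "Wd = B + (q + 2)"
text \<open>For relative accuracy \<open>d = 1 / (16 k)\<close> Chebyshev's bound
  \<open>8 / (R1 d^2)\<close> is 1/16.\<close>

definition R1 :: nat where "R1 = 32768 * k * k"
text \<open>\<open>(10/11) ^ 32 \<le> 1/16\<close>, so \<open>R2\<close> rows beat a union bound
  over \<open>B \<le> n \<le> 2 ^ Lg\<close> positions.\<close>

definition R2 :: nat where "R2 = 32 * Lg"
definition R :: nat where "R = R1 + R2"
text \<open>More than \<open>7 + 2 Lg\<close> phases with \<open>1280 k + 1\<close> checkpoints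
  each. As a hard limit it keeps the memory bounded even when the estimates fail.\<close>

definition Cap :: nat where "Cap = 16384 * k * Lg"
text \<open>The weight of one mismatch against an estimate: \<open>e * DKR \<le> 2 Q\<close> and
  \<open>Q \<le> 10 R2 h\<close> together give \<open>16 k e \<le> h\<close>.\<close>

definition DKR :: nat where "DKR = 320 * k * R2"

lemma n_eq: "n = q * B + m0 + 1"
  using n2 by (simp add: q_def m0_def)

lemma m0B: "m0 < B"
  using B1 by (simp add: m0_def)

lemma q1: "1 \<le> q"
proof -
  have "B \<le> n - 1"
  proof (cases "B = 1")
    case True then show ?thesis using n2 by simp
  next
    case False
    then have "2 * B \<le> B * B" using B1 by (intro mult_le_mono1) simp
    then show ?thesis using BB B1 False by linarith
  qed
  then show ?thesis using B1 unfolding q_def by (metis div_le_mono div_self not_one_le_zero)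
qed

text \<open>Needed for the schedule: the \<open>q - 1\<close> block sketches that are prepared for
  the next block, one per arrival, must fit into \<open>B\<close> arrivals.\<close>

lemma qB: "q \<le> B + 1"
proof -
  have "q * B \<le> n - 1" using n_eq by simp
  also have "n - 1 < (B + 2) * B" using nB n2 by (simp add: algebra_simps)
  finally have "q * B < (B + 2) * B" .
  then have "q < B + 2" using mult_less_cancel2[of q B "B + 2"] by blast
  then show ?thesis by simp
qed

lemma Cap1: "1 \<le> Cap" using k1 Lg1 by (simp add: Cap_def)
lemma R11: "1 \<le> R1" using k1 by (simp add: R1_def)

definition pat :: "nat \<Rightarrow> int" where "pat j = of_bool (P ! j)"
definition sr :: "(nat \<Rightarrow> int) \<Rightarrow> nat \<Rightarrow> nat \<Rightarrow> int" where "sr \<tau> \<rho> j = \<tau> (\<rho> * Wd + j)"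
definition ss :: "(nat \<Rightarrow> int) \<Rightarrow> nat \<Rightarrow> nat \<Rightarrow> int" where "ss \<tau> \<rho> b = \<tau> (\<rho> * Wd + B + b)"
definition blk :: "(nat \<Rightarrow> int) \<Rightarrow> nat \<Rightarrow> nat \<Rightarrow> int" where "blk y \<kappa> j = y (\<kappa> * B + j)"
definition Zs :: "(nat \<Rightarrow> int) \<Rightarrow> (nat \<Rightarrow> int) \<Rightarrow> nat \<Rightarrow> nat \<Rightarrow> nat \<Rightarrow> int" where
  "Zs \<tau> y \<kappa> i \<rho> = (\<Sum>j = i..<B. sr \<tau> \<rho> j * blk y \<kappa> j)"
definition YQ :: "(nat \<Rightarrow> int) \<Rightarrow> nat \<Rightarrow> nat \<Rightarrow> int" where
  "YQ \<tau> i \<rho> = (\<Sum>j = i..<B. sr \<tau> \<rho> j * pat (j - i))"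
text \<open>For a binary text this is \<open>R2\<close> times an unbiased estimate of the number of
  mismatches between the block suffix from \<open>i\<close> on and the pattern prefix of the same
  length.\<close>

definition Qf :: "(nat \<Rightarrow> int) \<Rightarrow> (nat \<Rightarrow> int) \<Rightarrow> nat \<Rightarrow> nat \<Rightarrow> int" where
  "Qf \<tau> y \<kappa> i = (\<Sum>\<rho> = R1..<R. (Zs \<tau> y \<kappa> i \<rho> - YQ \<tau> i \<rho>) * (Zs \<tau> y \<kappa> i \<rho> - YQ \<tau> i \<rho>))"

text \<open>The state consists of the reference alignment \<open>sig\<close>, its estimate
  \<open>mm\<close>, the mismatches \<open>ee\<close> with the reference since the last checkpoint,
  and the checkpoints. A checkpoint is due if the estimate at \<open>i\<close> beats the reference
  by a factor 2, or if the mismatches outweigh \<open>mm\<close>. Position 0 always gets one, and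
  its sketch is that of the full block.\<close>

definition dcs where
  "dcs Q i st = (case st of (sig, mm, ee, L :: (nat \<times> nat) list) \<Rightarrow>
     if i = 0 then (True, 0, Q 0, 0)
     else if 2 * Q i < mm then (True, i, Q i, 0)
     else if mm < ee * int DKR then (True, sig, mm, 0)
     else (False, sig :: nat, mm :: int, ee :: int))"

definition ckl :: "nat \<times> int \<times> int \<times> (nat \<times> nat) list \<Rightarrow> (nat \<times> nat) list" where
  "ckl st = snd (snd (snd st))"

text \<open>Symbol \<open>i\<close> is counted after the decision, so after a checkpoint at
  \<open>i\<close> the count \<open>ee\<close> already covers position \<open>i\<close>. With a full
  list a new reference is adopted without being stored; the analysis excludes this when the
  estimates are good.\<close>

definition stp where
  "stp Q x i st = (case dcs Q i st of (fl, sig, mm, ee) \<Rightarrow>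
     (sig, mm, ee + of_bool (x i \<noteq> pat (i - sig)),
      if fl \<and> length (ckl st) < Cap then ckl st @ [(i, sig)] else ckl st))"

primrec scan :: "(nat \<Rightarrow> int) \<Rightarrow> (nat \<Rightarrow> int) \<Rightarrow> nat \<Rightarrow> nat \<times> int \<times> int \<times> (nat \<times> nat) list" where
  "scan Q x 0 = (0, 0, 0, [])"
| "scan Q x (Suc i) = stp Q x i (scan Q x i)"

definition CL :: "(nat \<Rightarrow> int) \<Rightarrow> (nat \<Rightarrow> int) \<Rightarrow> nat \<Rightarrow> (nat \<times> nat) list" where
  "CL Q x i = ckl (scan Q x i)"

lemma CL_0: "CL Q x 0 = []" by (simp add: CL_def ckl_def)

lemma CL_Suc: "CL Q x (Suc i) = (case dcs Q i (scan Q x i) of (fl, sig, mm, ee) \<Rightarrow>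
     if fl \<and> length (CL Q x i) < Cap then CL Q x i @ [(i, sig)] else CL Q x i)"
  by (auto simp: CL_def stp_def ckl_def split: prod.splits)

lemma CL_Suc_cases:
  obtains "CL Q x (Suc i) = CL Q x i" | sig where "CL Q x (Suc i) = CL Q x i @ [(i, sig)]"
proof -
  have "CL Q x (Suc i) = CL Q x i \<or> (\<exists>sig. CL Q x (Suc i) = CL Q x i @ [(i, sig)])"
    by (simp add: CL_Suc split: prod.splits)
  then show ?thesis using that by blast
qed

lemma scan_sig: "fst (scan Q x (Suc i)) \<le> i"
  by (induction i) (auto simp: stp_def dcs_def split: prod.splits if_splits)

lemma dcs_sig: "fst (snd (dcs Q i (scan Q x i))) \<le> i"
proof -
  have "fst (scan Q x (Suc i)) = fst (snd (dcs Q i (scan Q x i)))"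
    by (auto simp: stp_def split: prod.splits)
  then show ?thesis using scan_sig[of Q x i] by simp
qed

lemma CL_set: "(c, sig) \<in> set (CL Q x i) \<Longrightarrow> sig \<le> c \<and> c < i"
proof (induction i)
  case (Suc i)
  show ?case
  proof (cases "(c, sig) \<in> set (CL Q x i)")
    case True then show ?thesis using Suc.IH by auto
  next
    case False
    obtain fl sg mm ee where d: "dcs Q i (scan Q x i) = (fl, sg, mm, ee)"
      by (cases "dcs Q i (scan Q x i)") auto
    show ?thesis using Suc.prems dcs_sig[of Q i x] False
      by (auto simp: CL_Suc d split: if_splits)
  qed
qed (simp add: CL_0)

lemma CL_len: "length (CL Q x i) \<le> Cap"
  by (induction i) (auto simp: CL_0 CL_Suc split: prod.splits)

lemma CL_1: "CL Q x (Suc 0) = [(0, 0)]"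
  using Cap1 by (simp add: CL_Suc dcs_def CL_0 split: prod.splits)

lemma CL_mono: "i \<le> j \<Longrightarrow> \<exists>ys. CL Q x j = CL Q x i @ ys \<and> (\<forall>z \<in> set ys. i \<le> fst z)"
proof (induction j)
  case (Suc j)
  show ?case
  proof (cases "i = Suc j")
    case False
    then obtain ys where ys: "CL Q x j = CL Q x i @ ys" "\<forall>z \<in> set ys. i \<le> fst z"
      using Suc by auto
    show ?thesis
      using CL_Suc_cases[of Q x j] False Suc.prems ys by cases auto
  qed auto
qed auto

lemma CL_hd: "0 < i \<Longrightarrow> CL Q x i ! 0 = (0, 0) \<and> CL Q x i \<noteq> []"
proof -
  assume "0 < i"
  then obtain ys where "CL Q x i = CL Q x (Suc 0) @ ys" using CL_mono[of "Suc 0" i Q x] by auto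
  then show ?thesis by (simp add: CL_1)
qed

text \<open>The state that the replay of a block reaches at position \<open>p\<close>: the last checkpoint up to
  \<open>p\<close>, from which on the block is replaced by the pattern.\<close>

definition lck :: "(nat \<Rightarrow> int) \<Rightarrow> (nat \<Rightarrow> int) \<Rightarrow> nat \<Rightarrow> nat \<times> nat" where
  "lck Q x p = last (CL Q x (Suc p))"

lemma lck_le: "snd (lck Q x p) \<le> fst (lck Q x p) \<and> fst (lck Q x p) \<le> p"
proof -
  have "lck Q x p \<in> set (CL Q x (Suc p))"
    unfolding lck_def using CL_hd[of "Suc p" Q x] by (intro last_in_set) auto
  then show ?thesis using CL_set[of "fst (lck Q x p)" "snd (lck Q x p)" Q x "Suc p"] by simp
qed

text \<open>An exact suffix sketch would subtract the symbols of the block, which are no longer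
  stored when the window start reaches them. The pattern prefix is available at any time.\<close>

definition Zl :: "(nat \<Rightarrow> int) \<Rightarrow> (nat \<Rightarrow> int) \<Rightarrow> nat \<Rightarrow> nat \<Rightarrow> nat \<Rightarrow> int" where
  "Zl \<tau> y \<kappa> p \<rho> = (case lck (Qf \<tau> y \<kappa>) (blk y \<kappa>) p of (c, sig) \<Rightarrow>
     Zs \<tau> y \<kappa> c \<rho> - (\<Sum>j = c..<p. sr \<tau> \<rho> j * pat (j - sig)))"

text \<open>\<open>B + i - m0\<close> is the grid position where a window ending at position
  \<open>i\<close> of its block starts. Block signs belong to the index of a block relative to the
  window, so this table depends on \<open>i\<close> only and can be precomputed.\<close>

definition Yp :: "(nat \<Rightarrow> int) \<Rightarrow> nat \<Rightarrow> nat \<Rightarrow> int" where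
  "Yp \<tau> i \<rho> = (\<Sum>j<n. ss \<tau> \<rho> ((B + i - m0 + j) div B) * sr \<tau> \<rho> ((B + i - m0 + j) mod B) * pat j)"

text \<open>\<open>le i\<close> and \<open>pp i\<close> are the block and the position of the window
  start: quotient and remainder of \<open>B + i - m0\<close> by \<open>B\<close>.\<close>

definition le :: "nat \<Rightarrow> nat" where "le i = (if i < m0 then 0 else 1)"
definition pp :: "nat \<Rightarrow> nat" where "pp i = (i + (B - m0)) mod B"

lemma pp_le: "i < B \<Longrightarrow> B + i - m0 = le i * B + pp i"
  using m0B by (auto simp: le_def pp_def mod_if)

lemma pp_B: "pp i < B" using B1 by (simp add: pp_def)

definition cu :: "(nat \<Rightarrow> int) \<Rightarrow> (nat \<Rightarrow> int) \<Rightarrow> nat \<Rightarrow> nat \<Rightarrow> nat \<Rightarrow> int" where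
  "cu \<tau> y \<kappa> i \<rho> = (\<Sum>j<i. sr \<tau> \<rho> j * blk y \<kappa> j)"

text \<open>The sketch of the window that ends at position \<open>i\<close> of block \<open>\<kappa> + G\<close>.\<close>

definition Wf :: "(nat \<Rightarrow> int) \<Rightarrow> (nat \<Rightarrow> int) \<Rightarrow> nat \<Rightarrow> nat \<Rightarrow> nat \<Rightarrow> int" where
  "Wf \<tau> y \<kappa> i \<rho> = ss \<tau> \<rho> (q + 1) * cu \<tau> y (\<kappa> + G) (Suc i) \<rho> +
     (\<Sum>b = Suc (le i)..<Suc q. ss \<tau> \<rho> b * Zs \<tau> y (\<kappa> + b) 0 \<rho>) +
     ss \<tau> \<rho> (le i) * Zl \<tau> y (\<kappa> + le i) (pp i) \<rho>"

definition Vf :: "(nat \<Rightarrow> int) \<Rightarrow> (nat \<Rightarrow> int) \<Rightarrow> nat \<Rightarrow> nat \<Rightarrow> int" where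
  "Vf \<tau> y \<kappa> i = (\<Sum>\<rho><R1. (Yp \<tau> i \<rho> - Wf \<tau> y \<kappa> i \<rho>) * (Yp \<tau> i \<rho> - Wf \<tau> y \<kappa> i \<rho>))"

text \<open>The difference vector on the whole grid. To the left of the window, from the last
  checkpoint on, it is the error that the replay leaves behind.\<close>

definition uu :: "nat \<times> nat \<Rightarrow> (nat \<Rightarrow> int) \<Rightarrow> nat \<Rightarrow> nat \<Rightarrow> nat \<Rightarrow> int" where
  "uu cs y \<kappa> i g = (if B + i - m0 \<le> g \<and> g < B + i - m0 + n then pat (g - (B + i - m0)) - y (\<kappa> * B + g)
     else if le i * B + fst cs \<le> g \<and> g < B + i - m0 then pat (g - (le i * B + snd cs)) - y (\<kappa> * B + g)
     else 0)"

definition Sg :: "(nat \<Rightarrow> int) \<Rightarrow> nat \<Rightarrow> nat \<Rightarrow> int" where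
  "Sg \<tau> \<rho> g = ss \<tau> \<rho> (g div B) * sr \<tau> \<rho> (g mod B)"

lemma sum_seg:
  assumes "b \<le> B"
  shows "(\<Sum>g = \<beta> * B + a..<\<beta> * B + b. Sg \<tau> \<rho> g * h g)
    = ss \<tau> \<rho> \<beta> * (\<Sum>j = a..<b. sr \<tau> \<rho> j * h (\<beta> * B + j))"
proof -
  have "(\<Sum>g = \<beta> * B + a..<\<beta> * B + b. Sg \<tau> \<rho> g * h g)
      = (\<Sum>j = a..<b. Sg \<tau> \<rho> (\<beta> * B + j) * h (\<beta> * B + j))"
    by (rule sum.reindex_bij_witness[of _ "\<lambda>j. \<beta> * B + j" "\<lambda>g. g - \<beta> * B"]) auto
  also have "\<dots> = (\<Sum>j = a..<b. ss \<tau> \<rho> \<beta> * (sr \<tau> \<rho> j * h (\<beta> * B + j)))"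
    using assms by (intro sum.cong) (auto simp: Sg_def)
  finally show ?thesis by (simp add: sum_distrib_left)
qed

lemma sum_blocks: "a \<le> b \<Longrightarrow> (\<Sum>g = a * B..<b * B. h g) = (\<Sum>\<beta> = a..<b. \<Sum>g = \<beta> * B..<\<beta> * B + B. h g)"
  for h :: "nat \<Rightarrow> 'a::comm_monoid_add"
proof (induction b)
  case (Suc b)
  show ?case
  proof (cases "a = Suc b")
    case False
    then have ab: "a \<le> b" using Suc.prems by simp
    then have "(\<Sum>g = a * B..<Suc b * B. h g) = (\<Sum>g = a * B..<b * B. h g) + (\<Sum>g = b * B..<b * B + B. h g)"
      by (subst sum.atLeastLessThan_concat) (auto simp: add.commute)
    then show ?thesis using Suc.IH[OF ab] ab by simp
  qed simp
qed simp

lemma Wf_eq: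
  assumes "i < B" and cs: "lck (Qf \<tau> y (\<kappa> + le i)) (blk y (\<kappa> + le i)) (pp i) = (c, sig)"
  shows "Wf \<tau> y \<kappa> i \<rho> = (\<Sum>g = le i * B + c..<B + i - m0 + n. Sg \<tau> \<rho> g * y (\<kappa> * B + g))
     - (\<Sum>g = le i * B + c..<B + i - m0. Sg \<tau> \<rho> g * pat (g - (le i * B + sig)))"
proof -
  let ?l = "le i" and ?h = "\<lambda>g. Sg \<tau> \<rho> g * y (\<kappa> * B + g)"
  have c: "c \<le> pp i" "sig \<le> c"
    using lck_le[of "Qf \<tau> y (\<kappa> + le i)" "blk y (\<kappa> + le i)" "pp i"] cs by auto
  have cB: "c \<le> B" using c pp_B[of i] by simp
  have f: "B + i - m0 = ?l * B + pp i" using pp_le assms by blast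
  have e: "B + i - m0 + n = (q + 1) * B + Suc i"
    using n_eq m0B by (simp add: algebra_simps)
  have l1: "?l \<le> 1" by (simp add: le_def)
  have bl: "blk y (\<kappa> + b) j = y (\<kappa> * B + (b * B + j))" for b j
    by (simp add: blk_def algebra_simps)
  have "(\<Sum>g = ?l * B + c..<B + i - m0 + n. ?h g) = (\<Sum>g = ?l * B + c..<?l * B + B. ?h g)
     + (\<Sum>g = Suc ?l * B..<Suc q * B. ?h g) + (\<Sum>g = (q + 1) * B..<(q + 1) * B + Suc i. ?h g)"
  proof -
    have "?l * B + c \<le> ?l * B + B" using cB by simp
    moreover have "Suc ?l * B \<le> Suc q * B" using l1 q1 by (intro mult_le_mono1) simp
    note le1 = calculation this
    have le2: "?l * B + c \<le> Suc q * B" using le1 unfolding mult_Suc by linarith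
    have "(\<Sum>g = ?l * B + c..<?l * B + B. ?h g) + (\<Sum>g = ?l * B + B..<Suc q * B. ?h g)
        = (\<Sum>g = ?l * B + c..<Suc q * B. ?h g)"
      using le1 by (intro sum.atLeastLessThan_concat) auto
    moreover have "(\<Sum>g = ?l * B + c..<Suc q * B. ?h g) + (\<Sum>g = Suc q * B..<Suc q * B + Suc i. ?h g)
        = (\<Sum>g = ?l * B + c..<Suc q * B + Suc i. ?h g)"
      using le2 by (intro sum.atLeastLessThan_concat) auto
    ultimately show ?thesis unfolding e by (simp add: add.commute)
  qed
  also have "(\<Sum>g = ?l * B + c..<?l * B + B. ?h g) = ss \<tau> \<rho> ?l * Zs \<tau> y (\<kappa> + ?l) c \<rho>"
    unfolding sum_seg[OF order_refl] Zs_def bl by simp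
  also have "(\<Sum>g = Suc ?l * B..<Suc q * B. ?h g)
      = (\<Sum>b = Suc ?l..<Suc q. ss \<tau> \<rho> b * Zs \<tau> y (\<kappa> + b) 0 \<rho>)"
  proof -
    have "(\<Sum>g = b * B..<b * B + B. ?h g) = ss \<tau> \<rho> b * Zs \<tau> y (\<kappa> + b) 0 \<rho>" for b
      using sum_seg[OF order_refl, of \<tau> \<rho> "\<lambda>g. y (\<kappa> * B + g)" b 0] unfolding Zs_def bl by simp
    then show ?thesis using l1 q1 by (subst sum_blocks) auto
  qed
  also have "(\<Sum>g = (q + 1) * B..<(q + 1) * B + Suc i. ?h g)
      = ss \<tau> \<rho> (q + 1) * cu \<tau> y (\<kappa> + G) (Suc i) \<rho>"
    using sum_seg[of "Suc i" \<tau> \<rho> "\<lambda>g. y (\<kappa> * B + g)" "q + 1" 0] assms(1)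
    unfolding cu_def bl G_def by (simp add: atLeast0LessThan)
  finally have 1: "(\<Sum>g = ?l * B + c..<B + i - m0 + n. ?h g) = ss \<tau> \<rho> ?l * Zs \<tau> y (\<kappa> + ?l) c \<rho> +
     (\<Sum>b = Suc ?l..<Suc q. ss \<tau> \<rho> b * Zs \<tau> y (\<kappa> + b) 0 \<rho>) + ss \<tau> \<rho> (q + 1) * cu \<tau> y (\<kappa> + G) (Suc i) \<rho>" .
  have 2: "(\<Sum>g = ?l * B + c..<B + i - m0. Sg \<tau> \<rho> g * pat (g - (?l * B + sig)))
     = ss \<tau> \<rho> ?l * (\<Sum>j = c..<pp i. sr \<tau> \<rho> j * pat (j - sig))"
    unfolding f using pp_B[of i] by (subst sum_seg) (auto simp: less_imp_le)
  show ?thesis unfolding 1 2 Wf_def Zl_def cs by (simp add: algebra_simps)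
qed

text \<open>A row of the estimator is a linear form in product signs, evaluated at
  \<open>uu\<close>; this is where the moment bounds for \<open>grid\<close> become
  applicable.\<close>

lemma diff_grid:
  assumes "i < B" and cs: "lck (Qf \<tau> y (\<kappa> + le i)) (blk y (\<kappa> + le i)) (pp i) = cs"
  shows "real_of_int (Yp \<tau> i \<rho> - Wf \<tau> y \<kappa> i \<rho>)
    = grid B (q + 2) (\<lambda>c. \<tau> (\<rho> * Wd + c)) (\<lambda>b j. real_of_int (uu cs y \<kappa> i (b * B + j)))"
proof -
  obtain c sig where cs': "cs = (c, sig)" by (cases cs)
  let ?l = "le i" and ?f = "B + i - m0"
  have c: "c \<le> pp i" "sig \<le> c"
    using lck_le[of "Qf \<tau> y (\<kappa> + le i)" "blk y (\<kappa> + le i)" "pp i"] cs cs' by auto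
  have f: "?f = ?l * B + pp i" using pp_le assms by blast
  have e: "?f + n = (q + 1) * B + Suc i"
    using n_eq m0B by (simp add: algebra_simps)
  have Y: "Yp \<tau> i \<rho> = (\<Sum>g = ?f..<?f + n. Sg \<tau> \<rho> g * pat (g - ?f))"
    unfolding Yp_def Sg_def
    by (rule sum.reindex_bij_witness[of _ "\<lambda>g. g - ?f" "\<lambda>j. ?f + j"]) auto
  have W: "(\<Sum>g = ?l * B + c..<?f + n. Sg \<tau> \<rho> g * y (\<kappa> * B + g))
     = (\<Sum>g = ?l * B + c..<?f. Sg \<tau> \<rho> g * y (\<kappa> * B + g)) + (\<Sum>g = ?f..<?f + n. Sg \<tau> \<rho> g * y (\<kappa> * B + g))"
    using c f by (subst sum.atLeastLessThan_concat) auto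
  have "Yp \<tau> i \<rho> - Wf \<tau> y \<kappa> i \<rho> = (\<Sum>g = ?f..<?f + n. Sg \<tau> \<rho> g * uu cs y \<kappa> i g)
      + (\<Sum>g = ?l * B + c..<?f. Sg \<tau> \<rho> g * uu cs y \<kappa> i g)"
  proof -
    have "(\<Sum>g = ?f..<?f + n. Sg \<tau> \<rho> g * uu cs y \<kappa> i g)
       = (\<Sum>g = ?f..<?f + n. Sg \<tau> \<rho> g * pat (g - ?f)) - (\<Sum>g = ?f..<?f + n. Sg \<tau> \<rho> g * y (\<kappa> * B + g))"
      unfolding sum_subtractf[symmetric] by (intro sum.cong) (auto simp: uu_def algebra_simps)
    moreover have "(\<Sum>g = ?l * B + c..<?f. Sg \<tau> \<rho> g * uu cs y \<kappa> i g)
       = (\<Sum>g = ?l * B + c..<?f. Sg \<tau> \<rho> g * pat (g - (?l * B + sig))) - (\<Sum>g = ?l * B + c..<?f. Sg \<tau> \<rho> g * y (\<kappa> * B + g))"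
      unfolding sum_subtractf[symmetric] by (intro sum.cong) (auto simp: uu_def cs' algebra_simps)
    ultimately show ?thesis
      unfolding Y Wf_eq[OF assms(1) cs[unfolded cs']] W by simp
  qed
  also have "\<dots> = (\<Sum>g = ?l * B + c..<?f + n. Sg \<tau> \<rho> g * uu cs y \<kappa> i g)"
    using c f by (subst add.commute, subst sum.atLeastLessThan_concat) auto
  also have "\<dots> = (\<Sum>g = 0 * B..<(q + 2) * B. Sg \<tau> \<rho> g * uu cs y \<kappa> i g)"
  proof (rule sum.mono_neutral_left)
    show "{?l * B + c..<?f + n} \<subseteq> {0 * B..<(q + 2) * B}" using assms(1) unfolding e by auto
    have "?l * B + c \<le> ?f" using c f by simp
    then show "\<forall>g\<in>{0 * B..<(q + 2) * B} - {?l * B + c..<?f + n}. Sg \<tau> \<rho> g * uu cs y \<kappa> i g = 0"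
      by (auto simp: uu_def cs')
  qed simp
  also have "\<dots> = (\<Sum>b = 0..<q + 2. ss \<tau> \<rho> b * (\<Sum>j = 0..<B. sr \<tau> \<rho> j * uu cs y \<kappa> i (b * B + j)))"
  proof -
    have "(\<Sum>g = b * B..<b * B + B. Sg \<tau> \<rho> g * uu cs y \<kappa> i g)
        = ss \<tau> \<rho> b * (\<Sum>j = 0..<B. sr \<tau> \<rho> j * uu cs y \<kappa> i (b * B + j))" for b
      using sum_seg[OF order_refl, of \<tau> \<rho> "uu cs y \<kappa> i" b 0] by simp
    then show ?thesis by (subst sum_blocks) auto
  qed
  finally show ?thesis
    unfolding grid_def ss_def sr_def by (simp add: atLeast0LessThan add.assoc)
qed

end

section \<open>Accuracy of the estimate\<close>

text \<open>It rests on \<open>1 - 1/(16k) \<ge> 2k/(2k+1)\<close> and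
  \<open>(1 + 1/(16k))^2 \<le> (2k+2)/(2k+1)\<close>; the square appears because both the sampling
  error and the replay error \<open>e\<close> push upwards. After scaling by
  \<open>(2k+1)/(2k)\<close> the conclusion reads: at least \<open>h\<close> and at most
  \<open>(1 + 1/k) h\<close>.\<close>

lemma concentration_imp_good:
  fixes V h e r k :: real
  assumes k: "1 \<le> k" and r: "0 \<le> r" and h: "0 \<le> h" and e: "0 \<le> e" "e * (16 * k) \<le> h"
    and V: "\<bar>V - r * (h + e)\<bar> \<le> 1 / (16 * k) * r * (h + e)"
  shows "2 * k * r * h \<le> V * (2 * k + 1)" "V * (2 * k + 1) \<le> 2 * r * (k + 1) * h"
proof -
  have k0: "0 < 16 * k" using k by simp
  have rN: "0 \<le> r * (h + e)" using r h e by simp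
  have lo: "r * (h + e) * (16 * k - 1) \<le> V * (16 * k)"
    and hi: "V * (16 * k) \<le> r * (h + e) * (16 * k + 1)"
  proof -
    have "1 / (16 * k) * r * (h + e) * (16 * k) = r * (h + e)" using k0 by simp
    moreover have "\<bar>V - r * (h + e)\<bar> * (16 * k) \<le> 1 / (16 * k) * r * (h + e) * (16 * k)"
      using V k0 by (intro mult_right_mono) auto
    ultimately have b: "\<bar>V - r * (h + e)\<bar> * (16 * k) \<le> r * (h + e)" by simp
    have "(r * (h + e) - V) * (16 * k) \<le> \<bar>V - r * (h + e)\<bar> * (16 * k)"
      "(V - r * (h + e)) * (16 * k) \<le> \<bar>V - r * (h + e)\<bar> * (16 * k)"
      using k0 by (intro mult_right_mono; simp)+
    with b show "r * (h + e) * (16 * k - 1) \<le> V * (16 * k)" "V * (16 * k) \<le> r * (h + e) * (16 * k + 1)"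
      by (simp_all add: algebra_simps)
  qed
  have rh: "0 \<le> r * h" using r h by simp
  have "2 * k * r * h * (16 * k) = r * h * (32 * k * k)" by simp
  also have "\<dots> \<le> r * h * ((16 * k - 1) * (2 * k + 1))"
    using rh k by (intro mult_left_mono) (auto simp: algebra_simps)
  also have "\<dots> \<le> r * (h + e) * ((16 * k - 1) * (2 * k + 1))"
    using r h e k by (intro mult_right_mono mult_left_mono) auto
  also have "\<dots> = (r * (h + e) * (16 * k - 1)) * (2 * k + 1)" by simp
  also have "\<dots> \<le> (V * (16 * k)) * (2 * k + 1)" using lo k by (intro mult_right_mono) auto
  finally have "2 * k * r * h * (16 * k) \<le> V * (2 * k + 1) * (16 * k)" by (simp add: mult_ac)
  then show "2 * k * r * h \<le> V * (2 * k + 1)" using k0 by (rule mult_right_le_imp_le)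
  have "V * (2 * k + 1) * (16 * k * (16 * k)) = V * (16 * k) * ((2 * k + 1) * (16 * k))" by simp
  also have "\<dots> \<le> r * (h + e) * (16 * k + 1) * ((2 * k + 1) * (16 * k))"
    using hi k by (intro mult_right_mono) auto
  also have "\<dots> = ((h + e) * (16 * k)) * (r * (16 * k + 1) * (2 * k + 1))" by simp
  also have "\<dots> \<le> (h * (16 * k + 1)) * (r * (16 * k + 1) * (2 * k + 1))"
    using e(2) r k by (intro mult_right_mono) (auto simp: algebra_simps)
  also have "\<dots> = r * h * ((16 * k + 1) * (16 * k + 1) * (2 * k + 1))" by simp
  also have "\<dots> \<le> r * h * (2 * (k + 1) * (16 * k * (16 * k)))"
  proof (rule mult_left_mono[OF _ rh])
    have "1 \<le> k * k" "k \<le> k * k" using k mult_mono[of 1 k 1 k] mult_right_mono[of 1 k k] by auto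
    then show "(16 * k + 1) * (16 * k + 1) * (2 * k + 1) \<le> 2 * (k + 1) * (16 * k * (16 * k))"
      by (simp add: algebra_simps)
  qed
  finally have "V * (2 * k + 1) * (16 * k * (16 * k)) \<le> 2 * r * (k + 1) * h * (16 * k * (16 * k))"
    by (simp add: mult_ac)
  then show "V * (2 * k + 1) \<le> 2 * r * (k + 1) * h"
    using mult_pos_pos[OF k0 k0] by (rule mult_right_le_imp_le)
qed

section \<open>Number and quality of the checkpoints\<close>

context params
begin

definition mis :: "(nat \<Rightarrow> int) \<Rightarrow> nat \<Rightarrow> nat \<Rightarrow> nat \<Rightarrow> int" where
  "mis x sig a b = (\<Sum>j = a..<b. of_bool (x j \<noteq> pat (j - sig)))"

lemma mis_nonneg: "0 \<le> mis x sig a b"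
  unfolding mis_def by (intro sum_nonneg) simp

lemma mis_Suc: "a \<le> b \<Longrightarrow> mis x sig a (Suc b) = mis x sig a b + of_bool (x b \<noteq> pat (b - sig))"
  by (simp add: mis_def)

lemma mis_mono: "a \<le> a' \<Longrightarrow> b' \<le> b \<Longrightarrow> mis x sig a' b' \<le> mis x sig a b"
  unfolding mis_def by (intro sum_mono2) auto

abbreviation "ck \<equiv> 1280 * k"

text \<open>\<open>J\<close> counts the changes of reference, \<open>a\<close> the checkpoints
  caused by mismatches since the last change. A change more than halves \<open>mm\<close>, so
  \<open>J\<close> is logarithmic in \<open>Q 0\<close>. The inequality for \<open>a\<close> is a
  potential argument: each such checkpoint spends mismatches of total weight above
  \<open>mm\<close>, and those counted in \<open>ee\<close> are not spent yet.\<close>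

definition inv where
  "inv Q x i st J a \<longleftrightarrow> (case st of (sig, mm, ee, L) \<Rightarrow>
     length L \<le> J * (ck + 1) + 1 + a \<and> a \<le> ck \<and> mm = Q sig \<and> sig < i \<and>
     (J = 0 \<or> 2 ^ (J - 1) \<le> Q 0) \<and> mm * 2 ^ J \<le> Q 0 \<and>
     int a * mm \<le> int DKR * (mis x sig sig i - ee) \<and>
     (\<exists>c. L \<noteq> [] \<and> last L = (c, sig) \<and> sig \<le> c \<and> c < i \<and> ee = mis x sig c i))"

lemma inv_Cap:
  assumes "inv Q x i (sig, mm, ee, L) J a" "Q 0 \<le> 2 ^ (5 + 2 * Lg)"
  shows "length L < Cap"
proof -
  have J: "J = 0 \<or> 2 ^ (J - 1) \<le> Q 0" "length L \<le> J * (ck + 1) + 1 + a" "a \<le> ck"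
    using assms(1) by (auto simp: inv_def)
  have "J \<le> 6 + 2 * Lg"
  proof (cases "J = 0")
    case False
    then have "(2::int) ^ (J - 1) \<le> 2 ^ (5 + 2 * Lg)" using J(1) assms(2) by linarith
    then have "J - 1 \<le> 5 + 2 * Lg" by (subst (asm) power_increasing_iff) auto
    then show ?thesis by simp
  qed simp
  then have "J + 1 \<le> 9 * Lg" using Lg1 by simp
  then have "(J + 1) * (ck + 1) \<le> (9 * Lg) * (1281 * k)"
    using k1 by (intro mult_le_mono) auto
  moreover have "length L \<le> (J + 1) * (ck + 1)" using J by (simp add: algebra_simps)
  moreover have "(9 * Lg) * (1281 * k) < Cap" using k1 Lg1 by (simp add: Cap_def)
  ultimately show ?thesis by linarith
qed

lemma R2_pos: "0 < R2" using Lg1 by (simp add: R2_def)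

text \<open>The second conclusion is the purpose of the scan. A checkpoint at \<open>i\<close>
  leaves no replayed positions; otherwise the two failed tests give
  \<open>ee * DKR \<le> mm \<le> 2 * Q i\<close>.\<close>

lemma inv_step:
  assumes inv: "inv Q x i (scan Q x i) J a" and i: "i < B" "0 < i"
    and Q0: "Q 0 \<le> 2 ^ (5 + 2 * Lg)" and Qn: "\<And>i. 0 \<le> Q i"
    and low: "\<And>i. i < B \<Longrightarrow> int R2 * mis x i i B \<le> 4 * Q i"
  shows "(\<exists>J a. inv Q x (Suc i) (scan Q x (Suc i)) J a) \<and>
    (\<exists>c sig. lck Q x i = (c, sig) \<and> mis x sig c i * int DKR \<le> 2 * Q i)"
proof -
  obtain sig mm ee L where st: "scan Q x i = (sig, mm, ee, L)" by (cases "scan Q x i") auto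
  note iv = inv[unfolded st]
  have cap: "length L < Cap" using inv_Cap[OF iv Q0] .
  obtain c where h: "length L \<le> J * (ck + 1) + 1 + a" "a \<le> ck" "mm = Q sig" "sig < i"
     "J = 0 \<or> 2 ^ (J - 1) \<le> Q 0" "mm * 2 ^ J \<le> Q 0"
     "int a * mm \<le> int DKR * (mis x sig sig i - ee)"
     "L \<noteq> []" "last L = (c, sig)" "sig \<le> c" "c < i" "ee = mis x sig c i"
    using iv by (auto simp: inv_def)
  have lc: "lck Q x i = last (CL Q x (Suc i))" by (simp add: lck_def)
  have CLi: "CL Q x i = L" by (simp add: CL_def ckl_def st)
  consider (A) "2 * Q i < mm" | (BB) "\<not> 2 * Q i < mm" "mm < ee * int DKR"
    | (C) "\<not> 2 * Q i < mm" "\<not> mm < ee * int DKR" by blast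
  then show ?thesis
  proof cases
    case A
    have d: "dcs Q i (scan Q x i) = (True, i, Q i, 0)" using A i by (simp add: dcs_def st)
    have s: "scan Q x (Suc i) = (i, Q i, of_bool (x i \<noteq> pat 0), L @ [(i, i)])"
      using cap d by (simp add: stp_def ckl_def st)
    have m1: "mis x i i (Suc i) = of_bool (x i \<noteq> pat 0)" by (simp add: mis_def)
    \<comment> \<open>A reference can be beaten only if \<open>mm\<close> is at least 1. This bounds
      the number of changes even when estimates drop to 0.\<close>
    have p: "2 ^ J \<le> Q 0"
    proof -
      have "1 \<le> mm" using A Qn[of i] by linarith
      then have "1 * 2 ^ J \<le> mm * 2 ^ J" by (intro mult_right_mono) auto
      then show ?thesis using h(6) by linarith
    qed
    have p2: "Q i * 2 ^ Suc J \<le> Q 0"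
    proof -
      have "(2 * Q i) * 2 ^ J \<le> mm * 2 ^ J" using A by (intro mult_right_mono) auto
      moreover have "(2 * Q i) * 2 ^ J = Q i * 2 ^ Suc J" by simp
      ultimately show ?thesis using h(6) by linarith
    qed
    have "inv Q x (Suc i) (scan Q x (Suc i)) (Suc J) 0"
      unfolding s inv_def using p p2 m1 h(1,2) by (auto simp: algebra_simps)
    moreover have "lck Q x i = (i, i)" unfolding lc CL_def s by (simp add: ckl_def)
    ultimately show ?thesis using Qn[of i] by (auto simp: mis_def)
  next
    case BB
    have d: "dcs Q i (scan Q x i) = (True, sig, mm, 0)" using BB i by (simp add: dcs_def st)
    have s: "scan Q x (Suc i) = (sig, mm, of_bool (x i \<noteq> pat (i - sig)), L @ [(i, sig)])"
      using cap d by (simp add: stp_def ckl_def st)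
    have m1: "mis x sig i (Suc i) = of_bool (x i \<noteq> pat (i - sig))" by (simp add: mis_def)
    have m2: "mis x sig sig (Suc i) = mis x sig sig i + of_bool (x i \<noteq> pat (i - sig))"
      using h(4) by (intro mis_Suc) simp
    have am: "int (Suc a) * mm \<le> int DKR * mis x sig sig i"
    proof -
      have "int (Suc a) * mm = int a * mm + mm" by (simp add: algebra_simps)
      also have "\<dots> \<le> int DKR * (mis x sig sig i - ee) + ee * int DKR" using h(7) BB(2) by linarith
      finally show ?thesis by (simp add: algebra_simps)
    qed
    \<comment> \<open>By \<open>low\<close> the reference has at most \<open>4 mm / R2\<close>
      mismatches in the whole block, and each checkpoint spends more than \<open>mm / DKR\<close> of
      them: at most \<open>4 DKR / R2 = 1280 k\<close> checkpoints.\<close>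
    have "Suc a \<le> ck"
    proof -
      let ?m = "mis x sig sig B"
      have e0: "0 < ee"
      proof (rule ccontr)
        assume "\<not> 0 < ee"
        then have "ee * int DKR \<le> 0" by (simp add: mult_nonpos_nonneg)
        then show False using BB(2) Qn[of sig] h(3) by linarith
      qed
      have "ee \<le> mis x sig sig i" unfolding h(12) using h by (intro mis_mono) auto
      also have le: "mis x sig sig i \<le> ?m" using i by (intro mis_mono) auto
      finally have mpos: "0 < ?m" using e0 by linarith
      have "int (Suc a) * (int R2 * ?m) \<le> int (Suc a) * (4 * mm)"
        using low[of sig] h i by (intro mult_left_mono) auto
      also have "\<dots> \<le> 4 * (int DKR * ?m)"
        using am mult_left_mono[OF le, of "int DKR"] by (simp add: algebra_simps)
      finally have "int (Suc a) * (int R2 * ?m) \<le> int ck * (int R2 * ?m)"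
        by (simp add: DKR_def algebra_simps)
      then have "int (Suc a) \<le> int ck" using mpos R2_pos
        by (subst (asm) mult_le_cancel_right) auto
      then show ?thesis by linarith
    qed
    then have "inv Q x (Suc i) (scan Q x (Suc i)) J (Suc a)"
      unfolding s inv_def using am m1 m2 h by auto
    moreover have "lck Q x i = (i, sig)" unfolding lc CL_def s by (simp add: ckl_def)
    ultimately show ?thesis using Qn[of i] by (auto simp: mis_def)
  next
    case C
    have d: "dcs Q i (scan Q x i) = (False, sig, mm, ee)" using C i by (simp add: dcs_def st)
    have s: "scan Q x (Suc i) = (sig, mm, ee + of_bool (x i \<noteq> pat (i - sig)), L)"
      using d by (simp add: stp_def ckl_def st)
    have m1: "mis x sig c (Suc i) = ee + of_bool (x i \<noteq> pat (i - sig))"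
      using h by (simp add: mis_Suc)
    have m2: "mis x sig sig (Suc i) = mis x sig sig i + of_bool (x i \<noteq> pat (i - sig))"
      using h(4) by (intro mis_Suc) simp
    have "inv Q x (Suc i) (scan Q x (Suc i)) J a"
      unfolding s inv_def using m1 m2 h by auto
    moreover have "lck Q x i = (c, sig)" unfolding lc CL_def s using h by (simp add: ckl_def)
    ultimately show ?thesis using C h(12) by (auto simp: algebra_simps)
  qed
qed

lemma lck_error:
  assumes p: "p < B"
    and Q0: "Q 0 \<le> 2 ^ (5 + 2 * Lg)" and Qn: "\<And>i. 0 \<le> Q i"
    and low: "\<And>i. i < B \<Longrightarrow> int R2 * mis x i i B \<le> 4 * Q i"
  shows "\<exists>c sig. lck Q x p = (c, sig) \<and> mis x sig c p * int DKR \<le> 2 * Q p"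
proof (cases "p = 0")
  case True
  then show ?thesis using Qn[of 0] by (auto simp: lck_def CL_1 mis_def)
next
  case False
  have "\<exists>J a. inv Q x (Suc i) (scan Q x (Suc i)) J a" if "i < B" for i
    using that
  proof (induction i)
    case 0
    have "scan Q x (Suc 0) = (0, Q 0, of_bool (x 0 \<noteq> pat 0), [(0, 0)])"
      using Cap1 by (simp add: stp_def dcs_def ckl_def)
    then have "inv Q x (Suc 0) (scan Q x (Suc 0)) 0 0"
      unfolding inv_def by (auto simp: mis_def)
    then show ?case by blast
  next
    case (Suc i)
    then obtain J a where "inv Q x (Suc i) (scan Q x (Suc i)) J a" by auto
    from inv_step[OF this Suc.prems _ Q0 Qn low] show ?case by simp
  qed
  from this[of "p - 1"] False p have "\<exists>J a. inv Q x p (scan Q x p) J a" by simp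
  then obtain J a where "inv Q x p (scan Q x p) J a" by blast
  from inv_step[OF this p _ Q0 Qn low] False show ?thesis by simp
qed

section \<open>Squared norms as mismatch counts\<close>

definition hd' :: "(nat \<Rightarrow> int) \<Rightarrow> nat \<Rightarrow> nat \<Rightarrow> int" where
  "hd' y \<kappa> i = (\<Sum>j<n. of_bool (pat j \<noteq> y (\<kappa> * B + (B + i - m0) + j)))"

definition bin :: "(nat \<Rightarrow> int) \<Rightarrow> bool" where "bin y \<longleftrightarrow> (\<forall>j. y j = 0 \<or> y j = 1)"

lemma pat_bin: "pat j = 0 \<or> pat j = 1"
  by (simp add: pat_def)

lemma bin_sq: "bin y \<Longrightarrow> (pat a - y b)\<^sup>2 = of_bool (pat a \<noteq> y b)"
  using pat_bin[of a] unfolding bin_def by (elim allE[of _ b]) auto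

text \<open>For binary strings a squared difference is a mismatch bit; the window contributes the
  Hamming distance, the replayed positions contribute their mismatches.\<close>

lemma uu_norm:
  assumes "bin y" "i < B" "sig \<le> c" "c \<le> pp i"
  shows "(\<Sum>b<q + 2. \<Sum>j<B. (real_of_int (uu (c, sig) y \<kappa> i (b * B + j)))\<^sup>2)
    = real_of_int (hd' y \<kappa> i + mis (blk y (\<kappa> + le i)) sig c (pp i))"
proof -
  let ?l = "le i" and ?f = "B + i - m0" and ?u = "\<lambda>g. (uu (c, sig) y \<kappa> i g)\<^sup>2"
  have f: "?f = ?l * B + pp i" using pp_le assms by blast
  have e: "?f + n = (q + 1) * B + Suc i"
    using n_eq m0B by (simp add: algebra_simps)
  have "(\<Sum>b<q + 2. \<Sum>j<B. ?u (b * B + j)) = (\<Sum>b = 0..<q + 2. \<Sum>g = b * B..<b * B + B. ?u g)"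
  proof -
    have "(\<Sum>g = b * B..<b * B + B. ?u g) = (\<Sum>j<B. ?u (b * B + j))" for b
      by (rule sum.reindex_bij_witness[of _ "\<lambda>j. b * B + j" "\<lambda>g. g - b * B"]) auto
    then show ?thesis by (simp add: atLeast0LessThan)
  qed
  also have "\<dots> = (\<Sum>g = 0 * B..<(q + 2) * B. ?u g)" by (rule sum_blocks[symmetric]) simp
  also have "\<dots> = (\<Sum>g = ?l * B + c..<?f + n. ?u g)"
  proof (rule sum.mono_neutral_right)
    show "{?l * B + c..<?f + n} \<subseteq> {0 * B..<(q + 2) * B}" using assms(2) unfolding e by auto
    have "?l * B + c \<le> ?f" using assms f by simp
    then show "\<forall>g\<in>{0 * B..<(q + 2) * B} - {?l * B + c..<?f + n}. ?u g = 0"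
      by (auto simp: uu_def)
  qed simp
  also have "\<dots> = (\<Sum>g = ?l * B + c..<?f. ?u g) + (\<Sum>g = ?f..<?f + n. ?u g)"
    using assms f by (subst sum.atLeastLessThan_concat) auto
  also have "(\<Sum>g = ?f..<?f + n. ?u g) = hd' y \<kappa> i"
    unfolding hd'_def
    by (rule sum.reindex_bij_witness[of _ "\<lambda>j. ?f + j" "\<lambda>g. g - ?f"])
      (auto simp: uu_def bin_sq[OF assms(1)] algebra_simps)
  also have "(\<Sum>g = ?l * B + c..<?f. ?u g) = mis (blk y (\<kappa> + ?l)) sig c (pp i)"
    unfolding mis_def
  proof (rule sum.reindex_bij_witness[of _ "\<lambda>j. ?l * B + j" "\<lambda>g. g - ?l * B"])
    fix g assume g: "g \<in> {?l * B + c..<?f}"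
    have "g - (?l * B + sig) = g - ?l * B - sig" by simp
    moreover have "\<kappa> * B + g = (\<kappa> + ?l) * B + (g - ?l * B)" using g by (simp add: algebra_simps)
    ultimately show "of_bool (blk y (\<kappa> + ?l) (g - ?l * B) \<noteq> pat (g - ?l * B - sig)) = ?u g"
      using g by (auto simp: uu_def bin_sq[OF assms(1)] blk_def)
  qed (use f in auto)
  finally have "(\<Sum>b<q + 2. \<Sum>j<B. ?u (b * B + j)) = hd' y \<kappa> i + mis (blk y (\<kappa> + le i)) sig c (pp i)"
    by simp
  from arg_cong[OF this, of real_of_int] show ?thesis by simp
qed

text \<open>The part of the left block inside the window faces a prefix of the pattern, so its
  mismatches are among those of the window. This turns a bound by the estimate at the window start
  into a bound by the Hamming distance.\<close>

lemma left_le_hd: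
  assumes "i < B"
  shows "mis (blk y (\<kappa> + le i)) (pp i) (pp i) B \<le> hd' y \<kappa> i"
proof -
  let ?l = "le i" and ?p = "pp i"
  have f: "B + i - m0 = ?l * B + ?p" using pp_le assms by blast
  have p: "?p < B" by (rule pp_B)
  have Bn: "B - ?p \<le> n"
  proof -
    have "B \<le> q * B" using q1 by simp
    then show ?thesis using n_eq by linarith
  qed
  have "mis (blk y (\<kappa> + ?l)) ?p ?p B = (\<Sum>j<B - ?p. of_bool (pat j \<noteq> y (\<kappa> * B + (B + i - m0) + j)))"
    unfolding mis_def
    by (rule sum.reindex_bij_witness[of _ "\<lambda>j. ?p + j" "\<lambda>g. g - ?p"])
      (auto simp: blk_def f algebra_simps)
  also have "\<dots> \<le> hd' y \<kappa> i" unfolding hd'_def using Bn by (intro sum_mono2) auto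
  finally show ?thesis .
qed

lemma hd'_le: "0 \<le> hd' y \<kappa> i \<and> hd' y \<kappa> i \<le> int n"
proof -
  have "hd' y \<kappa> i \<le> (\<Sum>j<n. 1)" unfolding hd'_def by (intro sum_mono) simp
  then show ?thesis unfolding hd'_def by (auto intro: sum_nonneg)
qed

definition xi :: "(nat \<Rightarrow> int) \<Rightarrow> nat \<Rightarrow> nat \<Rightarrow> int" where
  "xi x i j = (if i \<le> j then x j - pat (j - i) else 0)"

lemma Q_lin:
  assumes "i < B"
  shows "real_of_int (Zs \<tau> y \<kappa> i \<rho> - YQ \<tau> i \<rho>) = lin B (\<lambda>c. \<tau> (\<rho> * Wd + c)) (\<lambda>j. real_of_int (xi (blk y \<kappa>) i j))"
proof -
  have "Zs \<tau> y \<kappa> i \<rho> - YQ \<tau> i \<rho> = (\<Sum>j = i..<B. \<tau> (\<rho> * Wd + j) * xi (blk y \<kappa>) i j)"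
    unfolding Zs_def YQ_def sum_subtractf[symmetric]
    by (intro sum.cong) (auto simp: xi_def sr_def algebra_simps)
  also have "\<dots> = (\<Sum>j<B. \<tau> (\<rho> * Wd + j) * xi (blk y \<kappa>) i j)"
    by (intro sum.mono_neutral_left) (auto simp: xi_def)
  finally show ?thesis by (simp add: lin_def)
qed

lemma xi_norm:
  assumes "bin y" "i < B"
  shows "(\<Sum>j<B. (real_of_int (xi (blk y \<kappa>) i j))\<^sup>2) = real_of_int (mis (blk y \<kappa>) i i B)"
proof -
  have "(\<Sum>j<B. (xi (blk y \<kappa>) i j)\<^sup>2) = (\<Sum>j = i..<B. (xi (blk y \<kappa>) i j)\<^sup>2)"
    by (intro sum.mono_neutral_right) (auto simp: xi_def)
  also have "\<dots> = mis (blk y \<kappa>) i i B"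
    unfolding mis_def
  proof (rule sum.cong[OF refl])
    fix j assume "j \<in> {i..<B}"
    then have "(xi (blk y \<kappa>) i j)\<^sup>2 = (pat (j - i) - y (\<kappa> * B + j))\<^sup>2"
      by (simp add: xi_def blk_def power2_commute)
    then show "(xi (blk y \<kappa>) i j)\<^sup>2 = of_bool (blk y \<kappa> j \<noteq> pat (j - i))"
      using bin_sq[OF assms(1)] by (auto simp: blk_def)
  qed
  finally have "(\<Sum>j<B. (xi (blk y \<kappa>) i j)\<^sup>2) = mis (blk y \<kappa>) i i B" .
  from arg_cong[OF this, of real_of_int] show ?thesis by simp
qed

lemma Qf_nonneg: "0 \<le> Qf \<tau> y \<kappa> i"
  unfolding Qf_def by (intro sum_nonneg) simp

definition sbd :: "(nat \<Rightarrow> int) \<Rightarrow> bool" where "sbd \<tau> \<longleftrightarrow> (\<forall>j. \<bar>\<tau> j\<bar> \<le> 1)"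

lemma sketch_bound:
  assumes "sbd \<tau>" "\<And>j. \<bar>h j\<bar> \<le> 1"
  shows "\<bar>\<Sum>j = i..<B. sr \<tau> \<rho> j * h j\<bar> \<le> int B"
proof -
  have "\<bar>\<Sum>j = i..<B. sr \<tau> \<rho> j * h j\<bar> \<le> (\<Sum>j = i..<B. \<bar>sr \<tau> \<rho> j * h j\<bar>)" by (rule sum_abs)
  also have "\<dots> \<le> (\<Sum>j = i..<B. 1)"
    using assms by (intro sum_mono) (auto simp: abs_mult sr_def sbd_def intro!: mult_le_one)
  finally show ?thesis by simp
qed

lemma Qf_bound:
  assumes "sbd \<tau>" "bin y"
  shows "Qf \<tau> y \<kappa> i \<le> int (R2 * (B * B))"
proof -
  have d: "\<bar>Zs \<tau> y \<kappa> i \<rho> - YQ \<tau> i \<rho>\<bar> \<le> int B" for \<rho>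
  proof -
    have "Zs \<tau> y \<kappa> i \<rho> - YQ \<tau> i \<rho> = (\<Sum>j = i..<B. sr \<tau> \<rho> j * (blk y \<kappa> j - pat (j - i)))"
      unfolding Zs_def YQ_def sum_subtractf[symmetric] by (simp add: algebra_simps)
    moreover have "\<bar>blk y \<kappa> j - pat (j - i)\<bar> \<le> 1" for j
      using pat_bin[of "j - i"] assms(2) unfolding bin_def blk_def by (elim allE[of _ "\<kappa> * B + j"]) auto
    ultimately show ?thesis using sketch_bound[OF assms(1)] by simp
  qed
  have "(Zs \<tau> y \<kappa> i \<rho> - YQ \<tau> i \<rho>) * (Zs \<tau> y \<kappa> i \<rho> - YQ \<tau> i \<rho>) \<le> int B * int B" for \<rho>
    using mult_mono[OF d[of \<rho>] d[of \<rho>]] unfolding abs_mult_self_eq by force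
  then have "Qf \<tau> y \<kappa> i \<le> (\<Sum>\<rho> = R1..<R. int B * int B)"
    unfolding Qf_def by (intro sum_mono)
  then show ?thesis by (simp add: R_def)
qed

lemma Qf_0:
  assumes "sbd \<tau>" "bin y"
  shows "Qf \<tau> y \<kappa> 0 \<le> 2 ^ (5 + 2 * Lg)"
proof -
  have "Lg \<le> 2 ^ Lg" by (rule less_imp_le[OF less_exp])
  have "R2 * (B * B) \<le> 32 * 2 ^ Lg * 2 ^ Lg"
    unfolding R2_def using \<open>Lg \<le> 2 ^ Lg\<close> BB nLg by (intro mult_le_mono) auto
  also have "\<dots> = 2 ^ (5 + 2 * Lg)" unfolding mult_2 power_add by simp
  finally have "int (R2 * (B * B)) \<le> int (2 ^ (5 + 2 * Lg))" by (simp only: of_nat_le_iff)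
  then show ?thesis using Qf_bound[OF assms, where \<kappa> = \<kappa> and i = 0] by simp
qed

section \<open>Success probability of the estimator\<close>

definition tab :: "(nat \<Rightarrow> nat \<Rightarrow> int) \<Rightarrow> nat \<Rightarrow> int" where
  "tab F j = (if j < R * Wd then F (j div Wd) (j mod Wd) else 0)"

lemma tab_row: "\<rho> < R \<Longrightarrow> c < Wd \<Longrightarrow> tab F (\<rho> * Wd + c) = F \<rho> c"
proof -
  assume h: "\<rho> < R" "c < Wd"
  have "\<rho> * Wd + c < Suc \<rho> * Wd" using h by simp
  also have "\<dots> \<le> R * Wd" using h by (intro mult_le_mono1) simp
  finally show ?thesis using h by (simp add: tab_def)
qed

lemma tab_r: "\<rho> < R \<Longrightarrow> j < B \<Longrightarrow> tab F (\<rho> * Wd + j) = F \<rho> j"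
  by (rule tab_row) (auto simp: Wd_def)

lemma tab_s: "\<rho> < R \<Longrightarrow> b < q + 2 \<Longrightarrow> tab F (\<rho> * Wd + (B + b)) = F \<rho> (B + b)"
  by (rule tab_row) (auto simp: Wd_def)

lemma lin_tab: "\<rho> < R \<Longrightarrow> lin B (\<lambda>c. tab F (\<rho> * Wd + c)) x = lin B (F \<rho>) x"
  unfolding lin_def by (intro sum.cong refl) (simp add: tab_r)

lemma grid_tab: "\<rho> < R \<Longrightarrow> grid B (q + 2) (\<lambda>c. tab F (\<rho> * Wd + c)) x = grid B (q + 2) (F \<rho>) x"
  unfolding grid_def by (intro sum.cong refl arg_cong2[where f = times]) (simp_all add: tab_r tab_s del: add_2_eq_Suc')

lemma Qf_tab:
  assumes "i < B"
  shows "real_of_int (Qf (tab F) y \<kappa> i)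
    = (\<Sum>\<rho>\<in>{R1..<R}. (lin B (F \<rho>) (\<lambda>j. real_of_int (xi (blk y \<kappa>) i j)))\<^sup>2)"
  unfolding Qf_def of_int_sum of_int_mult Q_lin[OF assms]
  by (intro sum.cong refl) (simp add: lin_tab power2_eq_square)

text \<open>The source of independence: the scan, and hence every checkpoint, is a function of the
  rows from \<open>R1\<close> on.\<close>

lemma Qf_cong:
  assumes "\<And>\<rho>. R1 \<le> \<rho> \<Longrightarrow> \<rho> < R \<Longrightarrow> F \<rho> = F' \<rho>"
  shows "Qf (tab F) y \<kappa> = Qf (tab F') y \<kappa>"
proof
  fix i
  have "sr (tab F) \<rho> j = sr (tab F') \<rho> j" if "R1 \<le> \<rho>" "\<rho> < R" "j < B" for \<rho> j
    using that assms by (simp add: sr_def tab_r)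
  then show "Qf (tab F) y \<kappa> i = Qf (tab F') y \<kappa> i"
    unfolding Qf_def Zs_def YQ_def by (intro sum.cong arg_cong2[where f = times] arg_cong2[where f = minus]) auto
qed

abbreviation "rowp \<equiv> rad {..<Wd}"

lemma tab_abs:
  assumes "\<And>\<rho> c. \<bar>F \<rho> c\<bar> \<le> 1"
  shows "sbd (tab F)"
  using assms by (simp add: tab_def sbd_def)

lemma rad_abs: "r \<in> set_pmf rowp \<Longrightarrow> \<bar>r c\<bar> \<le> 1"
  by (auto simp: set_Pi_pmf PiE_dflt_def split: if_splits) (metis abs_1 abs_0 abs_minus_cancel insertE singletonD zero_le_one order_refl)

lemma rows_abs:
  assumes "F \<in> set_pmf (Pi_pmf A (\<lambda>_. 0) (\<lambda>_. rowp))" "finite A"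
  shows "\<bar>F \<rho> c\<bar> \<le> 1"
proof (cases "\<rho> \<in> A")
  case True
  then have "F \<rho> \<in> set_pmf rowp" using assms by (auto simp: set_Pi_pmf PiE_dflt_def)
  then show ?thesis by (rule rad_abs)
next
  case False
  then show ?thesis using assms set_Pi_pmf_subset[of A "\<lambda>_. 0" "\<lambda>_. rowp"] by auto
qed

text \<open>The lower side is required everywhere because it limits the number of checkpoints; the
  upper side relates the replay error to the Hamming distance and is required only at the window
  start \<open>p\<close>.\<close>

definition good2 :: "(nat \<Rightarrow> int) \<Rightarrow> nat \<Rightarrow> nat \<Rightarrow> (nat \<Rightarrow> nat \<Rightarrow> int) \<Rightarrow> bool" where
  "good2 y \<kappa> p F \<longleftrightarrow> Qf (tab F) y \<kappa> p \<le> 10 * int R2 * mis (blk y \<kappa>) p p B \<and>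
     (\<forall>i<B. int R2 * mis (blk y \<kappa>) i i B \<le> 4 * Qf (tab F) y \<kappa> i)"

text \<open>Markov's inequality at \<open>p\<close> costs 1/10. The union bound over
  \<open>B \<le> 2 ^ Lg\<close> positions costs at most \<open>(2 / 16) ^ Lg \<le> 1/8\<close>. The
  sum is 9/40.\<close>

lemma prob_bad2:
  assumes y: "bin y" and p: "p < B"
  shows "measure_pmf.prob (Pi_pmf {R1..<R} (\<lambda>_. 0) (\<lambda>_. rowp)) {F. \<not> good2 y \<kappa> p F} \<le> 9 / 40"
proof -
  let ?P = "Pi_pmf {R1..<R} (\<lambda>_. 0) (\<lambda>_. rowp)"
  let ?x = "\<lambda>i j. real_of_int (xi (blk y \<kappa>) i j)"
  let ?S = "\<lambda>i F. \<Sum>\<rho>\<in>{R1..<R}. (lin B (F \<rho>) (?x i))\<^sup>2"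
  let ?m = "\<lambda>i. mis (blk y \<kappa>) i i B"
  let ?U = "{F. ?S p F > 10 * real (card {R1..<R}) * (\<Sum>j<B. (?x p j)\<^sup>2)}"
  let ?L = "\<lambda>i. {F. ?S i F < real (card {R1..<R}) * (\<Sum>j<B. (?x i j)\<^sup>2) / 4}"
  have c: "card {R1..<R} = R2" by (simp add: R_def)
  have "{F. \<not> good2 y \<kappa> p F} \<subseteq> ?U \<union> (\<Union>i\<in>{..<B}. ?L i)"
  proof
    fix F assume "F \<in> {F. \<not> good2 y \<kappa> p F}"
    then consider "\<not> Qf (tab F) y \<kappa> p \<le> 10 * int R2 * ?m p"
      | i where "i < B" "\<not> int R2 * ?m i \<le> 4 * Qf (tab F) y \<kappa> i"
      unfolding good2_def by blast
    then show "F \<in> ?U \<union> (\<Union>i\<in>{..<B}. ?L i)"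
    proof cases
      case 1
      then have "real_of_int (10 * int R2 * ?m p) < real_of_int (Qf (tab F) y \<kappa> p)" by linarith
      then show ?thesis unfolding Qf_tab[OF p] c xi_norm[OF y p] by simp
    next
      case 2
      then have "real_of_int (4 * Qf (tab F) y \<kappa> i) < real_of_int (int R2 * ?m i)" by linarith
      then have "F \<in> ?L i" unfolding c xi_norm[OF y 2(1)] using Qf_tab[OF 2(1), of F y \<kappa>] by simp
      then show ?thesis using 2(1) by blast
    qed
  qed
  then have "measure_pmf.prob ?P {F. \<not> good2 y \<kappa> p F} \<le> measure_pmf.prob ?P (?U \<union> (\<Union>i\<in>{..<B}. ?L i))"
    by (intro measure_pmf.finite_measure_mono) auto
  also have "\<dots> \<le> measure_pmf.prob ?P ?U + measure_pmf.prob ?P (\<Union>i\<in>{..<B}. ?L i)"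
    by (rule measure_Un_le) auto
  also have "measure_pmf.prob ?P ?U \<le> 1 / 10"
    using lin_upper_tail[of "{R1..<R}" "\<lambda>_. 0" B "q + 2" "?x p"] unfolding Wd_def by simp
  also have "measure_pmf.prob ?P (\<Union>i\<in>{..<B}. ?L i) \<le> (\<Sum>i<B. measure_pmf.prob ?P (?L i))"
    by (rule measure_UNION_le) auto
  also have "(\<Sum>i<B. measure_pmf.prob ?P (?L i)) \<le> (\<Sum>i<B. (10 / 11) ^ R2)"
  proof (rule sum_mono)
    fix i
    show "measure_pmf.prob ?P (?L i) \<le> (10 / 11) ^ R2"
      using lin_lower_tail[of "{R1..<R}" "\<lambda>_. 0" B "q + 2" "?x i"] c unfolding Wd_def by simp
  qed
  also have "\<dots> = real B * ((10 / 11) ^ 32) ^ Lg" by (simp add: R2_def power_mult)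
  also have "\<dots> \<le> real n * (1 / 16) ^ Lg"
  proof (intro mult_mono power_mono)
    have "B \<le> B * B" using B1 by simp
    then show "real B \<le> real n" using BB by linarith
  qed (auto simp: power_numeral_reduce field_simps)
  also have "\<dots> \<le> real (2 ^ Lg) * (1 / 16) ^ Lg" using nLg by (intro mult_right_mono) auto
  also have "\<dots> = (1 / 8) ^ Lg" by (simp add: power_mult_distrib[symmetric])
  also have "\<dots> \<le> (1 / 8) ^ 1" using Lg1 by (intro power_decreasing) auto
  finally show ?thesis by simp
qed

definition goodV :: "(nat \<Rightarrow> int) \<Rightarrow> nat \<Rightarrow> nat \<Rightarrow> (nat \<Rightarrow> int) \<Rightarrow> bool" where
  "goodV y \<kappa> i \<tau> \<longleftrightarrow> 2 * int k * int R1 * hd' y \<kappa> i \<le> Vf \<tau> y \<kappa> i * (2 * int k + 1) \<and>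
     Vf \<tau> y \<kappa> i * (2 * int k + 1) \<le> 2 * int R1 * (int k + 1) * hd' y \<kappa> i"

text \<open>For fixed \<open>g\<close> the checkpoint \<open>(c, sig)\<close> is fixed, and so is
  the difference vector; the rows below \<open>R1\<close> are independent of it and the
  concentration bound applies.\<close>

lemma prob_bad1:
  assumes y: "bin y" and i: "i < B" and g2: "good2 y (\<kappa> + le i) (pp i) g"
    and ga: "\<And>\<rho> c. \<bar>g \<rho> c\<bar> \<le> 1"
  shows "measure_pmf.prob (Pi_pmf {..<R1} (\<lambda>_. 0) (\<lambda>_. rowp))
    {f. \<not> goodV y \<kappa> i (tab (\<lambda>x. if x \<in> {R1..<R} then g x else f x))} \<le> 1 / 16"
proof -
  let ?m = "\<lambda>f x. if x \<in> {R1..<R} then g x else f x"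
  let ?\<kappa> = "\<kappa> + le i" and ?p = "pp i"
  let ?Q = "Qf (tab g) y ?\<kappa>" and ?x = "blk y ?\<kappa>"
  have Qm: "Qf (tab (?m f)) y ?\<kappa> = ?Q" for f by (rule Qf_cong) auto
  obtain c sig where cs: "lck ?Q ?x ?p = (c, sig)" "mis ?x sig c ?p * int DKR \<le> 2 * ?Q ?p"
  proof -
    have "sbd (tab g)" using ga by (rule tab_abs)
    from lck_error[where Q = ?Q and x = ?x, OF pp_B[of i] Qf_0[OF this y] Qf_nonneg] g2
    show ?thesis using that unfolding good2_def by blast
  qed
  have c: "sig \<le> c" "c \<le> ?p" using lck_le[of ?Q ?x ?p] cs by auto
  let ?u = "\<lambda>b j. real_of_int (uu (c, sig) y \<kappa> i (b * B + j))"
  define h where "h = hd' y \<kappa> i"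
  define e where "e = mis ?x sig c ?p"
  have norm: "(\<Sum>b<q + 2. \<Sum>j<B. (?u b j)\<^sup>2) = real_of_int h + real_of_int e"
    using uu_norm[OF y i c] by (simp add: h_def e_def)
  have h0: "0 \<le> h" using hd'_le by (simp add: h_def)
  have e0: "0 \<le> e" unfolding e_def by (rule mis_nonneg)
  have "e * int DKR \<le> 20 * int R2 * h"
  proof -
    have "2 * ?Q ?p \<le> 20 * int R2 * mis ?x ?p ?p B" using g2 unfolding good2_def by simp
    also have "\<dots> \<le> 20 * int R2 * h"
      unfolding h_def using left_le_hd[OF i] by (intro mult_left_mono) auto
    finally show ?thesis using cs(2) unfolding e_def by linarith
  qed
  then have "(e * (16 * int k)) * (20 * int R2) \<le> h * (20 * int R2)"
    by (simp add: DKR_def algebra_simps)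
  then have e16: "e * (16 * int k) \<le> h" using R2_pos by (subst (asm) mult_le_cancel_right) auto
  have e16': "real_of_int e * (16 * real k) \<le> real_of_int h"
  proof -
    have "real_of_int (e * (16 * int k)) \<le> real_of_int h" using e16 by (simp only: of_int_le_iff)
    then show ?thesis by simp
  qed
  have Vm: "real_of_int (Vf (tab (?m f)) y \<kappa> i) = (\<Sum>\<rho><R1. (grid B (q + 2) (f \<rho>) ?u)\<^sup>2)" for f
  proof -
    have l: "lck (Qf (tab (?m f)) y ?\<kappa>) ?x ?p = (c, sig)" unfolding Qm by (rule cs(1))
    have "real_of_int (Yp (tab (?m f)) i \<rho> - Wf (tab (?m f)) y \<kappa> i \<rho>) = grid B (q + 2) (f \<rho>) ?u"
      if "\<rho> < R1" for \<rho>
    proof -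
      have "\<rho> < R" using that by (simp add: R_def)
      then show ?thesis unfolding diff_grid[OF i l] grid_tab[OF \<open>\<rho> < R\<close>] using that by simp
    qed
    then show ?thesis unfolding Vf_def of_int_sum of_int_mult
      by (intro sum.cong refl) (simp add: power2_eq_square)
  qed
  let ?bad = "{f. \<bar>(\<Sum>\<rho><R1. (grid B (q + 2) (f \<rho>) ?u)\<^sup>2) - real R1 * (\<Sum>b<q + 2. \<Sum>j<B. (?u b j)\<^sup>2)\<bar>
        > 1 / (16 * real k) * real R1 * (\<Sum>b<q + 2. \<Sum>j<B. (?u b j)\<^sup>2)}"
  have "{f. \<not> goodV y \<kappa> i (tab (?m f))} \<subseteq> ?bad"
  proof (rule ccontr)
    assume "\<not> ?thesis"
    then obtain f where f: "\<not> goodV y \<kappa> i (tab (?m f))" "f \<notin> ?bad" by blast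
    then have V: "\<bar>real_of_int (Vf (tab (?m f)) y \<kappa> i) - real R1 * (real_of_int h + real_of_int e)\<bar>
      \<le> 1 / (16 * real k) * real R1 * (real_of_int h + real_of_int e)"
      unfolding Vm norm by simp
    let ?V = "Vf (tab (?m f)) y \<kappa> i"
    have "2 * real k * real R1 * real_of_int h \<le> real_of_int ?V * (2 * real k + 1)"
      "real_of_int ?V * (2 * real k + 1) \<le> 2 * real R1 * (real k + 1) * real_of_int h"
      using concentration_imp_good[OF _ _ _ _ e16' V] k1 h0 e0 by auto
    then have "real_of_int (2 * int k * int R1 * h) \<le> real_of_int (?V * (2 * int k + 1))"
      "real_of_int (?V * (2 * int k + 1)) \<le> real_of_int (2 * int R1 * (int k + 1) * h)" by simp_all
    then have "goodV y \<kappa> i (tab (?m f))" unfolding goodV_def h_def by (simp only: of_int_le_iff)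
    then show False using f by blast
  qed
  then have "measure_pmf.prob (Pi_pmf {..<R1} (\<lambda>_. 0) (\<lambda>_. rowp)) {f. \<not> goodV y \<kappa> i (tab (?m f))}
     \<le> measure_pmf.prob (Pi_pmf {..<R1} (\<lambda>_. 0) (\<lambda>_. rowp)) ?bad"
    by (intro measure_pmf.finite_measure_mono) auto
  also have "\<dots> \<le> 8 / (real R1 * (1 / (16 * real k))\<^sup>2)"
    unfolding Wd_def by (rule grid_concentration) (use k1 R11 in auto)
  also have "\<dots> = 1 / 16"
    using k1 by (simp add: R1_def power2_eq_square field_simps)
  finally show ?thesis .
qed

text \<open>The checkpoint rows are drawn first. Where they are bad the trivial bound 1 is used,
  elsewhere the bound 1/16; the total is 23/80.\<close>

theorem prob_goodV:
  assumes y: "bin y" and i: "i < B"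
  shows "measure_pmf.prob (rad {..<R * Wd}) {\<tau>. goodV y \<kappa> i \<tau>} \<ge> 2 / 3"
proof -
  let ?G = "Pi_pmf {R1..<R} (\<lambda>_. 0) (\<lambda>_. rowp)" and ?F = "Pi_pmf {..<R1} (\<lambda>_. 0) (\<lambda>_. rowp)"
  let ?m = "\<lambda>g f x. if x \<in> {R1..<R} then g x else f x"
  let ?g2 = "good2 y (\<kappa> + le i) (pp i)"
  have fin: "finite (set_pmf ?G)" "finite (set_pmf ?F)" by (intro finite_set_Pi_pmf; simp)+
  have u: "{..<R} = {R1..<R} \<union> {..<R1}" by (auto simp: R_def)
  have "rad {..<R * Wd} = map_pmf tab (Pi_pmf {..<R} (\<lambda>_. 0) (\<lambda>_. rowp))"
    unfolding Pi_pmf_rows by (simp add: tab_def[abs_def])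
  also have "Pi_pmf {..<R} (\<lambda>_. 0) (\<lambda>_. rowp) = map_pmf (\<lambda>(g, f). ?m g f) (pair_pmf ?G ?F)"
    unfolding u by (rule Pi_pmf_union) auto
  finally have dist: "rad {..<R * Wd} = map_pmf (\<lambda>z. tab (?m (fst z) (snd z))) (pair_pmf ?G ?F)"
    by (simp add: pmf.map_comp o_def case_prod_unfold)
  have "measure_pmf.prob (rad {..<R * Wd}) {\<tau>. \<not> goodV y \<kappa> i \<tau>}
     = E (pair_pmf ?G ?F) (indicator {z. \<not> goodV y \<kappa> i (tab (?m (fst z) (snd z)))})"
    unfolding dist by (simp add: vimage_def)
  also have "\<dots> = E ?G (\<lambda>g. E ?F (\<lambda>f. indicator {z. \<not> goodV y \<kappa> i (tab (?m (fst z) (snd z)))} (g, f)))"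
    by (rule E_pair[OF fin])
  also have "\<dots> = E ?G (\<lambda>g. measure_pmf.prob ?F {f. \<not> goodV y \<kappa> i (tab (?m g f))})"
  proof (rule E_cong)
    fix g
    have "(\<lambda>f. indicator {z. \<not> goodV y \<kappa> i (tab (?m (fst z) (snd z)))} (g, f) :: real)
       = indicator {f. \<not> goodV y \<kappa> i (tab (?m g f))}"
      unfolding indicator_def mem_Collect_eq fst_conv snd_conv ..
    then show "E ?F (\<lambda>f. indicator {z. \<not> goodV y \<kappa> i (tab (?m (fst z) (snd z)))} (g, f))
      = measure_pmf.prob ?F {f. \<not> goodV y \<kappa> i (tab (?m g f))}" by simp
  qed
  also have "\<dots> \<le> E ?G (\<lambda>g. 1 / 16 + indicator {g. \<not> ?g2 g} g)"
  proof (rule E_mono[OF fin(1)])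
    fix g assume g: "g \<in> set_pmf ?G"
    show "measure_pmf.prob ?F {f. \<not> goodV y \<kappa> i (tab (?m g f))} \<le> 1 / 16 + indicator {g. \<not> ?g2 g} g"
    proof (cases "?g2 g")
      case True
      have "\<bar>g \<rho> c\<bar> \<le> 1" for \<rho> c by (rule rows_abs[OF g]) simp
      from prob_bad1[OF y i True this] show ?thesis using True by simp
    next
      case False
      have "measure_pmf.prob ?F {f. \<not> goodV y \<kappa> i (tab (?m g f))} \<le> 1" by (rule measure_pmf.prob_le_1)
      moreover have "indicator {g. \<not> ?g2 g} g = (1::real)" using False by simp
      ultimately show ?thesis by linarith
    qed
  qed
  also have "\<dots> = 1 / 16 + measure_pmf.prob ?G {g. \<not> ?g2 g}"
    using fin by (subst E_add) auto
  also have "\<dots> \<le> 1 / 16 + 9 / 40" using prob_bad2[OF y pp_B[of i], of "\<kappa> + le i"] by linarith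
  finally have b: "measure_pmf.prob (rad {..<R * Wd}) {\<tau>. \<not> goodV y \<kappa> i \<tau>} \<le> 1 / 16 + 9 / 40" .
  have "measure_pmf.prob (rad {..<R * Wd}) (- {\<tau>. goodV y \<kappa> i \<tau>}) = 1 - measure_pmf.prob (rad {..<R * Wd}) {\<tau>. goodV y \<kappa> i \<tau>}"
    by (subst measure_pmf.prob_compl[symmetric]) (auto simp: Compl_eq_Diff_UNIV)
  moreover have "- {\<tau>. goodV y \<kappa> i \<tau>} = {\<tau>. \<not> goodV y \<kappa> i \<tau>}" by auto
  ultimately show ?thesis using b by simp
qed

end

section \<open>The program for an arriving symbol\<close>

abbreviation (input) ex_add (infixl "+:" 65) where "a +: b \<equiv> Op Add a b"
abbreviation (input) ex_sub (infixl "-:" 65) where "a -: b \<equiv> Op Sub a b"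
abbreviation (input) ex_mul (infixl "*:" 70) where "a *: b \<equiv> Op Mul a b"
abbreviation (input) ex_less (infix "<:" 50) where "a <: b \<equiv> Op Less a b"
abbreviation (input) ex_eq (infix "=:" 50) where "a =: b \<equiv> Op Eq a b"
abbreviation (input) cmd_seq (infixr ";;" 40) where "a ;; b \<equiv> Seq a b"

text \<open>Variables: 0 symbol/output, 2 \<open>n\<close>, 3 \<open>k\<close>, 4 \<open>B\<close>, 5 \<open>q\<close>, 6 \<open>m0\<close>, 8 \<open>R1\<close>, 9 \<open>R\<close>, 10 \<open>Cap\<close>,
  11 \<open>G\<close>, 12 \<open>Wd\<close>, 13 \<open>DKR\<close>, 20 position \<open>i\<close> in the current block, 21 its slot, 22--24 the state
  of the scan of the previous block, 25 reference and 26 next checkpoint of the replay.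
  Arrays: 0 signs, 1 pattern prefix, 2 last \<open>B\<close> symbols, 3 \<open>Yp\<close>, 4 \<open>YQ\<close>, 5 sketch of the unscanned
  part of the previous block, 6 sketch of the current block, 7 sketch of the left part,
  8 and 9 sketch of the full blocks now and in the next block, 10--13 number, positions,
  references and sketches of the checkpoints of each slot.\<close>

definition A1 :: cmd where
  "A1 = (Asg 27 (Arr 2 (Var 20)) ;; Sto 2 (Var 20) (Var 0))"

text \<open>The estimate at \<open>i\<close> for the previous block: array 5 holds the sketch of its
  suffix from \<open>i\<close> on.\<close>

definition A2 :: cmd where
  "A2 = (Asg 28 (Cst 0) ;;
     For 16 (Var 8) 9 (Asg 28 (Var 28 +:
       (Arr 5 (Var 16) -: Arr 4 (Var 20 *: Var 9 +: Var 16)) *: (Arr 5 (Var 16) -: Arr 4 (Var 20 *: Var 9 +: Var 16)))))"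

text \<open>The previous block has slot \<open>Var 21 + q\<close> modulo \<open>G\<close>, since
  \<open>q\<close> and \<open>-1\<close> agree modulo \<open>G = q + 1\<close>. At position 0 the
  slot still belongs to an outdated block, so its counter is reset.\<close>

definition A3 :: cmd where
  "A3 = (Asg 30 (Op Mod (Var 21 +: Var 5) (Var 11)) ;; Asg 29 (Cst 0) ;;
     If (Var 20 =: Cst 0)
       (Asg 29 (Cst 1) ;; Asg 22 (Cst 0) ;; Asg 23 (Var 28) ;; Asg 24 (Cst 0) ;; Sto 10 (Var 30) (Cst 0))
       (If (Cst 2 *: Var 28 <: Var 23)
         (Asg 29 (Cst 1) ;; Asg 22 (Var 20) ;; Asg 23 (Var 28) ;; Asg 24 (Cst 0))
         (If (Var 23 <: Var 24 *: Var 13)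
           (Asg 29 (Cst 1) ;; Asg 24 (Cst 0)) Skip)) ;;
     Asg 31 (Arr 10 (Var 30)) ;;
     Asg 29 (Var 29 *: (Var 31 <: Var 10)))"

definition A4 :: cmd where
  "A4 = If (Var 29)
     (Sto 11 (Var 30 *: Var 10 +: Var 31) (Var 20) ;; Sto 12 (Var 30 *: Var 10 +: Var 31) (Var 22) ;;
      Sto 10 (Var 30) (Var 31 +: Cst 1) ;;
      For 16 (Cst 0) 8 (Sto 13 ((Var 30 *: Var 10 +: Var 31) *: Var 8 +: Var 16) (Arr 5 (Var 16)))) Skip"

text \<open>\<open>Var 27\<close> is symbol \<open>i\<close> of the previous block, saved before the
  arriving symbol took its cell. The suffix sketch of the previous block shrinks while the sketch of
  the current one grows.\<close>

definition A5 :: cmd where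
  "A5 = (Asg 24 (Var 24 +: (Cst 1 -: (Var 27 =: Arr 1 (Var 20 -: Var 22)))) ;;
     For 16 (Cst 0) 9
       (Sto 5 (Var 16) (Arr 5 (Var 16) -: Arr 0 (Var 16 *: Var 12 +: Var 20) *: Var 27) ;;
        Sto 6 (Var 16) (Arr 6 (Var 16) +: Arr 0 (Var 16 *: Var 12 +: Var 20) *: Var 0)))"

text \<open>Checkpoints are stored in the order of their positions, so a single pointer
  \<open>Var 26\<close> tells whether the window start sits on one. The pointer restarts with every
  new left block.\<close>

definition A6 :: cmd where
  "A6 = (Asg 32 (Op Mod (Var 20 +: (Var 4 -: Var 6)) (Var 4)) ;;
     Asg 33 (Cst 1 -: (Var 20 <: Var 6)) ;;
     Asg 34 (Op Mod (Var 21 +: Var 33) (Var 11)) ;;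
     If (Var 32 =: Cst 0) (Asg 25 (Cst 0) ;; Asg 26 (Cst 0)) Skip ;;
     Asg 29 (Cst 0) ;;
     If (Var 26 <: Arr 10 (Var 34)) (Asg 29 (Arr 11 (Var 34 *: Var 10 +: Var 26) =: Var 32)) Skip)"

definition A7 :: cmd where
  "A7 = If (Var 29)
     (Asg 25 (Arr 12 (Var 34 *: Var 10 +: Var 26)) ;;
      For 16 (Cst 0) 8 (Sto 7 (Var 16) (Arr 13 ((Var 34 *: Var 10 +: Var 26) *: Var 8 +: Var 16))) ;;
      Asg 26 (Var 26 +: Cst 1)) Skip"

definition sE :: "ex \<Rightarrow> ex" where "sE b = Arr 0 (Var 16 *: Var 12 +: Var 4 +: b)"

text \<open>The first test succeeds when the window start reaches a block boundary: that block
  leaves the sum of the full blocks, and array 7 has just been loaded with its full sketch. The last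
  test extends the sum for the next block by one block, whose full sketch is that of its first
  checkpoint.\<close>

definition A8b :: cmd where
  "A8b =
     (If (Var 32 =: Cst 0) (Sto 8 (Var 16) (Arr 8 (Var 16) -: sE (Cst 1) *: Arr 7 (Var 16))) Skip ;;
      Asg 36 (Arr 3 (Var 20 *: Var 8 +: Var 16) -:
        (sE (Var 5 +: Cst 1) *: Arr 6 (Var 16) +: Arr 8 (Var 16) +: sE (Var 33) *: Arr 7 (Var 16))) ;;
      Asg 35 (Var 35 +: Var 36 *: Var 36) ;;
      Sto 7 (Var 16) (Arr 7 (Var 16) -: Arr 0 (Var 16 *: Var 12 +: Var 32) *: Arr 1 (Var 32 -: Var 25)) ;;
      If (Var 20 +: Cst 1 <: Var 5)
        (Sto 9 (Var 16) (Arr 9 (Var 16) +: sE (Var 20 +: Cst 1) *: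
           Arr 13 (Op Mod (Var 21 +: Var 20 +: Cst 2) (Var 11) *: Var 10 *: Var 8 +: Var 16))) Skip)"

definition A8 :: cmd where
  "A8 = (Asg 35 (Cst 0) ;; For 16 (Cst 0) 8 A8b)"

text \<open>The quotient averages the \<open>R1\<close> rows and shifts the error to one side.
  Rounding down preserves the lower bound because the distance is an integer.\<close>

definition A9 :: cmd where
  "A9 = (Asg 0 (Op Div (Var 35 *: (Cst 2 *: Var 3 +: Cst 1)) (Cst 2 *: Var 3 *: Var 8)) ;;
     Asg 20 (Var 20 +: Cst 1))"

text \<open>At the end of a block its sketch moves from array 6 to array 5 and enters the new sum
  with block sign \<open>q\<close>; this is the one summand that could not be prepared
  earlier.\<close>

definition A10 :: cmd where
  "A10 = If (Var 20 =: Var 4)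
      (For 16 (Cst 0) 9 (Sto 5 (Var 16) (Arr 6 (Var 16)) ;; Sto 6 (Var 16) (Cst 0)) ;;
       For 16 (Cst 0) 8 (Sto 8 (Var 16) (Arr 9 (Var 16) +: sE (Var 5) *: Arr 5 (Var 16)) ;; Sto 9 (Var 16) (Cst 0)) ;;
       Asg 20 (Cst 0) ;; Asg 21 (Op Mod (Var 21 +: Cst 1) (Var 11))) Skip"

definition arrival :: cmd where
  "arrival = (A1 ;; A2 ;; A3 ;; A4 ;; A5 ;; A6 ;; A7 ;; A8 ;; A9 ;; A10)"

lemma vr_upd [simp]: "s\<lparr>vr := f\<rparr> = \<lparr>vr = f, ar = ar s\<rparr>"
  by (cases s) simp

lemma ar_upd [simp]: "s\<lparr>ar := f\<rparr> = \<lparr>vr = vr s, ar = f\<rparr>"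
  by (cases s) simp

definition chg :: "nat set \<Rightarrow> nat set \<Rightarrow> st \<Rightarrow> st \<Rightarrow> bool" where
  "chg X Y s s' \<longleftrightarrow> (\<forall>v. v \<notin> X \<longrightarrow> vr s' v = vr s v) \<and> (\<forall>a. a \<notin> Y \<longrightarrow> ar s' a = ar s a)"

lemma idx_simps [simp]:
  "nat (int a * int b + int c) = a * b + c"
  "nat (int a * int b + int c + int d) = a * b + c + d"
  "nat ((int a * int b + int c) * int d + int e) = (a * b + c) * d + e"
  "nat (int a * int b * int d + int e) = a * b * d + e"
  by (simp_all flip: of_nat_add of_nat_mult)

lemma idx_bound: "a < b \<Longrightarrow> c < d \<Longrightarrow> a * d + c < b * (d::nat)"
proof -
  assume h: "a < b" "c < d"
  have "a * d + c < Suc a * d" using h by simp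
  also have "\<dots> \<le> b * d" using h by (intro mult_le_mono1) simp
  finally show ?thesis .
qed

section \<open>Polynomial bounds on the parameters\<close>

context params
begin

lemma n_le_pow: "0 < j \<Longrightarrow> n \<le> n ^ j"
  using n2 by (simp add: self_le_power)

lemma Bn: "B \<le> n" using BB B1 by (metis le_square le_trans)
lemma qn: "q \<le> n" unfolding q_def using div_le_dividend[of "n - 1" B] by linarith
lemma Lgn': "Lg \<le> n"
proof -
  have "2 ^ Lg < 2 * n" by (rule Lgn)
  moreover have "2 * Lg \<le> 2 ^ Lg"
  proof -
    have "2 * m \<le> 2 ^ m" for m :: nat
    proof (induction m)
      case (Suc m) then show ?case by (cases m) auto
    qed simp
    then show ?thesis .
  qed
  ultimately show ?thesis by linarith
qed
lemma R1n: "R1 \<le> 2 ^ 17 * n ^ 2"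
proof -
  have "k * k \<le> (2 * n) * (2 * n)" using k2 by (intro mult_le_mono) auto
  then show ?thesis unfolding R1_def by (simp add: power2_eq_square)
qed
lemma R2n: "R2 \<le> 2 ^ 5 * n" using Lgn' by (simp add: R2_def)
lemma Rn: "R \<le> 2 ^ 18 * n ^ 2"
proof -
  have "n \<le> n ^ 2" by (rule n_le_pow) simp
  then show ?thesis using R1n R2n unfolding R_def by simp
qed
lemma Capn: "Cap \<le> 2 ^ 15 * n ^ 2"
proof -
  have "k * Lg \<le> (2 * n) * n" using k2 Lgn' by (intro mult_le_mono) auto
  then show ?thesis unfolding Cap_def by (simp add: power2_eq_square mult.assoc mult.commute)
qed
lemma DKRn: "DKR \<le> 2 ^ 15 * n ^ 2"
proof -
  have "k * R2 \<le> (2 * n) * (2 ^ 5 * n)" using k2 R2n by (intro mult_le_mono) auto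
  then show ?thesis unfolding DKR_def by (simp add: power2_eq_square)
qed

end

locale algo = params n k B Lg P + machine w M for n k B Lg :: nat and P :: "bool list" and w M :: nat +
  assumes M_eq: "M = R * Wd + G * Cap * R1" and big: "n ^ 64 \<le> 2 ^ w"
begin

text \<open>Since \<open>n \<ge> 2\<close>, constants up to \<open>2 ^ 40\<close> are absorbed by
  \<open>n ^ 40\<close>. This is why the word size is a generous multiple of the logarithm.\<close>

lemma lt_pw: "x \<le> 2 ^ 40 * n ^ 20 \<Longrightarrow> x < 2 ^ w"
proof -
  assume "x \<le> 2 ^ 40 * n ^ 20"
  also have "\<dots> \<le> n ^ 40 * n ^ 20" using n2 by (intro mult_le_mono1 power_mono) auto
  also have "\<dots> = n ^ 60" by (simp flip: power_add)
  also have "\<dots> < n ^ 64" using n2 by (intro power_strict_increasing) auto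
  finally show ?thesis using big by simp
qed

lemma pow_le: "c \<le> 2 ^ 40 \<Longrightarrow> j \<le> 20 \<Longrightarrow> x \<le> c * n ^ j \<Longrightarrow> x < 2 ^ w"
proof (rule lt_pw)
  assume "c \<le> 2 ^ 40" "j \<le> 20" "x \<le> c * n ^ j"
  moreover have "c * n ^ j \<le> 2 ^ 40 * n ^ 20"
    using calculation n2 by (intro mult_le_mono power_increasing) auto
  ultimately show "x \<le> 2 ^ 40 * n ^ 20" by linarith
qed

lemma small: "n < 2 ^ w" "B < 2 ^ w" "q < 2 ^ w" "R1 < 2 ^ w" "R < 2 ^ w" "Cap < 2 ^ w"
  "x \<le> 10 * n \<Longrightarrow> x < 2 ^ w"
  using pow_le[of 1 1 n] pow_le[of 1 1 B] pow_le[of 1 1 q] pow_le[of "2 ^ 17" 2 R1] pow_le[of "2 ^ 18" 2 R]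
    pow_le[of "2 ^ 15" 2 Cap] Bn qn R1n Rn Capn pow_le[of 10 1 x] by simp_all

lemma mod_w [simp]: "j < 2 ^ w \<Longrightarrow> int j mod 2 ^ w = int j"
  by (rule nat_mod_pw)

lemma RW_M: "R * Wd \<le> M" by (simp add: M_eq)
lemma R_R1: "R1 < R" using Lg1 by (simp add: R_def R2_def)
lemma R_M: "R \<le> M" using RW_M mult_le_mono2[of 1 Wd R] by (simp add: Wd_def)
lemma BR_M: "i < B \<Longrightarrow> \<rho> < R \<Longrightarrow> i * R + \<rho> < M"
proof -
  assume "i < B" "\<rho> < R"
  then have "i * R + \<rho> < B * R" by (rule idx_bound)
  also have "\<dots> \<le> Wd * R" by (intro mult_le_mono1) (simp add: Wd_def)
  finally show ?thesis using RW_M by (simp add: mult.commute)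
qed
lemma BR1_M: "i < B \<Longrightarrow> \<rho> < R1 \<Longrightarrow> i * R1 + \<rho> < M"
proof -
  assume h: "i < B" "\<rho> < R1"
  have "i * R1 \<le> i * R" using R_R1 by (intro mult_le_mono2) simp
  moreover have "i * R + \<rho> < M" using BR_M[of i \<rho>] h R_R1 by simp
  ultimately show ?thesis by linarith
qed
lemma W_M: "\<rho> < R \<Longrightarrow> c < Wd \<Longrightarrow> \<rho> * Wd + c < M"
  using idx_bound[of \<rho> R c Wd] RW_M by simp
lemma B_M: "B \<le> M"
proof -
  have "B * 1 \<le> Wd * R" using R11 R_R1 by (intro mult_le_mono) (auto simp: Wd_def)
  then show ?thesis using RW_M by (simp add: mult.commute)
qed
lemma GCR_M: "sl < G \<Longrightarrow> e < Cap \<Longrightarrow> \<rho> < R1 \<Longrightarrow> (sl * Cap + e) * R1 + \<rho> < M"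
  using idx_bound[of "sl * Cap + e" "G * Cap" \<rho> R1] idx_bound[of sl G e Cap] by (simp add: M_eq)
lemma GC_M: "sl < G \<Longrightarrow> e < Cap \<Longrightarrow> sl * Cap + e < M"
proof -
  assume "sl < G" "e < Cap"
  then have "sl * Cap + e < G * Cap" by (rule idx_bound)
  also have "\<dots> \<le> G * Cap * R1" using R11 by simp
  finally show ?thesis by (simp add: M_eq)
qed
lemma G_M: "G \<le> M"
proof -
  have "G * 1 * 1 \<le> G * Cap * R1" using Cap1 R11 by (intro mult_le_mono) auto
  then show ?thesis unfolding M_eq by linarith
qed

text \<open>A uniform time bound for pieces with at most one loop, of at most \<open>R\<close>
  rounds; 60 is slack for the loop overhead. \<open>A10\<close> has two loops and is charged
  twice.\<close>

definition tm :: "cmd \<Rightarrow> nat" where "tm c = (clen c + 60) * Suc R"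

lemma tm_loopfree: "clen c \<le> tm c"
proof -
  have "clen c * 1 \<le> (clen c + 60) * Suc R" by (intro mult_le_mono) auto
  then show ?thesis by (simp add: tm_def)
qed

lemma tm_For: "hi \<le> R \<Longrightarrow> length (cx 0 e) + 5 + hi * (clen c + 10) \<le> tm (For x e y c)"
proof -
  assume "hi \<le> R"
  then have "hi * (clen c + 10) \<le> R * (clen c + 10)" by (rule mult_le_mono1)
  then show ?thesis by (simp add: tm_def For_def algebra_simps)
qed

end

section \<open>Correctness of the pieces of the arrival program\<close>

context algo
begin

lemma iop_Less [simp]: "a < 2 ^ w \<Longrightarrow> b < 2 ^ w \<Longrightarrow> iop w Less (int a) (int b) = of_bool (a < b)"
  by simp

lemma iop_Eq [simp]: "a < 2 ^ w \<Longrightarrow> b < 2 ^ w \<Longrightarrow> iop w Eq (int a) (int b) = of_bool (a = b)"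
  by simp

lemma iop_Mod [simp]: "a < 2 ^ w \<Longrightarrow> b < 2 ^ w \<Longrightarrow> iop w Mod (int a) (int b) = int (a mod b)"
  by simp

lemma iop_Less_int: "0 \<le> a \<Longrightarrow> a < 2 ^ w \<Longrightarrow> 0 \<le> b \<Longrightarrow> b < 2 ^ w \<Longrightarrow> iop w Less a b = of_bool (a < b)"
  by simp

lemma iop_Eq_int: "0 \<le> a \<Longrightarrow> a < 2 ^ w \<Longrightarrow> 0 \<le> b \<Longrightarrow> b < 2 ^ w \<Longrightarrow> iop w Eq a b = of_bool (a = b)"
  by (auto simp: nat_eq_iff)

lemma w_pos [simp]: "0 < w"
  using one_mod_pw by (cases w) auto

lemma one_mod_w [simp]: "(1::int) mod 2 ^ w = 1"
  by (rule one_mod_pw)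

lemma of_bool_pw [simp]: "(of_bool b :: int) mod 2 ^ w = of_bool b"
  using one_mod_pw by (cases b) auto

declare iop.simps(4-12) [simp del]

lemma tri_For_tm:
  assumes "okx w M s e" "ev w s e = int lo" "vr s y = int hi" "lo \<le> hi" "hi \<le> R" "x \<noteq> y"
    "F lo = s\<lparr>vr := (vr s)(x := int lo)\<rparr>" "loopfree c"
    "\<And>j. lo \<le> j \<Longrightarrow> j < hi \<Longrightarrow>
       okc Pt c (F j) \<and> vr (den Pt c (F j)) x = int j \<and> vr (den Pt c (F j)) y = int hi \<and>
       (den Pt c (F j))\<lparr>vr := (vr (den Pt c (F j)))(x := 1 + int j)\<rparr> = F (Suc j)"
    "Q (F hi)"
  shows "tri Pt (For x e y c) s (tm (For x e y c)) Q"
  using assms small(5) by (intro tri_For_fun[where F = F and lo = lo and hi = hi] tm_For) auto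

lemma tri_den_Seq:
  assumes "loopfree c1" "okc Pt c1 s" "tri Pt c2 (den Pt c1 s) t Q"
  shows "tri Pt (Seq c1 c2) s (clen c1 + t) Q"
  by (rule tri_Seq, rule tri_den) (use assms in auto)

lemma tri_If_bool:
  assumes "okx w M s e" "ev w s e = of_bool b" "b \<Longrightarrow> tri Pt c1 s t Q" "\<not> b \<Longrightarrow> tri Pt c2 s t Q"
    "length (cx 0 e) + t + 3 \<le> T"
  shows "tri Pt (If e c1 c2) s T Q"
  by (rule tri_mono[OF tri_If[OF assms(1), where t = t and Q = Q]]) (use assms(2-5) in auto)

lemma tri_Skip: "Q s \<Longrightarrow> tri Pt Skip s t Q"
  by (rule tri_den) auto

lemma pw1: "1 < (2::nat) ^ w" "2 < (2::nat) ^ w" "0 < (2::nat) ^ w"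
  using small(7)[of 2] small(7)[of 1] n2 by auto

definition cpar :: "(nat \<Rightarrow> int) \<Rightarrow> st \<Rightarrow> bool" where
  "cpar \<tau> s \<longleftrightarrow> vr s 2 = int n \<and> vr s 3 = int k \<and> vr s 4 = int B \<and> vr s 5 = int q \<and> vr s 6 = int m0 \<and>
     vr s 8 = int R1 \<and> vr s 9 = int R \<and> vr s 10 = int Cap \<and> vr s 11 = int G \<and> vr s 12 = int Wd \<and>
     vr s 13 = int DKR \<and> ar s 0 = \<tau> \<and> (\<forall>j<B. ar s 1 j = pat j) \<and>
     (\<forall>i<B. \<forall>\<rho><R1. ar s 3 (i * R1 + \<rho>) = Yp \<tau> i \<rho>) \<and>
     (\<forall>i<B. \<forall>\<rho><R. ar s 4 (i * R + \<rho>) = YQ \<tau> i \<rho>)"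

definition base :: "(nat \<Rightarrow> int) \<Rightarrow> nat \<Rightarrow> nat \<Rightarrow> st \<Rightarrow> bool" where
  "base \<tau> i sl s \<longleftrightarrow> cpar \<tau> s \<and> vr s 20 = int i \<and> vr s 21 = int sl \<and> i < B \<and> sl < G"

abbreviation "cX \<equiv> {2,3,4,5,6,8,9,10,11,12,13,20,21} :: nat set"

lemma base_chg:
  assumes "base \<tau> i sl s" "chg X Y s s'" "X \<inter> cX = {}" "Y \<inter> {0,1,3,4} = {}"
  shows "base \<tau> i sl s'"
proof -
  have "\<And>v. v \<in> cX \<Longrightarrow> vr s' v = vr s v" "\<And>a. a \<in> {0,1,3,4} \<Longrightarrow> ar s' a = ar s a"
    using assms unfolding chg_def by blast+
  then show ?thesis using assms(1) unfolding base_def cpar_def by simp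
qed

lemma Gw: "G < 2 ^ w" using small(7)[of G] qn n2 by (simp add: G_def)
lemma Gq: "x < G \<Longrightarrow> x + q < 2 ^ w" using small(7)[of "x + q"] qn n2 by (simp add: G_def)

lemma tri_A1:
  assumes "base \<tau> i sl s"
  shows "tri Pt A1 s (tm A1) (\<lambda>s'. chg {27} {2} s s' \<and> vr s' 27 = ar s 2 i \<and>
    ar s' 2 = (ar s 2)(i := vr s 0))"
proof (rule tri_den)
  have "i < M" using assms B_M by (simp add: base_def)
  then show "okc Pt A1 s" using assms by (simp add: A1_def base_def)
  show "chg {27} {2} s (den Pt A1 s) \<and> vr (den Pt A1 s) 27 = ar s 2 i \<and> ar (den Pt A1 s) 2 = (ar s 2)(i := vr s 0)"
    using assms by (simp add: A1_def base_def chg_def)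
qed (simp_all add: A1_def[THEN arg_cong[of _ _ loopfree]] tm_loopfree)

lemma tri_A2:
  assumes "base \<tau> i sl s"
  shows "tri Pt A2 s (tm A2) (\<lambda>s'. chg {16, 28} {} s s' \<and>
    vr s' 28 = (\<Sum>\<rho> = R1..<R. (ar s 5 \<rho> - ar s 4 (i * R + \<rho>)) * (ar s 5 \<rho> - ar s 4 (i * R + \<rho>))))"
proof -
  define S where "S j = (\<Sum>\<rho> = R1..<j. (ar s 5 \<rho> - ar s 4 (i * R + \<rho>)) * (ar s 5 \<rho> - ar s 4 (i * R + \<rho>)))" for j
  define F where "F j = \<lparr>vr = (vr s)(28 := S j, 16 := int j), ar = ar s\<rparr>" for j
  let ?b = "Asg 28 (Var 28 +:
       (Arr 5 (Var 16) -: Arr 4 (Var 20 *: Var 9 +: Var 16)) *: (Arr 5 (Var 16) -: Arr 4 (Var 20 *: Var 9 +: Var 16)))"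
  have v: "vr s 20 = int i" "vr s 9 = int R" "vr s 8 = int R1" "i < B"
    using assms by (auto simp: base_def cpar_def)
  have loop: "tri Pt (For 16 (Var 8) 9 ?b) (\<lparr>vr = (vr s)(28 := 0), ar = ar s\<rparr>) (tm (For 16 (Var 8) 9 ?b))
     (\<lambda>s'. chg {16, 28} {} s s' \<and> vr s' 28 = S R)"
  proof (rule tri_For_tm[where F = F and lo = R1 and hi = R])
    show "F R1 = \<lparr>vr = (vr s)(28 := 0), ar = ar s\<rparr>\<lparr>vr := (vr \<lparr>vr = (vr s)(28 := 0), ar = ar s\<rparr>)(16 := int R1)\<rparr>"
      by (simp add: F_def S_def)
  next
    fix j assume j: "R1 \<le> j" "j < R"
    then have "j < M" "i * R + j < M" using R_M BR_M[of i j] v by auto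
    then have "int i * int R + int j < int M" by (simp flip: of_nat_add of_nat_mult)
    then show "okc Pt ?b (F j) \<and> vr (den Pt ?b (F j)) 16 = int j \<and> vr (den Pt ?b (F j)) 9 = int R \<and>
      (den Pt ?b (F j))\<lparr>vr := (vr (den Pt ?b (F j)))(16 := 1 + int j)\<rparr> = F (Suc j)"
      using v j \<open>j < M\<close> by (auto simp: F_def S_def fun_eq_iff)
  qed (use v R_R1 in \<open>auto simp: F_def S_def chg_def\<close>)
  show ?thesis
    unfolding A2_def
    by (rule tri_mono[OF tri_den_Seq[where t = "tm (For 16 (Var 8) 9 ?b)"]])
      (use loop in \<open>simp_all add: S_def tm_def algebra_simps\<close>)
qed

text \<open>At \<open>i = 0\<close> the scan variables and the slot hold remains of older blocks, so
  the premises about them are confined to \<open>0 < i\<close>. The range premises make comparisons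
  of residues agree with comparisons of integers.\<close>

lemma tri_A3:
  assumes b: "base \<tau> i sl s" and cs: "cs = (sl + q) mod G"
    and Q: "vr s 28 = Q i" "0 \<le> Q i" "2 * Q i < 2 ^ w"
    and st: "0 < i \<Longrightarrow> vr s 22 = int sig \<and> vr s 23 = mm \<and> vr s 24 = ee \<and> ar s 10 cs = int (length L)"
    and L0: "i = 0 \<Longrightarrow> L = []"
    and bd: "0 < i \<Longrightarrow> 0 \<le> mm \<and> mm < 2 ^ w \<and> 0 \<le> ee * int DKR \<and> ee * int DKR < 2 ^ w"
    and LC: "length L \<le> Cap"
    and d: "dcs Q i (sig, mm, ee, L) = (fl, sig', mm', ee')"
  shows "tri Pt A3 s (tm A3) (\<lambda>s'. chg {22, 23, 24, 29, 30, 31} {10} s s' \<and>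
    vr s' 22 = int sig' \<and> vr s' 23 = mm' \<and> vr s' 24 = ee' \<and> vr s' 30 = int cs \<and>
    vr s' 31 = int (length L) \<and> vr s' 29 = of_bool (fl \<and> length L < Cap) \<and>
    ar s' 10 = (ar s 10)(cs := int (length L)))"
proof (rule tri_den)
  have csG: "cs < G" by (simp add: cs G_def)
  then have csM: "cs < M" using G_M by simp
  have v: "vr s 20 = int i" "vr s 21 = int sl" "vr s 5 = int q" "vr s 11 = int G" "vr s 13 = int DKR"
    "vr s 10 = int Cap" "i < B" "sl < G"
    using b by (auto simp: base_def cpar_def)
  have iw: "i < 2 ^ w" using v small(2) by simp
  have cs': "iop w Mod (int sl + int q) (int G) = int cs"
    using iop_Mod[of "sl + q" G] Gq[OF v(8)] Gw cs by simp
  have Lw: "length L < 2 ^ w" using LC small(6) by simp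
  have l: "iop w Less (int (length L)) (int Cap) = of_bool (length L < Cap)"
    using Lw small(6) by simp
  have z: "iop w Eq (int i) 0 = of_bool (i = 0)" using iop_Eq[of i 0] iw by simp
  have l1: "iop w Less (2 * Q i) mm = of_bool (2 * Q i < mm)"
    "iop w Less mm (ee * int DKR) = of_bool (mm < ee * int DKR)" if "0 < i"
    using bd[OF that] Q by (simp_all add: iop_Less_int)
  show "loopfree A3" by (simp add: A3_def)
  show "clen A3 \<le> tm A3" by (rule tm_loopfree)
  show "okc Pt A3 s"
    using v cs' csM by (simp add: A3_def)
  show "chg {22, 23, 24, 29, 30, 31} {10} s (den Pt A3 s) \<and>
    vr (den Pt A3 s) 22 = int sig' \<and> vr (den Pt A3 s) 23 = mm' \<and> vr (den Pt A3 s) 24 = ee' \<and> vr (den Pt A3 s) 30 = int cs \<and>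
    vr (den Pt A3 s) 31 = int (length L) \<and> vr (den Pt A3 s) 29 = of_bool (fl \<and> length L < Cap) \<and>
    ar (den Pt A3 s) 10 = (ar s 10)(cs := int (length L))"
  proof (cases "i = 0")
    case True
    have l0: "iop w Less 0 (int Cap) = of_bool (0 < Cap)" using iop_Less[of 0 Cap] small(6) pw1 by simp
    show ?thesis
      using v cs' z d L0[OF True] True Q l0 Cap1 by (auto simp: A3_def chg_def dcs_def)
  next
    case False
    then have i0: "0 < i" by simp
    have up: "(ar s 10)(cs := int (length L)) = ar s 10" using st[OF i0] by auto
    consider "2 * Q i < mm" | "\<not> 2 * Q i < mm" "mm < ee * int DKR" | "\<not> 2 * Q i < mm" "\<not> mm < ee * int DKR"
      by blast
    then show ?thesis
      unfolding up using v cs' z d l l1[OF i0] False Q st[OF i0]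
      by cases (auto simp: A3_def chg_def dcs_def)
  qed
qed

lemma tri_A4:
  assumes b: "base \<tau> i sl s" and cs: "cs < G" "len < Cap"
    and v': "vr s 30 = int cs" "fl \<Longrightarrow> vr s 31 = int len" "vr s 29 = of_bool fl"
  shows "tri Pt A4 s (tm A4) (\<lambda>s'. chg {16} {10, 11, 12, 13} s s' \<and>
     (if fl then ar s' 10 = (ar s 10)(cs := int len + 1) \<and> ar s' 11 = (ar s 11)(cs * Cap + len := int i) \<and>
        ar s' 12 = (ar s 12)(cs * Cap + len := vr s 22) \<and>
        ar s' 13 = (\<lambda>x. if (cs * Cap + len) * R1 \<le> x \<and> x < (cs * Cap + len) * R1 + R1
           then ar s 5 (x - (cs * Cap + len) * R1) else ar s 13 x)
      else ar s' = ar s))"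
proof (cases fl)
  case False
  then show ?thesis
    unfolding A4_def
    by (intro tri_If_bool[where b = fl and t = 0] tri_Skip) (use v' in \<open>auto simp: tm_def chg_def\<close>)
next
  case True
  let ?b = "Sto 13 ((Var 30 *: Var 10 +: Var 31) *: Var 8 +: Var 16) (Arr 5 (Var 16))"
  let ?c = "Sto 11 (Var 30 *: Var 10 +: Var 31) (Var 20) ;; Sto 12 (Var 30 *: Var 10 +: Var 31) (Var 22) ;;
      Sto 10 (Var 30) (Var 31 +: Cst 1) ;; For 16 (Cst 0) 8 ?b"
  let ?a = "cs * Cap + len"
  have v: "vr s 20 = int i" "vr s 10 = int Cap" "vr s 8 = int R1" "vr s 30 = int cs" "vr s 31 = int len"
    using b v' True by (auto simp: base_def cpar_def)
  have aM: "int cs * int Cap + int len < int M" using GC_M[OF cs] by (simp flip: of_nat_add of_nat_mult)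
  have csM: "cs < M" using cs G_M by simp
  define s1 where "s1 = \<lparr>vr = vr s, ar = (ar s)(11 := (ar s 11)(?a := int i), 12 := (ar s 12)(?a := vr s 22),
      10 := (ar s 10)(cs := int len + 1))\<rparr>"
  define F where "F j = \<lparr>vr = (vr s1)(16 := int j), ar = (ar s1)(13 :=
      (\<lambda>x. if ?a * R1 \<le> x \<and> x < ?a * R1 + j then ar s 5 (x - ?a * R1) else ar s 13 x))\<rparr>" for j
  let ?Q = "\<lambda>s'. chg {16} {10, 11, 12, 13} s s' \<and>
     (if fl then ar s' 10 = (ar s 10)(cs := int len + 1) \<and> ar s' 11 = (ar s 11)(?a := int i) \<and>
        ar s' 12 = (ar s 12)(?a := vr s 22) \<and>
        ar s' 13 = (\<lambda>x. if ?a * R1 \<le> x \<and> x < ?a * R1 + R1 then ar s 5 (x - ?a * R1) else ar s 13 x)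
      else ar s' = ar s)"
  have loop: "tri Pt (For 16 (Cst 0) 8 ?b) s1 (tm (For 16 (Cst 0) 8 ?b)) ?Q"
  proof (rule tri_For_tm[where F = F and lo = 0 and hi = R1])
    show "F 0 = s1\<lparr>vr := (vr s1)(16 := int 0)\<rparr>" by (auto simp: F_def s1_def fun_eq_iff)
  next
    fix j assume j: "j < R1"
    have "(cs * Cap + len) * R1 + j < M" using GCR_M[OF cs j] .
    then have m: "(int cs * int Cap + int len) * int R1 + int j < int M"
      by (simp flip: of_nat_add of_nat_mult)
    have jM: "j < M" using j R_R1 R_M by simp
    show "okc Pt ?b (F j) \<and> vr (den Pt ?b (F j)) 16 = int j \<and> vr (den Pt ?b (F j)) 8 = int R1 \<and>
      (den Pt ?b (F j))\<lparr>vr := (vr (den Pt ?b (F j)))(16 := 1 + int j)\<rparr> = F (Suc j)"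
      using v m jM by (auto simp: F_def s1_def fun_eq_iff)
  next
    show "?Q (F R1)" using True by (auto simp: F_def s1_def chg_def)
  qed (use v R_R1 in \<open>auto simp: s1_def\<close>)
  let ?t = "clen (Sto 11 (Var 30 *: Var 10 +: Var 31) (Var 20)) + (clen (Sto 12 (Var 30 *: Var 10 +: Var 31) (Var 22)) +
    (clen (Sto 10 (Var 30) (Var 31 +: Cst 1)) + tm (For 16 (Cst 0) 8 ?b)))"
  have "tri Pt ?c s ?t ?Q"
    by (intro tri_den_Seq) (use v aM csM loop in \<open>simp_all add: s1_def\<close>)
  from tri_If_bool[where b = fl, OF _ _ this, of "Var 29" Skip "tm A4"] show ?thesis
    unfolding A4_def[symmetric] using v'(3) True by (simp add: tm_def A4_def algebra_simps)
qed

end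

lemma idx_simps2 [simp]:
  "nat (int a * int b + int c + 1) = a * b + c + 1"
  "nat (int a * int b + int c + (int d + 1)) = a * b + c + (d + 1)"
  by (simp_all flip: of_nat_add of_nat_mult of_nat_Suc)

context algo
begin

lemma W_int: "\<rho> < R \<Longrightarrow> c < B \<Longrightarrow> int \<rho> * int Wd + int c < int M"
proof -
  assume "\<rho> < R" "c < B"
  then have "\<rho> * Wd + c < M" by (intro W_M) (auto simp: Wd_def)
  then show ?thesis by (simp flip: of_nat_add of_nat_mult)
qed

lemma W_ints: "\<rho> < R1 \<Longrightarrow> c < q + 2 \<Longrightarrow> int \<rho> * int Wd + int B + int c < int M"
proof -
  assume "\<rho> < R1" "c < q + 2"
  then have "\<rho> * Wd + (B + c) < M" using R_R1 by (intro W_M) (auto simp: Wd_def)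
  then show ?thesis by (simp add: algebra_simps flip: of_nat_add of_nat_mult)
qed

lemma tri_A5:
  assumes b: "base \<tau> i sl s" and v': "vr s 22 = int sig" "sig \<le> i" "vr s 27 = 0 \<or> vr s 27 = 1"
  shows "tri Pt A5 s (tm A5) (\<lambda>s'. chg {16, 24} {5, 6} s s' \<and>
    vr s' 24 = vr s 24 + of_bool (vr s 27 \<noteq> pat (i - sig)) \<and>
    (\<forall>\<rho><R. ar s' 5 \<rho> = ar s 5 \<rho> - sr \<tau> \<rho> i * vr s 27 \<and> ar s' 6 \<rho> = ar s 6 \<rho> + sr \<tau> \<rho> i * vr s 0))"
proof -
  let ?a = "Asg 24 (Var 24 +: (Cst 1 -: (Var 27 =: Arr 1 (Var 20 -: Var 22))))"
  let ?b = "Sto 5 (Var 16) (Arr 5 (Var 16) -: Arr 0 (Var 16 *: Var 12 +: Var 20) *: Var 27) ;;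
        Sto 6 (Var 16) (Arr 6 (Var 16) +: Arr 0 (Var 16 *: Var 12 +: Var 20) *: Var 0)"
  have v: "vr s 20 = int i" "vr s 9 = int R" "vr s 12 = int Wd" "i < B" "ar s 0 = \<tau>" "ar s 1 (i - sig) = pat (i - sig)"
    using b by (auto simp: base_def cpar_def)
  have isg: "int i - int sig = int (i - sig)" using v' by simp
  have eq: "iop w Eq (vr s 27) (pat (i - sig)) = of_bool (vr s 27 = pat (i - sig))"
    using v'(3) pat_bin[of "i - sig"] pw1(1) by (intro iop_Eq_int) auto
  define s1 where "s1 = \<lparr>vr = (vr s)(24 := vr s 24 + of_bool (vr s 27 \<noteq> pat (i - sig))), ar = ar s\<rparr>"
  define F where "F j = \<lparr>vr = (vr s1)(16 := int j), ar = (ar s)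
     (5 := \<lambda>\<rho>. if \<rho> < j then ar s 5 \<rho> - sr \<tau> \<rho> i * vr s 27 else ar s 5 \<rho>,
      6 := \<lambda>\<rho>. if \<rho> < j then ar s 6 \<rho> + sr \<tau> \<rho> i * vr s 0 else ar s 6 \<rho>)\<rparr>" for j
  let ?Q = "\<lambda>s'. chg {16, 24} {5, 6} s s' \<and>
    vr s' 24 = vr s 24 + of_bool (vr s 27 \<noteq> pat (i - sig)) \<and>
    (\<forall>\<rho><R. ar s' 5 \<rho> = ar s 5 \<rho> - sr \<tau> \<rho> i * vr s 27 \<and> ar s' 6 \<rho> = ar s 6 \<rho> + sr \<tau> \<rho> i * vr s 0)"
  have d: "den Pt ?a s = s1"
    using v v' eq isg by (auto simp: s1_def fun_eq_iff simp del: of_nat_diff)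
  have ok: "okc Pt ?a s" using v v' B_M isg by (auto simp del: of_nat_diff)
  have loop: "tri Pt (For 16 (Cst 0) 9 ?b) s1 (tm (For 16 (Cst 0) 9 ?b)) ?Q"
  proof (rule tri_For_tm[where F = F and lo = 0 and hi = R])
    show "F 0 = s1\<lparr>vr := (vr s1)(16 := int 0)\<rparr>" by (auto simp: F_def s1_def fun_eq_iff)
  next
    fix j assume j: "j < R"
    have jM: "j < M" using j R_M by simp
    show "okc Pt ?b (F j) \<and> vr (den Pt ?b (F j)) 16 = int j \<and> vr (den Pt ?b (F j)) 9 = int R \<and>
      (den Pt ?b (F j))\<lparr>vr := (vr (den Pt ?b (F j)))(16 := 1 + int j)\<rparr> = F (Suc j)"
      using v W_int[OF j v(4)] jM by (auto simp: F_def s1_def fun_eq_iff sr_def less_Suc_eq)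
  next
    show "?Q (F R)" by (auto simp: F_def s1_def chg_def)
  qed (use v in \<open>auto simp: s1_def\<close>)
  show ?thesis
    unfolding A5_def
    by (rule tri_mono[OF tri_den_Seq[where t = "tm (For 16 (Cst 0) 9 ?b)", OF _ ok]])
      (use loop d in \<open>simp_all add: tm_def algebra_simps\<close>)
qed

lemma tri_A6:
  assumes b: "base \<tau> i sl s" and ls: "ls = (sl + le i) mod G"
    and st: "0 < pp i \<Longrightarrow> vr s 26 = int cp \<and> vr s 25 = int lsg"
    and st0: "pp i = 0 \<Longrightarrow> cp = 0 \<and> lsg = 0"
    and ck: "ar s 10 ls = int len" "len \<le> Cap" "cp \<le> Cap"
    and pos: "cp < len \<Longrightarrow> ar s 11 (ls * Cap + cp) = int c \<and> c < B"
  shows "tri Pt A6 s (tm A6) (\<lambda>s'. chg {25, 26, 29, 32, 33, 34} {} s s' \<and>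
    vr s' 32 = int (pp i) \<and> vr s' 33 = int (le i) \<and> vr s' 34 = int ls \<and>
    vr s' 25 = int lsg \<and> vr s' 26 = int cp \<and> vr s' 29 = of_bool (cp < len \<and> c = pp i))"
proof (rule tri_den)
  have v: "vr s 20 = int i" "vr s 21 = int sl" "vr s 4 = int B" "vr s 6 = int m0" "vr s 11 = int G"
    "vr s 10 = int Cap" "i < B" "sl < G"
    using b by (auto simp: base_def cpar_def)
  have lsG: "ls < G" by (simp add: ls G_def)
  have lsM: "ls < M" using lsG G_M by simp
  have bm: "int B - int m0 = int (B - m0)" using m0B by simp
  have p: "iop w Mod (int i + (int B - int m0)) (int B) = int (pp i)"
    using iop_Mod[of "i + (B - m0)" B] small(2) small(7)[of "i + (B - m0)"] v Bn unfolding bm pp_def by (simp del: of_nat_diff)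
  have l: "1 - iop w Less (int i) (int m0) = int (le i)"
    using iop_Less[of i m0] small(2) v m0B by (simp add: le_def)
  have ls': "iop w Mod (int sl + int (le i)) (int G) = int ls"
    using iop_Mod[of "sl + le i" G] Gq[OF v(8)] Gw ls q1 by (simp add: le_def)
  have z: "iop w Eq (int (pp i)) 0 = of_bool (pp i = 0)"
    using iop_Eq[of "pp i" 0] pp_B[of i] small(2) by simp
  have lc: "iop w Less (int cp) (int len) = of_bool (cp < len)"
    using iop_Less[of cp len] ck small(6) by simp
  have lc0: "iop w Less 0 (int len) = of_bool (0 < len)"
    using iop_Less[of 0 len] ck small(6) pw1 by simp
  have e: "iop w Eq (int c) (int (pp i)) = of_bool (c = pp i)" if "cp < len"
    using iop_Eq[of c "pp i"] pp_B[of i] small(2) pos[OF that] by simp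
  have e0: "iop w Eq (int c) 0 = of_bool (c = 0)" if "cp < len"
    using iop_Eq[of c 0] small(2) pos[OF that] pw1 by simp
  have cM: "int ls * int Cap + int cp < int M" if "cp < len"
    using GC_M[OF lsG, of cp] that ck by (simp flip: of_nat_add of_nat_mult)
  have cM0: "int ls * int Cap < int M"
    using GC_M[OF lsG, of 0] Cap1 by (simp flip: of_nat_add of_nat_mult)
  have n0: "nat (int ls * int Cap) = ls * Cap" by (simp flip: of_nat_mult)
  show "loopfree A6" by (simp add: A6_def)
  show "clen A6 \<le> tm A6" by (rule tm_loopfree)
  show "okc Pt A6 s"
    using v p l ls' z lc lc0 lsM ck cM cM0 st st0 by (auto simp: A6_def)
  show "chg {25, 26, 29, 32, 33, 34} {} s (den Pt A6 s) \<and>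
    vr (den Pt A6 s) 32 = int (pp i) \<and> vr (den Pt A6 s) 33 = int (le i) \<and> vr (den Pt A6 s) 34 = int ls \<and>
    vr (den Pt A6 s) 25 = int lsg \<and> vr (den Pt A6 s) 26 = int cp \<and> vr (den Pt A6 s) 29 = of_bool (cp < len \<and> c = pp i)"
    using v p l ls' z lc lc0 ck st st0 e e0 pos n0 by (auto simp: A6_def chg_def)
qed

lemma tri_A7:
  assumes b: "base \<tau> i sl s" and fl: "vr s 29 = of_bool fl"
    and st: "fl \<Longrightarrow> vr s 34 = int ls \<and> vr s 26 = int cp \<and> ls < G \<and> cp < Cap"
  shows "tri Pt A7 s (tm A7) (\<lambda>s'. chg {16, 25, 26} {7} s s' \<and>
    (if fl then vr s' 25 = ar s 12 (ls * Cap + cp) \<and> vr s' 26 = int cp + 1 \<and>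
        (\<forall>\<rho><R1. ar s' 7 \<rho> = ar s 13 ((ls * Cap + cp) * R1 + \<rho>))
     else vr s' 25 = vr s 25 \<and> vr s' 26 = vr s 26 \<and> ar s' 7 = ar s 7))"
proof (cases fl)
  case False
  then show ?thesis
    unfolding A7_def
    by (intro tri_If_bool[where b = fl and t = 0] tri_Skip) (use fl in \<open>auto simp: tm_def chg_def\<close>)
next
  case True
  let ?a = "Asg 25 (Arr 12 (Var 34 *: Var 10 +: Var 26))"
  let ?b = "Sto 7 (Var 16) (Arr 13 ((Var 34 *: Var 10 +: Var 26) *: Var 8 +: Var 16))"
  let ?e = "Asg 26 (Var 26 +: Cst 1)"
  note s = st[OF True]
  have v: "vr s 10 = int Cap" "vr s 8 = int R1" using b by (auto simp: base_def cpar_def)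
  have aM: "int ls * int Cap + int cp < int M" using GC_M[of ls cp] s by (simp flip: of_nat_add of_nat_mult)
  define s1 where "s1 = \<lparr>vr = (vr s)(25 := ar s 12 (ls * Cap + cp)), ar = ar s\<rparr>"
  have d: "den Pt ?a s = s1" "okc Pt ?a s" using v s aM by (simp_all add: s1_def)
  define F where "F j = \<lparr>vr = (vr s1)(16 := int j), ar = (ar s)
     (7 := \<lambda>\<rho>. if \<rho> < j then ar s 13 ((ls * Cap + cp) * R1 + \<rho>) else ar s 7 \<rho>)\<rparr>" for j
  let ?Q = "\<lambda>s'. chg {16, 25, 26} {7} s s' \<and>
    (if fl then vr s' 25 = ar s 12 (ls * Cap + cp) \<and> vr s' 26 = int cp + 1 \<and>
        (\<forall>\<rho><R1. ar s' 7 \<rho> = ar s 13 ((ls * Cap + cp) * R1 + \<rho>))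
     else vr s' 25 = vr s 25 \<and> vr s' 26 = vr s 26 \<and> ar s' 7 = ar s 7)"
  have loop: "tri Pt (For 16 (Cst 0) 8 ?b) s1 (tm (For 16 (Cst 0) 8 ?b)) (\<lambda>s'. tri Pt ?e s' (clen ?e) ?Q)"
  proof (rule tri_For_tm[where F = F and lo = 0 and hi = R1])
    show "F 0 = s1\<lparr>vr := (vr s1)(16 := int 0)\<rparr>" by (auto simp: F_def s1_def fun_eq_iff)
  next
    fix j assume j: "j < R1"
    have jM: "j < M" using j R_M R_R1 by simp
    have "(ls * Cap + cp) * R1 + j < M" using GCR_M[of ls cp j] s j by simp
    then have "(int ls * int Cap + int cp) * int R1 + int j < int M" by (simp flip: of_nat_add of_nat_mult)
    then show "okc Pt ?b (F j) \<and> vr (den Pt ?b (F j)) 16 = int j \<and> vr (den Pt ?b (F j)) 8 = int R1 \<and>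
      (den Pt ?b (F j))\<lparr>vr := (vr (den Pt ?b (F j)))(16 := 1 + int j)\<rparr> = F (Suc j)"
      using v s jM by (auto simp: F_def s1_def fun_eq_iff less_Suc_eq)
  next
    show "tri Pt ?e (F R1) (clen ?e) ?Q"
      by (rule tri_den) (use s True in \<open>auto simp: F_def s1_def chg_def\<close>)
  qed (use v R_R1 in \<open>auto simp: s1_def\<close>)
  have "tri Pt (?a ;; For 16 (Cst 0) 8 ?b ;; ?e) s (clen ?a + (tm (For 16 (Cst 0) 8 ?b) + clen ?e)) ?Q"
    by (intro tri_den_Seq tri_Seq) (use d loop in simp_all)
  from tri_If_bool[where b = fl, OF _ _ this, of "Var 29" Skip "tm A7"] show ?thesis
    unfolding A7_def[symmetric] using fl True by (simp add: tm_def A7_def algebra_simps)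
qed

lemma den_A8b:
  assumes v: "vr u 16 = int j" "vr u 20 = int i" "vr u 21 = int sl" "vr u 4 = int B" "vr u 5 = int q"
      "vr u 11 = int G" "vr u 10 = int Cap" "vr u 8 = int R1" "vr u 12 = int Wd" "vr u 32 = int p" "vr u 33 = int l"
      "vr u 25 = int lsg"
    and ops: "iop w Eq (int p) 0 = of_bool (p = 0)" "iop w Mod (int sl + int i + 2) (int G) = int g"
      "iop w Less (int i + 1) (int q) = of_bool (i + 1 < q)" "int p - int lsg = int pl"
    and bd: "j < M" "int i * int R1 + int j < int M" "int g * int Cap * int R1 + int j < int M"
      "int j * int Wd + int B + 1 < int M" "int j * int Wd + int B + (int q + 1) < int M"
      "int j * int Wd + int B + int l < int M" "i + 1 < q \<Longrightarrow> int j * int Wd + int B + (int i + 1) < int M"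
      "int j * int Wd + int p < int M" "pl < M"
  defines "m \<equiv> ar u 8 j - (if p = 0 then ar u 0 (j * Wd + B + 1) * ar u 7 j else 0)"
  defines "d \<equiv> ar u 3 (i * R1 + j) - (ar u 0 (j * Wd + B + (q + 1)) * ar u 6 j + m + ar u 0 (j * Wd + B + l) * ar u 7 j)"
  shows "den Pt A8b u = \<lparr>vr = (vr u)(36 := d, 35 := vr u 35 + d * d), ar = (ar u)(8 := (ar u 8)(j := m),
      7 := (ar u 7)(j := ar u 7 j - ar u 0 (j * Wd + p) * ar u 1 pl),
      9 := (ar u 9)(j := ar u 9 j + (if i + 1 < q then ar u 0 (j * Wd + B + (i + 1)) * ar u 13 (g * Cap * R1 + j) else 0)))\<rparr>"
    "okc Pt A8b u"
proof -
  let ?c1 = "If (Var 32 =: Cst 0) (Sto 8 (Var 16) (Arr 8 (Var 16) -: sE (Cst 1) *: Arr 7 (Var 16))) Skip"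
  let ?c2 = "Asg 36 (Arr 3 (Var 20 *: Var 8 +: Var 16) -:
        (sE (Var 5 +: Cst 1) *: Arr 6 (Var 16) +: Arr 8 (Var 16) +: sE (Var 33) *: Arr 7 (Var 16)))"
  let ?c3 = "Asg 35 (Var 35 +: Var 36 *: Var 36)"
  let ?c4 = "Sto 7 (Var 16) (Arr 7 (Var 16) -: Arr 0 (Var 16 *: Var 12 +: Var 32) *: Arr 1 (Var 32 -: Var 25))"
  let ?c5 = "If (Var 20 +: Cst 1 <: Var 5)
        (Sto 9 (Var 16) (Arr 9 (Var 16) +: sE (Var 20 +: Cst 1) *:
           Arr 13 (Op Mod (Var 21 +: Var 20 +: Cst 2) (Var 11) *: Var 10 *: Var 8 +: Var 16))) Skip"
  define u1 where "u1 = \<lparr>vr = vr u, ar = (ar u)(8 := (ar u 8)(j := m))\<rparr>"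
  define u2 where "u2 = \<lparr>vr = (vr u)(36 := d), ar = ar u1\<rparr>"
  define u3 where "u3 = \<lparr>vr = (vr u)(36 := d, 35 := vr u 35 + d * d), ar = ar u1\<rparr>"
  define u4 where "u4 = \<lparr>vr = vr u3, ar = (ar u1)(7 := (ar u 7)(j := ar u 7 j - ar u 0 (j * Wd + p) * ar u 1 pl))\<rparr>"
  have 1: "den Pt ?c1 u = u1 \<and> okc Pt ?c1 u"
    using v ops(1) bd by (cases "p = 0") (simp_all add: u1_def m_def sE_def)
  have 2: "den Pt ?c2 u1 = u2 \<and> okc Pt ?c2 u1"
    using v bd by (simp add: u1_def u2_def d_def sE_def)
  have 3: "den Pt ?c3 u2 = u3 \<and> okc Pt ?c3 u2"
    by (simp add: u2_def u3_def)
  have 4: "den Pt ?c4 u3 = u4 \<and> okc Pt ?c4 u3"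
    using v bd ops(4) by (simp add: u3_def u4_def u1_def)
  have 5: "den Pt ?c5 u4 = \<lparr>vr = vr u3, ar = (ar u4)(9 := (ar u 9)(j := ar u 9 j +
      (if i + 1 < q then ar u 0 (j * Wd + B + (i + 1)) * ar u 13 (g * Cap * R1 + j) else 0)))\<rparr> \<and> okc Pt ?c5 u4"
    using v bd ops(2,3) by (cases "i + 1 < q") (simp_all add: u3_def u4_def u1_def sE_def fun_eq_iff)
  show "den Pt A8b u = \<lparr>vr = (vr u)(36 := d, 35 := vr u 35 + d * d), ar = (ar u)(8 := (ar u 8)(j := m),
      7 := (ar u 7)(j := ar u 7 j - ar u 0 (j * Wd + p) * ar u 1 pl),
      9 := (ar u 9)(j := ar u 9 j + (if i + 1 < q then ar u 0 (j * Wd + B + (i + 1)) * ar u 13 (g * Cap * R1 + j) else 0)))\<rparr>"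
    unfolding A8b_def den.simps(4) 1[THEN conjunct1] 2[THEN conjunct1] 3[THEN conjunct1] 4[THEN conjunct1] 5[THEN conjunct1]
    by (simp only: u3_def u4_def u1_def st.simps)
  show "okc Pt A8b u"
    unfolding A8b_def okc.simps(4) using 1 2 3 4 5 by (simp only: simp_thms)
qed

lemma tri_A8:
  assumes b: "base \<tau> i sl s"
    and st: "vr s 32 = int p" "p < B" "vr s 33 = int l" "l \<le> 1" "vr s 25 = int lsg" "lsg \<le> p"
  defines "m \<equiv> \<lambda>\<rho>. ar s 8 \<rho> - (if p = 0 then ss \<tau> \<rho> 1 * ar s 7 \<rho> else 0)"
  defines "d \<equiv> \<lambda>\<rho>. Yp \<tau> i \<rho> - (ss \<tau> \<rho> (q + 1) * ar s 6 \<rho> + m \<rho> + ss \<tau> \<rho> l * ar s 7 \<rho>)"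
  shows "tri Pt A8 s (tm A8) (\<lambda>s'. chg {16, 35, 36} {7, 8, 9} s s' \<and>
    vr s' 35 = (\<Sum>\<rho><R1. d \<rho> * d \<rho>) \<and>
    (\<forall>\<rho><R1. ar s' 8 \<rho> = m \<rho> \<and> ar s' 7 \<rho> = ar s 7 \<rho> - sr \<tau> \<rho> p * pat (p - lsg) \<and>
       ar s' 9 \<rho> = ar s 9 \<rho> + (if i + 1 < q then
          ss \<tau> \<rho> (i + 1) * ar s 13 ((sl + i + 2) mod G * Cap * R1 + \<rho>) else 0)))"
proof -
  let ?a = "Asg 35 (Cst 0)"
  have v: "vr s 20 = int i" "vr s 21 = int sl" "vr s 4 = int B" "vr s 5 = int q" "vr s 11 = int G"
    "vr s 10 = int Cap" "vr s 8 = int R1" "vr s 12 = int Wd" "i < B" "sl < G" "ar s 0 = \<tau>"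
    "\<And>\<rho>. \<rho> < R1 \<Longrightarrow> ar s 3 (i * R1 + \<rho>) = Yp \<tau> i \<rho>" "\<And>j. j < B \<Longrightarrow> ar s 1 j = pat j"
    using b by (auto simp: base_def cpar_def)
  let ?g = "(sl + i + 2) mod G"
  define a9 where "a9 \<rho> = ar s 9 \<rho> + (if i + 1 < q then ss \<tau> \<rho> (i + 1) * ar s 13 (?g * Cap * R1 + \<rho>) else 0)" for \<rho>
  define F where "F j = \<lparr>vr = (vr s)(35 := (\<Sum>\<rho><j. d \<rho> * d \<rho>), 36 := (if j = 0 then vr s 36 else d (j - 1)), 16 := int j),
     ar = (ar s)
     (8 := \<lambda>\<rho>. if \<rho> < j then m \<rho> else ar s 8 \<rho>,
      7 := \<lambda>\<rho>. if \<rho> < j then ar s 7 \<rho> - sr \<tau> \<rho> p * pat (p - lsg) else ar s 7 \<rho>,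
      9 := \<lambda>\<rho>. if \<rho> < j then a9 \<rho> else ar s 9 \<rho>)\<rparr>" for j
  have z: "iop w Eq (int p) 0 = of_bool (p = 0)"
    using iop_Eq[of p 0] st small(2) by simp
  have g: "iop w Mod (int sl + int i + 2) (int G) = int ?g"
  proof -
    have "sl + i + 2 \<le> 10 * n" using v Bn qn n2 by (simp add: G_def)
    then have "sl + i + 2 < 2 ^ w" by (rule small(7))
    moreover have "int sl + int i + 2 = int (sl + i + 2)" by simp
    ultimately show ?thesis using Gw by (simp only: iop_Mod)
  qed
  have l: "iop w Less (int i + 1) (int q) = of_bool (i + 1 < q)"
  proof -
    have "i + 1 < 2 ^ w" using small(2) v by simp
    moreover have "int i + 1 = int (i + 1)" by simp
    ultimately show ?thesis using small(3) by (simp only: iop_Less)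
  qed
  have pl: "int p - int lsg = int (p - lsg)" using st by simp
  have gG: "?g < G" by (simp add: G_def)
  let ?Q = "\<lambda>s'. chg {16, 35, 36} {7, 8, 9} s s' \<and>
    vr s' 35 = (\<Sum>\<rho><R1. d \<rho> * d \<rho>) \<and>
    (\<forall>\<rho><R1. ar s' 8 \<rho> = m \<rho> \<and> ar s' 7 \<rho> = ar s 7 \<rho> - sr \<tau> \<rho> p * pat (p - lsg) \<and> ar s' 9 \<rho> = a9 \<rho>)"
  have loop: "tri Pt (For 16 (Cst 0) 8 A8b) \<lparr>vr = (vr s)(35 := 0), ar = ar s\<rparr> (tm (For 16 (Cst 0) 8 A8b)) ?Q"
  proof (rule tri_For_tm[where F = F and lo = 0 and hi = R1])
    show "F 0 = \<lparr>vr = (vr s)(35 := 0), ar = ar s\<rparr>\<lparr>vr := (vr \<lparr>vr = (vr s)(35 := 0), ar = ar s\<rparr>)(16 := int 0)\<rparr>"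
      by (auto simp: F_def fun_eq_iff)
  next
    fix j assume j: "j < R1"
    have jR: "j < R" using j R_R1 by simp
    have jM: "j < M" using jR R_M by simp
    have i1: "int i * int R1 + int j < int M" using BR1_M[OF v(9) j] by (simp flip: of_nat_add of_nat_mult)
    have i2: "int ?g * int Cap * int R1 + int j < int M"
      using GCR_M[OF gG, of 0 j] Cap1 j by (simp flip: of_nat_add of_nat_mult)
    have w1: "int j * int Wd + int B + 1 < int M" using W_ints[OF j, of 1] by simp
    have w2: "int j * int Wd + int B + (int q + 1) < int M" using W_ints[OF j, of "q + 1"] by simp
    have w3: "int j * int Wd + int B + int l < int M" using W_ints[OF j, of l] st by simp
    have w4: "i + 1 < q \<Longrightarrow> int j * int Wd + int B + (int i + 1) < int M" using W_ints[OF j, of "i + 1"] by simp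
    have w5: "int j * int Wd + int p < int M" using W_int[OF jR st(2)] .
    have pM: "p - lsg < M" "p - lsg < B" using st B_M by auto
    have sj: "ss \<tau> j b = \<tau> (j * Wd + B + b)" for b by (simp add: ss_def)
    have Fv: "vr (F j) 16 = int j" "vr (F j) 20 = int i" "vr (F j) 21 = int sl" "vr (F j) 4 = int B" "vr (F j) 5 = int q"
      "vr (F j) 11 = int G" "vr (F j) 10 = int Cap" "vr (F j) 8 = int R1" "vr (F j) 12 = int Wd" "vr (F j) 32 = int p"
      "vr (F j) 33 = int l" "vr (F j) 25 = int lsg"
      using v st by (simp_all add: F_def)
    have Fa: "ar (F j) 0 = \<tau>" "ar (F j) 1 (p - lsg) = pat (p - lsg)" "ar (F j) 3 (i * R1 + j) = Yp \<tau> i j"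
      "ar (F j) 6 = ar s 6" "ar (F j) 13 = ar s 13" "ar (F j) 7 j = ar s 7 j" "ar (F j) 8 j = ar s 8 j" "ar (F j) 9 j = ar s 9 j"
      using v pM j by (simp_all add: F_def)
    have mj: "ar s 8 j - (if p = 0 then \<tau> (j * Wd + B + 1) * ar s 7 j else 0) = m j" by (simp add: m_def ss_def)
    have dj: "Yp \<tau> i j - (\<tau> (j * Wd + B + (q + 1)) * ar s 6 j + m j + \<tau> (j * Wd + B + l) * ar s 7 j) = d j"
      by (simp add: d_def ss_def)
    have aj: "ar s 9 j + (if i + 1 < q then \<tau> (j * Wd + B + (i + 1)) * ar s 13 (?g * Cap * R1 + j) else 0) = a9 j"
      by (simp add: a9_def ss_def)
    have sj: "\<tau> (j * Wd + p) = sr \<tau> j p" by (simp add: sr_def)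
    note D = den_A8b[OF Fv z g l pl jM i1 i2 w1 w2 w3 w4 w5 pM(1), unfolded Fa mj dj aj sj, of Pt]
    have up: "(\<lambda>\<rho>. if \<rho> < j then f \<rho> else h \<rho>)(j := f j) = (\<lambda>\<rho>. if \<rho> < Suc j then f \<rho> else h \<rho>)" for f h :: "nat \<Rightarrow> int"
      by (auto simp: fun_eq_iff less_Suc_eq)
    have Far: "ar (F j) 8 = (\<lambda>\<rho>. if \<rho> < j then m \<rho> else ar s 8 \<rho>)"
      "ar (F j) 7 = (\<lambda>\<rho>. if \<rho> < j then ar s 7 \<rho> - sr \<tau> \<rho> p * pat (p - lsg) else ar s 7 \<rho>)"
      "ar (F j) 9 = (\<lambda>\<rho>. if \<rho> < j then a9 \<rho> else ar s 9 \<rho>)" "vr (F j) 35 = (\<Sum>\<rho><j. d \<rho> * d \<rho>)"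
      by (simp_all add: F_def)
    have ard: "ar (den Pt A8b (F j)) = ar (F (Suc j))"
    proof -
      have "ar (den Pt A8b (F j)) = (ar (F j))(8 := (ar (F j) 8)(j := m j),
          7 := (ar (F j) 7)(j := ar s 7 j - sr \<tau> j p * pat (p - lsg)), 9 := (ar (F j) 9)(j := a9 j))"
        using arg_cong[OF D(1), of ar] by simp
      also have "\<dots> = ar (F (Suc j))"
        unfolding Far up[of m] up[of a9] up[of "\<lambda>\<rho>. ar s 7 \<rho> - sr \<tau> \<rho> p * pat (p - lsg)"]
        by (simp add: F_def fun_eq_iff)
      finally show ?thesis .
    qed
    have vrd: "vr (den Pt A8b (F j)) = (vr (F j))(36 := d j, 35 := (\<Sum>\<rho><Suc j. d \<rho> * d \<rho>))"
      using arg_cong[OF D(1), of vr] Far(4) by simp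
    have "\<lparr>vr = ((vr (F j))(36 := d j, 35 := (\<Sum>\<rho><Suc j. d \<rho> * d \<rho>)))(16 := 1 + int j), ar = ar (F (Suc j))\<rparr> = F (Suc j)"
      by (simp add: F_def fun_eq_iff)
    then have "(den Pt A8b (F j))\<lparr>vr := (vr (den Pt A8b (F j)))(16 := 1 + int j)\<rparr> = F (Suc j)"
      unfolding vr_upd vrd ard .
    then show "okc Pt A8b (F j) \<and> vr (den Pt A8b (F j)) 16 = int j \<and> vr (den Pt A8b (F j)) 8 = int R1 \<and>
      (den Pt A8b (F j))\<lparr>vr := (vr (den Pt A8b (F j)))(16 := 1 + int j)\<rparr> = F (Suc j)"
      using D(2) Fv unfolding vrd by simp
  next
    show "?Q (F R1)" by (auto simp: F_def chg_def)
  next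
    show "loopfree A8b" by (simp add: A8b_def)
  qed (use v R_R1 in auto)
  have "tri Pt A8 s (tm A8) ?Q"
    unfolding A8_def
    by (rule tri_mono[OF tri_den_Seq[where t = "tm (For 16 (Cst 0) 8 A8b)"]])
      (use loop in \<open>simp_all add: tm_def algebra_simps\<close>)
  then show ?thesis unfolding a9_def .
qed

lemma tri_A9:
  assumes b: "base \<tau> i sl s"
  shows "tri Pt A9 s (tm A9) (\<lambda>s'. chg {0, 20} {} s s' \<and> vr s' 20 = int (Suc i) \<and>
    vr s' 0 = iop w Div (vr s 35 * (2 * int k + 1)) (2 * int k * int R1))"
  by (rule tri_den[OF _ _ _ tm_loopfree]) (use b in \<open>auto simp: A9_def base_def cpar_def chg_def\<close>)

lemma tri_A10:
  assumes c: "cpar \<tau> s" and st: "vr s 20 = int (Suc i)" "i < B" "vr s 21 = int sl" "sl < G"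
  shows "tri Pt A10 s (2 * tm A10) (\<lambda>s'. chg {16, 20, 21} {5, 6, 8, 9} s s' \<and>
    (if Suc i = B then vr s' 20 = 0 \<and> vr s' 21 = int ((sl + 1) mod G) \<and>
        (\<forall>\<rho><R. ar s' 5 \<rho> = ar s 6 \<rho> \<and> ar s' 6 \<rho> = 0) \<and>
        (\<forall>\<rho><R1. ar s' 8 \<rho> = ar s 9 \<rho> + ss \<tau> \<rho> q * ar s 6 \<rho> \<and> ar s' 9 \<rho> = 0)
     else vr s' = vr s \<and> ar s' = ar s))"
proof -
  have v: "vr s 4 = int B" "vr s 5 = int q" "vr s 11 = int G"
    "vr s 8 = int R1" "vr s 9 = int R" "vr s 12 = int Wd" "ar s 0 = \<tau>"
    using c by (auto simp: cpar_def)
  have e: "iop w Eq (1 + int i) (int B) = of_bool (Suc i = B)"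
    using iop_Eq[of "Suc i" B] small(2) st by simp
  show ?thesis
  proof (cases "Suc i = B")
    case False
    then show ?thesis
      unfolding A10_def
      by (intro tri_If_bool[where b = False and t = 0] tri_Skip) (use e st v in \<open>auto simp: tm_def chg_def add.commute\<close>)
  next
    case True
    let ?b = "Sto 5 (Var 16) (Arr 6 (Var 16)) ;; Sto 6 (Var 16) (Cst 0)"
    let ?c = "Sto 8 (Var 16) (Arr 9 (Var 16) +: sE (Var 5) *: Arr 5 (Var 16)) ;; Sto 9 (Var 16) (Cst 0)"
    let ?e = "Asg 20 (Cst 0) ;; Asg 21 (Op Mod (Var 21 +: Cst 1) (Var 11))"
    let ?L1 = "For 16 (Cst 0) 9 ?b" and ?L2 = "For 16 (Cst 0) 8 ?c"
    let ?Q = "\<lambda>s'. chg {16, 20, 21} {5, 6, 8, 9} s s' \<and>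
    (if Suc i = B then vr s' 20 = 0 \<and> vr s' 21 = int ((sl + 1) mod G) \<and>
        (\<forall>\<rho><R. ar s' 5 \<rho> = ar s 6 \<rho> \<and> ar s' 6 \<rho> = 0) \<and>
        (\<forall>\<rho><R1. ar s' 8 \<rho> = ar s 9 \<rho> + ss \<tau> \<rho> q * ar s 6 \<rho> \<and> ar s' 9 \<rho> = 0)
     else vr s' = vr s \<and> ar s' = ar s)"
    have g: "iop w Mod (int sl + 1) (int G) = int ((sl + 1) mod G)"
      using iop_Mod[of "sl + 1" G] Gw st by (simp add: add.commute)
    define F where "F j = \<lparr>vr = (vr s)(16 := int j), ar = (ar s)
     (5 := \<lambda>\<rho>. if \<rho> < j then ar s 6 \<rho> else ar s 5 \<rho>, 6 := \<lambda>\<rho>. if \<rho> < j then 0 else ar s 6 \<rho>)\<rparr>" for j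
    define H where "H j = \<lparr>vr = (vr s)(16 := int j), ar = (ar (F R))
     (8 := \<lambda>\<rho>. if \<rho> < j then ar s 9 \<rho> + ss \<tau> \<rho> q * ar s 6 \<rho> else ar s 8 \<rho>,
      9 := \<lambda>\<rho>. if \<rho> < j then 0 else ar s 9 \<rho>)\<rparr>" for j
    have last: "tri Pt ?e (H R1) (clen ?e) ?Q"
      by (rule tri_den) (use st v g True in \<open>auto simp: H_def F_def chg_def\<close>)
    have loop2: "tri Pt ?L2 (F R) (tm ?L2) (\<lambda>s'. tri Pt ?e s' (clen ?e) ?Q)"
    proof (rule tri_For_tm[where F = H and lo = 0 and hi = R1])
      show "H 0 = (F R)\<lparr>vr := (vr (F R))(16 := int 0)\<rparr>" by (auto simp: F_def H_def fun_eq_iff)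
    next
      fix j assume j: "j < R1"
      have jR: "j < R" using j R_R1 by simp
      have jM: "j < M" using jR R_M by simp
      have w1: "int j * int Wd + int B + int q < int M" using W_ints[OF j, of q] by simp
      have sj: "ss \<tau> j b = \<tau> (j * Wd + B + b)" for b by (simp add: ss_def)
      show "okc Pt ?c (H j) \<and> vr (den Pt ?c (H j)) 16 = int j \<and> vr (den Pt ?c (H j)) 8 = int R1 \<and>
        (den Pt ?c (H j))\<lparr>vr := (vr (den Pt ?c (H j)))(16 := 1 + int j)\<rparr> = H (Suc j)"
        using v jM jR w1 by (auto simp: F_def H_def sE_def fun_eq_iff sj less_Suc_eq)
    qed (use v R_R1 last in \<open>auto simp: F_def\<close>)
    have loop1: "tri Pt ?L1 s (tm ?L1) (\<lambda>s'. tri Pt (?L2 ;; ?e) s' (tm ?L2 + clen ?e) ?Q)"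
    proof (rule tri_For_tm[where F = F and lo = 0 and hi = R])
      show "F 0 = s\<lparr>vr := (vr s)(16 := int 0)\<rparr>" by (auto simp: F_def fun_eq_iff)
    next
      fix j assume j: "j < R"
      have jM: "j < M" using j R_M by simp
      show "okc Pt ?b (F j) \<and> vr (den Pt ?b (F j)) 16 = int j \<and> vr (den Pt ?b (F j)) 9 = int R \<and>
        (den Pt ?b (F j))\<lparr>vr := (vr (den Pt ?b (F j)))(16 := 1 + int j)\<rparr> = F (Suc j)"
        using v jM by (auto simp: F_def fun_eq_iff less_Suc_eq)
    next
      show "tri Pt (?L2 ;; ?e) (F R) (tm ?L2 + clen ?e) ?Q" by (rule tri_Seq) (rule loop2)
    qed (use v in auto)
    have main: "tri Pt (?L1 ;; ?L2 ;; ?e) s (tm ?L1 + (tm ?L2 + clen ?e)) ?Q"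
      by (rule tri_Seq) (rule loop1)
    have ok: "okx w M s (Var 20 =: Var 4)" "ev w s (Var 20 =: Var 4) = of_bool True"
      using st v True small(2) by simp_all
    have t: "length (cx 0 (Var 20 =: Var 4)) + (tm ?L1 + (tm ?L2 + clen ?e)) + 3 \<le> 2 * tm A10"
      by (simp add: tm_def A10_def algebra_simps)
    show ?thesis
      using tri_If_bool[OF ok main _ t, of Skip] unfolding A10_def by simp
  qed
qed

end

section \<open>Invariant between two arrivals\<close>

context algo
begin

lemma scan_mm:
  assumes "\<And>j. 0 \<le> Q j \<and> Q j \<le> U"
  shows "0 \<le> fst (snd (scan Q x i)) \<and> fst (snd (scan Q x i)) \<le> U"
proof (induction i)
  case 0
  have "0 \<le> U" using assms[of 0] by linarith
  then show ?case by simp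
next
  case (Suc i)
  then show ?case using assms[of i] assms[of 0] by (auto simp: stp_def dcs_def split: prod.splits if_splits)
qed

lemma scan_ee: "0 \<le> fst (snd (snd (scan Q x i))) \<and> fst (snd (snd (scan Q x i))) \<le> int i"
  by (induction i) (auto simp: stp_def dcs_def split: prod.splits if_splits)

text \<open>Entries after those up to \<open>p\<close> have larger positions, so inspecting the next
  entry reveals whether the scan set a checkpoint at \<open>p\<close>. A list known up to some
  \<open>m\<close> beyond \<open>p\<close> suffices.\<close>

lemma ck_next:
  assumes "p < m"
  shows "if length (CL Q x p) < length (CL Q x m) \<and> fst (CL Q x m ! length (CL Q x p)) = p
    then length (CL Q x (Suc p)) = Suc (length (CL Q x p)) \<and> CL Q x m ! length (CL Q x p) = lck Q x p \<and>
      fst (lck Q x p) = p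
    else CL Q x (Suc p) = CL Q x p"
proof -
  obtain ys where ys: "CL Q x m = CL Q x (Suc p) @ ys" "\<forall>z \<in> set ys. Suc p \<le> fst z"
    using CL_mono[of "Suc p" m Q x] assms by auto
  show ?thesis
  proof (cases rule: CL_Suc_cases[of Q x p])
    case 1
    have "\<not> (length (CL Q x p) < length (CL Q x m) \<and> fst (CL Q x m ! length (CL Q x p)) = p)"
    proof
      assume h: "length (CL Q x p) < length (CL Q x m) \<and> fst (CL Q x m ! length (CL Q x p)) = p"
      then have "ys \<noteq> []" using ys(1) 1 by auto
      then have "CL Q x m ! length (CL Q x p) \<in> set ys" using ys(1) 1 by (cases ys) auto
      then show False using ys(2) h by fastforce
    qed
    then show ?thesis using 1 by simp
  next
    case (2 sig)
    then have "lck Q x p = (p, sig)" by (simp add: lck_def)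
    then show ?thesis using 2 ys(1) by (simp add: nth_append)
  qed
qed

lemma lck_same:
  assumes "CL Q x (Suc p) = CL Q x p" "0 < p"
  shows "lck Q x p = lck Q x (p - 1)"
  using assms by (simp add: lck_def)

lemma Zl_same:
  assumes "CL (Qf \<tau> y \<kappa>) (blk y \<kappa>) (Suc p) = CL (Qf \<tau> y \<kappa>) (blk y \<kappa>) p" "0 < p"
  shows "Zl \<tau> y \<kappa> p \<rho> = Zl \<tau> y \<kappa> (p - 1) \<rho>
     - sr \<tau> \<rho> (p - 1) * pat (p - 1 - snd (lck (Qf \<tau> y \<kappa>) (blk y \<kappa>) (p - 1)))"
proof -
  obtain c sig where cs: "lck (Qf \<tau> y \<kappa>) (blk y \<kappa>) (p - 1) = (c, sig)" by fastforce
  have "c \<le> p - 1" using lck_le[of "Qf \<tau> y \<kappa>" "blk y \<kappa>" "p - 1"] cs by simp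
  moreover obtain p' where "p = Suc p'" using assms(2) by (cases p) auto
  ultimately show ?thesis unfolding Zl_def lck_same[OF assms] cs by simp
qed

lemma Zl_new:
  assumes "fst (lck (Qf \<tau> y \<kappa>) (blk y \<kappa>) p) = p"
  shows "Zl \<tau> y \<kappa> p \<rho> = Zs \<tau> y \<kappa> p \<rho>"
  using assms unfolding Zl_def by (auto split: prod.splits)

definition ckd :: "(nat \<Rightarrow> int) \<Rightarrow> (nat \<Rightarrow> int) \<Rightarrow> nat \<Rightarrow> nat \<Rightarrow> st \<Rightarrow> bool" where
  "ckd \<tau> y \<kappa> m s \<longleftrightarrow> (let L = CL (Qf \<tau> y \<kappa>) (blk y \<kappa>) m; sl = \<kappa> mod G in
     ar s 10 sl = int (length L) \<and>
     (\<forall>e<length L. ar s 11 (sl * Cap + e) = int (fst (L ! e)) \<and> ar s 12 (sl * Cap + e) = int (snd (L ! e)) \<and>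
        (\<forall>\<rho><R1. ar s 13 ((sl * Cap + e) * R1 + \<rho>) = Zs \<tau> y \<kappa> (fst (L ! e)) \<rho>)))"

text \<open>Blocks with \<open>\<kappa> + 1 < G\<close> belong to the zero padding and are never
  scanned: their slots are empty and their sketches zero. Block \<open>G - 1\<close> is padding too,
  but it is scanned as the predecessor of the first real block.\<close>

definition okck :: "(nat \<Rightarrow> int) \<Rightarrow> (nat \<Rightarrow> int) \<Rightarrow> nat \<Rightarrow> st \<Rightarrow> bool" where
  "okck \<tau> y \<kappa> s \<longleftrightarrow> (if G \<le> \<kappa> + 1 then ckd \<tau> y \<kappa> B s
     else ar s 10 (\<kappa> mod G) = 0 \<and> (\<forall>\<rho><R1. ar s 13 (\<kappa> mod G * Cap * R1 + \<rho>) = 0))"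

definition same_slot :: "nat \<Rightarrow> st \<Rightarrow> st \<Rightarrow> bool" where
  "same_slot sl s s' \<longleftrightarrow> ar s' 10 sl = ar s 10 sl \<and> (\<forall>e<Cap. ar s' 11 (sl * Cap + e) = ar s 11 (sl * Cap + e) \<and>
     ar s' 12 (sl * Cap + e) = ar s 12 (sl * Cap + e) \<and>
     (\<forall>\<rho><R1. ar s' 13 ((sl * Cap + e) * R1 + \<rho>) = ar s 13 ((sl * Cap + e) * R1 + \<rho>)))"

lemma ckd_same: "ckd \<tau> y \<kappa> m s \<Longrightarrow> same_slot (\<kappa> mod G) s s' \<Longrightarrow> ckd \<tau> y \<kappa> m s'"
  using CL_len[of "Qf \<tau> y \<kappa>" "blk y \<kappa>" m] unfolding ckd_def same_slot_def Let_def by auto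

lemma okck_same:
  assumes "okck \<tau> y \<kappa> s" "same_slot (\<kappa> mod G) s s'"
  shows "okck \<tau> y \<kappa> s'"
proof (cases "G \<le> \<kappa> + 1")
  case True
  then show ?thesis using assms ckd_same unfolding okck_def by auto
next
  case False
  have "\<forall>\<rho><R1. ar s' 13 ((\<kappa> mod G * Cap + 0) * R1 + \<rho>) = ar s 13 ((\<kappa> mod G * Cap + 0) * R1 + \<rho>)"
    using assms(2) Cap1 unfolding same_slot_def by (metis less_le_trans zero_less_one)
  then show ?thesis using False assms unfolding okck_def same_slot_def by simp
qed

lemma same_slot_ar: "(\<And>a. a \<in> {10, 11, 12, 13} \<Longrightarrow> ar s' a = ar s a) \<Longrightarrow> same_slot sl s s'"
  unfolding same_slot_def by simp

lemma first_ckd: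
  assumes "ckd \<tau> y \<kappa> m s" "0 < m" "\<rho> < R1"
  shows "ar s 13 (\<kappa> mod G * Cap * R1 + \<rho>) = Zs \<tau> y \<kappa> 0 \<rho>"
proof -
  let ?L = "CL (Qf \<tau> y \<kappa>) (blk y \<kappa>) m"
  have L: "?L ! 0 = (0, 0)" "0 < length ?L" using CL_hd[OF assms(2), of "Qf \<tau> y \<kappa>" "blk y \<kappa>"] by auto
  then have "ar s 13 ((\<kappa> mod G * Cap + 0) * R1 + \<rho>) = Zs \<tau> y \<kappa> (fst (?L ! 0)) \<rho>"
    using assms(1,3) unfolding ckd_def Let_def by blast
  then show ?thesis using L by simp
qed

text \<open>\<open>G\<close> blocks of zeros precede the stream, so that every window has all its
  blocks from the first arrival on.\<close>

definition zpad :: "(nat \<Rightarrow> int) \<Rightarrow> bool" where "zpad y \<longleftrightarrow> (\<forall>j < G * B. y j = 0)"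

lemma first_okck:
  assumes "okck \<tau> y \<kappa> s" "\<rho> < R1" "zpad y"
  shows "ar s 13 (\<kappa> mod G * Cap * R1 + \<rho>) = Zs \<tau> y \<kappa> 0 \<rho>"
proof (cases "G \<le> \<kappa> + 1")
  case True
  then show ?thesis using assms first_ckd[of \<tau> y \<kappa> B s \<rho>] B1 unfolding okck_def by auto
next
  case False
  have "y (\<kappa> * B + j) = 0" if "j < B" for j
  proof -
    have "\<kappa> * B + j < G * B" using False that by (intro idx_bound) auto
    then show ?thesis using assms(3) by (simp add: zpad_def)
  qed
  then have "Zs \<tau> y \<kappa> 0 \<rho> = 0" unfolding Zs_def blk_def by simp
  then show ?thesis using False assms unfolding okck_def by simp
qed

definition scst :: "(nat \<Rightarrow> int) \<Rightarrow> (nat \<Rightarrow> int) \<Rightarrow> nat \<Rightarrow> nat \<Rightarrow> st \<Rightarrow> bool" where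
  "scst \<tau> y \<kappa> i s \<longleftrightarrow> vr s 22 = int (fst (scan (Qf \<tau> y \<kappa>) (blk y \<kappa>) i)) \<and>
     vr s 23 = fst (snd (scan (Qf \<tau> y \<kappa>) (blk y \<kappa>) i)) \<and>
     vr s 24 = fst (snd (snd (scan (Qf \<tau> y \<kappa>) (blk y \<kappa>) i)))"

text \<open>The replay between two positions: pattern symbol \<open>p - 1\<close> is already
  subtracted, but whether \<open>p\<close> is a checkpoint is still open. For blocks that were never
  scanned only the pointer and the reference are specified.\<close>

definition lft :: "(nat \<Rightarrow> int) \<Rightarrow> (nat \<Rightarrow> int) \<Rightarrow> nat \<Rightarrow> nat \<Rightarrow> st \<Rightarrow> bool" where
  "lft \<tau> y \<kappa> p s \<longleftrightarrow> (if G \<le> \<kappa> + 1 then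
      vr s 26 = int (length (CL (Qf \<tau> y \<kappa>) (blk y \<kappa>) p)) \<and>
      vr s 25 = int (snd (lck (Qf \<tau> y \<kappa>) (blk y \<kappa>) (p - 1))) \<and>
      (\<forall>\<rho><R1. ar s 7 \<rho> = Zl \<tau> y \<kappa> (p - 1) \<rho>
         - sr \<tau> \<rho> (p - 1) * pat (p - 1 - snd (lck (Qf \<tau> y \<kappa>) (blk y \<kappa>) (p - 1))))
    else vr s 26 = 0 \<and> vr s 25 = 0)"

definition mds :: "(nat \<Rightarrow> int) \<Rightarrow> (nat \<Rightarrow> int) \<Rightarrow> nat \<Rightarrow> nat \<Rightarrow> nat \<Rightarrow> int" where
  "mds \<tau> y \<kappa> a \<rho> = (\<Sum>b = a..<Suc q. ss \<tau> \<rho> b * Zs \<tau> y (\<kappa> + b) 0 \<rho>)"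

text \<open>The state before symbol \<open>i\<close> of block \<open>\<kappa>\<close> arrives.
  Checkpoints exist for \<open>\<kappa> - G\<close> up to \<open>\<kappa> - 2\<close> and partly for
  \<open>\<kappa> - 1\<close>: \<open>G\<close> consecutive blocks, hence different slots. Array 8
  sums from block 1 on until the window start has entered that block, then from block 2 on. The
  latter is claimed for scanned left blocks only, because otherwise the subtracted array 7 has no
  meaning.\<close>

definition Inv :: "(nat \<Rightarrow> int) \<Rightarrow> (nat \<Rightarrow> int) \<Rightarrow> nat \<Rightarrow> nat \<Rightarrow> st \<Rightarrow> bool" where
  "Inv \<tau> y \<kappa> i s \<longleftrightarrow> base \<tau> i (\<kappa> mod G) s \<and>
     (\<forall>j<B. ar s 2 j = (if j < i then blk y \<kappa> j else blk y (\<kappa> - 1) j)) \<and>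
     (\<forall>\<rho><R. ar s 5 \<rho> = Zs \<tau> y (\<kappa> - 1) i \<rho> \<and> ar s 6 \<rho> = cu \<tau> y \<kappa> i \<rho>) \<and>
     (0 < i \<longrightarrow> scst \<tau> y (\<kappa> - 1) i s \<and> ckd \<tau> y (\<kappa> - 1) i s) \<and>
     (\<forall>\<kappa>'. \<kappa> - G \<le> \<kappa>' \<and> \<kappa>' < \<kappa> - 1 \<longrightarrow> okck \<tau> y \<kappa>' s) \<and>
     (0 < pp i \<longrightarrow> lft \<tau> y (\<kappa> - G + le i) (pp i) s) \<and>
     (i \<le> m0 \<longrightarrow> (\<forall>\<rho><R1. ar s 8 \<rho> = mds \<tau> y (\<kappa> - G) 1 \<rho>)) \<and>
     (m0 < i \<and> G \<le> \<kappa> - G + 2 \<longrightarrow> (\<forall>\<rho><R1. ar s 8 \<rho> = mds \<tau> y (\<kappa> - G) 2 \<rho>)) \<and>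
     (\<forall>\<rho><R1. ar s 9 \<rho> = (\<Sum>b = 1..<Suc (min i (q - 1)). ss \<tau> \<rho> b * Zs \<tau> y (\<kappa> + 1 - G + b) 0 \<rho>))"

lemma slot_neq:
  assumes "a < b" "b < a + G"
  shows "a mod G \<noteq> b mod G"
proof
  assume "a mod G = b mod G"
  then have "G dvd b - a" using assms(1) by (metis mod_eq_dvd_iff_nat less_imp_le)
  then have "G \<le> b - a" using assms(1) by (intro dvd_imp_le) auto
  then show False using assms by linarith
qed

lemma ckd_store:
  assumes ck: "0 < i \<Longrightarrow> ckd \<tau> y \<kappa> i s" and L: "L = CL (Qf \<tau> y \<kappa>) (blk y \<kappa>) i"
    and d: "dcs (Qf \<tau> y \<kappa>) i (scan (Qf \<tau> y \<kappa>) (blk y \<kappa>) i) = (fl, sig, mm, ee)"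
    and s3: "ar s3 10 = (ar s 10)(\<kappa> mod G := int (length L))" "\<And>a. a \<noteq> 10 \<Longrightarrow> ar s3 a = ar s a"
    and z5: "\<And>\<rho>. \<rho> < R1 \<Longrightarrow> ar s3 5 \<rho> = Zs \<tau> y \<kappa> i \<rho>" and v22: "vr s3 22 = int sig"
    and s4: "if fl \<and> length L < Cap then ar s4 10 = (ar s3 10)(\<kappa> mod G := int (length L) + 1) \<and>
        ar s4 11 = (ar s3 11)(\<kappa> mod G * Cap + length L := int i) \<and>
        ar s4 12 = (ar s3 12)(\<kappa> mod G * Cap + length L := vr s3 22) \<and>
        ar s4 13 = (\<lambda>x. if (\<kappa> mod G * Cap + length L) * R1 \<le> x \<and> x < (\<kappa> mod G * Cap + length L) * R1 + R1
           then ar s3 5 (x - (\<kappa> mod G * Cap + length L) * R1) else ar s3 13 x)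
      else ar s4 = ar s3"
  shows "ckd \<tau> y \<kappa> (Suc i) s4" "sl \<noteq> \<kappa> mod G \<Longrightarrow> same_slot sl s s4"
proof -
  let ?sl = "\<kappa> mod G"
  have Suc: "CL (Qf \<tau> y \<kappa>) (blk y \<kappa>) (Suc i) = (if fl \<and> length L < Cap then L @ [(i, sig)] else L)"
    by (simp add: CL_Suc d L)
  have LC: "length L \<le> Cap" unfolding L by (rule CL_len)
  have old: "ar s 11 (?sl * Cap + e) = int (fst (L ! e)) \<and> ar s 12 (?sl * Cap + e) = int (snd (L ! e)) \<and>
        (\<forall>\<rho><R1. ar s 13 ((?sl * Cap + e) * R1 + \<rho>) = Zs \<tau> y \<kappa> (fst (L ! e)) \<rho>)" if "e < length L" for e
  proof -
    have "0 < i" using that unfolding L by (cases i) (auto simp: CL_0)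
    from ck[OF this] that show ?thesis unfolding ckd_def L Let_def by blast
  qed
  have blk_neq: "\<not> (b * R1 \<le> a * R1 + \<rho> \<and> a * R1 + \<rho> < b * R1 + R1)" if "a \<noteq> b" "\<rho> < R1" for a b \<rho>
  proof
    assume h: "b * R1 \<le> a * R1 + \<rho> \<and> a * R1 + \<rho> < b * R1 + R1"
    show False
    proof (cases "a < b")
      case True
      then have "a * R1 + \<rho> < b * R1" using that(2) by (intro idx_bound)
      then show False using h by simp
    next
      case False
      then have "b < a" using that by simp
      then have "Suc b * R1 \<le> a * R1" by (intro mult_le_mono1) simp
      then show False using h by simp
    qed
  qed
  show "ckd \<tau> y \<kappa> (Suc i) s4"
  proof (cases "fl \<and> length L < Cap")
    case False
    have "ar s4 = ar s3" using s4 False by (simp split: if_splits)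
    then show ?thesis using old s3 False unfolding ckd_def Suc Let_def by simp
  next
    case True
    have a: "ar s4 10 ?sl = int (length L) + 1" "ar s4 11 = (ar s 11)(?sl * Cap + length L := int i)"
      "ar s4 12 = (ar s 12)(?sl * Cap + length L := int sig)"
      "ar s4 13 = (\<lambda>x. if (?sl * Cap + length L) * R1 \<le> x \<and> x < (?sl * Cap + length L) * R1 + R1
           then ar s3 5 (x - (?sl * Cap + length L) * R1) else ar s 13 x)"
      using s4 True s3(1) s3(2)[of 11] s3(2)[of 12] s3(2)[of 13] v22 by auto
    have "ar s4 11 (?sl * Cap + e) = int (fst ((L @ [(i, sig)]) ! e)) \<and> ar s4 12 (?sl * Cap + e) = int (snd ((L @ [(i, sig)]) ! e)) \<and>
        (\<forall>\<rho><R1. ar s4 13 ((?sl * Cap + e) * R1 + \<rho>) = Zs \<tau> y \<kappa> (fst ((L @ [(i, sig)]) ! e)) \<rho>)" if e: "e < Suc (length L)" for e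
    proof (cases "e = length L")
      case True
      then show ?thesis using a z5 by simp
    next
      case False
      then have e': "e < length L" using e by simp
      have "?sl * Cap + e \<noteq> ?sl * Cap + length L" using False by simp
      then show ?thesis using a old[OF e'] e' blk_neq[of "?sl * Cap + e" "?sl * Cap + length L"]
        by (auto simp: nth_append)
    qed
    then show ?thesis using True a(1) unfolding ckd_def Suc Let_def by simp
  qed
  show "same_slot sl s s4" if sl: "sl \<noteq> \<kappa> mod G"
  proof (cases "fl \<and> length L < Cap")
    case False
    have "ar s4 = ar s3" using s4 False by (simp split: if_splits)
    then show ?thesis using s3 sl unfolding same_slot_def by simp
  next
    case True
    have a: "ar s4 10 sl = ar s 10 sl" "ar s4 11 = (ar s 11)(?sl * Cap + length L := int i)"
      "ar s4 12 = (ar s 12)(?sl * Cap + length L := int sig)"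
      "ar s4 13 = (\<lambda>x. if (?sl * Cap + length L) * R1 \<le> x \<and> x < (?sl * Cap + length L) * R1 + R1
           then ar s3 5 (x - (?sl * Cap + length L) * R1) else ar s 13 x)"
      using s4 True s3(1) s3(2)[of 11] s3(2)[of 12] s3(2)[of 13] v22 sl by auto
    have ne: "sl * Cap + e \<noteq> ?sl * Cap + length L" if "e < Cap" for e
    proof
      assume h: "sl * Cap + e = ?sl * Cap + length L"
      have "(sl * Cap + e) div Cap = sl" "(?sl * Cap + length L) div Cap = ?sl"
        using that True by simp_all
      then show False using h sl by metis
    qed
    show ?thesis using a ne blk_neq unfolding same_slot_def by auto
  qed
qed

end

section \<open>One arrival\<close>

context algo
begin

definition TT :: nat where
  "TT = tm A1 + (tm A2 + (tm A3 + (tm A4 + (tm A5 + (tm A6 + (tm A7 + (tm A8 + (tm A9 + 2 * tm A10))))))))"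

lemma triE:
  assumes "tri Pt c s t Q"
  obtains t' s' where "goes Pt c s t' s'" "t' \<le> t" "Q s'"
  using assms by (auto simp: tri_def)

lemma chgD:
  assumes "chg X Y s s'"
  shows "\<And>v. v \<notin> X \<Longrightarrow> vr s' v = vr s v" "\<And>a. a \<notin> Y \<Longrightarrow> ar s' a = ar s a"
  using assms unfolding chg_def by auto

lemma pp_Suc: "Suc i < B \<Longrightarrow> 0 < pp (Suc i) \<Longrightarrow> pp (Suc i) = Suc (pp i) \<and> le (Suc i) = le i"
  using m0B by (auto simp: pp_def le_def mod_if split: if_splits)

lemma pp_wrap: "Suc i = B \<Longrightarrow> 0 < pp 0 \<Longrightarrow> pp 0 = Suc (pp i) \<and> le i = 1 \<and> le 0 = 0"
  using m0B by (auto simp: pp_def le_def mod_if split: if_splits)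

lemma pp_less: "i < m0 \<Longrightarrow> 0 < pp i \<and> le i = 0"
  using m0B by (auto simp: pp_def le_def mod_if)

lemma pp_ge: "m0 \<le> i \<Longrightarrow> i < B \<Longrightarrow> pp i = i - m0 \<and> le i = 1"
  using m0B by (auto simp: pp_def le_def mod_if)

lemma Zs_Suc: "i < B \<Longrightarrow> Zs \<tau> y \<kappa> (Suc i) \<rho> = Zs \<tau> y \<kappa> i \<rho> - sr \<tau> \<rho> i * blk y \<kappa> i"
  unfolding Zs_def by (simp add: sum.atLeast_Suc_lessThan[of i B])

lemma cu_Suc: "cu \<tau> y \<kappa> (Suc i) \<rho> = cu \<tau> y \<kappa> i \<rho> + sr \<tau> \<rho> i * blk y \<kappa> i"
  unfolding cu_def by simp

lemma cu_B: "cu \<tau> y \<kappa> B \<rho> = Zs \<tau> y \<kappa> 0 \<rho>"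
  unfolding cu_def Zs_def by (simp add: atLeast0LessThan)

lemma mds_head: "mds \<tau> y \<kappa> 1 \<rho> = ss \<tau> \<rho> 1 * Zs \<tau> y (\<kappa> + 1) 0 \<rho> + mds \<tau> y \<kappa> 2 \<rho>"
  unfolding mds_def using q1 by (subst sum.atLeast_Suc_lessThan) (auto simp: numeral_2_eq_2)

lemma Q_bounds:
  assumes "sbd \<tau>" "bin y"
  shows "0 \<le> Qf \<tau> y \<kappa> i \<and> Qf \<tau> y \<kappa> i \<le> int (2 ^ 5 * n ^ 2)"
proof -
  have "R2 * (B * B) \<le> (2 ^ 5 * n) * n" using R2n BB by (intro mult_le_mono) auto
  then have "int (R2 * (B * B)) \<le> int (2 ^ 5 * n ^ 2)" by (simp only: of_nat_le_iff power2_eq_square mult.assoc)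
  then show ?thesis using Qf_nonneg[of \<tau> y \<kappa> i] Qf_bound[OF assms, of \<kappa> i] by linarith
qed

lemma int_lt_pw: "x \<le> int m \<Longrightarrow> m < 2 ^ w \<Longrightarrow> x < 2 ^ w"
proof -
  assume "x \<le> int m" "m < 2 ^ w"
  moreover have "int m < 2 ^ w" using \<open>m < 2 ^ w\<close> by (metis of_nat_less_iff of_nat_numeral of_nat_power)
  ultimately show ?thesis by linarith
qed

text \<open>The invariant is preserved by every arrival, while the output is specified only when the
  left block of the window has been scanned, that is, lies at \<open>G - 1\<close> or later.\<close>

theorem arrival_step:
  assumes I: "Inv \<tau> y \<kappa> i s" and x: "vr s 0 = y (\<kappa> * B + i)"
    and y: "bin y" "zpad y" and t: "sbd \<tau>" and \<kappa>G: "G \<le> \<kappa>"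
  shows "tri Pt arrival s TT (\<lambda>s'. (if Suc i = B then Inv \<tau> y (Suc \<kappa>) 0 s' else Inv \<tau> y \<kappa> (Suc i) s') \<and>
    (G \<le> \<kappa> - G + le i + 1 \<longrightarrow>
       vr s' 0 = iop w Div (Vf \<tau> y (\<kappa> - G) i * (2 * int k + 1)) (2 * int k * int R1)))"
proof -
  define \<kappa>p where "\<kappa>p = \<kappa> - 1"
  define \<kappa>l where "\<kappa>l = \<kappa> - G + le i"
  define p where "p = pp i"
  have G2: "2 \<le> G" using q1 by (simp add: G_def)
  have \<kappa>p: "\<kappa> = Suc \<kappa>p" using \<kappa>G G2 by (simp add: \<kappa>p_def)
  let ?sl = "\<kappa> mod G" and ?Q = "Qf \<tau> y \<kappa>p" and ?x = "blk y \<kappa>p"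
  let ?Ql = "Qf \<tau> y \<kappa>l" and ?xl = "blk y \<kappa>l"
  have b: "base \<tau> i ?sl s"
    and XB: "\<And>j. j < B \<Longrightarrow> ar s 2 j = (if j < i then blk y \<kappa> j else ?x j)"
    and Z5: "\<And>\<rho>. \<rho> < R \<Longrightarrow> ar s 5 \<rho> = Zs \<tau> y \<kappa>p i \<rho>" and Z6: "\<And>\<rho>. \<rho> < R \<Longrightarrow> ar s 6 \<rho> = cu \<tau> y \<kappa> i \<rho>"
    and SC: "0 < i \<Longrightarrow> scst \<tau> y \<kappa>p i s" "0 < i \<Longrightarrow> ckd \<tau> y \<kappa>p i s"
    and CK: "\<And>\<kappa>'. \<kappa> - G \<le> \<kappa>' \<Longrightarrow> \<kappa>' < \<kappa>p \<Longrightarrow> okck \<tau> y \<kappa>' s"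
    and LF: "0 < p \<Longrightarrow> lft \<tau> y \<kappa>l p s"
    and M1: "\<And>\<rho>. i \<le> m0 \<Longrightarrow> \<rho> < R1 \<Longrightarrow> ar s 8 \<rho> = mds \<tau> y (\<kappa> - G) 1 \<rho>"
    and M2: "\<And>\<rho>. m0 < i \<Longrightarrow> G \<le> \<kappa> - G + 2 \<Longrightarrow> \<rho> < R1 \<Longrightarrow> ar s 8 \<rho> = mds \<tau> y (\<kappa> - G) 2 \<rho>"
    and AC: "\<And>\<rho>. \<rho> < R1 \<Longrightarrow> ar s 9 \<rho> = (\<Sum>b = 1..<Suc (min i (q - 1)). ss \<tau> \<rho> b * Zs \<tau> y (\<kappa> + 1 - G + b) 0 \<rho>)"
    using I unfolding Inv_def \<kappa>p_def[symmetric] \<kappa>l_def[symmetric] p_def[symmetric] by blast+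
  have iB: "i < B" using b by (simp add: base_def)
  have pB: "p < B" unfolding p_def by (rule pp_B)
  have cs: "\<kappa>p mod G = (?sl + q) mod G"
  proof -
    have "(?sl + q) mod G = (\<kappa> + q) mod G" by (simp add: mod_add_left_eq)
    also have "\<kappa> + q = \<kappa>p + G" using \<kappa>p by (simp add: G_def)
    finally show ?thesis by simp
  qed
  have ls: "\<kappa>l mod G = (?sl + le i) mod G"
  proof -
    have "(?sl + le i) mod G = (\<kappa> + le i) mod G" by (simp add: mod_add_left_eq)
    also have "\<kappa> + le i = \<kappa>l + G" using \<kappa>G by (simp add: \<kappa>l_def)
    finally show ?thesis by simp
  qed

  obtain t1 s1 where g1: "goes Pt A1 s t1 s1" "t1 \<le> tm A1" and c1: "chg {27} {2} s s1"
    and p1: "vr s1 27 = ar s 2 i" "ar s1 2 = (ar s 2)(i := vr s 0)"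
    using tri_A1[OF b] by (rule triE) auto
  note c1D = chgD[OF c1]
  have b1: "base \<tau> i ?sl s1" by (rule base_chg[OF b c1]) auto
  have x27: "vr s1 27 = ?x i" using p1 XB[OF iB] by simp

  obtain t2 s2 where g2: "goes Pt A2 s1 t2 s2" "t2 \<le> tm A2" and c2: "chg {16, 28} {} s1 s2"
    and p2: "vr s2 28 = (\<Sum>\<rho> = R1..<R. (ar s1 5 \<rho> - ar s1 4 (i * R + \<rho>)) * (ar s1 5 \<rho> - ar s1 4 (i * R + \<rho>)))"
    using tri_A2[OF b1] by (rule triE) auto
  note c2D = chgD[OF c2]
  have b2: "base \<tau> i ?sl s2" by (rule base_chg[OF b1 c2]) auto
  have Q28: "vr s2 28 = ?Q i"
  proof -
    have "ar s1 4 (i * R + \<rho>) = YQ \<tau> i \<rho>" if "\<rho> < R" for \<rho>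
      using b1 iB that by (simp add: base_def cpar_def)
    moreover have "ar s1 5 \<rho> = Zs \<tau> y \<kappa>p i \<rho>" if "\<rho> < R" for \<rho>
      using Z5[OF that] c1D(2)[of 5] by simp
    ultimately show ?thesis unfolding p2 Qf_def by (intro sum.cong refl) simp
  qed

  obtain sig mm ee L where sc: "scan ?Q ?x i = (sig, mm, ee, L)" by (cases "scan ?Q ?x i") auto
  have L: "L = CL ?Q ?x i" by (simp add: CL_def ckl_def sc)
  obtain fl sig' mm' ee' where d: "dcs ?Q i (scan ?Q ?x i) = (fl, sig', mm', ee')"
    by (cases "dcs ?Q i (scan ?Q ?x i)") auto
  have sig'i: "sig' \<le> i" using dcs_sig[of ?Q i ?x] d by simp
  have ck2: "ckd \<tau> y \<kappa>p i s2" if "0 < i"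
    by (rule ckd_same[OF SC(2)[OF that] same_slot_ar]) (auto simp: c1D c2D)
  have st3: "vr s2 22 = int sig \<and> vr s2 23 = mm \<and> vr s2 24 = ee \<and> ar s2 10 (\<kappa>p mod G) = int (length L)" if "0 < i"
    using SC(1)[OF that] ck2[OF that] c1D(1) c2D(1) unfolding scst_def ckd_def sc L Let_def by simp
  have w1: "2 * (2 ^ 5 * n ^ 2) < 2 ^ w" by (rule pow_le[of "2 ^ 6" 2]) auto
  have Qb: "0 \<le> ?Q i" "2 * ?Q i < 2 ^ w"
    using Q_bounds[OF t y(1), of \<kappa>p i] int_lt_pw[OF _ w1, of "2 * ?Q i"] by auto
  have bd: "0 \<le> mm \<and> mm < 2 ^ w \<and> 0 \<le> ee * int DKR \<and> ee * int DKR < 2 ^ w"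
  proof -
    have mmb: "0 \<le> mm \<and> mm \<le> int (2 ^ 5 * n ^ 2)"
      using scan_mm[of ?Q "int (2 ^ 5 * n ^ 2)" ?x i] Q_bounds[OF t y(1)] by (simp add: sc)
    moreover have "mm < 2 ^ w"
      by (rule int_lt_pw[OF mmb[THEN conjunct2] pow_le[of "2 ^ 5" 2]]) auto
    moreover have e: "0 \<le> ee" "ee \<le> int i" using scan_ee[of ?Q ?x i] by (auto simp: sc)
    moreover have "ee * int DKR < 2 ^ w"
    proof (rule int_lt_pw)
      have "ee * int DKR \<le> int i * int DKR" using e by (intro mult_right_mono) auto
      then show "ee * int DKR \<le> int (i * DKR)" by simp
      have "i * DKR \<le> n * (2 ^ 15 * n ^ 2)" using iB Bn DKRn by (intro mult_le_mono) auto
      then have "i * DKR \<le> 2 ^ 15 * n ^ 3" by (simp add: power2_eq_square power3_eq_cube mult_ac)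
      then show "i * DKR < 2 ^ w" by (intro pow_le[of "2 ^ 15" 3]) auto
    qed
    ultimately show ?thesis by simp
  qed
  have L0: "i = 0 \<Longrightarrow> L = []" unfolding L by (simp add: CL_0)
  have LC: "length L \<le> Cap" unfolding L by (rule CL_len)
  obtain t3 s3 where g3: "goes Pt A3 s2 t3 s3" "t3 \<le> tm A3" and c3: "chg {22, 23, 24, 29, 30, 31} {10} s2 s3"
    and p3: "vr s3 22 = int sig'" "vr s3 23 = mm'" "vr s3 24 = ee'" "vr s3 30 = int (\<kappa>p mod G)"
     "vr s3 31 = int (length L)" "vr s3 29 = of_bool (fl \<and> length L < Cap)"
     "ar s3 10 = (ar s2 10)(\<kappa>p mod G := int (length L))"
    using tri_A3[OF b2 cs Q28 Qb st3 L0 bd LC d[unfolded sc]] by (rule triE) auto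
  note c3D = chgD[OF c3]
  have b3: "base \<tau> i ?sl s3" by (rule base_chg[OF b2 c3]) auto

  define len where "len = (if fl \<and> length L < Cap then length L else 0)"
  have csG: "\<kappa>p mod G < G" "len < Cap" using G2 Cap1 by (auto simp: len_def)
  have v31: "fl \<and> length L < Cap \<Longrightarrow> vr s3 31 = int len" using p3(5) by (simp add: len_def)
  obtain t4 s4 where g4: "goes Pt A4 s3 t4 s4" "t4 \<le> tm A4" and c4: "chg {16} {10, 11, 12, 13} s3 s4"
    and p4': "if fl \<and> length L < Cap then ar s4 10 = (ar s3 10)(\<kappa>p mod G := int len + 1) \<and>
        ar s4 11 = (ar s3 11)(\<kappa>p mod G * Cap + len := int i) \<and>
        ar s4 12 = (ar s3 12)(\<kappa>p mod G * Cap + len := vr s3 22) \<and>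
        ar s4 13 = (\<lambda>x. if (\<kappa>p mod G * Cap + len) * R1 \<le> x \<and> x < (\<kappa>p mod G * Cap + len) * R1 + R1
           then ar s3 5 (x - (\<kappa>p mod G * Cap + len) * R1) else ar s3 13 x)
      else ar s4 = ar s3"
  proof -
    have "tri Pt A4 s3 (tm A4) (\<lambda>s4. chg {16} {10, 11, 12, 13} s3 s4 \<and>
      (if fl \<and> length L < Cap then ar s4 10 = (ar s3 10)(\<kappa>p mod G := int len + 1) \<and>
        ar s4 11 = (ar s3 11)(\<kappa>p mod G * Cap + len := int i) \<and>
        ar s4 12 = (ar s3 12)(\<kappa>p mod G * Cap + len := vr s3 22) \<and>
        ar s4 13 = (\<lambda>x. if (\<kappa>p mod G * Cap + len) * R1 \<le> x \<and> x < (\<kappa>p mod G * Cap + len) * R1 + R1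
           then ar s3 5 (x - (\<kappa>p mod G * Cap + len) * R1) else ar s3 13 x)
      else ar s4 = ar s3))"
      by (rule tri_A4[OF b3 csG p3(4) _ p3(6)]) (rule v31)
    then show ?thesis by (rule triE) (elim conjE, rule that)
  qed
  have p4: "if fl \<and> length L < Cap then ar s4 10 = (ar s3 10)(\<kappa>p mod G := int (length L) + 1) \<and>
        ar s4 11 = (ar s3 11)(\<kappa>p mod G * Cap + length L := int i) \<and>
        ar s4 12 = (ar s3 12)(\<kappa>p mod G * Cap + length L := vr s3 22) \<and>
        ar s4 13 = (\<lambda>x. if (\<kappa>p mod G * Cap + length L) * R1 \<le> x \<and> x < (\<kappa>p mod G * Cap + length L) * R1 + R1
           then ar s3 5 (x - (\<kappa>p mod G * Cap + length L) * R1) else ar s3 13 x)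
      else ar s4 = ar s3"
  proof (cases "fl \<and> length L < Cap")
    case True
    then have ll: "len = length L" by (simp add: len_def)
    show ?thesis using p4' unfolding ll .
  next
    case False
    then show ?thesis using p4' by (simp only: if_False)
  qed
  note c4D = chgD[OF c4]
  have b4: "base \<tau> i ?sl s4" by (rule base_chg[OF b3 c4]) auto
  have z3: "ar s3 5 \<rho> = Zs \<tau> y \<kappa>p i \<rho>" if "\<rho> < R1" for \<rho>
    using Z5[of \<rho>] that R_R1 c1D(2) c2D(2) c3D(2) by simp
  have store: "ckd \<tau> y \<kappa>p (Suc i) s4" "sl \<noteq> \<kappa>p mod G \<Longrightarrow> same_slot sl s2 s4" for sl
    using ckd_store[OF ck2 L d p3(7) c3D(2) z3 p3(1) p4] by auto
  have CK4: "okck \<tau> y \<kappa>' s4" if "\<kappa> - G \<le> \<kappa>'" "\<kappa>' < \<kappa>p" for \<kappa>'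
  proof -
    have "okck \<tau> y \<kappa>' s2"
      by (rule okck_same[OF CK[OF that] same_slot_ar]) (auto simp: c1D c2D)
    \<comment> \<open>The store touches one slot only; the other blocks within the last
      \<open>G\<close> have different residues.\<close>
    moreover have "\<kappa>' mod G \<noteq> \<kappa>p mod G" using that \<kappa>p \<kappa>G by (intro slot_neq) auto
    ultimately show ?thesis using okck_same store(2) by blast
  qed

  have x01: "vr s4 27 = 0 \<or> vr s4 27 = 1" "vr s4 27 = ?x i"
    using x27 c4D(1) c3D(1) c2D(1) y(1) by (auto simp: bin_def blk_def)
  have v22: "vr s4 22 = int sig'" using p3(1) c4D(1) by simp
  obtain t5 s5 where g5: "goes Pt A5 s4 t5 s5" "t5 \<le> tm A5" and c5: "chg {16, 24} {5, 6} s4 s5"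
    and p5: "vr s5 24 = vr s4 24 + of_bool (vr s4 27 \<noteq> pat (i - sig'))"
     "\<And>\<rho>. \<rho> < R \<Longrightarrow> ar s5 5 \<rho> = ar s4 5 \<rho> - sr \<tau> \<rho> i * vr s4 27"
     "\<And>\<rho>. \<rho> < R \<Longrightarrow> ar s5 6 \<rho> = ar s4 6 \<rho> + sr \<tau> \<rho> i * vr s4 0"
    using tri_A5[OF b4 v22 sig'i x01(1)] by (rule triE) auto
  note c5D = chgD[OF c5]
  have b5: "base \<tau> i ?sl s5" by (rule base_chg[OF b4 c5]) auto
  have scSuc: "scan ?Q ?x (Suc i) = (sig', mm', ee' + of_bool (?x i \<noteq> pat (i - sig')),
      if fl \<and> length L < Cap then L @ [(i, sig')] else L)"
    using d by (simp add: stp_def sc ckl_def)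
  have SC5: "scst \<tau> y \<kappa>p (Suc i) s5"
    unfolding scst_def scSuc using p3(1-3) p5(1) x01(2) c4D(1) c5D(1) by simp
  have Z55: "ar s5 5 \<rho> = Zs \<tau> y \<kappa>p (Suc i) \<rho>" "ar s5 6 \<rho> = cu \<tau> y \<kappa> (Suc i) \<rho>" if "\<rho> < R" for \<rho>
  proof -
    show "ar s5 5 \<rho> = Zs \<tau> y \<kappa>p (Suc i) \<rho>"
      using p5(2)[OF that] Z5[OF that] x01(2) c1D(2) c2D(2) c3D(2) c4D(2) Zs_Suc[OF iB] by simp
    have "vr s4 0 = blk y \<kappa> i" using x c1D(1) c2D(1) c3D(1) c4D(1) by (simp add: blk_def)
    then show "ar s5 6 \<rho> = cu \<tau> y \<kappa> (Suc i) \<rho>"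
      using p5(3)[OF that] Z6[OF that] c1D(2) c2D(2) c3D(2) c4D(2) cu_Suc by simp
  qed
  have ckp5: "ckd \<tau> y \<kappa>p (Suc i) s5"
    by (rule ckd_same[OF store(1) same_slot_ar]) (auto simp: c5D)
  have CK5: "okck \<tau> y \<kappa>' s5" if "\<kappa> - G \<le> \<kappa>'" "\<kappa>' < \<kappa>p" for \<kappa>'
    by (rule okck_same[OF CK4[OF that] same_slot_ar]) (auto simp: c5D)

  have le1: "le i \<le> 1" by (simp add: le_def)
  have \<kappa>l_le: "\<kappa>l \<le> \<kappa>p" using \<kappa>p \<kappa>G G2 le1 by (simp add: \<kappa>l_def)
  \<comment> \<open>For \<open>q = 1\<close> the left block may be the one still being scanned. Its
    scan has just treated position \<open>i\<close>, and the replay is at \<open>p = i - m0\<close>,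
    so the list up to \<open>Suc i\<close> already decides about \<open>p\<close>.\<close>
  have "\<exists>m. p < m \<and> m \<le> B \<and> ckd \<tau> y \<kappa>l m s5" if real: "G \<le> \<kappa>l + 1"
  proof (cases "\<kappa>l = \<kappa>p")
    case True
    then have "le i = 1" using \<kappa>p \<kappa>G G2 le1 unfolding \<kappa>l_def by linarith
    then have "m0 \<le> i" by (simp add: le_def split: if_splits)
    then have "p \<le> i" using pp_ge iB by (simp add: p_def)
    then show ?thesis using True ckp5 iB by (intro exI[of _ "Suc i"]) auto
  next
    case False
    then have "okck \<tau> y \<kappa>l s5" using \<kappa>l_le by (intro CK5) (auto simp: \<kappa>l_def)
    then show ?thesis using real pB by (intro exI[of _ B]) (auto simp: okck_def)
  qed
  then obtain m where m: "G \<le> \<kappa>l + 1 \<Longrightarrow> p < m \<and> m \<le> B \<and> ckd \<tau> y \<kappa>l m s5" by blast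
  have virt: "ar s5 10 (\<kappa>l mod G) = 0" if "\<not> G \<le> \<kappa>l + 1"
  proof -
    have "\<kappa>l < \<kappa>p" using that \<kappa>p \<kappa>G by linarith
    then have "okck \<tau> y \<kappa>l s5" by (intro CK5) (auto simp: \<kappa>l_def)
    then show ?thesis using that by (simp add: okck_def)
  qed
  let ?real = "G \<le> \<kappa>l + 1"
  define Lm where "Lm = CL ?Ql ?xl m"
  define ln where "ln = (if ?real then length Lm else 0)"
  define cp where "cp = (if ?real then length (CL ?Ql ?xl p) else 0)"
  define lsg where "lsg = (if ?real \<and> 0 < p then snd (lck ?Ql ?xl (p - 1)) else 0)"
  define c where "c = (if ?real then fst (Lm ! cp) else 0)"
  have st6: "vr s5 26 = int cp \<and> vr s5 25 = int lsg" if "0 < pp i"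
  proof -
    have v: "vr s5 26 = vr s 26" "vr s5 25 = vr s 25"
      using c1D(1) c2D(1) c3D(1) c4D(1) c5D(1) by simp_all
    have "0 < p" using that by (simp add: p_def)
    from LF[OF this] this show ?thesis unfolding lft_def v cp_def lsg_def by (auto split: if_splits)
  qed
  have st60: "cp = 0 \<and> lsg = 0" if "pp i = 0"
    using that CL_0[of ?Ql ?xl] by (simp add: cp_def lsg_def p_def)
  have ln6: "ar s5 10 (\<kappa>l mod G) = int ln" "ln \<le> Cap" "cp \<le> Cap"
    using m virt CL_len[of ?Ql ?xl m] CL_len[of ?Ql ?xl p]
    by (auto simp: ln_def cp_def Lm_def ckd_def Let_def)
  have pos6: "ar s5 11 (\<kappa>l mod G * Cap + cp) = int c \<and> c < B" if "cp < ln"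
  proof -
    have r: ?real using that by (auto simp: ln_def split: if_splits)
    then have l: "cp < length Lm" using that by (simp add: ln_def)
    then have "ar s5 11 (\<kappa>l mod G * Cap + cp) = int (fst (Lm ! cp))"
      using m[OF r] unfolding ckd_def Lm_def Let_def by blast
    moreover have "fst (Lm ! cp) < m"
      using CL_set[of "fst (Lm ! cp)" "snd (Lm ! cp)" ?Ql ?xl m] l unfolding Lm_def by simp
    ultimately show ?thesis using r m[OF r] by (simp add: c_def)
  qed
  obtain t6 s6 where g6: "goes Pt A6 s5 t6 s6" "t6 \<le> tm A6" and c6: "chg {25, 26, 29, 32, 33, 34} {} s5 s6"
    and p6: "vr s6 32 = int p" "vr s6 33 = int (le i)" "vr s6 34 = int (\<kappa>l mod G)"
     "vr s6 25 = int lsg" "vr s6 26 = int cp" "vr s6 29 = of_bool (cp < ln \<and> c = p)"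
    using tri_A6[OF b5 ls st6 st60 ln6 pos6] unfolding p_def by (rule triE) auto
  note c6D = chgD[OF c6]
  have b6: "base \<tau> i ?sl s6" by (rule base_chg[OF b5 c6]) auto

  have st7: "vr s6 34 = int (\<kappa>l mod G) \<and> vr s6 26 = int cp \<and> \<kappa>l mod G < G \<and> cp < Cap" if "cp < ln \<and> c = p"
    using that ln6 p6 G2 by auto
  obtain t7 s7 where g7: "goes Pt A7 s6 t7 s7" "t7 \<le> tm A7" and c7: "chg {16, 25, 26} {7} s6 s7"
    and p7: "if cp < ln \<and> c = p then vr s7 25 = ar s6 12 (\<kappa>l mod G * Cap + cp) \<and> vr s7 26 = int cp + 1 \<and>
        (\<forall>\<rho><R1. ar s7 7 \<rho> = ar s6 13 ((\<kappa>l mod G * Cap + cp) * R1 + \<rho>))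
     else vr s7 25 = vr s6 25 \<and> vr s7 26 = vr s6 26 \<and> ar s7 7 = ar s6 7"
    using tri_A7[OF b6 p6(6) st7] by (rule triE) auto
  note c7D = chgD[OF c7]
  have b7: "base \<tau> i ?sl s7" by (rule base_chg[OF b6 c7]) auto
  have real7: "vr s7 25 = int (snd (lck ?Ql ?xl p)) \<and> vr s7 26 = int (length (CL ?Ql ?xl (Suc p))) \<and>
      (\<forall>\<rho><R1. ar s7 7 \<rho> = Zl \<tau> y \<kappa>l p \<rho>)" if r: ?real
  proof -
    have pm: "p < m" and ckm: "ckd \<tau> y \<kappa>l m s5" using m[OF r] by auto
    note nx = ck_next[OF pm, of ?Ql ?xl, folded Lm_def]
    have cpl: "cp = length (CL ?Ql ?xl p)" "c = fst (Lm ! cp)" "ln = length Lm"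
      using r by (simp_all add: cp_def c_def ln_def)
    show ?thesis
    proof (cases "cp < ln \<and> c = p")
      case True
      then have n1: "length (CL ?Ql ?xl (Suc p)) = Suc cp" "Lm ! cp = lck ?Ql ?xl p" "fst (lck ?Ql ?xl p) = p"
        using nx cpl by auto
      have "ar s5 12 (\<kappa>l mod G * Cap + cp) = int (snd (Lm ! cp)) \<and>
          (\<forall>\<rho><R1. ar s5 13 ((\<kappa>l mod G * Cap + cp) * R1 + \<rho>) = Zs \<tau> y \<kappa>l (fst (Lm ! cp)) \<rho>)"
        using ckm True cpl unfolding ckd_def Lm_def Let_def by blast
      then show ?thesis using p7 True n1 c6D(2) Zl_new[OF n1(3)] by simp
    next
      case False
      then have n1: "CL ?Ql ?xl (Suc p) = CL ?Ql ?xl p" using nx cpl by auto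
      have p0: "0 < p"
      proof (rule ccontr)
        assume "\<not> 0 < p"
        then show False using n1 CL_1[of ?Ql ?xl] CL_0[of ?Ql ?xl] by simp
      qed
      have v7: "ar s7 7 = ar s 7" using p7 False c1D(2) c2D(2) c3D(2) c4D(2) c5D(2) c6D(2) by simp
      have "lft \<tau> y \<kappa>l p s" by (rule LF[OF p0])
      then have "\<forall>\<rho><R1. ar s 7 \<rho> = Zl \<tau> y \<kappa>l p \<rho>"
        using r Zl_same[OF n1 p0] unfolding lft_def by simp
      then show ?thesis
        using p7 False p6(4,5) p0 r lck_same[OF n1 p0] n1 v7 unfolding lsg_def cp_def by simp
    qed
  qed
  have virt7: "vr s7 25 = 0 \<and> vr s7 26 = 0" if "\<not> ?real"
  proof -
    have "ln = 0" "lsg = 0" "cp = 0" using that by (simp_all add: ln_def lsg_def cp_def)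
    then show ?thesis using p7 p6 by simp
  qed

  \<comment> \<open>For a left block that was never scanned the replay works on meaningless data;
    reference 0 still keeps the index \<open>p - lg\<close> in range.\<close>
  define lg where "lg = (if ?real then snd (lck ?Ql ?xl p) else 0)"
  have lg: "vr s7 25 = int lg" "lg \<le> p"
    using real7 virt7 lck_le[of ?Ql ?xl p] by (auto simp: lg_def)
  define mf where "mf \<rho> = ar s7 8 \<rho> - (if p = 0 then ss \<tau> \<rho> 1 * ar s7 7 \<rho> else 0)" for \<rho>
  define df where "df \<rho> = Yp \<tau> i \<rho> - (ss \<tau> \<rho> (q + 1) * ar s7 6 \<rho> + mf \<rho> + ss \<tau> \<rho> (le i) * ar s7 7 \<rho>)" for \<rho>
  have v7: "vr s7 32 = int p" "vr s7 33 = int (le i)" using p6 c7D(1) by simp_all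
  obtain t8 s8 where g8: "goes Pt A8 s7 t8 s8" "t8 \<le> tm A8" and c8: "chg {16, 35, 36} {7, 8, 9} s7 s8"
    and p8: "vr s8 35 = (\<Sum>\<rho><R1. df \<rho> * df \<rho>)"
     "\<And>\<rho>. \<rho> < R1 \<Longrightarrow> ar s8 8 \<rho> = mf \<rho>" "\<And>\<rho>. \<rho> < R1 \<Longrightarrow> ar s8 7 \<rho> = ar s7 7 \<rho> - sr \<tau> \<rho> p * pat (p - lg)"
     "\<And>\<rho>. \<rho> < R1 \<Longrightarrow> ar s8 9 \<rho> = ar s7 9 \<rho> + (if i + 1 < q then
          ss \<tau> \<rho> (i + 1) * ar s7 13 ((?sl + i + 2) mod G * Cap * R1 + \<rho>) else 0)"
    using tri_A8[where Pt = Pt, OF b7 v7(1) pB v7(2) le1 lg] unfolding df_def mf_def by (rule triE) blast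
  note c8D = chgD[OF c8]
  have b8: "base \<tau> i ?sl s8" by (rule base_chg[OF b7 c8]) auto
  have a7: "ar s7 8 = ar s 8" "ar s7 9 = ar s 9" "ar s7 6 = ar s5 6" "ar s7 13 = ar s5 13"
    using c1D(2) c2D(2) c3D(2) c4D(2) c5D(2) c6D(2) c7D(2) by simp_all
  have mf1: "mf \<rho> = mds \<tau> y (\<kappa> - G) 1 \<rho>" if "i < m0" "\<rho> < R1" for \<rho>
    using M1[of \<rho>] that pp_less[OF that(1)] unfolding mf_def a7 p_def by simp
  have mf2: "mf \<rho> = mds \<tau> y (\<kappa> - G) 2 \<rho>" if "m0 \<le> i" "\<rho> < R1" ?real for \<rho>
  proof -
    have le: "le i = 1" "p = i - m0" using pp_ge[OF that(1) iB] by (simp_all add: p_def)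
    have \<kappa>l1: "\<kappa>l = \<kappa> - G + 1" by (simp add: \<kappa>l_def le)
    show ?thesis
    \<comment> \<open>\<open>i = m0\<close> is the moment when the window start enters a new block.
      Position 0 is always a checkpoint, so array 7 holds the full sketch that is subtracted from
      the sum.\<close>
    proof (cases "i = m0")
      case True
      then have p0: "p = 0" using le by simp
      have l0: "fst (lck ?Ql ?xl 0) = 0" by (simp add: lck_def CL_1)
      have "ar s7 7 \<rho> = Zs \<tau> y \<kappa>l 0 \<rho>" using real7[OF that(3)] that(2) p0 Zl_new[OF l0] by simp
      then show ?thesis using M1[of \<rho>] True that(2) p0 mds_head[of \<tau> y "\<kappa> - G" \<rho>] \<kappa>l1
        unfolding mf_def a7 by simp
    next
      case False
      then have "0 < p" "m0 < i" using le that by auto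
      then show ?thesis using M2[of \<rho>] that \<kappa>l1 unfolding mf_def a7 by simp
    qed
  qed
  have V8: "vr s8 35 = Vf \<tau> y (\<kappa> - G) i" if r: ?real
  proof -
    have "df \<rho> = Yp \<tau> i \<rho> - Wf \<tau> y (\<kappa> - G) i \<rho>" if "\<rho> < R1" for \<rho>
    proof -
      have "mf \<rho> = mds \<tau> y (\<kappa> - G) (Suc (le i)) \<rho>"
        using mf1[OF _ that] mf2[OF _ that r] pp_less[of i] pp_ge[of i] iB by (cases "i < m0") (auto simp: numeral_2_eq_2)
      moreover have "ar s7 6 \<rho> = cu \<tau> y (\<kappa> - G + G) (Suc i) \<rho>"
        using Z55(2)[of \<rho>] that R_R1 \<kappa>G a7 by simp
      moreover have "ar s7 7 \<rho> = Zl \<tau> y (\<kappa> - G + le i) (pp i) \<rho>"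
        using real7[OF r] that by (simp add: \<kappa>l_def p_def)
      ultimately show ?thesis unfolding df_def Wf_def mds_def by simp
    qed
    then show ?thesis unfolding p8(1) Vf_def by (intro sum.cong) auto
  qed
  have AC8: "ar s8 9 \<rho> = (\<Sum>b = 1..<Suc (min (Suc i) (q - 1)). ss \<tau> \<rho> b * Zs \<tau> y (\<kappa> + 1 - G + b) 0 \<rho>)"
    if \<rho>: "\<rho> < R1" for \<rho>
  proof (cases "i + 1 < q")
    case True
    \<comment> \<open>The block whose full sketch joins the prepared sum in this arrival. It may
      even be the block under scan, since checkpoint 0 is the first one stored.\<close>
    define \<kappa>' where "\<kappa>' = \<kappa> + 1 - G + (i + 1)"
    have k': "\<kappa>' = \<kappa> + i + 2 - G" using \<kappa>G by (simp add: \<kappa>'_def)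
    have sl: "(?sl + i + 2) mod G = \<kappa>' mod G"
    proof -
      have "(?sl + i + 2) mod G = (\<kappa> + (i + 2)) mod G" by (simp only: mod_add_left_eq add.assoc)
      also have "\<kappa> + (i + 2) = \<kappa>' + G" using k' \<kappa>G by simp
      finally show ?thesis by simp
    qed
    have rng: "\<kappa> - G \<le> \<kappa>'" "\<kappa>' \<le> \<kappa>p" using k' True \<kappa>p \<kappa>G by (auto simp: G_def)
    have "ar s5 13 (\<kappa>' mod G * Cap * R1 + \<rho>) = Zs \<tau> y \<kappa>' 0 \<rho>"
    proof (cases "\<kappa>' = \<kappa>p")
      case True
      then show ?thesis using first_ckd[OF ckp5 _ \<rho>] by simp
    next
      case False
      then show ?thesis using rng by (intro first_okck[OF CK5 \<rho> y(2)]) auto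
    qed
    moreover have "min i (q - 1) = i" "min (Suc i) (q - 1) = Suc i" using True by auto
    ultimately show ?thesis
      using p8(4)[OF \<rho>] AC[OF \<rho>] True unfolding a7 sl \<kappa>'_def by simp
  next
    case False
    then have e: "min (Suc i) (q - 1) = min i (q - 1)" by auto
    have "ar s8 9 \<rho> = ar s 9 \<rho>" using p8(4)[OF \<rho>] False unfolding a7 by simp
    then show ?thesis unfolding e AC[OF \<rho>] .
  qed
  obtain t9 s9 where g9: "goes Pt A9 s8 t9 s9" "t9 \<le> tm A9" and c9: "chg {0, 20} {} s8 s9"
    and p9: "vr s9 20 = int (Suc i)" "vr s9 0 = iop w Div (vr s8 35 * (2 * int k + 1)) (2 * int k * int R1)"
    using tri_A9[OF b8] by (rule triE) auto
  note c9D = chgD[OF c9]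
  have cp9: "cpar \<tau> s9" using b8 c9D unfolding base_def cpar_def by simp
  have sl9: "vr s9 21 = int ?sl" "?sl < G" using b8 c9D(1) by (simp_all add: base_def)
  obtain t10 s10 where g10: "goes Pt A10 s9 t10 s10" "t10 \<le> 2 * tm A10"
    and c10: "chg {16, 20, 21} {5, 6, 8, 9} s9 s10"
    and p10: "if Suc i = B then vr s10 20 = 0 \<and> vr s10 21 = int ((?sl + 1) mod G) \<and>
        (\<forall>\<rho><R. ar s10 5 \<rho> = ar s9 6 \<rho> \<and> ar s10 6 \<rho> = 0) \<and>
        (\<forall>\<rho><R1. ar s10 8 \<rho> = ar s9 9 \<rho> + ss \<tau> \<rho> q * ar s9 6 \<rho> \<and> ar s10 9 \<rho> = 0)
     else vr s10 = vr s9 \<and> ar s10 = ar s9"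
    using tri_A10[OF cp9 p9(1) iB sl9] by (rule triE) auto
  note c10D = chgD[OF c10]
  have cp10: "cpar \<tau> s10" using cp9 c10D unfolding cpar_def by simp

  have go: "goes Pt arrival s (t1 + (t2 + (t3 + (t4 + (t5 + (t6 + (t7 + (t8 + (t9 + t10))))))))) s10"
    unfolding arrival_def
    by (intro goes_Seq) (rule g1(1) g2(1) g3(1) g4(1) g5(1) g6(1) g7(1) g8(1) g9(1) g10(1))+
  have tt: "t1 + (t2 + (t3 + (t4 + (t5 + (t6 + (t7 + (t8 + (t9 + t10)))))))) \<le> TT"
    unfolding TT_def using g1(2) g2(2) g3(2) g4(2) g5(2) g6(2) g7(2) g8(2) g9(2) g10(2) by linarith

  have XB': "ar s10 2 j = (if j < Suc i then blk y \<kappa> j else ?x j)" if "j < B" for j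
  proof -
    have "ar s10 2 = (ar s 2)(i := vr s 0)"
      using p1(2) c2D(2) c3D(2) c4D(2) c5D(2) c6D(2) c7D(2) c8D(2) c9D(2) c10D(2) by simp
    then show ?thesis using XB[OF that] x by (auto simp: blk_def)
  qed
  have ck10: "\<And>a. a \<in> {10, 11, 12, 13} \<Longrightarrow> ar s10 a = ar s5 a"
    using c6D(2) c7D(2) c8D(2) c9D(2) c10D(2) by auto
  have ckp10: "ckd \<tau> y \<kappa>p (Suc i) s10" by (rule ckd_same[OF ckp5 same_slot_ar[OF ck10]])
  have CK10: "okck \<tau> y \<kappa>' s10" if "\<kappa> - G \<le> \<kappa>'" "\<kappa>' < \<kappa>p" for \<kappa>'
    by (rule okck_same[OF CK5[OF that] same_slot_ar[OF ck10]])
  have SC10: "scst \<tau> y \<kappa>p (Suc i) s10"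
    using SC5 c6D(1) c7D(1) c8D(1) c9D(1) c10D(1) unfolding scst_def by simp
  have LF10: "lft \<tau> y \<kappa>l (Suc p) s10"
  proof -
    have v: "vr s10 25 = vr s7 25" "vr s10 26 = vr s7 26" "ar s10 7 = ar s8 7"
      using c8D(1) c9D(1) c10D(1) c9D(2) c10D(2) by simp_all
    show ?thesis
    proof (cases ?real)
      case True
      then have "lg = snd (lck ?Ql ?xl p)" by (simp add: lg_def)
      then show ?thesis using True real7 p8(3) unfolding lft_def v by simp
    next
      case False
      then show ?thesis using virt7 unfolding lft_def v by simp
    qed
  qed
  have out: "vr s10 0 = iop w Div (Vf \<tau> y (\<kappa> - G) i * (2 * int k + 1)) (2 * int k * int R1)" if ?real
    using p9(2) V8[OF that] c10D(1) by simp

  have "if Suc i = B then Inv \<tau> y (Suc \<kappa>) 0 s10 else Inv \<tau> y \<kappa> (Suc i) s10"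
  proof (cases "Suc i = B")
    case False
    then have iB': "Suc i < B" using iB by simp
    have e: "vr s10 = vr s9" "ar s10 = ar s9" using p10 False by simp_all
    have b10: "base \<tau> (Suc i) ?sl s10"
      using cp10 p9(1) sl9 iB' e unfolding base_def by simp
    have a9: "ar s9 5 = ar s5 5" "ar s9 6 = ar s5 6" "ar s9 8 = ar s8 8" "ar s9 9 = ar s8 9"
      using c6D(2) c7D(2) c8D(2) c9D(2) by simp_all
    have "Inv \<tau> y \<kappa> (Suc i) s10"
      unfolding Inv_def \<kappa>p_def[symmetric]
    proof (intro conjI allI impI)
      show "base \<tau> (Suc i) ?sl s10" by (rule b10)
      show "ar s10 2 j = (if j < Suc i then blk y \<kappa> j else ?x j)" if "j < B" for j by (rule XB'[OF that])
      show "ar s10 5 \<rho> = Zs \<tau> y \<kappa>p (Suc i) \<rho>" if "\<rho> < R" for \<rho> using Z55[OF that] e a9 by simp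
      show "ar s10 6 \<rho> = cu \<tau> y \<kappa> (Suc i) \<rho>" if "\<rho> < R" for \<rho> using Z55[OF that] e a9 by simp
      show "scst \<tau> y \<kappa>p (Suc i) s10" by (rule SC10)
      show "ckd \<tau> y \<kappa>p (Suc i) s10" by (rule ckp10)
      show "okck \<tau> y \<kappa>' s10" if "\<kappa> - G \<le> \<kappa>' \<and> \<kappa>' < \<kappa>p" for \<kappa>' using CK10 that by blast
      show "lft \<tau> y (\<kappa> - G + le (Suc i)) (pp (Suc i)) s10" if "0 < pp (Suc i)"
        using LF10 pp_Suc[OF iB' that] by (simp add: \<kappa>l_def p_def)
      show "ar s10 8 \<rho> = mds \<tau> y (\<kappa> - G) 1 \<rho>" if "Suc i \<le> m0" "\<rho> < R1" for \<rho>
        using p8(2)[OF that(2)] mf1[of \<rho>] that e a9 by simp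
      show "ar s10 8 \<rho> = mds \<tau> y (\<kappa> - G) 2 \<rho>" if "m0 < Suc i \<and> G \<le> \<kappa> - G + 2" "\<rho> < R1" for \<rho>
      proof -
        have "le i = 1" using that pp_ge[of i] iB by simp
        then have ?real using that by (simp add: \<kappa>l_def)
        then show ?thesis using p8(2)[OF that(2)] mf2[of \<rho>] that e a9 by simp
      qed
      show "ar s10 9 \<rho> = (\<Sum>b = 1..<Suc (min (Suc i) (q - 1)). ss \<tau> \<rho> b * Zs \<tau> y (\<kappa> + 1 - G + b) 0 \<rho>)"
        if "\<rho> < R1" for \<rho> using AC8[OF that] e a9 by simp
    qed
    then show ?thesis using False by simp
  next
    case True
    have e: "vr s10 20 = 0" "vr s10 21 = int ((?sl + 1) mod G)"
      "\<And>\<rho>. \<rho> < R \<Longrightarrow> ar s10 5 \<rho> = ar s9 6 \<rho>" "\<And>\<rho>. \<rho> < R \<Longrightarrow> ar s10 6 \<rho> = 0"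
      "\<And>\<rho>. \<rho> < R1 \<Longrightarrow> ar s10 8 \<rho> = ar s9 9 \<rho> + ss \<tau> \<rho> q * ar s9 6 \<rho>" "\<And>\<rho>. \<rho> < R1 \<Longrightarrow> ar s10 9 \<rho> = 0"
      using p10 True by simp_all
    have sl': "(?sl + 1) mod G = Suc \<kappa> mod G" by (simp add: mod_Suc_eq)
    have a9: "ar s9 6 = ar s5 6" "ar s9 9 = ar s8 9"
      using c6D(2) c7D(2) c8D(2) c9D(2) by simp_all
    have c6: "ar s9 6 \<rho> = Zs \<tau> y \<kappa> 0 \<rho>" if "\<rho> < R" for \<rho>
      using Z55(2)[OF that] a9 True cu_B by simp
    have Sk: "Suc \<kappa> - 1 = \<kappa>" by simp
    have "Inv \<tau> y (Suc \<kappa>) 0 s10"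
      unfolding Inv_def Sk
    proof (intro conjI allI impI)
      show "base \<tau> 0 (Suc \<kappa> mod G) s10"
        using cp10 e(1,2) sl' B1 G2 unfolding base_def by simp
      show "ar s10 2 j = (if j < 0 then blk y (Suc \<kappa>) j else blk y \<kappa> j)" if "j < B" for j
        using XB'[OF that] True that by simp
      show "ar s10 5 \<rho> = Zs \<tau> y \<kappa> 0 \<rho>" if "\<rho> < R" for \<rho> using e(3)[OF that] c6[OF that] by simp
      show "ar s10 6 \<rho> = cu \<tau> y (Suc \<kappa>) 0 \<rho>" if "\<rho> < R" for \<rho> using e(4)[OF that] by (simp add: cu_def)
      show "okck \<tau> y \<kappa>' s10" if "Suc \<kappa> - G \<le> \<kappa>' \<and> \<kappa>' < \<kappa>" for \<kappa>'
      proof (cases "\<kappa>' = \<kappa>p")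
        case True': True
        have "G \<le> \<kappa>p + 1" using \<kappa>p \<kappa>G by simp
        then show ?thesis using ckp10 True True' by (simp add: okck_def)
      next
        case False
        then show ?thesis using that \<kappa>p by (intro CK10) auto
      qed
      show "lft \<tau> y (Suc \<kappa> - G + le 0) (pp 0) s10" if "0 < pp 0"
      proof -
        have "Suc \<kappa> - G + le 0 = \<kappa>l" "pp 0 = Suc p"
          using pp_wrap[OF True that] \<kappa>G by (simp_all add: \<kappa>l_def p_def)
        then show ?thesis using LF10 by simp
      qed
      show "ar s10 8 \<rho> = mds \<tau> y (Suc \<kappa> - G) 1 \<rho>" if "\<rho> < R1" for \<rho>
      proof -
        \<comment> \<open>After \<open>B\<close> arrivals all blocks 1 to \<open>q - 1\<close> have
          been added; only block \<open>q\<close>, just completed, is missing.\<close>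
        have "q - 1 \<le> B" using qB by simp
        then have mn: "min (Suc i) (q - 1) = q - 1" using True by simp
        have k1: "\<kappa> + 1 - G + q = \<kappa>" using \<kappa>G by (simp add: G_def)
        have "mds \<tau> y (\<kappa> + 1 - G) 1 \<rho> = (\<Sum>b = 1..<Suc (q - 1). ss \<tau> \<rho> b * Zs \<tau> y (\<kappa> + 1 - G + b) 0 \<rho>)
            + ss \<tau> \<rho> q * Zs \<tau> y \<kappa> 0 \<rho>"
          unfolding mds_def using q1 k1 by simp
        then show ?thesis using e(5)[OF that] AC8[OF that] a9 c6[of \<rho>] that R_R1 mn by simp
      qed
      show "ar s10 9 \<rho> = (\<Sum>b = 1..<Suc (min 0 (q - 1)). ss \<tau> \<rho> b * Zs \<tau> y (Suc \<kappa> + 1 - G + b) 0 \<rho>)"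
        if "\<rho> < R1" for \<rho> using e(6)[OF that] by simp
    qed auto
    then show ?thesis using True by simp
  qed
  then show ?thesis
    using out by (intro triI[OF go tt]) (auto simp: \<kappa>l_def)
qed

end

section \<open>Preprocessing\<close>

definition pa :: cmd where
  "pa = (Asg 2 (Var 0) ;; If (Var 1 <: Cst 2 *: Var 0) (Asg 3 (Var 1)) (Asg 3 (Cst 2 *: Var 0)) ;; Asg 4 (Cst 1))"

text \<open>A linear search for the integer square root; the time bound concerns arrivals, not
  preprocessing.\<close>

definition pb :: cmd where
  "pb = While ((Var 4 +: Cst 1) *: (Var 4 +: Cst 1) <: Var 2 +: Cst 1) (Asg 4 (Var 4 +: Cst 1))"

definition pc :: cmd where "pc = (Asg 7 (Cst 1) ;; Asg 15 (Cst 2))"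

definition pd :: cmd where
  "pd = While (Var 15 <: Var 2) (Asg 15 (Var 15 *: Cst 2) ;; Asg 7 (Var 7 +: Cst 1))"

definition pe :: cmd where
  "pe = (Asg 5 (Op Div (Var 2 -: Cst 1) (Var 4)) ;; Asg 6 (Op Mod (Var 2 -: Cst 1) (Var 4)) ;;
     Asg 11 (Var 5 +: Cst 1) ;; Asg 12 (Var 4 +: (Var 5 +: Cst 2)) ;;
     Asg 8 (Cst 32768 *: Var 3 *: Var 3) ;; Asg 9 (Var 8 +: Cst 32 *: Var 7) ;;
     Asg 10 (Cst 16384 *: Var 3 *: Var 7) ;; Asg 13 (Cst 320 *: Var 3 *: (Cst 32 *: Var 7)) ;;
     Asg 15 (Var 9 *: Var 12) ;; Asg 17 (Cst 0))"

definition setup_params :: cmd where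
  "setup_params = (pa ;; pb ;; pc ;; pd ;; pe)"

text \<open>Only the parity of the random word is used, as a sign. Clearing the word afterwards
  makes the state a function of the signs drawn so far.\<close>

definition fill_body :: cmd where
  "fill_body = (Sto 0 (Var 17) (Cst 1 -: Cst 2 *: Op Mod (Var 14) (Cst 2)) ;;
     Asg 17 (Var 17 +: Cst 1) ;; Asg 14 (Cst 0))"

definition ta :: cmd where
  "ta = For 16 (Cst 0) 4 (Rp 14 (Var 16) ;; Sto 1 (Var 16) (Var 14))"

definition vE :: ex where "vE = Var 4 +: Var 16 -: Var 6 +: Var 19"

definition tb1 :: cmd where
  "tb1 = (Rp 14 (Var 19) ;; Asg 18 (Var 18 +: Arr 0 (Var 17 *: Var 12 +: Var 4 +: Op Div vE (Var 4)) *: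
        Arr 0 (Var 17 *: Var 12 +: Op Mod vE (Var 4)) *: Var 14))"

definition tb2 :: cmd where
  "tb2 = (Asg 18 (Cst 0) ;; For 19 (Cst 0) 2 tb1 ;; Sto 3 (Var 16 *: Var 8 +: Var 17) (Var 18))"

definition tb :: cmd where "tb = For 16 (Cst 0) 4 (For 17 (Cst 0) 8 tb2)"

definition td1 :: cmd where
  "td1 = Asg 18 (Var 18 +: Arr 0 (Var 17 *: Var 12 +: Var 19) *: Arr 1 (Var 19 -: Var 16))"

definition td2 :: cmd where
  "td2 = (Asg 18 (Cst 0) ;; For 19 (Var 16) 4 td1 ;; Sto 4 (Var 16 *: Var 9 +: Var 17) (Var 18))"

definition td :: cmd where "td = For 16 (Cst 0) 4 (For 17 (Cst 0) 9 td2)"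

definition tables :: cmd where "tables = (ta ;; tb ;; td)"

context algo
begin

lemma goes_den: "loopfree c \<Longrightarrow> okc Pt c s \<Longrightarrow> \<exists>t. goes Pt c s t (den Pt c s)"
  using den_correct by blast

lemma goes_While_count:
  assumes "\<And>j. lo \<le> j \<Longrightarrow> j < hi \<Longrightarrow> okx w M (F j) e \<and> ev w (F j) e = 1 \<and> okc Pt c (F j) \<and> den Pt c (F j) = F (Suc j)"
    and "loopfree c" "okx w M (F hi) e" "ev w (F hi) e = 0" "lo \<le> hi"
  shows "\<exists>t. goes Pt (While e c) (F lo) t (F hi)"
  using assms(5,1)
proof (induction "hi - lo" arbitrary: lo)
  case 0
  then have "lo = hi" by simp
  then show ?case using goes_While_end[OF assms(3), of Pt c] assms(4) by auto
next
  case (Suc d)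
  then have lt: "lo < hi" by simp
  from Suc.prems(2)[OF _ lt] have h: "okx w M (F lo) e" "ev w (F lo) e = 1" "okc Pt c (F lo)" "den Pt c (F lo) = F (Suc lo)"
    by auto
  obtain t1 where t1: "goes Pt c (F lo) t1 (F (Suc lo))" using goes_den[OF assms(2) h(3)] h(4) by auto
  have "\<exists>t. goes Pt (While e c) (F (Suc lo)) t (F hi)"
    by (rule Suc.hyps(1)) (use Suc.hyps(2) lt Suc.prems(2) in auto)
  then obtain t2 where t2: "goes Pt (While e c) (F (Suc lo)) t2 (F hi)" by blast
  show ?case using goes_While_step[OF h(1) _ t1 t2] h(2) by auto
qed

lemma iop_Div [simp]: "a < 2 ^ w \<Longrightarrow> b < 2 ^ w \<Longrightarrow> iop w Div (int a) (int b) = int (a div b)"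
  by (simp add: iop.simps)

definition V0 :: "nat \<Rightarrow> nat \<Rightarrow> int" where
  "V0 kin = (\<lambda>_. 0)(0 := int n, 1 := int kin)"

definition Fs :: "nat \<Rightarrow> nat \<Rightarrow> (nat \<Rightarrow> int) \<Rightarrow> st" where
  "Fs kin j \<tau> = \<lparr>vr = (V0 kin)(2 := int n, 3 := int k, 4 := int B, 7 := int Lg, 5 := int q, 6 := int m0,
     11 := int G, 12 := int Wd, 8 := int R1, 9 := int R, 10 := int Cap, 13 := int DKR, 15 := int (R * Wd), 17 := int j),
     ar = (\<lambda>_ _. 0)(0 := \<tau>)\<rparr>"

lemma setup_goes:
  assumes kin: "kin < 2 ^ w" "k = min kin (2 * n)"
  shows "\<exists>t. goes Pt setup_params \<lparr>vr = V0 kin, ar = \<lambda>_ _. 0\<rparr> t (Fs kin 0 (\<lambda>_. 0))"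
proof -
  let ?s0 = "\<lparr>vr = V0 kin, ar = \<lambda>_ _. 0\<rparr>"
  define F1 where "F1 j = \<lparr>vr = (V0 kin)(2 := int n, 3 := int k, 4 := int j), ar = \<lambda>_ _. 0\<rparr>" for j :: nat
  define F2 where "F2 j = \<lparr>vr = (V0 kin)(2 := int n, 3 := int k, 4 := int B, 7 := int j, 15 := 2 ^ j), ar = \<lambda>_ _. 0\<rparr>" for j :: nat
  have l: "iop w Less (int kin) (2 * int n) = of_bool (kin < 2 * n)"
    using iop_Less[of kin "2 * n"] kin small(7)[of "2 * n"] by simp
  have "den Pt pa ?s0 = F1 1"
    using l kin(2) by (auto simp: pa_def F1_def V0_def fun_eq_iff min_def)
  moreover have "okc Pt pa ?s0" "loopfree pa" by (simp_all add: pa_def)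
  ultimately obtain ta where ta: "goes Pt pa ?s0 ta (F1 1)" using goes_den[of pa Pt ?s0] by auto
  have c1: "ev w (F1 j) ((Var 4 +: Cst 1) *: (Var 4 +: Cst 1) <: Var 2 +: Cst 1) = of_bool (j < B)" if "j \<le> B" for j
  proof -
    have "(j + 1) * (j + 1) \<le> (n + 1) * (n + 1)" using that Bn by (intro mult_le_mono) auto
    also have "\<dots> \<le> (2 * n) * (2 * n)" using n2 by (intro mult_le_mono) auto
    finally have "(j + 1) * (j + 1) < 2 ^ w" by (intro pow_le[of 4 2]) (auto simp: power2_eq_square)
    moreover have "n + 1 < 2 ^ w" using small(7)[of "n + 1"] n2 by simp
    ultimately have "iop w Less (int ((j + 1) * (j + 1))) (int (n + 1)) = of_bool ((j + 1) * (j + 1) < n + 1)"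
      by (rule iop_Less)
    moreover have "(j + 1) * (j + 1) < n + 1 \<longleftrightarrow> j < B"
    proof
      assume "j < B"
      then have "(j + 1) * (j + 1) \<le> B * B" by (intro mult_le_mono) auto
      then show "(j + 1) * (j + 1) < n + 1" using BB by simp
    next
      assume h: "(j + 1) * (j + 1) < n + 1"
      show "j < B"
      proof (rule ccontr)
        assume "\<not> j < B"
        then have "j = B" using that by simp
        then show False using h nB by simp
      qed
    qed
    moreover have "ev w (F1 j) ((Var 4 +: Cst 1) *: (Var 4 +: Cst 1) <: Var 2 +: Cst 1)
       = iop w Less (int ((j + 1) * (j + 1))) (int (n + 1))"
      by (simp add: F1_def algebra_simps)
    ultimately show ?thesis by simp
  qed
  have "\<exists>t. goes Pt pb (F1 1) t (F1 B)"
    unfolding pb_def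
    by (rule goes_While_count[where F = F1]) (use c1 B1 in \<open>auto simp: F1_def fun_eq_iff\<close>)
  then obtain tb where tb: "goes Pt pb (F1 1) tb (F1 B)" by blast
  have "den Pt pc (F1 B) = F2 1" by (auto simp: pc_def F1_def F2_def fun_eq_iff)
  moreover have "okc Pt pc (F1 B)" "loopfree pc" by (simp_all add: pc_def)
  ultimately obtain tc where tc: "goes Pt pc (F1 B) tc (F2 1)" using goes_den[of pc Pt "F1 B"] by auto
  have c2: "ev w (F2 j) (Var 15 <: Var 2) = of_bool (j < Lg)" if "j \<le> Lg" for j
  proof -
    have "(2::nat) ^ j \<le> 2 ^ Lg" using that by (intro power_increasing) auto
    then have "2 ^ j \<le> 10 * n" using Lgn by linarith
    then have "(2::nat) ^ j < 2 ^ w" by (rule small(7))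
    then have "iop w Less (int (2 ^ j)) (int n) = of_bool (2 ^ j < n)" by (intro iop_Less small(1))
    moreover have "2 ^ j < n \<longleftrightarrow> j < Lg"
    proof
      assume "j < Lg"
      then have "(2::nat) ^ Suc j \<le> 2 ^ Lg" by (intro power_increasing) auto
      then show "2 ^ j < n" using Lgn by simp
    next
      assume h: "2 ^ j < n"
      then have "(2::nat) ^ j < 2 ^ Lg" using nLg by linarith
      then show "j < Lg" by (simp add: power_strict_increasing_iff)
    qed
    ultimately show ?thesis by (simp add: F2_def)
  qed
  have "\<exists>t. goes Pt pd (F2 1) t (F2 Lg)"
    unfolding pd_def
    by (rule goes_While_count[where F = F2]) (use c2 Lg1 in \<open>auto simp: F2_def fun_eq_iff\<close>)
  then obtain td where td: "goes Pt pd (F2 1) td (F2 Lg)" by blast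
  have n1: "int n - 1 = int (n - 1)" using n2 by simp
  have nw: "n - 1 < 2 ^ w" using small(1) by simp
  have dq: "iop w Div (int n - 1) (int B) = int q" "iop w Mod (int n - 1) (int B) = int m0"
    unfolding n1 q_def m0_def using nw small(2) by (simp_all only: iop_Div iop_Mod)
  have "den Pt pe (F2 Lg) = Fs kin 0 (\<lambda>_. 0)"
    using dq by (auto simp: pe_def F2_def Fs_def fun_eq_iff G_def Wd_def R1_def R_def R2_def Cap_def DKR_def algebra_simps)
  moreover have "okc Pt pe (F2 Lg)" "loopfree pe" by (simp_all add: pe_def)
  ultimately obtain te where te: "goes Pt pe (F2 Lg) te (Fs kin 0 (\<lambda>_. 0))" using goes_den[of pe Pt "F2 Lg"] by auto
  show ?thesis
    unfolding setup_params_def using goes_Seq[OF ta goes_Seq[OF tb goes_Seq[OF tc goes_Seq[OF td te]]]] by blast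
qed

lemma fill_step:
  assumes "j < R * Wd" "v < 2 ^ w"
  shows "okc Pt fill_body ((Fs kin j \<tau>)\<lparr>vr := (vr (Fs kin j \<tau>))(14 := int v)\<rparr>) \<and>
    den Pt fill_body ((Fs kin j \<tau>)\<lparr>vr := (vr (Fs kin j \<tau>))(14 := int v)\<rparr>)
      = Fs kin (Suc j) (\<tau>(j := 1 - 2 * int (v mod 2)))"
proof -
  have "iop w Mod (int v) 2 = int (v mod 2)" using iop_Mod[of v 2] assms(2) pw1 by simp
  moreover have "j < M" using assms(1) RW_M by simp
  ultimately show ?thesis by (auto simp: fill_body_def Fs_def V0_def fun_eq_iff)
qed

lemma uni_sg: "map_pmf (\<lambda>v. 1 - 2 * int (v mod 2)) uni = sg"
proof -
  define m :: nat where "m = 2 ^ (w - 1)"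
  have m: "2 ^ w = 2 * m" "0 < m" using w_pos by (auto simp: m_def power_Suc[symmetric] simp del: power_Suc)
  have c: "card {v. v < 2 * m \<and> v mod 2 = r} = m" if "r < 2" for r
  proof -
    have "bij_betw (\<lambda>j. 2 * j + r) {..<m} {v. v < 2 * m \<and> v mod 2 = r}"
      by (rule bij_betw_byWitness[where f' = "\<lambda>v. v div 2"]) (use that in auto)
    then show ?thesis using bij_betw_same_card by fastforce
  qed
  have ne: "{..<2 ^ w :: nat} \<noteq> {}" by (auto simp: lessThan_empty_iff)
  have pr: "pmf (map_pmf (\<lambda>v. 1 - 2 * int (v mod 2)) uni) x = real (card ({..<2 ^ w} \<inter> {v. 1 - 2 * int (v mod 2) = x})) / real (2 ^ w)" for x
    unfolding pmf_map uni_def vimage_def by (subst measure_pmf_of_set) (use ne in \<open>auto simp: Int_commute\<close>)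
  show ?thesis
  proof (rule pmf_eqI)
    fix x :: int
    have "{..<2 ^ w} \<inter> {v. 1 - 2 * int (v mod 2) = x} =
       (if x = 1 then {v. v < 2 * m \<and> v mod 2 = 0} else if x = -1 then {v. v < 2 * m \<and> v mod 2 = 1} else {})"
      by (auto simp: m)
    then show "pmf (map_pmf (\<lambda>v. 1 - 2 * int (v mod 2)) uni) x = pmf sg x"
      unfolding pr using c[of 0] c[of 1] m by (auto simp: sg_def pmf_of_set indicator_def)
  qed
qed

definition Ti :: "nat \<Rightarrow> nat \<Rightarrow> nat" where "Ti H t = 6 + H * (t + 10)"

lemma double_loop:
  assumes H: "vr s0 y = int H" "H \<le> R" "y \<in> {8, 9}" "vr s0 4 = int B"
    and body: "\<And>s i \<rho>. chg {14, 16, 17, 18, 19} {a} s0 s \<Longrightarrow> vr s 16 = int i \<Longrightarrow> vr s 17 = int \<rho> \<Longrightarrow> i < B \<Longrightarrow> \<rho> < H \<Longrightarrow>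
      tri Pt c s t (\<lambda>s'. chg {14, 18, 19} {a} s s' \<and> ar s' a = (ar s a)(i * H + \<rho> := f i \<rho>))"
  shows "tri Pt (For 16 (Cst 0) 4 (For 17 (Cst 0) y c)) s0 (Ti B (Ti H t))
    (\<lambda>s'. chg {14, 16, 17, 18, 19} {a} s0 s' \<and> (\<forall>i<B. \<forall>\<rho><H. ar s' a (i * H + \<rho>) = f i \<rho>))"
proof -
  let ?X = "{14, 16, 17, 18, 19} :: nat set"
  define I where "I i s \<longleftrightarrow> chg ?X {a} s0 s \<and> (\<forall>i'<i. \<forall>\<rho><H. ar s a (i' * H + \<rho>) = f i' \<rho>)" for i s
  have Hw: "H < 2 ^ w" using H(2) small(5) by simp
  show ?thesis
  proof (rule tri_For[where I = I and lo = 0 and hi = B and t = "Ti H t"])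
    show "I 0 (s0\<lparr>vr := (vr s0)(16 := int 0)\<rparr>)" by (simp add: I_def chg_def)
  next
    fix i s assume i: "i < B" and Is: "I i s" and v: "vr s 16 = int i" "vr s 4 = int B"
    define K where "K \<rho> s' \<longleftrightarrow> chg ?X {a} s0 s' \<and> vr s' 16 = int i \<and> (\<forall>i'<i. \<forall>\<rho><H. ar s' a (i' * H + \<rho>) = f i' \<rho>) \<and>
        (\<forall>\<rho>'<\<rho>. ar s' a (i * H + \<rho>') = f i \<rho>')" for \<rho> s'
    show "tri Pt (For 17 (Cst 0) y c) s (Ti H t) (\<lambda>s'. vr s' 16 = int i \<and> vr s' 4 = int B \<and>
        I (Suc i) (s'\<lparr>vr := (vr s')(16 := 1 + int i)\<rparr>))"
    proof (rule tri_For[where I = K and lo = 0 and hi = H and t = t])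
      show "K 0 (s\<lparr>vr := (vr s)(17 := int 0)\<rparr>)" using Is v by (auto simp: K_def I_def chg_def)
      show "vr s y = int H" using Is H by (auto simp: I_def chg_def)
    next
      fix \<rho> s' assume r: "\<rho> < H" and K: "K \<rho> s'" and v': "vr s' 17 = int \<rho>" "vr s' y = int H"
      have ne: "i' * H + \<rho>' \<noteq> i * H + \<rho>" if "i' < i" "\<rho>' < H" for i' \<rho>'
        using idx_bound[OF that] by simp
      have "tri Pt c s' t (\<lambda>s''. chg {14, 18, 19} {a} s' s'' \<and> ar s'' a = (ar s' a)(i * H + \<rho> := f i \<rho>))"
        using K v' i r by (intro body) (auto simp: K_def)
      then show "tri Pt c s' t (\<lambda>s''. vr s'' 17 = int \<rho> \<and> vr s'' y = int H \<and>
          K (Suc \<rho>) (s''\<lparr>vr := (vr s'')(17 := 1 + int \<rho>)\<rparr>))"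
      proof (rule tri_mono)
        fix s'' assume h: "chg {14, 18, 19} {a} s' s'' \<and> ar s'' a = (ar s' a)(i * H + \<rho> := f i \<rho>)"
        have ch: "chg ?X {a} s0 s''" using h K unfolding K_def chg_def by auto
        have "vr s'' 17 = int \<rho>" "vr s'' y = int H" "vr s'' 16 = int i"
          using h v' K H(3) by (auto simp: chg_def K_def)
        then show "vr s'' 17 = int \<rho> \<and> vr s'' y = int H \<and> K (Suc \<rho>) (s''\<lparr>vr := (vr s'')(17 := 1 + int \<rho>)\<rparr>)"
          using h K ch ne by (auto simp: K_def chg_def less_Suc_eq)
      qed simp
    next
      fix s' assume "K H s'" "vr s' 17 = int H"
      then show "vr s' 16 = int i \<and> vr s' 4 = int B \<and> I (Suc i) (s'\<lparr>vr := (vr s')(16 := 1 + int i)\<rparr>)"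
        using H(4) by (auto simp: K_def I_def chg_def less_Suc_eq)
    qed (use H Hw in \<open>auto simp: Ti_def\<close>)
  next
    fix s assume "I B s" "vr s 16 = int B"
    then show "chg ?X {a} s0 s \<and> (\<forall>i<B. \<forall>\<rho><H. ar s a (i * H + \<rho>) = f i \<rho>)" by (simp add: I_def)
  qed (use H small(2) in \<open>auto simp: Ti_def\<close>)
qed

lemma tri_ta:
  assumes "vr s 4 = int B"
  shows "tri P ta s (Ti B 20) (\<lambda>s'. chg {14, 16} {1} s s' \<and> (\<forall>j<B. ar s' 1 j = pat j))"
proof -
  let ?b = "Rp 14 (Var 16) ;; Sto 1 (Var 16) (Var 14)"
  define F where "F j = \<lparr>vr = (vr s)(14 := if j = 0 then vr s 14 else pat (j - 1), 16 := int j),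
    ar = (ar s)(1 := \<lambda>x. if x < j then pat x else ar s 1 x)\<rparr>" for j
  show ?thesis
    unfolding ta_def
  proof (rule tri_For_fun[where F = F and lo = 0 and hi = B])
    show "F 0 = s\<lparr>vr := (vr s)(16 := int 0)\<rparr>" by (auto simp: F_def fun_eq_iff)
  next
    fix j assume j: "j < B"
    have "j < M" "j < n" "j < 2 ^ w" using j B_M Bn small(2) by auto
    moreover from this have "int j < 2 ^ w" using int_lt_pw by blast
    ultimately show "okc P ?b (F j) \<and> vr (den P ?b (F j)) 16 = int j \<and> vr (den P ?b (F j)) 4 = int B \<and>
      (den P ?b (F j))\<lparr>vr := (vr (den P ?b (F j)))(16 := 1 + int j)\<rparr> = F (Suc j)"
      using assms lenP by (auto simp: F_def fun_eq_iff pat_def less_Suc_eq)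
  next
    have "clen ?b + 10 \<le> 30" by (simp add: caddr_def)
    then have "B * (clen ?b + 10) \<le> B * 30" by (intro mult_le_mono2)
    then show "length (cx 0 (Cst 0)) + 5 + B * (clen ?b + 10) \<le> Ti B 20"
      by (simp only: Ti_def) simp
  qed (use assms small(2) in \<open>auto simp: F_def chg_def\<close>)
qed

lemma tri_tb2:
  assumes v: "vr s 2 = int n" "vr s 4 = int B" "vr s 6 = int m0" "vr s 8 = int R1" "vr s 12 = int Wd"
    "vr s 16 = int i" "vr s 17 = int \<rho>" "ar s 0 = \<tau>" "i < B" "\<rho> < R1"
  shows "tri P tb2 s (clen tb2 + Ti n (clen tb1)) (\<lambda>s'. chg {14, 18, 19} {3} s s' \<and> ar s' 3 = (ar s 3)(i * R1 + \<rho> := Yp \<tau> i \<rho>))"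
proof -
  let ?v = "\<lambda>j. B + i - m0 + j"
  let ?S = "\<lambda>j. (\<Sum>x<j. ss \<tau> \<rho> (?v x div B) * sr \<tau> \<rho> (?v x mod B) * pat x)"
  let ?e = "Sto 3 (Var 16 *: Var 8 +: Var 17) (Var 18)"
  let ?Q = "\<lambda>s'. chg {14, 18, 19} {3} s s' \<and> ar s' 3 = (ar s 3)(i * R1 + \<rho> := Yp \<tau> i \<rho>)"
  define s1 where "s1 = \<lparr>vr = (vr s)(18 := 0), ar = ar s\<rparr>"
  define F where "F j = \<lparr>vr = (vr s)(14 := if j = 0 then vr s 14 else pat (j - 1), 18 := ?S j, 19 := int j), ar = ar s\<rparr>" for j
  have Yp: "?S n = Yp \<tau> i \<rho>" by (simp add: Yp_def)
  have idx: "int i * int R1 + int \<rho> < int M" using BR1_M[OF v(9,10)] by (simp flip: of_nat_add of_nat_mult)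
  have last: "tri P ?e (F n) (clen ?e) ?Q"
    by (rule tri_den) (use v idx Yp in \<open>auto simp: F_def chg_def\<close>)
  have loop: "tri P (For 19 (Cst 0) 2 tb1) s1 (Ti n (clen tb1)) (\<lambda>s'. tri P ?e s' (clen ?e) ?Q)"
  proof (rule tri_For_fun[where F = F and lo = 0 and hi = n])
    show "F 0 = s1\<lparr>vr := (vr s1)(19 := int 0)\<rparr>" by (auto simp: F_def s1_def fun_eq_iff)
  next
    fix j assume j: "j < n"
    have vj: "int B + int i - int m0 + int j = int (?v j)" using m0B by simp
    have "?v j \<le> 10 * n" using v(9) Bn j by simp
    then have vw: "?v j < 2 ^ w" by (rule small(7))
    have dv: "iop w Div (int B + int i - int m0 + int j) (int B) = int (?v j div B)"
      "iop w Mod (int B + int i - int m0 + int j) (int B) = int (?v j mod B)"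
      unfolding vj using vw small(2) by (simp_all only: iop_Div iop_Mod)
    have "?v j < (q + 2) * B"
    proof -
      have "?v j \<le> B + i + (n - 1) - m0" using j m0B by simp
      also have "\<dots> = B + i + q * B" using n_eq by simp
      also have "\<dots> < (q + 2) * B" using v(9) by simp
      finally show ?thesis .
    qed
    then have dq: "?v j div B < q + 2" by (simp add: less_mult_imp_div_less)
    have b1: "int \<rho> * int Wd + int B + int (?v j div B) < int M" by (rule W_ints[OF v(10) dq])
    have b2: "int \<rho> * int Wd + int (?v j mod B) < int M"
      using v(10) R_R1 B1 by (intro W_int) auto
    have jw: "int j < 2 ^ w" using int_lt_pw[of "int j" j] j small(1) by simp
    have Fv: "vr (F j) 4 = int B" "vr (F j) 16 = int i" "vr (F j) 6 = int m0" "vr (F j) 19 = int j"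
      "vr (F j) 17 = int \<rho>" "vr (F j) 12 = int Wd" "vr (F j) 2 = int n" "ar (F j) 0 = \<tau>" "vr (F j) 18 = ?S j"
      using v by (simp_all add: F_def)
    have D: "den P tb1 (F j) = \<lparr>vr = (vr (F j))(14 := pat j, 18 := ?S (Suc j)), ar = ar (F j)\<rparr> \<and> okc P tb1 (F j)"
      using Fv dv b1 b2 j jw lenP by (simp add: tb1_def vE_def pat_def ss_def sr_def)
    have "\<lparr>vr = ((vr (F j))(14 := pat j, 18 := ?S (Suc j)))(19 := 1 + int j), ar = ar (F j)\<rparr> = F (Suc j)"
      by (simp add: F_def fun_eq_iff)
    then show "okc P tb1 (F j) \<and> vr (den P tb1 (F j)) 19 = int j \<and> vr (den P tb1 (F j)) 2 = int n \<and>
      (den P tb1 (F j))\<lparr>vr := (vr (den P tb1 (F j)))(19 := 1 + int j)\<rparr> = F (Suc j)"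
      using D Fv by simp
  qed (use v small(1) last in \<open>auto simp: s1_def Ti_def tb1_def\<close>)
  have "tri P tb2 s (clen (Asg 18 (Cst 0)) + (Ti n (clen tb1) + clen ?e)) ?Q"
    unfolding tb2_def by (intro tri_den_Seq tri_Seq) (use loop in \<open>simp_all add: s1_def\<close>)
  then show ?thesis by (rule tri_mono) (auto simp: tb2_def)
qed

lemma tri_td2:
  assumes v: "vr s 4 = int B" "vr s 9 = int R" "vr s 12 = int Wd" "\<And>j. j < B \<Longrightarrow> ar s 1 j = pat j"
    "vr s 16 = int i" "vr s 17 = int \<rho>" "ar s 0 = \<tau>" "i < B" "\<rho> < R"
  shows "tri P td2 s (clen td2 + Ti B (clen td1)) (\<lambda>s'. chg {14, 18, 19} {4} s s' \<and> ar s' 4 = (ar s 4)(i * R + \<rho> := YQ \<tau> i \<rho>))"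
proof -
  let ?S = "\<lambda>j. (\<Sum>x = i..<j. sr \<tau> \<rho> x * pat (x - i))"
  let ?e = "Sto 4 (Var 16 *: Var 9 +: Var 17) (Var 18)"
  let ?Q = "\<lambda>s'. chg {14, 18, 19} {4} s s' \<and> ar s' 4 = (ar s 4)(i * R + \<rho> := YQ \<tau> i \<rho>)"
  define s1 where "s1 = \<lparr>vr = (vr s)(18 := 0), ar = ar s\<rparr>"
  define F where "F j = \<lparr>vr = (vr s)(18 := ?S j, 19 := int j), ar = ar s\<rparr>" for j
  have idx: "int i * int R + int \<rho> < int M" using BR_M[OF v(8,9)] by (simp flip: of_nat_add of_nat_mult)
  have last: "tri P ?e (F B) (clen ?e) ?Q"
    by (rule tri_den) (use v idx in \<open>auto simp: F_def chg_def YQ_def\<close>)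
  have loop: "tri P (For 19 (Var 16) 4 td1) s1 (Ti B (clen td1)) (\<lambda>s'. tri P ?e s' (clen ?e) ?Q)"
  proof (rule tri_For_fun[where F = F and lo = i and hi = B])
    show "F i = s1\<lparr>vr := (vr s1)(19 := int i)\<rparr>" by (auto simp: F_def s1_def fun_eq_iff)
  next
    fix j assume j: "i \<le> j" "j < B"
    have ji: "int j - int i = int (j - i)" using j by simp
    have jM: "j - i < M" "j - i < B" using j B_M by auto
    show "okc P td1 (F j) \<and> vr (den P td1 (F j)) 19 = int j \<and> vr (den P td1 (F j)) 4 = int B \<and>
      (den P td1 (F j))\<lparr>vr := (vr (den P td1 (F j)))(19 := 1 + int j)\<rparr> = F (Suc j)"
      using v j ji jM W_int[OF v(9) j(2)]
      by (auto simp: td1_def F_def fun_eq_iff sr_def simp del: of_nat_diff)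
  qed (use v small(2) last in \<open>auto simp: s1_def Ti_def td1_def\<close>)
  have "tri P td2 s (clen (Asg 18 (Cst 0)) + (Ti B (clen td1) + clen ?e)) ?Q"
    unfolding td2_def by (intro tri_den_Seq tri_Seq) (use loop in \<open>simp_all add: s1_def\<close>)
  then show ?thesis by (rule tri_mono) (auto simp: td2_def)
qed

text \<open>One time bound serves all sign tables, because \<open>T\<^sub>0\<close> must not depend
  on random choices. The text \<open>y\<close> is quantified inside: preprocessing knows nothing of
  it but the padding.\<close>

lemma tri_tables:
  "\<exists>t. \<forall>\<tau>. tri P tables (Fs kin (R * Wd) \<tau>) t (\<lambda>s'. \<forall>y. zpad y \<longrightarrow> Inv \<tau> y G 0 s')"
proof -
  let ?t = "Ti B 20 + (Ti B (Ti R1 (clen tb2 + Ti n (clen tb1))) + Ti B (Ti R (clen td2 + Ti B (clen td1))))"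
  have "tri P tables (Fs kin (R * Wd) \<tau>) ?t (\<lambda>s'. \<forall>y. zpad y \<longrightarrow> Inv \<tau> y G 0 s')" for \<tau>
  proof -
    let ?s = "Fs kin (R * Wd) \<tau>"
    have pv: "vr ?s 2 = int n" "vr ?s 3 = int k" "vr ?s 4 = int B" "vr ?s 5 = int q" "vr ?s 6 = int m0"
      "vr ?s 8 = int R1" "vr ?s 9 = int R" "vr ?s 10 = int Cap" "vr ?s 11 = int G" "vr ?s 12 = int Wd"
      "vr ?s 13 = int DKR" "vr ?s 20 = 0" "vr ?s 21 = 0" "vr ?s 25 = 0" "vr ?s 26 = 0" "ar ?s 0 = \<tau>"
      "\<And>a j. a \<noteq> 0 \<Longrightarrow> ar ?s a j = 0"
      by (simp_all add: Fs_def V0_def)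
    obtain t1 s1 where g1: "goes P ta ?s t1 s1" "t1 \<le> Ti B 20"
      and c1: "chg {14, 16} {1} ?s s1" and p1: "\<And>j. j < B \<Longrightarrow> ar s1 1 j = pat j"
      using tri_ta[OF pv(3)] by (rule triE) auto
    note c1D = chgD[OF c1]
    have "tri P tb s1 (Ti B (Ti R1 (clen tb2 + Ti n (clen tb1))))
      (\<lambda>s'. chg {14, 16, 17, 18, 19} {3} s1 s' \<and> (\<forall>i<B. \<forall>\<rho><R1. ar s' 3 (i * R1 + \<rho>) = Yp \<tau> i \<rho>))"
      unfolding tb_def
    proof (rule double_loop)
      fix s i \<rho> assume h: "chg {14, 16, 17, 18, 19} {3} s1 s" "vr s 16 = int i" "vr s 17 = int \<rho>" "i < B" "\<rho> < R1"
      show "tri P tb2 s (clen tb2 + Ti n (clen tb1)) (\<lambda>s'. chg {14, 18, 19} {3} s s' \<and> ar s' 3 = (ar s 3)(i * R1 + \<rho> := Yp \<tau> i \<rho>))"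
        using h pv c1D chgD[OF h(1)] by (intro tri_tb2) auto
    qed (use pv c1D R_R1 in auto)
    then obtain t2 s2 where g2: "goes P tb s1 t2 s2" "t2 \<le> Ti B (Ti R1 (clen tb2 + Ti n (clen tb1)))"
      and c2: "chg {14, 16, 17, 18, 19} {3} s1 s2" and p2: "\<forall>i<B. \<forall>\<rho><R1. ar s2 3 (i * R1 + \<rho>) = Yp \<tau> i \<rho>"
      by (rule triE) auto
    note c2D = chgD[OF c2]
    have "tri P td s2 (Ti B (Ti R (clen td2 + Ti B (clen td1))))
      (\<lambda>s'. chg {14, 16, 17, 18, 19} {4} s2 s' \<and> (\<forall>i<B. \<forall>\<rho><R. ar s' 4 (i * R + \<rho>) = YQ \<tau> i \<rho>))"
      unfolding td_def
    proof (rule double_loop)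
      fix s i \<rho> assume h: "chg {14, 16, 17, 18, 19} {4} s2 s" "vr s 16 = int i" "vr s 17 = int \<rho>" "i < B" "\<rho> < R"
      show "tri P td2 s (clen td2 + Ti B (clen td1)) (\<lambda>s'. chg {14, 18, 19} {4} s s' \<and> ar s' 4 = (ar s 4)(i * R + \<rho> := YQ \<tau> i \<rho>))"
        using h pv p1 c1D c2D chgD[OF h(1)] by (intro tri_td2) auto
    qed (use pv c1D c2D in auto)
    then obtain t3 s3 where g3: "goes P td s2 t3 s3" "t3 \<le> Ti B (Ti R (clen td2 + Ti B (clen td1)))"
      and c3: "chg {14, 16, 17, 18, 19} {4} s2 s3" and p3: "\<forall>i<B. \<forall>\<rho><R. ar s3 4 (i * R + \<rho>) = YQ \<tau> i \<rho>"
      by (rule triE) auto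
    note c3D = chgD[OF c3]
    have v3: "\<And>v. v \<notin> {14, 16, 17, 18, 19} \<Longrightarrow> vr s3 v = vr ?s v" using c1D(1) c2D(1) c3D(1) by auto
    have a3: "\<And>a j. a \<notin> {0, 1, 3, 4} \<Longrightarrow> ar s3 a j = 0" using c1D(2) c2D(2) c3D(2) pv(17) by auto
    have cp: "cpar \<tau> s3"
      unfolding cpar_def using v3 pv p1 p2 p3 c1D(2) c2D(2) c3D(2) by simp
    have "Inv \<tau> y G 0 s3" if y: "zpad y" for y
    proof -
      have z: "blk y \<kappa> j = 0" if "\<kappa> < G" "j < B" for \<kappa> j
        using y idx_bound[OF that] by (simp add: zpad_def blk_def)
      have Z: "Zs \<tau> y \<kappa> 0 \<rho> = 0" if "\<kappa> < G" for \<kappa> \<rho>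
        unfolding Zs_def using z[OF that] by simp
      have G2: "2 \<le> G" using q1 by (simp add: G_def)
      have md: "mds \<tau> y 0 1 \<rho> = 0" for \<rho>
        unfolding mds_def by (rule sum.neutral) (auto simp: Z G_def)
      show ?thesis
        unfolding Inv_def
      proof (intro conjI allI impI)
        show "base \<tau> 0 (G mod G) s3" unfolding base_def using cp v3 pv B1 G2 by simp
        show "ar s3 2 j = (if j < 0 then blk y G j else blk y (G - 1) j)" if "j < B" for j
          using a3 z[of "G - 1" j] that G2 by simp
        show "ar s3 5 \<rho> = Zs \<tau> y (G - 1) 0 \<rho>" for \<rho> using a3 Z[of "G - 1"] G2 by simp
        show "ar s3 6 \<rho> = cu \<tau> y G 0 \<rho>" for \<rho> using a3 by (simp add: cu_def)
        show "okck \<tau> y \<kappa>' s3" if "G - G \<le> \<kappa>' \<and> \<kappa>' < G - 1" for \<kappa>'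
        proof -
          have "\<not> G \<le> \<kappa>' + 1" using that by auto
          then show ?thesis using a3 by (simp add: okck_def)
        qed
        show "lft \<tau> y (G - G + le 0) (pp 0) s3" if "0 < pp 0"
        proof -
          have "le 0 = 0" using that pp_ge[of 0] B1 by (auto simp: le_def)
          then show ?thesis using G2 v3 pv by (simp add: lft_def)
        qed
        show "ar s3 8 \<rho> = mds \<tau> y (G - G) 1 \<rho>" for \<rho> using a3 md by simp
        show "ar s3 9 \<rho> = (\<Sum>b = 1..<Suc (min 0 (q - 1)). ss \<tau> \<rho> b * Zs \<tau> y (G + 1 - G + b) 0 \<rho>)" for \<rho>
          using a3 by simp
      qed auto
    qed
    moreover have "goes P tables ?s (t1 + (t2 + t3)) s3"
      unfolding tables_def by (rule goes_Seq[OF g1(1) goes_Seq[OF g2(1) g3(1)]])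
    ultimately show ?thesis using g1(2) g2(2) g3(2) by (intro triI) auto
  qed
  then show ?thesis by blast
qed

end

section \<open>Correctness and resource bounds\<close>

definition alg :: stream_alg where
  "alg = \<lparr>preprocess = cc 0 (Seq (Seq setup_params (Fill 17 15 14 fill_body)) tables) @ [Halt],
     on_arrival = cc 0 arrival @ [Halt]\<rparr>"

lemma wf_setup: "wfc setup_params"
  by (simp add: setup_params_def pa_def pb_def pc_def pd_def pe_def nV_def nT_def nA_def)

lemma wf_fill: "wfc (Fill 17 15 14 fill_body)"
  by (simp add: Fill_def fill_body_def nV_def nT_def nA_def)

lemma wf_tables: "wfc tables"
  by (simp add: tables_def ta_def tb_def tb1_def tb2_def td_def td1_def td2_def vE_def For_def nV_def nT_def nA_def)

lemma wf_arrival: "wfc arrival"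
  by (simp add: arrival_def A1_def A2_def A3_def A4_def A5_def A6_def A7_def A8_def A8b_def A9_def A10_def
      sE_def For_def nV_def nT_def nA_def)

text \<open>The factor of \<open>Suc R\<close> in the time per arrival; it depends on the program
  text only. The summand 660 is 11 times the 60 in \<open>tm\<close>, with \<open>A10\<close>
  counted twice.\<close>

definition kappa :: nat where
  "kappa = clen A1 + clen A2 + clen A3 + clen A4 + clen A5 + clen A6 + clen A7 + clen A8 + clen A9 + 2 * clen A10 + 660"

section \<open>Distribution of the output after a stream\<close>

context algo
begin

lemma TT_eq: "TT = kappa * Suc R"
  unfolding TT_def tm_def kappa_def by (simp only: distrib_right add_mult_distrib2)

lemma rel_initial:
  assumes "kin < 2 ^ w" "kin = min (nat \<lceil>1 / \<epsilon>\<rceil>) (2 ^ w - 1)"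
  shows "rel w M \<lparr>vr = V0 kin, ar = \<lambda>_ _. 0\<rparr> (initial_memory w (nV + nT + nA * M) n \<epsilon>)"
  using assms small(1)
  by (auto simp: rel_def initial_memory_def V0_def nth_list_update nV_def nT_def nA_def)

definition pad :: "bool list \<Rightarrow> nat \<Rightarrow> int" where
  "pad xs j = (if G * B \<le> j \<and> j - G * B < length xs then of_bool (xs ! (j - G * B)) else 0)"

lemma pad_zpad: "zpad (pad xs)" by (simp add: zpad_def pad_def)
lemma pad_bin: "bin (pad xs)" by (simp add: bin_def pad_def)

lemma sbd_rad: "\<tau> \<in> set_pmf (rad {..<N}) \<Longrightarrow> sbd \<tau>"
  unfolding sbd_def
proof
  fix j assume t: "\<tau> \<in> set_pmf (rad {..<N})"
  then have "\<tau> j \<in> {1, -1} \<or> \<tau> j = 0"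
    by (auto simp: set_Pi_pmf PiE_dflt_def)
  then show "\<bar>\<tau> j\<bar> \<le> 1" by auto
qed

text \<open>After \<open>j\<close> arrivals the last symbol has index \<open>j - 1\<close>; with the
  padding it lies in block \<open>(j - 1) div B + G\<close>, so the grid of its window begins at
  block \<open>(j - 1) div B\<close>.\<close>

abbreviation out :: "(nat \<Rightarrow> int) \<Rightarrow> (nat \<Rightarrow> int) \<Rightarrow> nat \<Rightarrow> int" where
  "out \<tau> y j \<equiv> iop w Div (Vf \<tau> y ((j - 1) div B) ((j - 1) mod B) * (2 * int k + 1)) (2 * int k * int R1)"

text \<open>With \<open>n = q * B + m0 + 1\<close> the window start becomes
  \<open>G * B + (length xs - n)\<close>; the window avoids the padding as soon as \<open>n\<close>
  symbols have arrived.\<close>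

lemma hd'_hamming:
  assumes "n \<le> length xs"
  shows "hd' (pad xs) ((length xs - 1) div B) ((length xs - 1) mod B) = int (hamming_distance P (latest n xs))"
proof -
  let ?t = "length xs - 1"
  let ?k = "?t div B" and ?i = "?t mod B"
  have t: "?t = ?k * B + ?i" by simp
  have pos: "?k * B + (B + ?i - m0) + j = G * B + (length xs - n + j)" for j
  proof -
    have "?k * B + (B + ?i - m0) + m0 = ?t + B" using m0B t by linarith
    moreover have "?t + B = (length xs - n) + (q * B + m0) + B" using n_eq assms n2 by linarith
    ultimately show ?thesis by (simp add: G_def algebra_simps)
  qed
  have "hd' (pad xs) ?k ?i = (\<Sum>j<n. of_bool (P ! j \<noteq> latest n xs ! j))"
    unfolding hd'_def pos
    by (intro sum.cong refl) (use assms in \<open>auto simp: pad_def pat_def latest_def\<close>)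
  also have "\<dots> = int (card {j. j < n \<and> P ! j \<noteq> latest n xs ! j})"
  proof -
    have "(\<Sum>j<n. of_bool (P ! j \<noteq> latest n xs ! j) :: int) = (\<Sum>j\<in>{j. j < n \<and> P ! j \<noteq> latest n xs ! j}. 1)"
      by (rule sum.mono_neutral_cong_right) auto
    then show ?thesis by simp
  qed
  finally show ?thesis by (simp add: hamming_distance_def lenP)
qed

lemma preprocess_dist:
  assumes kin: "kin < 2 ^ w" "kin = min (nat \<lceil>1 / \<epsilon>\<rceil>) (2 ^ w - 1)" "k = min kin (2 * n)"
  shows "\<exists>T\<^sub>0 (D :: (nat list \<times> (nat \<Rightarrow> int)) pmf).
    run w P (preprocess alg) T\<^sub>0 (Running 0 (initial_memory w (nV + nT + nA * M) n \<epsilon>)) = map_pmf (\<lambda>d. Halted (fst d)) D \<and>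
    map_pmf snd D = rad {..<R * Wd} \<and>
    (\<forall>d \<in> set_pmf D. \<exists>s. rel w M s (fst d) \<and> (\<forall>y. zpad y \<longrightarrow> Inv (snd d) y G 0 s))"
proof -
  obtain t1 where t1: "goes P setup_params \<lparr>vr = V0 kin, ar = \<lambda>_ _. 0\<rparr> t1 (Fs kin 0 (\<lambda>_. 0))"
    using setup_goes[OF kin(1,3)] by blast
  obtain t2 where t2: "\<And>\<tau>. tri P tables (Fs kin (R * Wd) \<tau>) t2 (\<lambda>s'. \<forall>y. zpad y \<longrightarrow> Inv \<tau> y G 0 s')"
    using tri_tables[of kin] by blast
  have NW: "R * Wd < 2 ^ w"
  proof -
    have "M \<le> nA * M" by (simp add: nA_def)
    then have "R * Wd + nV \<le> 2 ^ w" using RW_M fit by linarith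
    then show ?thesis by (simp add: nV_def)
  qed
  have "\<exists>T\<^sub>0 (D :: (nat list \<times> (nat \<Rightarrow> int)) pmf).
    run w P (cc 0 (Seq (Seq setup_params (Fill 17 15 14 fill_body)) tables) @ [Halt]) T\<^sub>0
      (Running 0 (initial_memory w (nV + nT + nA * M) n \<epsilon>)) = map_pmf (\<lambda>d. Halted (fst d)) D \<and>
    map_pmf snd D = Pi_pmf {..<R * Wd} 0 (\<lambda>_. map_pmf (\<lambda>v. 1 - 2 * int (v mod 2)) uni) \<and>
    (\<forall>d \<in> set_pmf D. \<exists>s'. rel w M s' (fst d) \<and> (\<forall>y. zpad y \<longrightarrow> Inv (snd d) y G 0 s'))"
  proof (rule Fill_program[where F = "Fs kin" and N = "R * Wd" and ?t2.0 = t2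
        and Q = "\<lambda>\<tau> s'. \<forall>y. zpad y \<longrightarrow> Inv \<tau> y G 0 s'"])
    show "tri P setup_params \<lparr>vr = V0 kin, ar = \<lambda>_ _. 0\<rparr> t1 (\<lambda>s'. s' = Fs kin 0 (\<lambda>_. 0))"
      by (rule triI[OF t1]) auto
    show "rel w M \<lparr>vr = V0 kin, ar = \<lambda>_ _. 0\<rparr> (initial_memory w (nV + nT + nA * M) n \<epsilon>)"
      by (rule rel_initial[OF kin(1,2)])
    show "straight fill_body" "loopfree fill_body" by (simp_all add: fill_body_def)
    show "vr (Fs kin j \<tau>) 17 = int j" "vr (Fs kin j \<tau>) 15 = int (R * Wd)" for j \<tau> by (simp_all add: Fs_def)
  qed (use wf_setup wf_fill wf_tables NW fill_step t2 in auto)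
  then show ?thesis unfolding uni_sg alg_def by simp
qed

text \<open>Arrivals are deterministic, so the joint law of memory and sign table is passed on with
  the table unchanged. The padded stream is fixed as a whole and the induction runs over its
  prefixes.\<close>

lemma stream_dist:
  assumes kin: "kin < 2 ^ w" "kin = min (nat \<lceil>1 / \<epsilon>\<rceil>) (2 ^ w - 1)" "k = min kin (2 * n)"
  shows "\<exists>T\<^sub>0. \<forall>xs. \<exists>D :: (nat list \<times> (nat \<Rightarrow> int)) pmf.
    after_stream alg w (nV + nT + nA * M) T\<^sub>0 (Suc TT) \<epsilon> P xs = map_pmf (\<lambda>d. Halted (fst d)) D \<and>
    map_pmf snd D = rad {..<R * Wd} \<and>
    (n \<le> length xs \<longrightarrow> (\<forall>d \<in> set_pmf D. int (fst d ! 0) = out (snd d) (pad xs) (length xs) mod 2 ^ w))"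
proof -
  obtain T\<^sub>0 D0 where D0: "run w P (preprocess alg) T\<^sub>0 (Running 0 (initial_memory w (nV + nT + nA * M) n \<epsilon>)) = map_pmf (\<lambda>d. Halted (fst d)) D0"
    "map_pmf snd D0 = rad {..<R * Wd}"
    "\<And>d. d \<in> set_pmf D0 \<Longrightarrow> \<exists>s. rel w M s (fst d) \<and> (\<forall>y. zpad y \<longrightarrow> Inv (snd d) y G 0 s)"
    using preprocess_dist[OF kin] by blast
  let ?S = "nV + nT + nA * M"
  have "\<exists>D :: (nat list \<times> (nat \<Rightarrow> int)) pmf.
    after_stream alg w ?S T\<^sub>0 (Suc TT) \<epsilon> P xs = map_pmf (\<lambda>d. Halted (fst d)) D \<and>
    map_pmf snd D = rad {..<R * Wd} \<and>
    (n \<le> length xs \<longrightarrow> (\<forall>d \<in> set_pmf D. int (fst d ! 0) = out (snd d) (pad xs) (length xs) mod 2 ^ w))" for xs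
  proof -
    let ?y = "pad xs"
    have J: "\<exists>D :: (nat list \<times> (nat \<Rightarrow> int)) pmf.
      after_stream alg w ?S T\<^sub>0 (Suc TT) \<epsilon> P (take j xs) = map_pmf (\<lambda>d. Halted (fst d)) D \<and>
      map_pmf snd D = rad {..<R * Wd} \<and>
      (\<forall>d \<in> set_pmf D. \<exists>s. rel w M s (fst d) \<and> Inv (snd d) ?y (j div B + G) (j mod B) s \<and>
         (n \<le> j \<longrightarrow> vr s 0 = out (snd d) ?y j))" if "j \<le> length xs" for j
      using that
    proof (induction j)
      case 0
      have "after_stream alg w ?S T\<^sub>0 (Suc TT) \<epsilon> P (take 0 xs) = map_pmf (\<lambda>d. Halted (fst d)) D0"
        unfolding after_stream_def lenP using D0(1) by simp
      moreover have "\<forall>d \<in> set_pmf D0. \<exists>s. rel w M s (fst d) \<and> Inv (snd d) ?y (0 div B + G) (0 mod B) s \<and>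
         (n \<le> 0 \<longrightarrow> vr s 0 = out (snd d) ?y 0)"
        using D0(3) pad_zpad n2 by fastforce
      ultimately show ?case using D0(2) by blast
    next
      case (Suc j)
      then have j: "j < length xs" by simp
      obtain D where D: "after_stream alg w ?S T\<^sub>0 (Suc TT) \<epsilon> P (take j xs) = map_pmf (\<lambda>d. Halted (fst d)) D"
        "map_pmf snd D = rad {..<R * Wd}"
        "\<And>d. d \<in> set_pmf D \<Longrightarrow> \<exists>s. rel w M s (fst d) \<and> Inv (snd d) ?y (j div B + G) (j mod B) s"
        using Suc by fastforce
      let ?\<kappa> = "j div B + G" and ?i = "j mod B"
      have step: "\<exists>m'. run w [] (on_arrival alg) (Suc TT) (Running 0 ((fst d)[0 := of_bool (xs ! j)])) = return_pmf (Halted m') \<and>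
          (\<exists>s'. rel w M s' m' \<and> Inv (snd d) ?y (Suc j div B + G) (Suc j mod B) s' \<and>
            (n \<le> Suc j \<longrightarrow> vr s' 0 = out (snd d) ?y (Suc j)))" if d: "d \<in> set_pmf D" for d
      proof -
        obtain s where s: "rel w M s (fst d)" "Inv (snd d) ?y ?\<kappa> ?i s" using D(3)[OF d] by blast
        define s0 where "s0 = s\<lparr>vr := (vr s)(0 := of_bool (xs ! j))\<rparr>"
        have "int (of_bool (xs ! j)) = of_bool (xs ! j) mod 2 ^ w" by simp
        then have r0: "rel w M s0 ((fst d)[0 := of_bool (xs ! j)])"
          unfolding s0_def using rel_var[OF s(1), of 0] by (simp add: nV_def)
        have b0: "base (snd d) ?i (?\<kappa> mod G) s0"
          using s(2) unfolding Inv_def base_def cpar_def s0_def by simp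
        have e: "\<And>v. vr s0 (numeral v) = vr s (numeral v)" "vr s0 1 = vr s 1" "ar s0 = ar s" by (simp_all add: s0_def)
        have I0: "Inv (snd d) ?y ?\<kappa> ?i s0"
          using s(2) b0 unfolding Inv_def scst_def ckd_def okck_def lft_def Let_def e by blast
        have idx: "?\<kappa> * B + ?i = G * B + j"
          using div_mult_mod_eq[of j B] by (simp add: algebra_simps)
        have x0: "vr s0 0 = ?y (?\<kappa> * B + ?i)" unfolding idx using j by (simp add: s0_def pad_def)
        have "snd d \<in> set_pmf (rad {..<R * Wd})" using d D(2) by (metis imageI set_map_pmf)
        then have sb: "sbd (snd d)" by (rule sbd_rad)
        have T: "tri [] arrival s0 TT (\<lambda>s'. (if Suc ?i = B then Inv (snd d) ?y (Suc ?\<kappa>) 0 s' else Inv (snd d) ?y ?\<kappa> (Suc ?i) s') \<and>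
          (G \<le> ?\<kappa> - G + le ?i + 1 \<longrightarrow>
             vr s' 0 = iop w Div (Vf (snd d) ?y (?\<kappa> - G) ?i * (2 * int k + 1)) (2 * int k * int R1)))"
          by (rule arrival_step[OF I0 x0 pad_bin pad_zpad sb]) simp
        obtain m' s' where m': "run w [] (cc 0 arrival @ [Halt]) (Suc TT) (Running 0 ((fst d)[0 := of_bool (xs ! j)])) = return_pmf (Halted m')"
          "rel w M s' m'" "if Suc ?i = B then Inv (snd d) ?y (Suc ?\<kappa>) 0 s' else Inv (snd d) ?y ?\<kappa> (Suc ?i) s'"
          "G \<le> ?\<kappa> - G + le ?i + 1 \<longrightarrow>
             vr s' 0 = iop w Div (Vf (snd d) ?y (?\<kappa> - G) ?i * (2 * int k + 1)) (2 * int k * int R1)"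
          using tri_halts[OF T r0 wf_arrival] by blast
        have I': "Inv (snd d) ?y (Suc j div B + G) (Suc j mod B) s'"
        proof (cases "Suc ?i = B")
          case True
          then have "Suc j mod B = 0" "Suc j div B = Suc (j div B)" by (simp_all add: mod_Suc div_Suc)
          then show ?thesis using m'(3) True by simp
        next
          case False
          then have "Suc j mod B = Suc ?i" "Suc j div B = j div B" by (simp_all add: mod_Suc div_Suc)
          then show ?thesis using m'(3) False by simp
        qed
        \<comment> \<open>With \<open>n\<close> arrivals the window start lies in block
          \<open>q = G - 1\<close> or later, which is exactly the condition of
          \<open>arrival_step\<close>.\<close>
        have o: "vr s' 0 = out (snd d) ?y (Suc j)" if nj: "n \<le> Suc j"
        proof -
          have jn: "q * B + m0 \<le> j" using nj n_eq by linarith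
          have "G \<le> j div B + le ?i + 1"
          proof (cases "q < j div B")
            case True then show ?thesis by (simp add: G_def)
          next
            case False
            have "q * B \<le> j" using jn by simp
            then have "q \<le> j div B" using B1 by (simp add: less_eq_div_iff_mult_less_eq)
            then have qe: "j div B = q" using False by simp
            show ?thesis unfolding qe by (simp add: G_def)
          qed
          then show ?thesis using m'(4) by simp
        qed
        show ?thesis using m'(1,2) I' o unfolding alg_def by auto
      qed
      then obtain h where h: "\<And>d. d \<in> set_pmf D \<Longrightarrow>
          run w [] (on_arrival alg) (Suc TT) (Running 0 ((fst d)[0 := of_bool (xs ! j)])) = return_pmf (Halted (h d))"
        "\<And>d. d \<in> set_pmf D \<Longrightarrow> \<exists>s'. rel w M s' (h d) \<and> Inv (snd d) ?y (Suc j div B + G) (Suc j mod B) s' \<and>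
            (n \<le> Suc j \<longrightarrow> vr s' 0 = out (snd d) ?y (Suc j))"
        by metis
      define D' where "D' = map_pmf (\<lambda>d. (h d, snd d)) D"
      have "after_stream alg w ?S T\<^sub>0 (Suc TT) \<epsilon> P (take (Suc j) xs)
        = bind_pmf (after_stream alg w ?S T\<^sub>0 (Suc TT) \<epsilon> P (take j xs)) (arrive alg w (Suc TT) (xs ! j))"
        using j by (simp add: after_stream_def take_Suc_conv_app_nth)
      also have "\<dots> = bind_pmf D (\<lambda>d. run w [] (on_arrival alg) (Suc TT) (Running 0 ((fst d)[0 := of_bool (xs ! j)])))"
        unfolding D(1) by (simp only: bind_map_pmf arrive_def config.case)
      also have "\<dots> = bind_pmf D (\<lambda>d. return_pmf (Halted (h d)))"
        by (rule bind_pmf_cong[OF refl h(1)])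
      also have "\<dots> = map_pmf (\<lambda>d. Halted (fst d)) D'"
        unfolding D'_def by (simp add: map_pmf_comp map_pmf_def[symmetric])
      finally have "after_stream alg w ?S T\<^sub>0 (Suc TT) \<epsilon> P (take (Suc j) xs) = map_pmf (\<lambda>d. Halted (fst d)) D'" .
      moreover have "map_pmf snd D' = rad {..<R * Wd}" unfolding D'_def by (simp add: map_pmf_comp D(2))
      moreover have "\<forall>d \<in> set_pmf D'. \<exists>s. rel w M s (fst d) \<and> Inv (snd d) ?y (Suc j div B + G) (Suc j mod B) s \<and>
         (n \<le> Suc j \<longrightarrow> vr s 0 = out (snd d) ?y (Suc j))"
        using h(2) by (auto simp: D'_def)
      ultimately show ?case by blast
    qed
    obtain D :: "(nat list \<times> (nat \<Rightarrow> int)) pmf" where D: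
      "after_stream alg w ?S T\<^sub>0 (Suc TT) \<epsilon> P xs = map_pmf (\<lambda>d. Halted (fst d)) D"
      "map_pmf snd D = rad {..<R * Wd}"
      "\<And>d. d \<in> set_pmf D \<Longrightarrow> \<exists>s. rel w M s (fst d) \<and> (n \<le> length xs \<longrightarrow> vr s 0 = out (snd d) ?y (length xs))"
      using J[OF order_refl, unfolded take_all[OF order_refl]] by blast
    have "\<forall>d \<in> set_pmf D. int (fst d ! 0) = out (snd d) ?y (length xs) mod 2 ^ w" if "n \<le> length xs"
    proof
      fix d assume d: "d \<in> set_pmf D"
      obtain s where "rel w M s (fst d)" "n \<le> length xs \<longrightarrow> vr s 0 = out (snd d) ?y (length xs)" using D(3)[OF d] by (elim exE conjE)
      then show "int (fst d ! 0) = out (snd d) ?y (length xs) mod 2 ^ w"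
        using that unfolding rel_def by (simp add: nV_def)
    qed
    then show ?thesis using D(1,2) by blast
  qed
  then show ?thesis by blast
qed

text \<open>All numbers are below \<open>2 ^ w\<close>, so the stored residue is the true quotient
  \<open>x\<close>, with \<open>h \<le> x \<le> (1 + 1/k) h\<close>. Either
  \<open>1/k \<le> \<epsilon>\<close>, or \<open>k = 2 n\<close> and \<open>h / k < 1\<close>, which
  forces \<open>x = h\<close>.\<close>

lemma good_output:
  assumes g: "goodV (pad xs) ((length xs - 1) div B) ((length xs - 1) mod B) \<tau>" and xs: "n \<le> length xs"
    and m: "int x = out \<tau> (pad xs) (length xs) mod 2 ^ w"
    and e: "0 < \<epsilon>" "k = min (nat \<lceil>1 / \<epsilon>\<rceil>) (2 * n)"
  shows "is_approximation \<epsilon> (real (hamming_distance P (latest n xs))) (real x)"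
proof -
  let ?h = "hamming_distance P (latest n xs)"
  define V where "V = Vf \<tau> (pad xs) ((length xs - 1) div B) ((length xs - 1) mod B) * (2 * int k + 1)"
  define dd where "dd = 2 * k * R1"
  have h: "hd' (pad xs) ((length xs - 1) div B) ((length xs - 1) mod B) = int ?h"
    by (rule hd'_hamming[OF xs])
  have hn: "?h \<le> n" using hd'_le[of "pad xs"] h by (metis of_nat_le_iff)
  have V1: "int dd * int ?h \<le> V" and V2: "V \<le> 2 * int R1 * (int k + 1) * int ?h"
    using g unfolding goodV_def h V_def dd_def by simp_all
  have ddp: "0 < dd" using k1 R11 by (simp add: dd_def)
  have ddw: "dd < 2 ^ w"
  proof -
    have "dd \<le> 2 * (2 * n) * (2 ^ 17 * n ^ 2)" unfolding dd_def using k2 R1n by (intro mult_le_mono) auto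
    then have "dd \<le> 2 ^ 19 * n ^ 3" by (simp add: power2_eq_square power3_eq_cube)
    then show ?thesis by (intro pow_le[of "2 ^ 19" 3]) auto
  qed
  have V3: "V \<le> int (2 * R1 * (k + 1) * ?h)" using V2 by (simp add: algebra_simps)
  have V0: "0 \<le> V" using V1 by (meson mult_nonneg_nonneg of_nat_0_le_iff order_trans)
  have Vw: "V < 2 ^ w"
  proof (rule int_lt_pw)
    show "V \<le> int (2 * R1 * (k + 1) * ?h)" by (rule V3)
    have "2 * R1 * (k + 1) * ?h \<le> 2 * (2 ^ 17 * n ^ 2) * (4 * n) * n"
      using R1n k2 hn n2 by (intro mult_le_mono) auto
    then have "2 * R1 * (k + 1) * ?h \<le> 2 ^ 20 * n ^ 4" by (simp add: power2_eq_square power4_eq_xxxx)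
    then show "2 * R1 * (k + 1) * ?h < 2 ^ w" by (intro pow_le[of "2 ^ 20" 4]) auto
  qed
  have "out \<tau> (pad xs) (length xs) = int (nat V div dd)"
  proof -
    have "nat V < 2 ^ w" using V0 Vw by (simp add: nat_less_iff)
    then have "iop w Div (int (nat V)) (int dd) = int (nat V div dd)" using ddw by (rule iop_Div)
    then show ?thesis using V0 unfolding V_def dd_def by simp
  qed
  moreover have "nat V div dd < 2 ^ w"
  proof -
    have "nat V < 2 ^ w" using V0 Vw by (simp add: nat_less_iff)
    then show ?thesis by (meson div_le_dividend le_less_trans)
  qed
  ultimately have x: "x = nat V div dd" using m by simp
  have lo: "?h \<le> x"
  proof -
    have "dd * ?h \<le> nat V" using V1 V0 by (simp add: le_nat_iff)
    then show ?thesis unfolding x using ddp by (simp add: less_eq_div_iff_mult_less_eq mult.commute)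
  qed
  have hi: "x * k \<le> (k + 1) * ?h"
  proof -
    have "x * dd \<le> nat V" unfolding x by (rule div_times_less_eq_dividend)
    also have "nat V \<le> 2 * R1 * (k + 1) * ?h" using V3 by (simp only: nat_le_iff)
    finally have "(2 * R1) * (x * k) \<le> (2 * R1) * ((k + 1) * ?h)" by (simp only: dd_def mult_ac)
    then show ?thesis using R11 by simp
  qed
  show ?thesis
  proof (cases "nat \<lceil>1 / \<epsilon>\<rceil> \<le> 2 * n")
    case True
    then have k: "k = nat \<lceil>1 / \<epsilon>\<rceil>" using e by simp
    have "1 / \<epsilon> \<le> real k" unfolding k by linarith
    then have ke: "1 \<le> \<epsilon> * real k" using e by (simp add: field_simps)
    have "real x * real k \<le> (real k + 1) * real ?h" using hi by (metis of_nat_1 of_nat_add of_nat_le_iff of_nat_mult)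
    also have "\<dots> = real k * real ?h + 1 * real ?h" by (simp add: algebra_simps)
    also have "\<dots> \<le> real k * real ?h + (\<epsilon> * real k) * real ?h" using ke by (intro add_left_mono mult_right_mono) auto
    also have "\<dots> = ((1 + \<epsilon>) * real ?h) * real k" by (simp add: algebra_simps)
    finally have "real x \<le> (1 + \<epsilon>) * real ?h" using k1 by (simp add: mult_le_cancel_right)
    then show ?thesis using lo by (simp add: is_approximation_def)
  next
    case False
    have k: "k = 2 * n" using e(2) False by (simp only: min_def if_False)
    have "x \<le> ?h"
    proof (rule ccontr)
      assume "\<not> x \<le> ?h"
      then have "(?h + 1) * k \<le> x * k" by (intro mult_le_mono1) simp
      then have "k \<le> ?h" using hi by (simp add: mult.commute)
      then show False using k hn n2 by simp
    qed
    then have "x = ?h" using lo by simp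
    then show ?thesis using e by (simp add: is_approximation_def algebra_simps)
  qed
qed

theorem solves:
  assumes kin: "kin < 2 ^ w" "kin = min (nat \<lceil>1 / \<epsilon>\<rceil>) (2 ^ w - 1)" "k = min kin (2 * n)"
    and e: "0 < \<epsilon>" "k = min (nat \<lceil>1 / \<epsilon>\<rceil>) (2 * n)"
  shows "solves_approx_hamming alg w (nV + nT + nA * M) (Suc TT) \<epsilon> P"
proof -
  let ?S = "nV + nT + nA * M"
  obtain T\<^sub>0 where T0: "\<And>xs. \<exists>D :: (nat list \<times> (nat \<Rightarrow> int)) pmf.
    after_stream alg w ?S T\<^sub>0 (Suc TT) \<epsilon> P xs = map_pmf (\<lambda>d. Halted (fst d)) D \<and>
    map_pmf snd D = rad {..<R * Wd} \<and>
    (n \<le> length xs \<longrightarrow> (\<forall>d \<in> set_pmf D. int (fst d ! 0) = out (snd d) (pad xs) (length xs) mod 2 ^ w))"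
    using stream_dist[OF kin] by blast
  show ?thesis
    unfolding solves_approx_hamming_def lenP
  proof (intro exI[of _ T\<^sub>0] allI conjI impI)
    fix xs
    obtain D :: "(nat list \<times> (nat \<Rightarrow> int)) pmf" where D:
      "after_stream alg w ?S T\<^sub>0 (Suc TT) \<epsilon> P xs = map_pmf (\<lambda>d. Halted (fst d)) D"
      "map_pmf snd D = rad {..<R * Wd}"
      "n \<le> length xs \<Longrightarrow> (\<forall>d \<in> set_pmf D. int (fst d ! 0) = out (snd d) (pad xs) (length xs) mod 2 ^ w)"
      using T0[of xs] by blast
    show "\<forall>c \<in> set_pmf (after_stream alg w ?S T\<^sub>0 (Suc TT) \<epsilon> P xs). \<exists>m. c = Halted m"
      unfolding D(1) by auto
    assume xs: "n \<le> length xs"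
    let ?A = "{Halted m | m. is_approximation \<epsilon> (real (hamming_distance P (latest n xs))) (real (m ! 0))}"
    let ?g = "{\<tau>. goodV (pad xs) ((length xs - 1) div B) ((length xs - 1) mod B) \<tau>}"
    have "2 / 3 \<le> measure_pmf.prob (rad {..<R * Wd}) ?g"
      using B1 by (intro prob_goodV pad_bin) simp
    also have "\<dots> = measure_pmf.prob D (snd -` ?g)" unfolding D(2)[symmetric] by simp
    also have "\<dots> \<le> measure_pmf.prob D ((\<lambda>d. Halted (fst d)) -` ?A)"
    proof (rule measure_pmf.finite_measure_mono_AE)
      show "AE d in D. d \<in> snd -` ?g \<longrightarrow> d \<in> (\<lambda>d. Halted (fst d)) -` ?A"
        using D(3)[OF xs] good_output[OF _ xs _ e] by (auto simp: AE_measure_pmf_iff)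
    qed simp
    also have "\<dots> = measure_pmf.prob (after_stream alg w ?S T\<^sub>0 (Suc TT) \<epsilon> P xs) ?A"
      unfolding D(1) by simp
    finally show "2 / 3 \<le> measure_pmf.prob (after_stream alg w ?S T\<^sub>0 (Suc TT) \<epsilon> P xs) ?A" .
  qed
qed

end

section \<open>Resource bounds and choice of parameters\<close>

definition words :: "nat \<Rightarrow> nat \<Rightarrow> nat \<Rightarrow> nat \<Rightarrow> nat" where
  "words n k B Lg = nV + nT + nA * ((32768 * k * k + 32 * Lg) * (B + ((n - 1) div B + 2)) +
     ((n - 1) div B + 1) * (16384 * k * Lg) * (32768 * k * k))"

definition steps :: "nat \<Rightarrow> nat \<Rightarrow> nat" where
  "steps k Lg = Suc (kappa * Suc (32768 * k * k + 32 * Lg))"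

context params
begin

lemma words_eq: "words n k B Lg = nV + nT + nA * (R * Wd + G * Cap * R1)"
  unfolding words_def R_def R1_def R2_def Wd_def q_def G_def Cap_def by simp

lemma words_fit: "words n k B Lg \<le> n ^ 64"
proof -
  have "Wd \<le> 4 * n" using Bn qn n2 by (simp add: Wd_def)
  then have "R * Wd \<le> (2 ^ 18 * n ^ 2) * (4 * n)" using Rn by (intro mult_le_mono) auto
  also have "\<dots> = 2 ^ 20 * n ^ 3" by (simp add: power2_eq_square power3_eq_cube)
  also have "\<dots> \<le> 2 ^ 20 * n ^ 5" using n2 by (intro mult_le_mono2 power_increasing) auto
  finally have a: "R * Wd \<le> 2 ^ 20 * n ^ 5" .
  have "G \<le> 2 * n" using qn n2 by (simp add: G_def)
  then have "G * Cap * R1 \<le> (2 * n) * (2 ^ 15 * n ^ 2) * (2 ^ 17 * n ^ 2)"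
    using Capn R1n by (intro mult_le_mono) auto
  also have "\<dots> = 2 ^ 33 * (n * n ^ 2 * n ^ 2)" by simp
  also have "n * n ^ 2 * n ^ 2 = n ^ 5" by (simp add: numeral_eq_Suc)
  finally have b: "G * Cap * R1 \<le> 2 ^ 33 * n ^ 5" .
  have "1 \<le> n ^ 5" using n2 by simp
  then have "words n k B Lg \<le> 2 ^ 39 * n ^ 5"
    using a b unfolding words_eq nV_def nT_def nA_def by simp
  also have "\<dots> \<le> n ^ 39 * n ^ 5" using n2 by (intro mult_le_mono1 power_mono) auto
  also have "\<dots> = n ^ 44" by (simp flip: power_add)
  also have "\<dots> \<le> n ^ 64" using n2 by (intro power_increasing) auto
  finally show ?thesis .
qed

lemma R_le: "Suc R \<le> 40000 * (k ^ 2 * Lg)"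
proof -
  have "k ^ 2 * 1 \<le> k ^ 2 * Lg" "1 * Lg \<le> k ^ 2 * Lg" "1 * 1 \<le> k ^ 2 * Lg"
    using Lg1 k1 by (intro mult_le_mono; simp)+
  moreover have "R = 32768 * k ^ 2 + 32 * Lg" by (simp add: R_def R1_def R2_def power2_eq_square)
  ultimately show ?thesis by linarith
qed

text \<open>The checkpoint sketches dominate: \<open>G \<le> 3 B\<close> blocks, \<open>Cap\<close>
  checkpoints of order \<open>k Lg\<close> per block, and \<open>R1\<close> words of order
  \<open>k^2\<close> per checkpoint. This is the origin of the cube of
  \<open>1 / \<epsilon>\<close>.\<close>

lemma words_le: "words n k B Lg \<le> 2 ^ 35 * (k ^ 3 * Lg * B)"
proof -
  let ?x = "k ^ 3 * Lg * B"
  have "R * Wd \<le> (40000 * (k ^ 2 * Lg)) * (5 * B)"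
    using R_le qB B1 by (intro mult_le_mono) (auto simp: Wd_def)
  also have "\<dots> = 200000 * (k ^ 2 * Lg * B)" by simp
  also have "k ^ 2 * Lg * B \<le> ?x" using k1 by (intro mult_le_mono1 power_increasing) auto
  finally have a: "R * Wd \<le> 200000 * ?x" by simp
  have "G \<le> 3 * B" using qB B1 by (simp add: G_def)
  then have "G * Cap * R1 \<le> (3 * B) * Cap * R1" by (intro mult_le_mono1)
  also have "\<dots> = 1610612736 * ?x" by (simp add: Cap_def R1_def power3_eq_cube)
  finally have b: "G * Cap * R1 \<le> 1610612736 * ?x" .
  have c: "1 \<le> ?x" using k1 Lg1 B1 by simp
  have "48 + 16 + 16 * (u + v) \<le> 34359738368 * x"
    if "u \<le> 200000 * x" "v \<le> 1610612736 * x" "1 \<le> x" for u v x :: nat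
  proof -
    have "48 + 16 + 16 * (u + v) \<le> 64 * x + 16 * (200000 * x + 1610612736 * x)"
      using that by (intro add_mono mult_le_mono) auto
    also have "\<dots> = 25773003840 * x" by simp
    also have "\<dots> \<le> 34359738368 * x" by (rule mult_le_mono1) simp
    finally show ?thesis .
  qed
  from this[OF a b c] show ?thesis unfolding words_eq nV_def nT_def nA_def by simp
qed

lemma steps_le: "steps k Lg \<le> (kappa + 1) * 40000 * (k ^ 2 * Lg)"
proof -
  have "steps k Lg = Suc (kappa * Suc R)" by (simp add: steps_def R_def R1_def R2_def)
  also have "\<dots> \<le> (kappa + 1) * Suc R" by simp
  also have "\<dots> \<le> (kappa + 1) * (40000 * (k ^ 2 * Lg))" by (intro mult_le_mono2 R_le)
  finally show ?thesis by (simp only: mult.assoc)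
qed

lemma solves_params:
  assumes e: "0 < \<epsilon>" "k = min (nat \<lceil>1 / \<epsilon>\<rceil>) (2 * n)"
  shows "solves_approx_hamming alg (64 * Lg) (words n k B Lg) (steps k Lg) \<epsilon> P"
proof -
  let ?w = "64 * Lg" and ?M = "R * Wd + G * Cap * R1"
  let ?kin = "min (nat \<lceil>1 / \<epsilon>\<rceil>) (2 ^ ?w - 1)"
  have big: "n ^ 64 \<le> 2 ^ ?w"
    using power_mono[OF nLg, of 64] by (simp add: power_mult mult.commute[of 64])
  have fit: "nV + nT + nA * ?M \<le> 2 ^ ?w" using words_fit big unfolding words_eq by linarith
  interpret algo n k B Lg P ?w ?M
    by unfold_locales (use fit big in auto)
  have "2 * n < n ^ 64"
  proof -
    have "2 * n \<le> n ^ 2" using n2 by (simp add: power2_eq_square)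
    also have "\<dots> < n ^ 64" using n2 by (intro power_strict_increasing) auto
    finally show ?thesis .
  qed
  then have "2 * n \<le> 2 ^ ?w - 1" using big by linarith
  then have "k = min ?kin (2 * n)" using e(2) by (simp add: min.assoc min_absorb2)
  moreover have "?kin < 2 ^ ?w" by (rule le_less_trans[OF min.cobounded2]) simp
  ultimately have "solves_approx_hamming alg ?w (nV + nT + nA * ?M) (Suc TT) \<epsilon> P"
    using solves[OF _ refl _ e] by blast
  then show ?thesis unfolding words_eq TT_eq steps_def R_def R1_def R2_def by simp
qed

end

theorem theorem3:
  shows "\<exists>(A :: stream_alg) (c :: nat) (C :: real). 0 < c \<and> 0 < C \<and>
    (\<forall>(\<epsilon> :: real) (n :: nat). 0 < \<epsilon> \<and> \<epsilon> < 1 / 2 \<and> 2 \<le> n \<longrightarrow>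
      (\<exists>(S :: nat) (T :: nat).
        real (S * word_size c n) \<le> C * (1 / \<epsilon> ^ 3) * sqrt (real n) * (log 2 (real n)) ^ 2 \<and>
        real T \<le> C * (1 / \<epsilon> ^ 2) * log 2 (real n) \<and>
        (\<forall>P :: bool list. length P = n \<longrightarrow>
          solves_approx_hamming A (word_size c n) S T \<epsilon> P)))"
proof -
  \<comment> \<open>From \<open>k \<le> 2 / \<epsilon>\<close> and \<open>Lg \<le> 2 * l\<close>:
    the space constant is \<open>2^35 * 64 * 2^3 * 2^2 = 2^46\<close>, the time constant
    \<open>40000 * 2^2 * 2 = 320000\<close> times \<open>kappa + 1\<close>. The sum covers
    both.\<close>
  define C :: real where "C = 2 ^ 46 + 320000 * (real kappa + 1)"
  have main: "\<exists>(S :: nat) (T :: nat).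
        real (S * word_size 64 n) \<le> C * (1 / \<epsilon> ^ 3) * sqrt (real n) * (log 2 (real n)) ^ 2 \<and>
        real T \<le> C * (1 / \<epsilon> ^ 2) * log 2 (real n) \<and>
        (\<forall>P :: bool list. length P = n \<longrightarrow> solves_approx_hamming alg (word_size 64 n) S T \<epsilon> P)"
    if e: "0 < \<epsilon>" "\<epsilon> < 1 / 2" and n: "2 \<le> n" for \<epsilon> :: real and n :: nat
  proof -
    define l where "l = log 2 (real n)"
    define Lg where "Lg = nat \<lceil>l\<rceil>"
    define B where "B = nat \<lfloor>sqrt (real n)\<rfloor>"
    define k where "k = min (nat \<lceil>1 / \<epsilon>\<rceil>) (2 * n)"
    have l1: "1 \<le> l" using n unfolding l_def by (simp add: le_log_iff)
    have Lg: "l \<le> real Lg" "real Lg < l + 1" using l1 unfolding Lg_def by linarith+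
    have Lg1: "1 \<le> Lg" using Lg l1 by linarith
    have nl: "real n = 2 powr l" using n unfolding l_def by simp
    have nLg: "n \<le> 2 ^ Lg"
    proof -
      have "real n \<le> 2 powr real Lg" unfolding nl using Lg by (intro powr_mono) auto
      then have "real n \<le> real (2 ^ Lg)" by (simp add: powr_realpow)
      then show ?thesis by (simp only: of_nat_le_iff)
    qed
    have Lgn: "2 ^ Lg < 2 * n"
    proof -
      have "2 powr real Lg < 2 powr (l + 1)" using Lg by (intro powr_less_mono) auto
      also have "\<dots> = 2 * real n" unfolding nl by (simp add: powr_add)
      finally have "real (2 ^ Lg) < real (2 * n)" by (simp add: powr_realpow)
      then show ?thesis by (simp only: of_nat_less_iff)
    qed
    have s1: "1 \<le> sqrt (real n)" using n by simp
    then have B: "real B \<le> sqrt (real n)" "sqrt (real n) < real B + 1" "1 \<le> B"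
      unfolding B_def by linarith+
    have BB: "B * B \<le> n"
    proof -
      have "real B * real B \<le> sqrt (real n) * sqrt (real n)" using B by (intro mult_mono) auto
      then show ?thesis by (simp flip: of_nat_mult)
    qed
    have nB: "n < (B + 1) * (B + 1)"
    proof -
      have "sqrt (real n) * sqrt (real n) < (real B + 1) * (real B + 1)"
        using B s1 by (intro mult_strict_mono) auto
      then have "real n < real ((B + 1) * (B + 1))" by (simp add: algebra_simps)
      then show ?thesis by (simp only: of_nat_less_iff)
    qed
    have ie: "2 < 1 / \<epsilon>" using e by (simp add: field_simps)
    have k: "1 \<le> k" "k \<le> 2 * n" using n ie unfolding k_def by linarith+
    have ke: "real k \<le> 2 * (1 / \<epsilon>)" using ie unfolding k_def by linarith
    have prm: "params n k B Lg P" if "length P = n" for P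
      by unfold_locales (use n k that B BB nB Lg1 nLg Lgn in auto)
    \<comment> \<open>The resource bounds are the same for all patterns of length \<open>n\<close>;
      an arbitrary one gives access to them.\<close>
    interpret Q: params n k B Lg "replicate n False" by (rule prm) simp
    have Ll: "real Lg \<le> 2 * l" using Lg l1 by linarith
    have w: "word_size 64 n = 64 * Lg" by (simp add: word_size_def Lg_def l_def)
    have "real (words n k B Lg * word_size 64 n) \<le> real (2 ^ 35 * (k ^ 3 * Lg * B) * (64 * Lg))"
      unfolding w using Q.words_le by (intro of_nat_mono mult_le_mono1)
    also have "\<dots> = 2 ^ 41 * (real k ^ 3 * real Lg ^ 2 * real B)" by (simp add: power2_eq_square)
    also have "\<dots> \<le> 2 ^ 41 * ((2 * (1 / \<epsilon>)) ^ 3 * (2 * l) ^ 2 * sqrt (real n))"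
      using ke Ll B e l1 by (intro mult_left_mono mult_mono power_mono) auto
    also have "\<dots> = 2 ^ 46 * ((1 / \<epsilon> ^ 3) * sqrt (real n) * l ^ 2)"
      by (simp add: power_mult_distrib power_divide)
    also have "\<dots> \<le> C * ((1 / \<epsilon> ^ 3) * sqrt (real n) * l ^ 2)"
      using e by (intro mult_right_mono) (auto simp: C_def)
    finally have S: "real (words n k B Lg * word_size 64 n) \<le> C * (1 / \<epsilon> ^ 3) * sqrt (real n) * l ^ 2"
      by (simp only: mult.assoc)
    have "real (steps k Lg) \<le> real ((kappa + 1) * 40000 * (k ^ 2 * Lg))"
      using Q.steps_le by (rule of_nat_mono)
    also have "\<dots> = (40000 * (real kappa + 1)) * (real k ^ 2 * real Lg)" by simp
    also have "\<dots> \<le> (40000 * (real kappa + 1)) * ((2 * (1 / \<epsilon>)) ^ 2 * (2 * l))"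
      using ke Ll e l1 by (intro mult_left_mono mult_mono power_mono) auto
    also have "\<dots> = (320000 * (real kappa + 1)) * ((1 / \<epsilon> ^ 2) * l)"
      by (simp add: power_mult_distrib power_divide)
    also have "\<dots> \<le> C * ((1 / \<epsilon> ^ 2) * l)"
      using l1 by (intro mult_right_mono) (auto simp: C_def)
    finally have T: "real (steps k Lg) \<le> C * (1 / \<epsilon> ^ 2) * l" by (simp only: mult.assoc)
    have "solves_approx_hamming alg (word_size 64 n) (words n k B Lg) (steps k Lg) \<epsilon> P"
      if "length P = n" for P
      unfolding w using params.solves_params[OF prm[OF that] e(1) k_def] .
    then show ?thesis using S T unfolding l_def by blast
  qed
  have "0 < C" by (simp add: C_def add_pos_nonneg)
  then show ?thesis using main by (intro exI[of _ alg] exI[of _ "64 :: nat"] exI[of _ C]) simp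
qed

end
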